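(* Let $\Phi$ be an irreducible crystallographic root system in $V=\mathbb{R}^\ell$ with positive system $\Phi^+$ and Coxeter number $h$. Let $\Psi\subset\Phi^+$ be an order ideal such that $\mathcal{A}(\Psi)$ is free with exponents $(e_1',\dots,e_\ell')$. Then for every integer $m\ge0$ the cone $\mathbf{c}\mathcal{A}(\Phi^+,\Psi,m)$ is free with exponents $(1,e_1'+mh,e_2'+mh,\dots,e_\ell'+mh)$.
   Context: For $\alpha\in\Phi^+$, $k\in\mathbb{Z}$, $H_{\alpha,k}=\{v\in V:\alpha(v)=k\}$. For positive roots, $\alpha\le\beta$ means $\beta-\alpha$ is a nonnegative combination of simple roots; $\Psi\subset\Phi^+$ is an order ideal if $\alpha\in\Psi$, $\beta\in\Phi^+$, $\beta\le\alpha$ imply $\beta\in\Psi$. $\mathcal{A}(\Psi)=\{H_{\alpha,0}:\alpha\in\Psi\}$, a central arrangement in $V$ (the empty one has exponents all $0$). $[p,q]=\{k\in\mathbb{Z}:p\le k\le q\}$ (empty if $p>q$), $\mathcal{A}(\Phi^+)^{[p,q]}=\{H_{\alpha,k}:\alpha\in\Phi^+,k\in[p,q]\}$, and $\mathcal{A}(\Phi^+,\Psi,m)=\mathcal{A}(\Phi^+)^{[1-m,m]}\cup\{H_{\alpha,-m}:\alpha\in\Psi\}$. The cone $\mathbf{c}\mathcal{B}$ of an affine arrangement $\mathcal{B}$ in $V$ is the central arrangement in $\mathbb{R}\times V$ (coordinates $(x_0,x_1,\dots,x_\ell)$) consisting of $\{\alpha-kx_0=0\}$ for each $H_{\alpha,k}\in\mathcal{B}$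 together with $\{x_0=0\}$. A central arrangement is free with exponents $(d_i)$ if its module of logarithmic derivations $D=\{\delta\in\mathrm{Der}:\delta(\alpha_H)\in\alpha_HS\ \forall H\}$ is a free module over the polynomial ring $S$ with homogeneous basis of polynomial degrees $d_i$. *)

theory Defs
  imports "HOL-Analysis.Analysis"
begin

section \<open>Root systems (roots are vectors in V = real^'n; alpha(v) is alpha \<bullet> v)\<close>

definition refl_root :: "real^'n \<Rightarrow> real^'n \<Rightarrow> real^'n" where
  "refl_root a v = v - (2 * (v \<bullet> a) / (a \<bullet> a)) *\<^sub>R a"

definition crystallographic_root_system :: "(real^'n) set \<Rightarrow> bool" where
  "crystallographic_root_system R \<longleftrightarrow>
     finite R \<and> 0 \<notin> R \<and> span R = UNIV \<and>
     (\<forall>a\<in>R. \<forall>b\<in>R. refl_root a b \<in> R) \<and>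
     (\<forall>a\<in>R. \<forall>b\<in>R. 2 * (b \<bullet> a) / (a \<bullet> a) \<in> \<int>) \<and>
     (\<forall>a\<in>R. \<forall>c::real. c *\<^sub>R a \<in> R \<longrightarrow> c = 1 \<or> c = -1)"

definition irreducible_root_system :: "(real^'n) set \<Rightarrow> bool" where
  "irreducible_root_system R \<longleftrightarrow>
     R \<noteq> {} \<and>
     \<not> (\<exists>A B. A \<noteq> {} \<and> B \<noteq> {} \<and> A \<union> B = R \<and> A \<inter> B = {} \<and>
            (\<forall>a\<in>A. \<forall>b\<in>B. a \<bullet> b = 0))"

definition positive_system :: "(real^'n) set \<Rightarrow> (real^'n) set \<Rightarrow> bool" where
  "positive_system R P \<longleftrightarrow>
     (\<exists>c. (\<forall>a\<in>R. c \<bullet> a \<noteq> 0) \<and> P = {a\<in>R. c \<bullet> a > 0})"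

definition simple_system :: "(real^'n) set \<Rightarrow> (real^'n) set \<Rightarrow> bool" where
  "simple_system P S \<longleftrightarrow>
     S \<subseteq> P \<and> independent S \<and>
     (\<forall>a\<in>P. \<exists>c. (\<forall>s\<in>S. c s \<ge> (0::real)) \<and> a = (\<Sum>s\<in>S. c s *\<^sub>R s))"

definition root_le :: "(real^'n) set \<Rightarrow> real^'n \<Rightarrow> real^'n \<Rightarrow> bool" where
  "root_le S a b \<longleftrightarrow>
     (\<exists>c. (\<forall>s\<in>S. c s \<ge> (0::real)) \<and> b - a = (\<Sum>s\<in>S. c s *\<^sub>R s))"

definition order_ideal :: "(real^'n) set \<Rightarrow> (real^'n) set \<Rightarrow> (real^'n) set \<Rightarrow> bool" where
  "order_ideal S P I \<longleftrightarrow>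
     I \<subseteq> P \<and> (\<forall>a\<in>I. \<forall>b\<in>P. root_le S b a \<longrightarrow> b \<in> I)"

definition coxeter_element :: "(real^'n) set \<Rightarrow> real^'n \<Rightarrow> real^'n" where
  "coxeter_element S =
     fold (\<lambda>s f. refl_root s \<circ> f) (SOME ds. distinct ds \<and> set ds = S) id"

definition coxeter_number :: "(real^'n) set \<Rightarrow> nat" where
  "coxeter_number S = (LEAST k. k > 0 \<and> (coxeter_element S ^^ k) = id)"

definition monom :: "('m::finite \<Rightarrow> nat) \<Rightarrow> real^'m \<Rightarrow> real" where
  "monom e x = (\<Prod>i\<in>UNIV. (x $ i) ^ e i)"

definition poly_fun :: "(real^'m::finite \<Rightarrow> real) \<Rightarrow> bool" where
  "poly_fun f \<longleftrightarrow> (\<exists>E c. finite E \<and> f = (\<lambda>x. \<Sum>e\<in>E. c e * monom e x))"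

text \<open>Homogeneous polynomial of degree d (the zero polynomial included).\<close>
definition homog_poly :: "nat \<Rightarrow> (real^'m::finite \<Rightarrow> real) \<Rightarrow> bool" where
  "homog_poly d f \<longleftrightarrow>
     (\<exists>c. f = (\<lambda>x. \<Sum>e\<in>{e::'m \<Rightarrow> nat. sum e UNIV = d}. c e * monom e x))"

text \<open>A polynomial derivation sum_i theta_i d/dx_i is given by its coefficient functions.\<close>
type_synonym 'm derivation = "'m \<Rightarrow> real^'m \<Rightarrow> real"

definition apply_lin :: "'m::finite derivation \<Rightarrow> real^'m \<Rightarrow> real^'m \<Rightarrow> real" where
  "apply_lin \<theta> a x = (\<Sum>i\<in>UNIV. \<theta> i x * a $ i)"

definition log_derivations :: "(real^'m::finite) set set \<Rightarrow> 'm derivation set" where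
  "log_derivations A =
     {\<theta>. (\<forall>i. poly_fun (\<theta> i)) \<and>
          (\<forall>H\<in>A. \<forall>a. a \<noteq> 0 \<and> H = {x. a \<bullet> x = 0} \<longrightarrow>
              (\<exists>g. poly_fun g \<and> (\<forall>x. apply_lin \<theta> a x = (a \<bullet> x) * g x)))}"

definition free_with_exponents :: "(real^'m::finite) set set \<Rightarrow> ('m \<Rightarrow> nat) \<Rightarrow> bool" where
  "free_with_exponents A d \<longleftrightarrow>
     (\<exists>B :: 'm \<Rightarrow> 'm derivation.
        (\<forall>j. B j \<in> log_derivations A \<and> (\<forall>i. homog_poly (d j) (B j i))) \<and>
        (\<forall>\<theta>\<in>log_derivations A. \<exists>!f. (\<forall>j. poly_fun (f j)) \<and>
              \<theta> = (\<lambda>i x. \<Sum>j\<in>UNIV. f j x * B j i x)))"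

definition central_arr :: "(real^'n) set \<Rightarrow> (real^'n) set set" where
  "central_arr I = (\<lambda>a. {v. a \<bullet> v = 0}) ` I"

text \<open>Affine arrangement given by labels (alpha, k) standing for H_{alpha,k}.\<close>
definition shi_catalan_arr :: "(real^'n) set \<Rightarrow> (real^'n) set \<Rightarrow> nat \<Rightarrow> ((real^'n) \<times> int) set" where
  "shi_catalan_arr P I m =
     {(a, k) | a k. a \<in> P \<and> 1 - int m \<le> k \<and> k \<le> int m} \<union> {(a, - int m) | a. a \<in> I}"

text \<open>Cone in R x V, realised as real^('n option): coordinate None is x_0,
  coordinate Some i is the i-th coordinate of V.\<close>
definition cone_arr :: "((real^'n) \<times> int) set \<Rightarrow> (real^('n option)) set set" where
  "cone_arr B =
     insert {x. x $ None = 0}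
       ((\<lambda>(a, k). {x. (\<Sum>i\<in>UNIV. a $ i * x $ Some i) - of_int k * x $ None = 0}) ` B)"

end

theory Submission
 imports Defs
begin

text \<open>
 The arrangement is built up one hyperplane at a time, along a linear extension of the order on affine roots.
 By the addition theorem a homogeneous basis survives the addition of a hyperplane H as soon as some field of the
 module takes on the normal of H exactly the value of Terao's polynomial b. Such a field exists locally away from
 the origin: at finite points by the theorem on ideal arrangements, at points of the hyperplane at infinity by
 induction on the root system. It exists globally because otherwise fewer forms of positive degree than the
 dimension of H would generate an ideal containing a power of the maximal ideal. The degree of b is computed by
 counting inversions of an affine reflection, and it moves exactly one exponent by one. The heights of the roots
 therefore determine all exponents. Passing from one period to the next needs the duality p(t) + p(h+1-t) = l of
 the height partition, which follows from evaluating an equivariant basis at a regular eigenvector of a Coxeter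
 element. Finally the exponents of a free arrangement are unique.
\<close>

text \<open>A hyperplane of the cone is written as an affine root, a pair \<open>(be, k)\<close>
  read as the linear form \<open>be + k x0\<close>: \<open>H_{a,k}\<close> becomes
  \<open>(a, -k)\<close> for \<open>k <= 0\<close> and \<open>(-a, k)\<close> for
  \<open>k >= 1\<close>. In these terms the deformed arrangement consists of all positive affine
  roots of level below \<open>m\<close> and, at level \<open>m\<close>, of the negative roots
  together with the ideal; every intermediate arrangement is an order ideal of positive affine
  roots. Near a finite point such an ideal is an ideal of a finite root system, but that system need
  not be parabolic and its positive system moves with the point. This is why \<open>root_sys\<close>
  assumes no spanning and takes an arbitrary regular vector \<open>c\<close>. A field realising
  \<open>b\<close> has to come from a basis element of degree exactly \<open>deg b\<close>; the
  obstacle is that only elements of larger degree might contribute, and it is the heights that bound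
  their number below the dimension of the hyperplane. The Euler field, responsible for the exponent
  1, is kept out of the induction by admitting only fields without \<open>x0\<close>-component and
  is added at the very end.\<close>

notation scaleR (infixr "*R" 75) and inner (infix "<.>" 70)

section \<open>Polynomial functions on Euclidean spaces\<close>

abbreviation rpoly :: "('a::real_normed_vector => real) => bool" where
 "rpoly \<equiv> real_polynomial_function"

declare real_polynomial_function.intros [rule del]

lemma rpoly_inner: "rpoly (%x::'a::euclidean_space. k <.> x)"
 by (intro real_polynomial_function.intros(1) bounded_linear_inner_right)

lemma rpoly_const: "rpoly (%x. c)"
 by (rule real_polynomial_function.intros(2))

lemma rpoly_mult: "rpoly f ==> rpoly g ==> rpoly (%x. f x * g x)"
 by (rule real_polynomial_function.intros(4))

lemma rpoly_add: "rpoly f ==> rpoly g ==> rpoly (%x. f x + g x)"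
 by (rule real_polynomial_function.intros(3))

lemma rpoly_sum: "(!!i. i : I ==> rpoly (f i)) ==> rpoly (%x. SUM i:I. f i x)"
 by (induction I rule: infinite_finite_induct) (auto intro: rpoly_const rpoly_add)

lemma rpoly_prod: "(!!i. i : I ==> rpoly (f i)) ==> rpoly (%x. PROD i:I. f i x)"
 by (induction I rule: infinite_finite_induct) (auto intro: rpoly_const rpoly_mult)

lemmas rpoly_intros = rpoly_inner rpoly_const rpoly_mult rpoly_add rpoly_sum rpoly_prod
 real_polynomial_function_diff real_polynomial_function_minus

lemma rpoly_prod_inner: "rpoly (%x::'a::euclidean_space. PROD l:L. l <.> x)"
 by (intro rpoly_intros)

lemma rpoly_comp:
 assumes "rpoly f" "bounded_linear g"
 shows "rpoly (%x. f (g x))"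
 using real_polynomial_function_compose[OF polynomial_function_bounded_linear[OF assms(2)] assms(1)]
 by (simp add: o_def)

lemma polynomial_function_inner_iff:
 fixes th :: "'a::euclidean_space => 'b::euclidean_space"
 shows "polynomial_function th \<longleftrightarrow> (ALL u. rpoly (%x. u <.> th x))"
proof
 assume "polynomial_function th"
 then show "ALL u. rpoly (%x. u <.> th x)"
  unfolding polynomial_function_def o_def using bounded_linear_inner_right by blast
next
 assume *: "ALL u. rpoly (%x. u <.> th x)"
 show "polynomial_function th"
  unfolding polynomial_function_iff_Basis_inner real_polynomial_function_eq[symmetric]
  using * by (simp add: inner_commute)
qed

text \<open>Restricting to lines reduces questions about polynomial functions to univariate
  polynomials, which vanish identically once they vanish everywhere.\<close>

lemma rpoly_line:
 assumes "rpoly f"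
 shows "EX p. ALL t. f (x + t *R v) = poly p t"
 using assms
proof (induction f rule: real_polynomial_function.induct)
 case (linear f)
 then have "ALL t. f (x + t *R v) = poly [:f x, f v:] t"
  by (simp add: bounded_linear.linear linear_add linear_scale)
 then show ?case by blast
next
 case (const c)
 have "ALL t. c = poly [:c:] t" by simp
 then show ?case by blast
next
 case (add f g)
 then obtain p q where "ALL t. f (x + t *R v) = poly p t" "ALL t. g (x + t *R v) = poly q t" by blast
 then have "ALL t. f (x + t *R v) + g (x + t *R v) = poly (p + q) t" by simp
 then show ?case by blast
next
 case (mult f g)
 then obtain p q where "ALL t. f (x + t *R v) = poly p t" "ALL t. g (x + t *R v) = poly q t" by blast
 then have "ALL t. f (x + t *R v) * g (x + t *R v) = poly (p * q) t" by simp
 then show ?case by blast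
qed

text \<open>Polynomial functions on a subspace form an integral domain: on the line from
  \<open>x\<close> to \<open>y\<close> both factors become univariate polynomials, each nonzero
  somewhere, with a product that vanishes everywhere.\<close>

lemma rpoly_domain:
 assumes f: "rpoly f" and g: "rpoly g" and K: "subspace K"
  and 0: "!!x. x : K ==> f x * g x = 0" and x: "x : K" "f x ~= 0" and y: "y : K"
 shows "g y = 0"
proof (rule ccontr)
 assume gy: "g y ~= 0"
 obtain p where p: "ALL t. f (x + t *R (y - x)) = poly p t" using rpoly_line[OF f] by blast
 obtain q where q: "ALL t. g (x + t *R (y - x)) = poly q t" using rpoly_line[OF g] by blast
 have "poly p 0 ~= 0" using p[rule_format, of 0] x by simp
 moreover have "poly q 1 ~= 0" using q[rule_format, of 1] gy by simp
 ultimately have "p * q ~= 0" by auto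
 moreover have "poly (p * q) t = 0" for t
 proof -
  have "x + t *R (y - x) : K"
   by (intro subspace_add[OF K] subspace_scale[OF K] subspace_diff[OF K] x y)
  then show ?thesis using 0 p q by (metis poly_mult)
 qed
 ultimately show False using poly_all_0_iff_0 by blast
qed

lemma rpoly_cancel:
 assumes "rpoly b" "rpoly f" "rpoly g" "subspace K"
  and "!!x. x : K ==> b x * f x = b x * g x" and "z : K" "b z ~= 0" and y: "y : K"
 shows "f y = g y"
proof -
 have "f y - g y = 0"
  by (rule rpoly_domain[where f=b and g="%x. f x - g x" and K=K and x=z])
    (use assms in \<open>auto simp: algebra_simps intro: rpoly_intros\<close>)
 then show ?thesis by simp
qed

text \<open>Structural induction with the telescoping product rule
  \<open>f g - f' g' = (f - f') g + f' (g - g')\<close>. When \<open>k <.> n = 1\<close> the shifted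
  point is the projection of \<open>x\<close> to the kernel of \<open>k\<close> along
  \<open>n\<close>.\<close>

lemma rpoly_diff_shift:
 fixes f :: "'a::euclidean_space => real"
 assumes "rpoly f"
 shows "EX g. rpoly g & (ALL x. f x - f (x - (k <.> x) *R n) = (k <.> x) * g x)"
 using assms
proof (induction f rule: real_polynomial_function.induct)
 case (linear f)
 then have "ALL x. f x - f (x - (k <.> x) *R n) = (k <.> x) * f n"
  by (simp add: bounded_linear.linear linear_diff linear_scale)
 then show ?case using rpoly_const[of "f n"] by blast
next
 case (const c)
 have "ALL x. c - c = (k <.> x) * 0" by simp
 then show ?case using rpoly_const[of 0] by blast
next
 case (add f g)
 then obtain f' g' where fg: "rpoly f'" "rpoly g'"
  and f': "ALL x. f x - f (x - (k <.> x) *R n) = (k <.> x) * f' x"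
  and g': "ALL x. g x - g (x - (k <.> x) *R n) = (k <.> x) * g' x" by blast
 have "f x + g x - (f (x - (k <.> x) *R n) + g (x - (k <.> x) *R n)) = (k <.> x) * (f' x + g' x)" for x
  using f'[rule_format, of x] g'[rule_format, of x] by (simp add: distrib_left)
 then show ?case using rpoly_add[OF fg] by (intro exI conjI allI)
next
 case (mult f g)
 then obtain f' g' where fg: "rpoly f'" "rpoly g'"
  and f': "ALL x. f x - f (x - (k <.> x) *R n) = (k <.> x) * f' x"
  and g': "ALL x. g x - g (x - (k <.> x) *R n) = (k <.> x) * g' x" by blast
 let ?p = "%x. x - (k <.> x) *R n"
 have "bounded_linear ?p"
  by (intro bounded_linear_sub bounded_linear_ident bounded_linear_scaleR_const bounded_linear_inner_right)
 then have "rpoly (%x. f (?p x))" using mult.hyps(1) by (rule rpoly_comp[rotated])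
 then have "rpoly (%x. f' x * g x + f (?p x) * g' x)" using fg mult.hyps by (intro rpoly_intros)
 moreover have "f x * g x - f (?p x) * g (?p x) = (k <.> x) * (f' x * g x + f (?p x) * g' x)" for x
 proof -
  have "f x * g x - f (?p x) * g (?p x) = (f x - f (?p x)) * g x + f (?p x) * (g x - g (?p x))"
   by (simp add: algebra_simps)
  then show ?thesis unfolding f'[rule_format] g'[rule_format] by (simp add: algebra_simps)
 qed
 ultimately show ?case by (intro exI conjI allI)
qed

text \<open>The factor theorem for a linear form on a subspace: comparing \<open>f\<close> at
  \<open>x\<close> with \<open>f\<close> at the projection of \<open>x\<close> to the kernel, where
  \<open>f\<close> is zero, exhibits the form as a factor.\<close>

lemma rpoly_divide_linear:
 fixes f :: "'a::euclidean_space => real"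
 assumes f: "rpoly f" and K: "subspace K" and 0: "!!x. x : K ==> k <.> x = 0 ==> f x = 0"
 shows "EX g. rpoly g & (ALL x:K. f x = (k <.> x) * g x)"
proof (cases "ALL x:K. k <.> x = 0")
 case True
 then show ?thesis using 0 rpoly_const[of 0] by auto
next
 case False
 then obtain m where m: "m : K" "k <.> m ~= 0" by blast
 \<comment> \<open>Normalised so that \<open>k <.> n = 1\<close>, which makes the shift along
   \<open>n\<close> land in the kernel of \<open>k\<close> without leaving \<open>K\<close>.\<close>
 define n where "n = (1 / (k <.> m)) *R m"
 have n: "n : K" "k <.> n = 1" using m K by (auto simp: n_def subspace_scale)
 obtain g where g: "rpoly g" "ALL x. f x - f (x - (k <.> x) *R n) = (k <.> x) * g x"
  using rpoly_diff_shift[OF f] by blast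
 have "f x = (k <.> x) * g x" if "x : K" for x
 proof -
  have "x - (k <.> x) *R n : K" using that n K by (simp add: subspace_diff subspace_scale)
  moreover have "k <.> (x - (k <.> x) *R n) = 0" using n by (simp add: inner_diff_right)
  ultimately show ?thesis using 0 g(2) by (metis diff_zero)
 qed
 then show ?thesis using g by blast
qed

lemma subspace_kernel_on: "subspace K ==> subspace {x:K. k <.> x = (0::real)}"
 by (auto simp: subspace_def inner_add_right)

lemma prod_linear_nonzero:
 fixes L :: "'a::euclidean_space set"
 assumes K: "subspace K" and "finite L" and "!!l. l : L ==> EX x:K. l <.> x ~= 0"
 shows "EX x:K. (PROD l:L. l <.> x) ~= 0"
 using assms(2,3)
proof (induction L rule: finite_induct)
 case empty
 then show ?case using subspace_0[OF K] by auto
next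
 case (insert k L)
 then obtain x y where x: "x : K" "(PROD l:L. l <.> x) ~= 0" and y: "y : K" "k <.> y ~= 0" by blast
 show ?case
 proof (rule ccontr)
  assume "~ ?thesis"
  then have z: "(PROD l:L. l <.> u) * (k <.> u) = 0" if "u : K" for u
   using that insert.hyps by auto
  from rpoly_prod_inner have "k <.> y = 0"
   by (rule rpoly_domain[OF _ rpoly_inner K z x y(1)])
  then show False using y by simp
 qed
qed

text \<open>The forms are split off one at a time. On the kernel of the next form the product of the
  earlier ones is not identically zero, so the quotient has to vanish there.\<close>

lemma rpoly_divide_by_prod:
 fixes L :: "'a::euclidean_space set"
 assumes K: "subspace K" and L: "finite L" and f: "rpoly f"
  and 0: "!!l x. l : L ==> x : K ==> l <.> x = 0 ==> f x = 0"
  and indep: "!!l l'. l : L ==> l' : L ==> l ~= l' ==> EX x:K. l <.> x = 0 & l' <.> x ~= 0"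
 shows "EX g. rpoly g & (ALL x:K. f x = (PROD l:L. l <.> x) * g x)"
 using L 0 indep
proof (induction L rule: finite_induct)
 case empty
 then show ?case using f by auto
next
 case (insert k L)
 then obtain g where g: "rpoly g" "ALL x:K. f x = (PROD l:L. l <.> x) * g x" by auto
 let ?K = "{x:K. k <.> x = 0}"
 have "EX x:?K. (PROD l:L. l <.> x) ~= 0"
  by (rule prod_linear_nonzero[OF subspace_kernel_on[OF K] insert.hyps(1)])
    (use insert.prems(2) insert.hyps in \<open>blast\<close>)
 then obtain z where z: "z : ?K" "(PROD l:L. l <.> z) ~= 0" by blast
 have "g x = 0" if x: "x : ?K" for x
  by (rule rpoly_domain[where f="%x. PROD l:L. l <.> x" and K="?K" and x=z, OF rpoly_prod_inner])
    (use g z x insert.prems(1) subspace_kernel_on[OF K] in auto)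
 then obtain g' where g': "rpoly g'" "ALL x:K. g x = (k <.> x) * g' x"
  using rpoly_divide_linear[OF g(1) K, of k] by blast
 then show ?case using g insert.hyps by auto
qed

text \<open>Coprimality is asked only between the two families. Members of one family may become
  proportional on \<open>K\<close>, so the products may have multiplicities; this happens when a
  class of hyperplanes is restricted to the hyperplane under consideration.\<close>

lemma rpoly_divide_coprime:
 fixes L1 L2 :: "'a::euclidean_space set"
 assumes K: "subspace K" and L: "finite L1" "finite L2" "L1 Int L2 = {}" and f: "rpoly f"
  and g1: "rpoly g1" "!!x. x : K ==> f x = (PROD l:L1. l <.> x) * g1 x"
  and g2: "rpoly g2" "!!x. x : K ==> f x = (PROD l:L2. l <.> x) * g2 x"
  and indep: "!!l l'. l : L1 ==> l' : L2 ==> EX x:K. l' <.> x = 0 & l <.> x ~= 0"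
  and nz: "!!l. l : L2 ==> EX x:K. l <.> x ~= 0"
 shows "EX g. rpoly g & (ALL x:K. f x = (PROD l:L1 Un L2. l <.> x) * g x)"
 using L(2,3) g2 indep nz
proof (induction L2 arbitrary: g2 rule: finite_induct)
 case empty
 then show ?case using g1 by auto
next
 case (insert k L2)
 have "rpoly (%x. (k <.> x) * g2 x)" using insert.prems(2) by (intro rpoly_intros)
 moreover have eq: "f x = (PROD l:L2. l <.> x) * ((k <.> x) * g2 x)" if "x : K" for x
  using insert.prems(3)[OF that] insert.hyps by (simp add: mult_ac)
 ultimately obtain g where g: "rpoly g" "ALL x:K. f x = (PROD l:L1 Un L2. l <.> x) * g x"
  using insert.IH[of "%x. (k <.> x) * g2 x", OF _ _ eq] insert.prems(1,4,5) by auto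
 have disj: "L1 Int L2 = {}" "k ~: L1" using insert.prems(1) by auto
 obtain z where z: "z : K" "(PROD l:L2. l <.> z) ~= 0"
  using prod_linear_nonzero[OF K insert.hyps(1)] insert.prems(5) by auto
 have p: "(PROD l:L1 Un L2. l <.> x) = (PROD l:L1. l <.> x) * (PROD l:L2. l <.> x)" for x
  by (rule prod.union_disjoint[OF L(1) insert.hyps(1) disj(1)])
 have e: "(PROD l:L1. l <.> x) * g x = (k <.> x) * g2 x" if "x : K" for x
  by (rule rpoly_cancel[where b="%x. PROD l:L2. l <.> x", OF rpoly_prod_inner _ _ K _ z that])
    (use g eq p insert.prems(2) in \<open>auto simp: mult_ac intro!: rpoly_intros\<close>)
 let ?K = "{x:K. k <.> x = 0}"
 have "EX x:?K. (PROD l:L1. l <.> x) ~= 0"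
  by (rule prod_linear_nonzero[OF subspace_kernel_on[OF K] L(1)])
    (use insert.prems(4) in \<open>blast\<close>)
 then obtain z where z: "z : ?K" "(PROD l:L1. l <.> z) ~= 0" by blast
 have "g x = 0" if x: "x : ?K" for x
  by (rule rpoly_domain[where f="%x. PROD l:L1. l <.> x" and K="?K" and x=z, OF rpoly_prod_inner])
    (use g z x e subspace_kernel_on[OF K] in auto)
 then obtain g' where g': "rpoly g'" "ALL x:K. g x = (k <.> x) * g' x"
  using rpoly_divide_linear[OF g(1) K, of k] by blast
 have "L1 Un insert k L2 = insert k (L1 Un L2)" by auto
 then show ?case using g g' insert.hyps disj L(1) by (auto simp: mult_ac)
qed

section \<open>Too few forms do not generate a power of the maximal ideal\<close>

text \<open>Gaussian elimination over an arbitrary field, phrased with index sets so that it applies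
  equally to monomials, basis fields and eigenvectors.\<close>

lemma nontrivial_left_kernel:
 fixes A :: "'i => 'k => 'f::field"
 assumes "finite K" "finite I" "card K < card I"
 shows "EX c. (EX i:I. c i ~= 0) & (ALL k:K. (SUM i:I. c i * A i k) = 0)"
 using assms
proof (induction K arbitrary: I A rule: finite_induct)
 case empty
 then obtain i where "i : I" by fastforce
 then show ?case by (intro exI[of _ "%_. 1"]) auto
next
 case (insert k K)
 show ?case
 proof (cases "ALL i:I. A i k = 0")
  case True
  obtain c where "EX i:I. c i ~= 0" "ALL k:K. (SUM i:I. c i * A i k) = 0"
   using insert.IH[of I A] insert.prems insert.hyps by auto
  then show ?thesis using True by (intro exI[of _ c]) auto
 next
  case False
  then obtain j where j: "j : I" "A j k ~= 0" by blast
  define A' where "A' i l = A i l - A i k / A j k * A j l" for i l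
  have "card K < card (I - {j})" using insert.prems insert.hyps j by simp
  then obtain c where c: "EX i:I - {j}. c i ~= 0" "ALL k:K. (SUM i:I - {j}. c i * A' i k) = 0"
   using insert.IH[of "I - {j}" A'] insert.prems by auto
  define c' where "c' i = (if i = j then - (SUM i:I - {j}. c i * (A i k / A j k)) else c i)" for i
  have "(SUM i:I. c' i * A i l) = (SUM i:I - {j}. c i * A' i l)" for l
  proof -
   have "(SUM i:I. c' i * A i l) = c' j * A j l + (SUM i:I - {j}. c' i * A i l)"
    using sum.remove[OF insert.prems(1) j(1)] by simp
   also have "(SUM i:I - {j}. c' i * A i l) = (SUM i:I - {j}. c i * A i l)"
    by (rule sum.cong) (auto simp: c'_def)
   also have "c' j * A j l = - (SUM i:I - {j}. c i * (A i k / A j k * A j l))"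
    by (simp add: c'_def sum_distrib_right mult.assoc)
   finally show ?thesis
    by (simp add: A'_def right_diff_distrib sum_subtractf)
  qed
  moreover have "A' i k = 0" for i using j by (simp add: A'_def)
  moreover have "EX i:I. c' i ~= 0" using c(1) by (auto simp: c'_def)
  ultimately show ?thesis using c(2) by (intro exI[of _ c']) auto
 qed
qed

text \<open>Induction on the variables: in the variable \<open>b\<close> the sum is a univariate
  polynomial that vanishes everywhere, and its coefficient at the exponent \<open>mu b\<close> is a
  relation in one variable less.\<close>

lemma monomials_independent:
 fixes c :: "('b => nat) => real"
 assumes "finite B" "finite F" "!!mu \<nu>. mu : F ==> \<nu> : F ==> (ALL b:B. mu b = \<nu> b) ==> mu = \<nu>"
  and "!!t. (SUM mu:F. c mu * (PROD b:B. t b ^ mu b)) = 0" "mu : F"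
 shows "c mu = 0"
 using assms
proof (induction B arbitrary: F rule: finite_induct)
 case empty
 then have "F = {mu}" by auto
 then show ?case using empty.prems(3) by simp
next
 case (insert b B)
 define n where "n = mu b"
 let ?F = "{\<nu>:F. \<nu> b = n}"
 have "(SUM \<nu>:?F. c \<nu> * (PROD b:B. t b ^ \<nu> b)) = 0" for t
 proof -
  define d where "d \<nu> = c \<nu> * (PROD b:B. t b ^ \<nu> b)" for \<nu>
  let ?p = "SUM \<nu>:F. Polynomial.monom (d \<nu>) (\<nu> b)"
  have "poly ?p u = 0" for u
  proof -
   have "poly ?p u = (SUM \<nu>:F. c \<nu> * (PROD b':insert b B. (t(b := u)) b' ^ \<nu> b'))"
    unfolding poly_sum
   proof (rule sum.cong)
    fix \<nu>
    have "(PROD b':B. (t(b := u)) b' ^ \<nu> b') = (PROD b':B. t b' ^ \<nu> b')"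
     by (rule prod.cong) (use insert.hyps in auto)
    then show "poly (Polynomial.monom (d \<nu>) (\<nu> b)) u = c \<nu> * (PROD b':insert b B. (t(b := u)) b' ^ \<nu> b')"
     using insert.hyps by (simp add: poly_monom d_def mult_ac del: fun_upd_apply) simp
   qed simp
   then show ?thesis using insert.prems(3) by simp
  qed
  then have "?p = 0" using poly_all_0_iff_0 by blast
  then have "coeff ?p n = 0" by simp
  then have "(SUM \<nu>:F. if \<nu> b = n then d \<nu> else 0) = 0" by (simp add: coeff_sum)
  then show ?thesis unfolding d_def using insert.prems(1) by (simp add: sum.inter_filter)
 qed
 then show ?case
  using insert.IH[of ?F] insert.prems by (auto simp: n_def)
qed

section \<open>Expansion of polynomial functions into monomials\<close>

definition monomial_on :: "'a::euclidean_space set => ('a => nat) => 'a => real" where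
 "monomial_on B mu x = (PROD b:B. (b <.> x) ^ mu b)"

lemma rpoly_power: "rpoly f ==> rpoly (%x. f x ^ n)"
 by (induction n) (auto intro: rpoly_const rpoly_mult)

lemma rpoly_monomial_on: "rpoly (monomial_on B mu)"
 unfolding monomial_on_def by (intro rpoly_intros rpoly_power)

lemma monomial_on_add: "monomial_on B (%b. mu b + \<nu> b) x = monomial_on B mu x * monomial_on B \<nu> x"
 by (simp add: monomial_on_def power_add prod.distrib)

lemma monomial_on_scale: "monomial_on B mu (t *R x) = t ^ (SUM b:B. mu b) * monomial_on B mu x"
 by (simp add: monomial_on_def power_mult_distrib prod.distrib power_sum)

definition expandable :: "'a::euclidean_space set => ('a => real) => bool" where
 "expandable B f \<longleftrightarrow> (EX F c. finite F & (ALL x:span B. f x = (SUM mu:F. c mu * monomial_on B mu x)))"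

lemma expandable_cong:
 "expandable B f ==> (!!x. x : span B ==> g x = f x) ==> expandable B g"
 unfolding expandable_def by auto

lemma expandable_const: "expandable B (%x. c)"
 unfolding expandable_def
 by (rule exI[of _ "{%_. 0}"], rule exI[of _ "%_. c"]) (simp add: monomial_on_def)

lemma expandable_inner:
 assumes "finite B" "b : B" shows "expandable B (%x. b <.> x)"
proof -
 have "monomial_on B (%b'. if b' = b then 1 else 0) x = b <.> x" for x
 proof -
  have "monomial_on B (%b'. if b' = b then 1 else 0) x = (PROD b':B. if b' = b then b <.> x else 1)"
   unfolding monomial_on_def by (rule prod.cong) auto
  then show ?thesis using assms by simp
 qed
 then show ?thesis unfolding expandable_def
  by (intro exI[of _ "{%b'. if b' = b then 1 else 0}"] exI[of _ "%_. 1"]) simp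
qed

lemma expandable_add:
 assumes "expandable B f" "expandable B g"
 shows "expandable B (%x. f x + g x)"
proof -
 obtain F c where F: "finite F" "ALL x:span B. f x = (SUM mu:F. c mu * monomial_on B mu x)"
  using assms(1) unfolding expandable_def by blast
 obtain G d where G: "finite G" "ALL x:span B. g x = (SUM mu:G. d mu * monomial_on B mu x)"
  using assms(2) unfolding expandable_def by blast
 let ?e = "%mu. (if mu : F then c mu else 0) + (if mu : G then d mu else 0)"
 have "(SUM mu:F. c mu * monomial_on B mu x) = (SUM mu:F Un G. (if mu : F then c mu else 0) * monomial_on B mu x)"
  "(SUM mu:G. d mu * monomial_on B mu x) = (SUM mu:F Un G. (if mu : G then d mu else 0) * monomial_on B mu x)" for x
  using F(1) G(1) by (auto intro!: sum.mono_neutral_cong_left)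
 then have "ALL x:span B. f x + g x = (SUM mu:F Un G. ?e mu * monomial_on B mu x)"
  using F(2) G(2) by (simp add: distrib_right sum.distrib)
 then show ?thesis unfolding expandable_def using F(1) G(1)
  by (intro exI[of _ "F Un G"] exI[of _ ?e]) simp
qed

lemma expandable_sum:
 "finite I ==> (!!i. i : I ==> expandable B (f i)) ==> expandable B (%x. SUM i:I. f i x)"
 by (induction I rule: finite_induct) (auto intro: expandable_const expandable_add)

lemma expandable_mult:
 assumes "expandable B f" "expandable B g"
 shows "expandable B (%x. f x * g x)"
proof -
 obtain F c where F: "finite F" "ALL x:span B. f x = (SUM mu:F. c mu * monomial_on B mu x)"
  using assms(1) unfolding expandable_def by blast
 obtain G d where G: "finite G" "ALL x:span B. g x = (SUM mu:G. d mu * monomial_on B mu x)"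
  using assms(2) unfolding expandable_def by blast
 have one: "expandable B (%x. (c mu * d \<nu>) * monomial_on B (%b. mu b + \<nu> b) x)" for mu \<nu>
  unfolding expandable_def by (intro exI[of _ "{%b. mu b + \<nu> b}"] exI[of _ "%_. c mu * d \<nu>"]) simp
 have "expandable B (%x. SUM mu:F. SUM \<nu>:G. (c mu * d \<nu>) * monomial_on B (%b. mu b + \<nu> b) x)"
  by (intro expandable_sum one F G)
 then show ?thesis
  by (rule expandable_cong) (use F(2) G(2) in \<open>simp add: monomial_on_add sum_product mult_ac\<close>)
qed

text \<open>The hypothesis on \<open>B\<close> says that \<open>B\<close> reproduces vectors like an
  orthonormal basis, so every linear form is a combination of the coordinates
  \<open>b <.> x\<close>; sums and products then follow.\<close>

lemma rpoly_expandable: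
 assumes f: "rpoly f" and B: "finite B" "!!x. x : span B ==> (SUM b:B. (b <.> x) *R b) = x"
 shows "expandable B f"
 using f
proof (induction f rule: real_polynomial_function.induct)
 case (linear f)
 have "expandable B (%x. SUM b:B. f b * (b <.> x))"
  using B(1) by (intro expandable_sum expandable_mult expandable_const expandable_inner) auto
 then show ?case
 proof (rule expandable_cong)
  fix x assume "x : span B"
  then have "f x = f (SUM b:B. (b <.> x) *R b)" using B by simp
  also have "... = (SUM b:B. f b * (b <.> x))"
   using linear by (simp add: bounded_linear.linear linear_sum linear_scale mult.commute)
  finally show "f x = (SUM b:B. f b * (b <.> x))" .
 qed
qed (auto intro: expandable_const expandable_add expandable_mult)

text \<open>Ideals are predicates on functions and are saturated under equality on \<open>Z\<close>,
  since only the restriction to the subspace \<open>Z\<close> matters.\<close>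

definition ideal_on :: "'a::euclidean_space set => (('a => real) => bool) => bool" where
 "ideal_on Z J \<longleftrightarrow> (ALL f g. J f --> J g --> J (%x. f x + g x)) & J (%_. 0) &
   (ALL f h. J f --> rpoly h --> J (%x. h x * f x)) &
   (ALL f g. (ALL x:Z. f x = g x) --> J f --> J g)"

lemma ideal_onD:
 assumes "ideal_on Z J"
 shows "J f ==> J g ==> J (%x. f x + g x)" "J (%_. 0)"
  "J f ==> rpoly h ==> J (%x. h x * f x)"
  "J f ==> (!!x. x : Z ==> g x = f x) ==> J g"
proof -
 note * = assms[unfolded ideal_on_def]
 show "J f ==> J g ==> J (%x. f x + g x)" using * by simp
 show "J (%_. 0)" using * by simp
 show "J f ==> rpoly h ==> J (%x. h x * f x)" using * by simp
 show "J f ==> (!!x. x : Z ==> g x = f x) ==> J g"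
  using *[THEN conjunct2, THEN conjunct2, THEN conjunct2, rule_format, of f g] by simp
qed

lemma ideal_on_adjoin:
 fixes Z :: "'a::euclidean_space set"
 assumes J: "ideal_on Z J" and q: "rpoly q"
 shows "ideal_on Z (%f. EX j h. J j & rpoly h & (ALL x:Z. f x = j x + h x * q x))"
 unfolding ideal_on_def
proof (intro conjI allI impI)
 fix f g :: "'a => real"
 assume "EX j h. J j & rpoly h & (ALL x:Z. f x = j x + h x * q x)" "EX j h. J j & rpoly h & (ALL x:Z. g x = j x + h x * q x)"
 then obtain j h j' h' where *: "J j" "rpoly h" "ALL x:Z. f x = j x + h x * q x" "J j'" "rpoly h'" "ALL x:Z. g x = j' x + h' x * q x" by blast
 show "EX j h. J j & rpoly h & (ALL x:Z. f x + g x = j x + h x * q x)"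
  by (rule exI[of _ "%x. j x + j' x"], rule exI[of _ "%x. h x + h' x"])
   (use * ideal_onD(1)[OF J] in \<open>auto simp: algebra_simps intro: rpoly_intros\<close>)
next
 show "EX j h. J j & rpoly h & (ALL x:Z. 0 = j x + h x * q x)"
  by (rule exI[of _ "%x. 0"], rule exI[of _ "%x. 0"])
   (use ideal_onD(2)[OF J] in \<open>auto intro: rpoly_intros\<close>)
next
 fix f k :: "'a => real"
 assume "EX j h. J j & rpoly h & (ALL x:Z. f x = j x + h x * q x)" "rpoly k"
 then obtain j h where *: "J j" "rpoly h" "ALL x:Z. f x = j x + h x * q x" "rpoly k" by blast
 show "EX j h. J j & rpoly h & (ALL x:Z. k x * f x = j x + h x * q x)"
  by (rule exI[of _ "%x. k x * j x"], rule exI[of _ "%x. k x * h x"])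
   (use * ideal_onD(3)[OF J] in \<open>auto simp: algebra_simps intro: rpoly_intros\<close>)
next
 fix f g :: "'a => real"
 assume "ALL x:Z. f x = g x" "EX j h. J j & rpoly h & (ALL x:Z. f x = j x + h x * q x)"
 then show "EX j h. J j & rpoly h & (ALL x:Z. g x = j x + h x * q x)" by metis
qed

lemma rpoly_prod_list: "rpoly (%x::'a::euclidean_space. \<Prod>l\<leftarrow>L. l <.> x)"
 by (induction L) (auto intro: rpoly_intros)

text \<open>A Nullstellensatz for generators that are products of linear forms, valid over the
  reals. A product \<open>l L\<close> in the ideal is handled by adjoining \<open>l\<close> and
  \<open>L\<close> separately and multiplying the two powers obtained.\<close>

lemma ideal_contains_powers:
 fixes Z :: "'a::euclidean_space set"
 assumes Z: "subspace Z"
 shows "ideal_on Z J ==> (ALL g:G. J (%x. g <.> x)) ==> (ALL L:set Ls. J (%x. \<Prod>l\<leftarrow>L. l <.> x)) ==>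
  (ALL x:Z. x ~= 0 --> (ALL g:G. g <.> x = 0) --> (EX L:set Ls. ALL l:set L. l <.> x ~= 0)) ==>
  EX N. J (%x. (v <.> x) ^ N)"
proof (induction Ls arbitrary: J G)
 case Nil
 have prj: "EX g'. g' : Z & (ALL x:Z. g' <.> x = g <.> x)" for g
 proof -
  obtain y z where "y : span Z" "!!w. w : span Z ==> orthogonal z w" "g = y + z"
   using orthogonal_subspace_decomp_exists by metis
  then have "y : Z" "ALL x:Z. y <.> x = g <.> x"
   using Z by (auto simp: orthogonal_def inner_add_left span_eq_iff[THEN iffD2])
  then show ?thesis by blast
 qed
 then obtain p where p: "!!g. p g : Z" "!!g x. x : Z ==> p g <.> x = g <.> x" by metis
 \<comment> \<open>With no products left, the linear forms in \<open>G\<close> have only the common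
   zero 0 in \<open>Z\<close>, so their projections to \<open>Z\<close> span it and the ideal
   contains every linear form.\<close>
 have "span (p ` G) = Z"
 proof (rule ccontr)
  assume "span (p ` G) ~= Z"
  moreover have "span (p ` G) \<subseteq> Z" using p(1) Z by (intro span_minimal) auto
  ultimately have "span (p ` G) \<subset> span Z" using Z by (auto simp: span_eq_iff[THEN iffD2])
  then obtain x where "x ~= 0" "x : span Z" "!!y. y : span (p ` G) ==> orthogonal x y"
   by (rule orthogonal_to_subspace_exists_gen) blast
  then have x: "x : Z" "x ~= 0" "!!g. g : G ==> x <.> p g = 0"
   using Z by (auto simp: orthogonal_def span_eq_iff[THEN iffD2] span_base)
  then have "ALL g:G. g <.> x = 0" using p(2)[OF x(1)] by (simp add: inner_commute)
  then show False using Nil.prems(4) x by auto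
 qed
 moreover have "span (p ` G) \<subseteq> {y. J (%x. y <.> x)}"
 proof (rule span_minimal)
  show "p ` G \<subseteq> {y. J (%x. y <.> x)}"
   using Nil.prems(2) p(2) ideal_onD(4)[OF Nil.prems(1)] by (auto intro: ideal_onD(4)[OF Nil.prems(1)])
  show "subspace {y. J (%x. y <.> x)}"
   unfolding subspace_def
  proof (intro conjI allI ballI impI)
   show "0 : {y. J (%x. y <.> x)}"
    by (rule CollectI, rule ideal_onD(4)[OF Nil.prems(1), OF ideal_onD(2)[OF Nil.prems(1)]]) simp
   fix y z assume "y : {y. J (%x. y <.> x)}" "z : {y. J (%x. y <.> x)}"
   then have "J (%x. y <.> x + z <.> x)" using ideal_onD(1)[OF Nil.prems(1)] by blast
   then show "y + z : {y. J (%x. y <.> x)}"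
    by (intro CollectI, elim ideal_onD(4)[OF Nil.prems(1)]) (simp add: inner_add_left)
  next
   fix c y assume "y : {y. J (%x. y <.> x)}"
   then have "J (%x. c * (y <.> x))" using ideal_onD(3)[OF Nil.prems(1), OF _ rpoly_const] by blast
   then show "c *R y : {y. J (%x. y <.> x)}"
    by (intro CollectI, elim ideal_onD(4)[OF Nil.prems(1)]) simp
  qed
 qed
 ultimately have "J (%x. p v <.> x)" using p(1) by blast
 then have "J (%x. (v <.> x) ^ 1)" by (rule ideal_onD(4)[OF Nil.prems(1)]) (use p in simp)
 then show ?case by blast
next
 case (Cons L Ls)
 from Cons.prems show ?case
 proof (induction L arbitrary: J)
  case Nil
  then have "J (%x. (v <.> x) ^ 0)" by (simp add: ideal_on_def)
  then show ?case by blast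
 next
  case (Cons l L)
  note J = Cons.prems(1)
  let ?J1 = "%f. EX j h. J j & rpoly h & (ALL x:Z. f x = j x + h x * (l <.> x))"
  let ?J2 = "%f. EX j h. J j & rpoly h & (ALL x:Z. f x = j x + h x * (\<Prod>l\<leftarrow>L. l <.> x))"
  have sub1: "?J1 f" if "J f" for f
   by (rule exI[of _ f], rule exI[of _ "%_. 0"]) (use that in \<open>auto intro: rpoly_intros\<close>)
  have sub2: "?J2 f" if "J f" for f
   by (rule exI[of _ f], rule exI[of _ "%_. 0"]) (use that in \<open>auto intro: rpoly_intros\<close>)
  have l1: "?J1 (%x. l <.> x)"
   by (rule exI[of _ "%_. 0"], rule exI[of _ "%_. 1"]) (use ideal_onD(2)[OF J] in \<open>auto intro: rpoly_intros\<close>)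
  have l2: "?J2 (%x. \<Prod>l\<leftarrow>L. l <.> x)"
   by (rule exI[of _ "%_. 0"], rule exI[of _ "%_. 1"]) (use ideal_onD(2)[OF J] in \<open>auto intro: rpoly_intros\<close>)
  have "EX N. ?J1 (%x. (v <.> x) ^ N)"
  proof (rule \<open>!!J G. ideal_on Z J ==> ALL g:G. J ((<.>) g) ==> ALL L:set Ls. J (%x. \<Prod>l\<leftarrow>L. l <.> x) ==>
    ALL x:Z. x ~= 0 --> (ALL g:G. g <.> x = 0) --> (EX L:set Ls. ALL l:set L. l <.> x ~= 0) ==> EX N. J (%x. (v <.> x) ^ N)\<close>)
   show "ideal_on Z ?J1" by (rule ideal_on_adjoin[OF J rpoly_inner])
   show "ALL g:insert l G. ?J1 ((<.>) g)" using l1 sub1 Cons.prems(2) by blast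
   show "ALL L:set Ls. ?J1 (%x. \<Prod>l\<leftarrow>L. l <.> x)" using Cons.prems(3) by (intro ballI sub1) auto
   show "ALL x:Z. x ~= 0 --> (ALL g:insert l G. g <.> x = 0) --> (EX L:set Ls. ALL l:set L. l <.> x ~= 0)"
    using Cons.prems(4) by fastforce
  qed
  then obtain N1 j1 h1 where 1: "J j1" "rpoly h1" "ALL x:Z. (v <.> x) ^ N1 = j1 x + h1 x * (l <.> x)" by blast
  have "EX N. ?J2 (%x. (v <.> x) ^ N)"
  proof (rule Cons.IH)
   show "ideal_on Z ?J2" by (rule ideal_on_adjoin[OF J rpoly_prod_list])
   show "ALL g:G. ?J2 ((<.>) g)" using sub2 Cons.prems(2) by blast
   show "ALL L:set (L # Ls). ?J2 (%x. \<Prod>l\<leftarrow>L. l <.> x)"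
   proof
    fix L' assume "L' : set (L # Ls)"
    then consider "L' = L" | "L' : set Ls" by auto
    then show "?J2 (%x. \<Prod>l\<leftarrow>L'. l <.> x)"
    proof cases
     case 1
     then show ?thesis using l2 by simp
    next
     case 2
     then show ?thesis using Cons.prems(3) by (intro sub2) simp
    qed
   qed
   show "ALL x:Z. x ~= 0 --> (ALL g:G. g <.> x = 0) --> (EX L:set (L # Ls). ALL l:set L. l <.> x ~= 0)"
    using Cons.prems(4) by fastforce
  qed
  then obtain N2 j2 h2 where 2: "J j2" "rpoly h2" "ALL x:Z. (v <.> x) ^ N2 = j2 x + h2 x * (\<Prod>l\<leftarrow>L. l <.> x)" by blast
  have "J (%x. \<Prod>l\<leftarrow>l # L. l <.> x)" using Cons.prems(3) by simp
  then have a: "J (%x. (h1 x * h2 x) * (\<Prod>l\<leftarrow>l # L. l <.> x))"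
   using ideal_onD(3)[OF J, OF _ rpoly_mult[OF 1(2) 2(2)]] by blast
  have b: "J (%x. (v <.> x) ^ N2 * j1 x)"
   by (rule ideal_onD(3)[OF J, of j1 "%x. (v <.> x) ^ N2", OF 1(1) rpoly_power[OF rpoly_inner]])
  have c: "J (%x. (h1 x * (l <.> x)) * j2 x)"
   by (rule ideal_onD(3)[OF J, of j2 "%x. h1 x * (l <.> x)", OF 2(1) rpoly_mult[OF 1(2) rpoly_inner]])
  let ?a = "%x. h1 x * h2 x * (\<Prod>l\<leftarrow>l # L. l <.> x)" and ?b = "%x. (v <.> x) ^ N2 * j1 x"
   and ?c = "%x. h1 x * (l <.> x) * j2 x"
  have ab: "J (%x. ?a x + ?b x)" by (rule ideal_onD(1)[OF J, of ?a ?b, OF a b])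
  have d: "J (%x. (?a x + ?b x) + ?c x)" by (rule ideal_onD(1)[OF J, of "%x. ?a x + ?b x" ?c, OF ab c])
  \<comment> \<open>Expanding \<open>(j1 + h1 l) (j2 + h2 L)\<close> leaves two terms divisible by
    \<open>j1\<close> or \<open>j2\<close> and the term \<open>h1 h2 l L\<close>, all of them in
    \<open>J\<close>.\<close>
  have "J (%x. (v <.> x) ^ (N1 + N2))"
  proof (rule ideal_onD(4)[OF J, OF d])
   fix x assume "x : Z"
   then have "(v <.> x) ^ N1 = j1 x + h1 x * (l <.> x)" "(v <.> x) ^ N2 = j2 x + h2 x * (\<Prod>l\<leftarrow>L. l <.> x)" using 1 2 by auto
   then have "(v <.> x) ^ (N1 + N2) = (v <.> x) ^ N2 * j1 x + h1 x * (l <.> x) * (j2 x + h2 x * (\<Prod>l\<leftarrow>L. l <.> x))"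
    by (metis (no_types, lifting) distrib_right mult.commute power_add)
   then show "(v <.> x) ^ (N1 + N2) = h1 x * h2 x * (\<Prod>l\<leftarrow>l # L. l <.> x) + (v <.> x) ^ N2 * j1 x + h1 x * (l <.> x) * j2 x"
    by (simp add: algebra_simps)
  qed
  then show ?case by blast
 qed
qed

text \<open>If every monomial of high degree lies in the ideal generated by \<open>k\<close> forms of positive degree, then
 repeatedly reducing monomials shows that the polynomials of degree at most \<open>D\<close> are spanned by
 \<open>O(D ^ k)\<close> products, so \<open>k\<close> is at least the number of variables.\<close>

lemma forms_generate_power_imp_dim_le:
 fixes Z :: "'a::euclidean_space set" and g :: "'j => 'a => real"
 assumes Z: "subspace Z" and Jn: "finite Jn"
  and g: "!!j. j : Jn ==> rpoly (g j)" "!!j. j : Jn ==> a j > 0"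
   "!!j x t. j : Jn ==> x : Z ==> g j (t *R x) = t ^ a j * g j x"
  and pow: "!!v. EX N h. (ALL j:Jn. rpoly (h j)) & (ALL x:Z. (v <.> x) ^ N = (SUM j:Jn. h j x * g j x))"
 shows "dim Z <= card Jn"
proof (rule ccontr)
 assume small: "~ dim Z <= card Jn"
 obtain B where B: "B \<subseteq> Z" "pairwise orthogonal B" "!!x. x : B ==> norm x = 1" "independent B" "card B = dim Z" "span B = Z"
  using orthonormal_basis_subspace[OF Z] by metis
 have finB: "finite B" using B(4) independent_imp_finite by blast
 have expB: "(SUM b:B. (b <.> x) *R b) = x" if "x : span B" for x
  using orthonormal_basis_expand[OF B(2,3) that finB] by (simp add: inner_commute)
 let ?m = "monomial_on B" and ?deg = "%mu. SUM b:B. mu b"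
 have "ALL v. EX N h. (ALL j:Jn. rpoly (h j)) & (ALL x:Z. (v <.> x) ^ N = (SUM j:Jn. h j x * g j x))" using pow by blast
 then obtain N0 h where N0: "!!v j. j : Jn ==> rpoly (h v j)"
   "!!v x. x : Z ==> (v <.> x) ^ N0 v = (SUM j:Jn. h v j x * g j x)" by metis
 \<comment> \<open>Every exponent that is at least \<open>N\<close> can be lowered with one of the
   relations \<open>b ^ N0 b\<close>.\<close>
 define N where "N = Suc (SUM b:B. N0 b)"
 have N0_le: "N0 b < N" if "b : B" for b
  unfolding N_def using member_le_sum[of b B N0] that finB by simp
 \<comment> \<open>Indices of reduced products: a monomial with all exponents below
   \<open>N\<close>, times powers of the forms with exponents at most \<open>n\<close>.\<close>
 define Idx where "Idx n = (B \<rightarrow>\<^sub>E {..<N}) \<times> (Jn \<rightarrow>\<^sub>E {..n})" for n :: nat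
 have finI: "finite (Idx n)" for n unfolding Idx_def using finB Jn by (auto intro: finite_PiE)
 define W where "W p x = ?m (fst p) x * (PROD j:Jn. g j x ^ snd p j)" for p :: "('a => nat) \<times> ('j => nat)" and x
 define SP where "SP n f \<longleftrightarrow> (EX c. ALL x:Z. f x = (SUM p:Idx n. c p * W p x))" for n f
 have SP_add: "SP n (%x. f x + f' x)" if "SP n f" "SP n f'" for n f f'
 proof -
  obtain c c' where "ALL x:Z. f x = (SUM p:Idx n. c p * W p x)" "ALL x:Z. f' x = (SUM p:Idx n. c' p * W p x)"
   using \<open>SP n f\<close> \<open>SP n f'\<close> unfolding SP_def by blast
  then have "ALL x:Z. f x + f' x = (SUM p:Idx n. (c p + c' p) * W p x)" by (simp add: sum.distrib distrib_right)
  then show ?thesis unfolding SP_def by (intro exI[of _ "%p. c p + c' p"])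
 qed
 have SP_scale: "SP n (%x. t * f x)" if f: "SP n f" for n f t
 proof -
  obtain c where "ALL x:Z. f x = (SUM p:Idx n. c p * W p x)" using f unfolding SP_def by blast
  then have "ALL x:Z. t * f x = (SUM p:Idx n. (t * c p) * W p x)" by (simp add: sum_distrib_left mult.assoc)
  then show ?thesis unfolding SP_def by (intro exI[of _ "%p. t * c p"])
 qed
 have SP_0: "SP n (%x. 0)" for n unfolding SP_def by (rule exI[of _ "%_. 0"]) simp
 have SP_sum: "SP n (%x. SUM i:I. f i x)" if "finite I" "!!i. i : I ==> SP n (f i)" for n I and f :: "'i => 'a => real"
  using that by (induction I rule: finite_induct) (auto intro: SP_0 SP_add)
 have SP_cong: "SP n f'" if "SP n f" "!!x. x : Z ==> f' x = f x" for n f f'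
  using that unfolding SP_def by auto
 have SP_W: "SP n (W p)" if "p : Idx n" for n p
  unfolding SP_def by (rule exI[of _ "%q. if q = p then 1 else 0"]) (use that finI in \<open>simp add: if_distrib[of "%u. u * _"] sum.delta cong: if_cong\<close>)
 have SP_mono: "SP n' f" if f: "SP n f" and le: "n <= n'" for n n' f
 proof -
  obtain c where c: "ALL x:Z. f x = (SUM p:Idx n. c p * W p x)" using f unfolding SP_def by blast
  have "Idx n \<subseteq> Idx n'" unfolding Idx_def PiE_def Pi_def using le by auto
  then have "SP n' (%x. SUM p:Idx n. c p * W p x)" by (intro SP_sum SP_scale SP_W finI) auto
  then show ?thesis by (rule SP_cong) (use c in auto)
 qed
 have SP_g: "SP (Suc n) (%x. f x * g j x)" if f: "SP n f" and j: "j : Jn" for n f j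
 proof -
  obtain c where c: "ALL x:Z. f x = (SUM p:Idx n. c p * W p x)" using f unfolding SP_def by blast
  let ?\<phi> = "%p::('a => nat) \<times> ('j => nat). (fst p, (snd p)(j := Suc (snd p j)))"
  have phi: "?\<phi> p : Idx (Suc n)" if "p : Idx n" for p
  proof -
   have "fst p : B \<rightarrow>\<^sub>E {..<N}" and s: "snd p : Jn \<rightarrow>\<^sub>E {..n}" using that unfolding Idx_def by auto
   moreover have "(snd p)(j := Suc (snd p j)) : Jn \<rightarrow>\<^sub>E {..Suc n}"
    using s j by (fastforce simp: PiE_iff extensional_def)
   ultimately show ?thesis unfolding Idx_def by simp
  qed
  have W_phi: "W (?\<phi> p) x = W p x * g j x" for p x
  proof -
   have "(PROD i:Jn. g i x ^ snd (?\<phi> p) i) = g j x ^ Suc (snd p j) * (PROD i:Jn - {j}. g i x ^ snd p i)"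
    by (subst prod.remove[OF Jn j]) (auto intro!: prod.cong)
   also have "... = g j x * (PROD i:Jn. g i x ^ snd p i)"
    using prod.remove[OF Jn j, of "%i. g i x ^ snd p i"] by simp
   finally show ?thesis unfolding W_def by (simp add: mult_ac)
  qed
  have "SP (Suc n) (%x. SUM p:Idx n. c p * W (?\<phi> p) x)" by (intro SP_sum SP_scale SP_W finI phi)
  then show ?thesis
   by (rule SP_cong) (use c in \<open>simp only: W_phi sum_distrib_right mult.assoc\<close>)
 qed
 \<comment> \<open>Reduction by degree: a large exponent is replaced through the relation for that
   coordinate, which brings in one factor \<open>g j\<close> of positive degree and leaves monomials
   of smaller degree.\<close>
 have SP_mon: "SP (?deg mu) (?m mu)" for mu
 proof (induction "?deg mu" arbitrary: mu rule: less_induct)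
  case less
  show ?case
  proof (cases "ALL b:B. mu b < N")
   case True
   let ?p = "(restrict mu B, restrict (%_. 0) Jn)"
   have "?p : Idx (?deg mu)" unfolding Idx_def using True by auto
   then have "SP (?deg mu) (W ?p)" by (rule SP_W)
   then show ?thesis by (rule SP_cong) (simp add: W_def monomial_on_def)
  next
   case False
   then obtain b where b: "b : B" "N0 b < mu b" using N0_le by (metis le_less_trans not_le_imp_less less_le_trans)
   define \<nu> where "\<nu> = mu(b := mu b - N0 b)"
   have mu: "?m mu x = (SUM j:Jn. (?m \<nu> x * h b j x) * g j x)" if "x : Z" for x
   proof -
    have "?m mu x = (b <.> x) ^ mu b * (PROD c:B - {b}. (c <.> x) ^ mu c)"
     unfolding monomial_on_def by (rule prod.remove[OF finB b(1)])
    also have "... = (b <.> x) ^ N0 b * ((b <.> x) ^ \<nu> b * (PROD c:B - {b}. (c <.> x) ^ \<nu> c))"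
    proof -
     have "mu b = N0 b + \<nu> b" using b by (simp add: \<nu>_def)
     moreover have "(PROD c:B - {b}. (c <.> x) ^ mu c) = (PROD c:B - {b}. (c <.> x) ^ \<nu> c)"
      by (rule prod.cong) (auto simp: \<nu>_def)
     ultimately show ?thesis by (simp add: power_add)
    qed
    also have "(b <.> x) ^ \<nu> b * (PROD c:B - {b}. (c <.> x) ^ \<nu> c) = ?m \<nu> x"
     unfolding monomial_on_def by (rule prod.remove[OF finB b(1), symmetric])
    finally show ?thesis unfolding N0(2)[OF that] by (simp add: sum_distrib_left sum_distrib_right mult_ac)
   qed
   have "expandable B (%x. ?m \<nu> x * h b j x)" if "j : Jn" for j
    by (rule rpoly_expandable[OF _ finB expB]) (use N0(1)[OF that] in \<open>auto intro: rpoly_mult rpoly_monomial_on\<close>)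
   then have "ALL j:Jn. EX F c. finite F & (ALL x:Z. ?m \<nu> x * h b j x = (SUM ka:F. c ka * ?m ka x))"
    unfolding expandable_def B(6) by blast
   then obtain F c where F: "!!j. j : Jn ==> finite (F j)"
     "!!j x. j : Jn ==> x : Z ==> ?m \<nu> x * h b j x = (SUM ka:F j. c j ka * ?m ka x)" by metis
   let ?n = "?deg mu"
   \<comment> \<open>The coefficients of the relations need not be homogeneous; only the part of the
     right degree is kept.\<close>
   define G where "G j = {ka:F j. ?deg ka + a j = ?n}" for j
   have finG: "finite (G j)" if "j : Jn" for j using F(1)[OF that] by (simp add: G_def)
   have eq: "?m mu x = (SUM j:Jn. SUM ka:G j. c j ka * (?m ka x * g j x))" if x: "x : Z" for x
   proof -
    let ?p = "Polynomial.monom (?m mu x) ?n - (SUM j:Jn. SUM ka:F j. Polynomial.monom (c j ka * ?m ka x * g j x) (?deg ka + a j))"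
    have "poly ?p t = 0" for t
    proof -
     have tx: "t *R x : Z" using x Z by (simp add: subspace_scale)
     have "t ^ ?n * ?m mu x = ?m mu (t *R x)" by (simp add: monomial_on_scale)
     also have "... = (SUM j:Jn. (SUM ka:F j. c j ka * ?m ka (t *R x)) * g j (t *R x))"
      unfolding mu[OF tx] by (rule sum.cong) (use F(2)[OF _ tx] in auto)
     also have "... = (SUM j:Jn. SUM ka:F j. (c j ka * ?m ka x * g j x) * t ^ (?deg ka + a j))"
      by (rule sum.cong)
       (auto simp: g(3)[OF _ x] monomial_on_scale sum_distrib_left sum_distrib_right power_add mult_ac)
     finally show ?thesis by (simp add: poly_sum poly_monom mult.commute)
    qed
    then have "?p = 0" using poly_all_0_iff_0 by blast
    then have "coeff ?p ?n = 0" by simp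
    then have "?m mu x = (SUM j:Jn. SUM ka:F j. if ?deg ka + a j = ?n then c j ka * ?m ka x * g j x else 0)"
     by (simp add: coeff_sum)
    also have "... = (SUM j:Jn. SUM ka:G j. c j ka * (?m ka x * g j x))"
     by (rule sum.cong) (auto simp: G_def F(1) sum.inter_filter mult.assoc intro!: sum.cong)
    finally show ?thesis .
   qed
   have "SP ?n (%x. SUM j:Jn. SUM ka:G j. c j ka * (?m ka x * g j x))"
   proof (intro SP_sum SP_scale Jn finG)
    fix j ka assume j: "j : Jn" and "ka : G j"
    then have lt: "?deg ka < ?n" using g(2)[OF j] by (simp add: G_def)
    show "SP ?n (%x. ?m ka x * g j x)"
     by (rule SP_mono[OF SP_g[OF less[OF lt] j]]) (use lt in simp)
   qed
   then show ?thesis by (rule SP_cong) (rule eq)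
  qed
 qed
 let ?s = "card B" and ?k = "card Jn"
 \<comment> \<open>Chosen so that \<open>N ^ s * (s * D + 1) ^ k <= D * (D + 1) ^ k < (D + 1) ^ (k +
   1)\<close>. With \<open>k < s\<close> this is at most the number \<open>(D + 1) ^ s\<close> of
   monomials with exponents up to \<open>D\<close>, so these monomials would be linearly
   dependent.\<close>
 define D where "D = N ^ ?s * Suc ?s ^ ?k"
 define M where "M = (B \<rightarrow>\<^sub>E {..D})"
 have degM: "?deg mu <= ?s * D" if "mu : M" for mu
 proof -
  have "?deg mu <= (SUM b:B. D)" by (rule sum_mono) (use that M_def in auto)
  then show ?thesis by simp
 qed
 have "ALL mu:M. EX c. ALL x:Z. ?m mu x = (SUM p:Idx (?s * D). c p * W p x)"
  using SP_mono[OF SP_mon degM] unfolding SP_def by blast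
 then obtain A where A: "!!mu x. mu : M ==> x : Z ==> ?m mu x = (SUM p:Idx (?s * D). A mu p * W p x)" by metis
 have "card (Idx (?s * D)) = N ^ ?s * Suc (?s * D) ^ ?k"
  unfolding Idx_def using finB Jn by (simp add: card_cartesian_product card_PiE)
 also have "... <= N ^ ?s * (Suc ?s * Suc D) ^ ?k"
  by (intro mult_left_mono power_mono) auto
 also have "... = D * Suc D ^ ?k" by (simp only: D_def power_mult_distrib mult.assoc)
 also have "... < Suc D * Suc D ^ ?k" by simp
 also have "... = Suc D ^ Suc ?k" by simp
 also have "... <= Suc D ^ ?s" by (rule power_increasing) (use small B(5) in auto)
 also have "... = card M" unfolding M_def using finB by (simp add: card_PiE)
 finally have "card (Idx (?s * D)) < card M" .
 moreover have finM: "finite M" unfolding M_def using finB by (auto intro: finite_PiE)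
 ultimately obtain c where c: "EX mu:M. c mu ~= 0" "ALL p:Idx (?s * D). (SUM mu:M. c mu * A mu p) = 0"
  using nontrivial_left_kernel[of "Idx (?s * D)" M A] finI by blast
 have "c mu = 0" if "mu : M" for mu
 proof (rule monomials_independent[OF finB finM _ _ that])
  fix mu \<nu> assume "mu : M" "\<nu> : M" "ALL b:B. mu b = \<nu> b"
  then show "mu = \<nu>" unfolding M_def by (metis PiE_ext)
 next
  fix t :: "'a => real"
  define x where "x = (SUM b:B. t b *R b)"
  have x: "x : Z" unfolding x_def B(6)[symmetric] by (intro span_sum span_scale span_base)
  have bx: "b <.> x = t b" if b: "b : B" for b
  proof -
   have "b <.> x = (SUM b':B. if b' = b then t b else 0)"
    unfolding x_def inner_sum_right
   proof (rule sum.cong)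
    fix b' assume b': "b' : B"
    show "b <.> t b' *R b' = (if b' = b then t b else 0)"
     using B(2,3) b b' by (auto simp: pairwise_def orthogonal_def dot_square_norm)
   qed simp
   then show ?thesis using b finB by simp
  qed
  have "(SUM mu:M. c mu * (PROD b:B. t b ^ mu b)) = (SUM mu:M. c mu * ?m mu x)"
   unfolding monomial_on_def by (intro sum.cong arg_cong2[where f="(*)"] prod.cong) (auto simp: bx)
  also have "... = (SUM mu:M. SUM p:Idx (?s * D). c mu * A mu p * W p x)"
   by (rule sum.cong) (auto simp: A[OF _ x] sum_distrib_left mult.assoc)
  also have "... = (SUM p:Idx (?s * D). (SUM mu:M. c mu * A mu p) * W p x)"
   by (subst sum.swap) (simp add: sum_distrib_right)
  also have "... = 0" using c(2) by simp
  finally show "(SUM mu:M. c mu * (PROD b:B. t b ^ mu b)) = 0" .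
 qed
 then show False using c(1) by blast
qed

text \<open>The form used for localisation: each nonzero point of \<open>Z\<close> is avoided by one
  of the products in the ideal, so the ideal contains powers of all linear forms.\<close>

lemma too_few_forms:
 fixes Z :: "'a::euclidean_space set" and g :: "'j => 'a => real"
 assumes Z: "subspace Z" and Jn: "finite Jn"
  and g: "!!j. j : Jn ==> rpoly (g j)" "!!j. j : Jn ==> a j > 0"
   "!!j x t. j : Jn ==> x : Z ==> g j (t *R x) = t ^ a j * g j x"
  and Ls: "finite \<L>" "!!L. L : \<L> ==> finite L"
   "!!L. L : \<L> ==> EX h. (ALL j:Jn. rpoly (h j)) & (ALL x:Z. (PROD l:L. l <.> x) = (SUM j:Jn. h j x * g j x))"
  and cover: "!!x. x : Z ==> x ~= 0 ==> EX L:\<L>. ALL l:L. l <.> x ~= 0"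
 shows "dim Z <= card Jn"
proof (rule forms_generate_power_imp_dim_le[OF Z Jn g])
 fix v
 define J where "J f \<longleftrightarrow> (EX h. (ALL j:Jn. rpoly (h j)) & (ALL x:Z. f x = (SUM j:Jn. h j x * g j x)))" for f
 have J: "ideal_on Z J"
  unfolding ideal_on_def
 proof (intro conjI allI impI)
  fix f f' :: "'a => real" assume "J f" "J f'"
  then obtain h h' where "ALL j:Jn. rpoly (h j)" "ALL x:Z. f x = (SUM j:Jn. h j x * g j x)"
   "ALL j:Jn. rpoly (h' j)" "ALL x:Z. f' x = (SUM j:Jn. h' j x * g j x)" unfolding J_def by blast
  then show "J (%x. f x + f' x)" unfolding J_def
   by (intro exI[of _ "%j x. h j x + h' j x"]) (auto simp: sum.distrib distrib_right intro: rpoly_add)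
 next
  show "J (%_. 0)" unfolding J_def by (rule exI[of _ "%_ _. 0"]) (auto intro: rpoly_const)
 next
  fix f k :: "'a => real" assume "J f" "rpoly k"
  moreover obtain h where "ALL j:Jn. rpoly (h j)" "ALL x:Z. f x = (SUM j:Jn. h j x * g j x)"
   using \<open>J f\<close> unfolding J_def by blast
  ultimately show "J (%x. k x * f x)" unfolding J_def
   by (intro exI[of _ "%j x. k x * h j x"]) (auto simp: sum_distrib_left mult.assoc intro: rpoly_mult)
 next
  fix f f' :: "'a => real" assume "ALL x:Z. f x = f' x" "J f"
  then show "J f'" unfolding J_def by auto
 qed
 have "ALL L:\<L>. EX l. set l = L & distinct l" using Ls(2) finite_distinct_list by blast
 then obtain lst where lst: "!!L. L : \<L> ==> set (lst L) = L & distinct (lst L)" by metis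
 obtain Ls where LsL: "set Ls = \<L>" using finite_list[OF Ls(1)] by blast
 have "EX N. J (%x. (v <.> x) ^ N)"
 proof (rule ideal_contains_powers[OF Z J, of "{}" "map lst Ls"])
  show "ALL L:set (map lst Ls). J (%x. \<Prod>l\<leftarrow>L. l <.> x)"
  proof
   fix l assume "l : set (map lst Ls)"
   then obtain L where L: "L : \<L>" "l = lst L" using LsL by auto
   have "(\<Prod>l\<leftarrow>l. l <.> x) = (PROD l:L. l <.> x)" for x
    using lst[OF L(1)] L(2) by (metis prod.distinct_set_conv_list)
   then show "J (%x. \<Prod>l\<leftarrow>l. l <.> x)" using Ls(3)[OF L(1)] unfolding J_def by simp
  qed
  show "ALL x:Z. x ~= 0 --> (ALL g:{}. g <.> x = 0) --> (EX L:set (map lst Ls). ALL l:set L. l <.> x ~= 0)"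
   using cover lst LsL by (metis (no_types, lifting) image_eqI set_map)
 qed simp
 then show "EX N h. (ALL j:Jn. rpoly (h j)) & (ALL x:Z. (v <.> x) ^ N = (SUM j:Jn. h j x * g j x))"
  unfolding J_def .
qed

section \<open>Tangent fields and the addition theorem\<close>

text \<open>\<open>U\<close> restricts the values only; the coefficients are polynomials on the
  whole space. Tangency on each kernel is equivalent to divisibility of \<open>K <.> th x\<close> by
  \<open>K <.> x\<close>, by \<open>rpoly_divide_linear\<close>.\<close>

definition tangent_fields :: "'e::euclidean_space set => 'e set => ('e => 'e) set" where
 "tangent_fields U A = {th. polynomial_function th & (ALL x. th x : U) & (ALL K:A. ALL x. K <.> x = 0 --> K <.> th x = 0)}"

text \<open>Hyperplanes are represented by normals, pairwise non-proportional, so that counting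
  normals counts hyperplanes.\<close>

definition arr :: "'e::euclidean_space set => bool" where
 "arr A \<longleftrightarrow> finite A & 0 ~: A & (ALL K:A. ALL L:A. K : span {L} --> K = L)"

text \<open>A transversal picks one hyperplane out of each class of hyperplanes having the same intersection
 with the kernel of \<open>a\<close>.\<close>

definition transversal :: "'e::euclidean_space set => 'e set => 'e => bool" where
 "transversal A C a \<longleftrightarrow> C \<subseteq> A & (ALL K:A. EX c:C. K : span {a, c}) & (ALL c:C. ALL c':C. c : span {a, c'} --> c = c')"

definition free_basis :: "'e::euclidean_space set => 'e set => 'i set => ('i => nat) => ('i => 'e => 'e) => bool" where
 "free_basis U A I e th \<longleftrightarrow> finite I &
   (ALL i:I. th i : tangent_fields U A & (ALL t x. th i (t *R x) = t ^ e i *R th i x)) &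
   (ALL et:tangent_fields U A. EX f. (ALL i:I. rpoly (f i)) & (ALL x. et x = (SUM i:I. f i x *R th i x))) &
   (ALL f. (ALL i:I. rpoly (f i)) --> (ALL x. (SUM i:I. f i x *R th i x) = 0) --> (ALL i:I. ALL x. f i x = 0))"

lemma tangent_fieldsD:
 assumes "th : tangent_fields U A"
 shows "polynomial_function th" "th x : U" "K : A ==> K <.> x = 0 ==> K <.> th x = 0" "rpoly (%x. u <.> th x)"
 using assms unfolding tangent_fields_def polynomial_function_inner_iff by auto

lemma tangent_fieldsI:
 assumes "!!u. rpoly (%x. u <.> th x)" "!!x. th x : U" "!!K x. K : A ==> K <.> x = 0 ==> K <.> th x = 0"
 shows "th : tangent_fields U A"
 using assms unfolding tangent_fields_def polynomial_function_inner_iff by auto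

lemma tangent_fields_add:
 assumes "subspace U" "th : tangent_fields U A" "et : tangent_fields U A"
 shows "(%x. th x + et x) : tangent_fields U A"
 by (rule tangent_fieldsI)
   (use assms in \<open>auto simp: inner_add_right tangent_fieldsD subspace_add intro: rpoly_add\<close>)

lemma tangent_fields_mult:
 assumes "subspace U" "th : tangent_fields U A" "rpoly f"
 shows "(%x. f x *R th x) : tangent_fields U A"
 by (rule tangent_fieldsI)
   (use assms in \<open>auto simp: tangent_fieldsD subspace_scale intro: rpoly_mult\<close>)

lemma tangent_fields_mult_ext:
 assumes "subspace U" "th : tangent_fields U A" "rpoly f"
  and "!!K x. K : B ==> K ~: A ==> K <.> x = 0 ==> f x = 0"
 shows "(%x. f x *R th x) : tangent_fields U B"
proof (rule tangent_fieldsI)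
 fix K x assume "K : B" "K <.> x = 0"
 then show "K <.> f x *R th x = 0"
  using assms tangent_fieldsD(3)[OF assms(2), of K x] by (cases "K : A") auto
qed (use assms in \<open>auto simp: tangent_fieldsD subspace_scale intro: rpoly_mult\<close>)

lemma tangent_fields_antimono: "B \<subseteq> A ==> tangent_fields U A \<subseteq> tangent_fields U B"
 unfolding tangent_fields_def by auto

text \<open>The component of \<open>k\<close> orthogonal to \<open>span T\<close> is such a
  vector.\<close>

lemma separating_vector:
 fixes k :: "'e::euclidean_space"
 assumes "k ~: span T"
 shows "EX x. (ALL t:T. t <.> x = 0) & k <.> x ~= 0"
proof -
 obtain y z where yz: "y : span T" "!!w. w : span T ==> orthogonal z w" "k = y + z"
  using orthogonal_subspace_decomp_exists[of T k] by metis
 have "z ~= 0" using yz assms by auto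
 then have "k <.> z ~= 0" using yz by (simp add: inner_add_left orthogonal_def inner_commute[of y])
 moreover have "ALL t:T. t <.> z = 0" using yz(2) by (simp add: orthogonal_def span_base inner_commute)
 ultimately show ?thesis by blast
qed

lemma span_pairE:
 assumes "k : span {a, c}"
 obtains u v where "k = u *R a + v *R (c::'e::euclidean_space)"
proof -
 obtain u where "k - u *R a : span {c}" using assms span_breakdown_eq[of k a "{c}"] by auto
 then obtain v where "k - u *R a = v *R c" by (auto simp: span_singleton)
 then show ?thesis using that[of u v] by (simp add: algebra_simps)
qed

lemma span_pairI: "u *R a + v *R c : span {a, c}"
 by (intro span_add span_scale span_base) auto

lemma arrD:
 assumes "arr A"
 shows "finite A" "K : A ==> K ~= 0" "K : A ==> L : A ==> K ~= L ==> K ~: span {L}"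
 using assms unfolding arr_def by auto

lemma arr_class:
 assumes A: "arr (insert a A)" "a ~: A" and K: "K : A" and c: "c : A" "K : span {a, c}"
 obtains u v where "K = u *R a + v *R c" "v ~= 0" "K ~= c ==> u ~= 0"
proof -
 obtain u v where uv: "K = u *R a + v *R c" using c(2) by (rule span_pairE)
 have "K ~: span {a}" using arrD(3)[OF A(1), of K a] K A(2) by auto
 then have "v ~= 0" using uv by (auto simp: span_singleton)
 moreover have "u ~= 0" if "K ~= c"
 proof
  assume "u = 0"
  then have "K : span {c}" using uv by (auto simp: span_singleton)
  then show False using arrD(3)[OF A(1), of K c] K c that by auto
 qed
 ultimately show ?thesis using that uv by blast
qed

lemma arr_class_sym:
 assumes A: "arr (insert a A)" "a ~: A" and K: "K : A" and c: "c : A" "K : span {a, c}"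
 shows "c : span {a, K}"
proof -
 obtain u v where uv: "K = u *R a + v *R c" "v ~= 0" using arr_class[OF assms] by metis
 then have "c = (- (u / v)) *R a + (1 / v) *R K" by (simp add: algebra_simps)
 then show ?thesis by (metis span_pairI)
qed

lemma span_pair_trans:
 assumes "k : span {a, l}" "l : span {a, m}"
 shows "k : span {a, m}"
proof -
 have "{a, l} \<subseteq> span {a, m}" using assms by (auto intro: span_base)
 then have "span {a, l} \<subseteq> span {a, m}" by (rule span_minimal) simp
 then show ?thesis using assms by blast
qed

lemma transversal_exists:
 assumes A: "arr (insert a A)" "a ~: A"
 shows "EX C. transversal A C a"
proof -
 \<comment> \<open>The choice depends only on the class of \<open>K\<close> modulo \<open>a\<close>:
   equal classes give the same predicate under \<open>SOME\<close>, hence the same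
   representative.\<close>
 define r where "r K = (SOME L. L : A & L : span {a, K})" for K
 have r: "r K : A & r K : span {a, K}" if "K : A" for K
  unfolding r_def by (rule someI[of _ K]) (use that in \<open>auto intro: span_base\<close>)
 have cl: "{L. L : A & L : span {a, K}} = {L. L : A & L : span {a, K'}}" if "K : A" "K' : A" "K : span {a, K'}" for K K'
  using arr_class_sym[OF A that] that span_pair_trans by blast
 have req: "r K = r K'" if "K : A" "K' : A" "K : span {a, K'}" for K K'
  unfolding r_def using cl[OF that] by (metis (mono_tags, lifting) mem_Collect_eq)
 have "transversal A (r ` A) a"
  unfolding transversal_def
 proof (intro conjI ballI impI)
  show "r ` A \<subseteq> A" using r by auto
  fix K assume K: "K : A"
  show "EX c:r ` A. K : span {a, c}" using r[OF K] arr_class_sym[OF A _ K] K by blast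
 next
  fix c c' assume "c : r ` A" "c' : r ` A" and s: "c : span {a, c'}"
  then obtain K K' where K: "K : A" "c = r K" "K' : A" "c' = r K'" by blast
  have "K : span {a, c}" using r[OF K(1)] arr_class_sym[OF A _ K(1)] K by blast
  then have "K : span {a, K'}" using s r[OF K(3)] K span_pair_trans by metis
  then show "c = c'" using req K by metis
 qed
 then show ?thesis by blast
qed

text \<open>Terao's polynomial \<open>b\<close>: the value of a tangent field on \<open>a\<close>, restricted to the kernel of \<open>a\<close>, is a multiple
 of a product of \<open>card (A - C)\<close> linear forms.\<close>

lemma tangent_field_factor:
 fixes a :: "'e::euclidean_space"
 assumes A: "arr (insert a A)" "a ~: A" and C: "transversal A C a" and th: "th : tangent_fields U A"
 shows "EX g. rpoly g & (ALL x. a <.> x = 0 --> a <.> th x = (PROD K:A - C. K <.> x) * g x)"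
proof -
 have finA: "finite A" using arrD(1)[OF A(1)] by simp
 have CA: "C \<subseteq> A" using C by (simp add: transversal_def)
 have finC: "finite C" using CA finA by (rule finite_subset)
 let ?H = "{x. a <.> x = 0}"
 have H: "subspace ?H" by (simp add: subspace_hyperplane)
 \<comment> \<open>The class of \<open>c\<close> without its representative; together these sets
   make up \<open>A - C\<close>.\<close>
 define Y where "Y c = {K:A. K : span {a, c}} - {c}" for c
 have finY: "finite (Y c)" for c using finA by (simp add: Y_def)
 have pol: "rpoly (%x. u <.> th x)" for u using tangent_fieldsD(4)[OF th] .
 have single: "EX g. rpoly g & (ALL x:?H. a <.> th x = (PROD K:Y c. K <.> x) * g x)" if c: "c : C" for c
 proof -
  have cA: "c : A" using c CA by blast
  obtain q where q: "rpoly q" "ALL x:UNIV. c <.> th x = (c <.> x) * q x"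
   using rpoly_divide_linear[OF pol subspace_UNIV, of c c] tangent_fieldsD(3)[OF th cA] by auto
  \<comment> \<open>Modulo \<open>a <.> x\<close> this is \<open>a <.> th x\<close>. It vanishes on
    every other hyperplane of the class, because \<open>K = u a + v c\<close> and both
    \<open>K <.> th\<close> and \<open>c <.> th - (c <.> x) q\<close> vanish there.\<close>
  let ?f = "%x. a <.> th x - (a <.> x) * q x"
  have "EX g. rpoly g & (ALL x:UNIV. ?f x = (PROD K:Y c. K <.> x) * g x)"
  proof (rule rpoly_divide_by_prod[OF subspace_UNIV finY])
   show "rpoly ?f" by (intro rpoly_intros pol q)
   fix K x assume K: "K : Y c" and Kx: "K <.> x = 0"
   then have KA: "K : A" "K : span {a, c}" "K ~= c" by (auto simp: Y_def)
   obtain u v where uv: "K = u *R a + v *R c" "u ~= 0"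
    using arr_class[OF A KA(1) cA KA(2)] KA(3) by metis
   have "u * (a <.> th x) + v * (c <.> th x) = 0"
    using tangent_fieldsD(3)[OF th KA(1) Kx] uv(1) by (simp add: inner_add_left)
   moreover have "u * (a <.> x) + v * (c <.> x) = 0" using Kx uv(1) by (simp add: inner_add_left)
   ultimately have "u * (a <.> th x) = u * ((a <.> x) * q x)" using q(2)
    by (metis (no_types, opaque_lifting) UNIV_I add_right_cancel distrib_right mult.assoc mult_zero_left)
   then show "?f x = 0" using uv(2) by simp
  next
   fix K L assume "K : Y c" "L : Y c" "K ~= L"
   then have "L ~: span {K}" using arrD(3)[OF A(1), of L K] by (auto simp: Y_def)
   then show "EX x:UNIV. K <.> x = 0 & L <.> x ~= 0" using separating_vector[of L "{K}"] by auto
  qed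
  then obtain g where "rpoly g" "ALL x. ?f x = (PROD K:Y c. K <.> x) * g x" by auto
  then show ?thesis by (intro exI[of _ g]) (metis (mono_tags, lifting) diff_zero mem_Collect_eq mult_zero_left)
 qed
 have "EX g. rpoly g & (ALL x:?H. a <.> th x = (PROD K:(UN c:F. Y c). K <.> x) * g x)" if "finite F" "F \<subseteq> C" for F
  using that
 proof (induction F rule: finite_induct)
  case empty
  show ?case by (rule exI[of _ "%x. a <.> th x"]) (simp add: pol)
 next
  case (insert c F)
  then obtain g1 where g1: "rpoly g1" "ALL x:?H. a <.> th x = (PROD K:(UN c:F. Y c). K <.> x) * g1 x" by auto
  have cC: "c : C" using insert.prems by simp
  obtain g2 where g2: "rpoly g2" "ALL x:?H. a <.> th x = (PROD K:Y c. K <.> x) * g2 x" using single[OF cC] by blast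
  \<comment> \<open>Forms from different classes stay non-proportional on the kernel of
    \<open>a\<close>, which is what coprimality of the class products requires.\<close>
  have nosp: "l ~: span {a, l'}" if l: "l : (UN c:F. Y c)" "l' : Y c" for l l'
  proof
   assume s: "l : span {a, l'}"
   obtain c' where c': "c' : F" "l : Y c'" using l by blast
   have "c' : A" "c' : C" using c' insert.prems CA by auto
   then have "c' : span {a, l}" using arr_class_sym[OF A, of l c'] c' by (auto simp: Y_def)
   then have "c' : span {a, c}" using s l(2) span_pair_trans by (metis (mono_tags, lifting) DiffD1 Y_def mem_Collect_eq)
   then have "c' = c" using C \<open>c' : C\<close> cC unfolding transversal_def by blast
   then show False using c' insert.hyps by simp
  qed
  have "EX g. rpoly g & (ALL x:?H. a <.> th x = (PROD K:(UN c:F. Y c) Un Y c. K <.> x) * g x)"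
  proof (rule rpoly_divide_coprime[OF H _ finY _ pol g1(1) _ g2(1)])
   show "finite (UN c:F. Y c)" using insert.hyps finY by auto
   show "(UN c:F. Y c) Int Y c = {}"
   proof (rule ccontr)
    assume "(UN c:F. Y c) Int Y c ~= {}"
    then obtain l where "l : (UN c:F. Y c)" "l : Y c" by blast
    from nosp[OF this] show False by (auto intro: span_base)
   qed
   show "EX x:?H. l' <.> x = 0 & l <.> x ~= 0" if "l : (UN c:F. Y c)" "l' : Y c" for l l'
    using separating_vector[OF nosp[OF that]] by auto
   show "EX x:?H. l <.> x ~= 0" if "l : Y c" for l
   proof -
    have "l ~: span {a}" using arrD(3)[OF A(1), of l a] that A(2) by (auto simp: Y_def)
    then show ?thesis using separating_vector[of l "{a}"] by auto
   qed
  qed (use g1 g2 in auto)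
  then show ?case by (simp add: Un_commute)
 qed
 from this[OF finC subset_refl] obtain g where g: "rpoly g" "ALL x:?H. a <.> th x = (PROD K:(UN c:C. Y c). K <.> x) * g x" by blast
 have "(UN c:C. Y c) = A - C"
 proof (intro equalityI subsetI)
  fix K assume "K : (UN c:C. Y c)"
  then obtain c where "c : C" "K : A" "K : span {a, c}" "K ~= c" by (auto simp: Y_def)
  then show "K : A - C" using C unfolding transversal_def by blast
 next
  fix K assume "K : A - C"
  then show "K : (UN c:C. Y c)" using C unfolding transversal_def Y_def by blast
 qed
 then show ?thesis using g by auto
qed

text \<open>Cancelling the product on the kernel gives \<open>t ^ d * j (t x) = t ^ e * j x\<close>
  with \<open>d\<close> the number of factors; along a ray this is an identity of univariate
  polynomials, so \<open>j\<close> is zero or homogeneous of degree \<open>e - d\<close>.\<close>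

lemma degree_of_factor:
 fixes a :: "'e::euclidean_space"
 assumes L: "finite L" "!!l. l : L ==> l ~: span {a}" and j: "rpoly j"
  and eq: "!!x. a <.> x = 0 ==> f x = (PROD l:L. l <.> x) * j x"
  and hom: "!!t x. f (t *R x) = t ^ e * f x" and x: "a <.> x = 0"
 shows "e < card L ==> j x = 0" "card L <= e ==> j (t *R x) = t ^ (e - card L) * j x"
proof -
 let ?H = "{x. a <.> x = 0}" and ?d = "card L"
 let ?b = "%x. PROD l:L. l <.> x"
 have H: "subspace ?H" by (simp add: subspace_hyperplane)
 have "EX z:?H. ?b z ~= 0"
 proof (rule prod_linear_nonzero[OF H L(1)])
  fix l assume "l : L"
  then show "EX x:?H. l <.> x ~= 0" using separating_vector[OF L(2)] by auto
 qed
 then obtain z where z: "z : ?H" "?b z ~= 0" by blast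
 have key: "t ^ ?d * j (t *R x) = t ^ e * j x" for t
 proof (rule rpoly_cancel[where b="?b", OF rpoly_prod_inner _ _ H _ z])
  have bl: "bounded_linear (%x::'e. t *R x)" by (rule bounded_linear_scaleR_right)
  show "rpoly (%x. t ^ ?d * j (t *R x))" by (intro rpoly_mult rpoly_const rpoly_comp[OF j bl])
  show "rpoly (%x. t ^ e * j x)" by (intro rpoly_mult rpoly_const j)
  fix y assume y: "y : ?H"
  have "?b (t *R y) = t ^ ?d * ?b y" by (simp add: prod.distrib)
  moreover have "f (t *R y) = ?b (t *R y) * j (t *R y)" "f y = ?b y * j y" using y by (intro eq; simp)+
  ultimately show "?b y * (t ^ ?d * j (t *R y)) = ?b y * (t ^ e * j y)" using hom[of t y] by (auto simp: mult_ac)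
 qed (use x in auto)
 obtain p where p: "ALL t. j (0 + t *R x) = poly p t" using rpoly_line[OF j] by blast
 have "poly (Polynomial.monom 1 ?d * p) t = poly (Polynomial.monom (j x) e) t" for t
  using key[of t] p by (simp add: poly_monom mult.commute)
 then have peq: "Polynomial.monom 1 ?d * p = Polynomial.monom (j x) e" using poly_eq_poly_eq_iff by blast
 show "j x = 0" if "e < ?d"
  using arg_cong[OF peq, of "%p. coeff p e"] that by (simp add: coeff_monom_mult)
 show "j (t *R x) = t ^ (e - ?d) * j x" if "?d <= e"
 proof -
  have "Polynomial.monom 1 ?d * p = Polynomial.monom 1 ?d * Polynomial.monom (j x) (e - ?d)"
   using peq that by (simp add: mult_monom)
  then have "p = Polynomial.monom (j x) (e - ?d)" by simp
  then show ?thesis using p by (simp add: poly_monom mult.commute)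
 qed
qed

lemma free_basisD:
 assumes "free_basis U A I e th"
 shows "finite I" "i : I ==> th i : tangent_fields U A" "i : I ==> th i (t *R x) = t ^ e i *R th i x"
  "et : tangent_fields U A ==> EX f. (ALL i:I. rpoly (f i)) & (ALL x. et x = (SUM i:I. f i x *R th i x))"
  "(!!i. i : I ==> rpoly (f i)) ==> (!!x. (SUM i:I. f i x *R th i x) = 0) ==> i : I ==> f i x = 0"
proof -
 note * = assms[unfolded free_basis_def]
 show "finite I" "i : I ==> th i : tangent_fields U A" "i : I ==> th i (t *R x) = t ^ e i *R th i x"
  using * by simp_all
 show "et : tangent_fields U A ==> EX f. (ALL i:I. rpoly (f i)) & (ALL x. et x = (SUM i:I. f i x *R th i x))"
  using * by simp
 show "(!!i. i : I ==> rpoly (f i)) ==> (!!x. (SUM i:I. f i x *R th i x) = 0) ==> i : I ==> f i x = 0"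
  using *[THEN conjunct2, THEN conjunct2, THEN conjunct2, rule_format, of f i x] by blast
qed

section \<open>The addition theorem for one hyperplane\<close>

locale addition =
 fixes U :: "'e::euclidean_space set" and A C :: "'e set" and a :: 'e
  and I :: "'i set" and e :: "'i => nat" and th :: "'i => 'e => 'e" and d :: nat
 assumes U: "subspace U" and A: "arr (insert a A)" "a ~: A" and C: "transversal A C a"
  and basis: "free_basis U A I e th" and d: "d = card (A - C)"
begin

abbreviation "H \<equiv> {x. a <.> x = 0}"
abbreviation "b x \<equiv> (PROD K:A - C. K <.> x)"

lemma finA: "finite A" using arrD(1)[OF A(1)] by simp

lemma H: "subspace H" by (simp add: subspace_hyperplane)

lemma not_span_a: "K : A ==> K ~: span {a}" using arrD(3)[OF A(1), of K a] A(2) by auto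

lemma b_nonzero: "EX z:H. b z ~= 0"
proof (rule prod_linear_nonzero[OF H])
 fix l assume "l : A - C"
 then show "EX x:H. l <.> x ~= 0" using separating_vector[OF not_span_a] by auto
qed (simp add: finA)

text \<open>\<open>j i\<close> is the value of the basis field \<open>th i\<close> on
  \<open>a\<close>, divided by Terao's polynomial on the hyperplane. A constant nonzero
  \<open>j i\<close> signals a basis field that can be replaced.\<close>

definition quotients :: "('i => 'e => real) => bool" where
 "quotients j \<longleftrightarrow> (ALL i:I. rpoly (j i) & (ALL x. a <.> x = 0 --> a <.> th i x = b x * j i x & (e i < d --> j i x = 0) &
   (d <= e i --> (ALL t. j i (t *R x) = t ^ (e i - d) * j i x))))"

lemma quotientsD:
 assumes "quotients j" "i : I"
 shows "rpoly (j i)" "a <.> x = 0 ==> a <.> th i x = b x * j i x" "a <.> x = 0 ==> e i < d ==> j i x = 0"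
  "a <.> x = 0 ==> d <= e i ==> j i (t *R x) = t ^ (e i - d) * j i x"
 using assms unfolding quotients_def by simp_all

lemma quotients_exist: "EX j. quotients j"
proof -
 have "ALL i:I. EX g. rpoly g & (ALL x. a <.> x = 0 --> a <.> th i x = b x * g x)"
  using tangent_field_factor[OF A C free_basisD(2)[OF basis]] by blast
 then obtain j where j: "!!i. i : I ==> rpoly (j i)" "!!i x. i : I ==> a <.> x = 0 ==> a <.> th i x = b x * j i x"
  by metis
 have fin: "finite (A - C)" and ns: "!!l. l : A - C ==> l ~: span {a}" using finA not_span_a by auto
 have hom: "a <.> th i (t *R x) = t ^ e i * (a <.> th i x)" if "i : I" for i t x
  using free_basisD(3)[OF basis that] by simp
 have "quotients j"
  unfolding quotients_def
 proof (intro ballI conjI allI impI)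
  fix i x assume i: "i : I" and x: "a <.> x = 0"
  show "j i x = 0" if "e i < d"
   using degree_of_factor(1)[OF fin ns j(1)[OF i] j(2)[OF i] hom[OF i] x] that d by simp
  show "j i (t *R x) = t ^ (e i - d) * j i x" if "d <= e i" for t
   using degree_of_factor(2)[OF fin ns j(1)[OF i] j(2)[OF i] hom[OF i] x] that d by simp
 qed (use j in auto)
 then show ?thesis by blast
qed

lemma combination_on_H:
 assumes j: "!!i x. i : I ==> a <.> x = 0 ==> a <.> th i x = b x * j i x" "!!i. i : I ==> rpoly (j i)"
  and f: "!!i. i : I ==> rpoly (f i)" "!!x. et x = (SUM i:I. f i x *R th i x)"
  and q: "rpoly q" "!!x. a <.> x = 0 ==> a <.> et x = b x * q x" and x: "a <.> x = 0"
 shows "(SUM i:I. f i x * j i x) = q x"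
proof -
 obtain z where z: "z : H" "b z ~= 0" using b_nonzero by blast
 show ?thesis
 proof (rule rpoly_cancel[where b="b", OF rpoly_prod_inner _ _ H _ z])
  show "rpoly (%x. SUM i:I. f i x * j i x)" by (intro rpoly_sum rpoly_mult f j)
  fix y assume "y : H"
  then have y: "a <.> y = 0" by simp
  have "b y * (SUM i:I. f i y * j i y) = (SUM i:I. f i y * (a <.> th i y))"
   by (simp add: sum_distrib_left j(1)[OF _ y] mult_ac)
  also have "... = a <.> et y" unfolding f(2) by (simp add: inner_sum_right)
  finally show "b y * (SUM i:I. f i y * j i y) = b y * q y" using q(2)[OF y] by simp
 qed (use x q in auto)
qed

text \<open>The coefficients of \<open>et\<close> satisfy \<open>sum f i * j i = 1\<close> on the
  hyperplane. At the origin this yields an index with \<open>j i 0 ~= 0\<close>, which forces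
  \<open>e i = d\<close> and makes \<open>j i\<close> constant; that field clears the values of the
  others and is itself multiplied by \<open>a\<close>.\<close>

lemma free_basis_add:
 assumes et: "et : tangent_fields U A" "!!x. a <.> x = 0 ==> a <.> et x = b x"
 shows "EX i:I. e i = d & (EX th'. free_basis U (insert a A) I (e(i := Suc d)) th')"
proof -
 obtain j where "quotients j" using quotients_exist by blast
 note j = quotientsD[OF this]
 obtain f where f: "!!i. i : I ==> rpoly (f i)" "!!x. et x = (SUM i:I. f i x *R th i x)"
  using free_basisD(4)[OF basis et(1)] by blast
 have "(SUM i:I. f i 0 * j i 0) = 1"
  by (rule combination_on_H[where j=j and f=f and et=et and q="%_. 1", OF j(2,1) f rpoly_const]) (use et(2) in auto)
 then have "EX i:I. f i 0 * j i 0 ~= 0" using sum.neutral[of I "%i. f i 0 * j i 0"] by fastforce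
 then obtain i0 where i0: "i0 : I" "j i0 0 ~= 0" by auto
 have ei0: "e i0 = d"
 proof (rule ccontr)
  assume "e i0 ~= d"
  then consider "e i0 < d" | "d < e i0" by linarith
  then show False
  proof cases
   case 1
   then show ?thesis using j(3)[OF i0(1), of 0] i0 by simp
  next
   case 2
   then show ?thesis using j(4)[OF i0(1), of 0 0] i0 by (simp add: power_0_left)
  qed
 qed
 define k where "k = j i0 0"
 have k: "k ~= 0" using i0 by (simp add: k_def)
 have jk: "j i0 x = k" if "a <.> x = 0" for x
  using j(4)[OF i0(1) that, of 0] ei0 by (simp add: k_def)
 have a0: "a ~= 0" using arrD(2)[OF A(1)] by simp
 \<comment> \<open>Orthogonal projection to the hyperplane; composing with it extends the quotients
   homogeneously to the whole space.\<close>
 define pr where "pr x = x - ((a <.> x) / (a <.> a)) *R a" for x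
 have pr: "a <.> pr x = 0" for x using a0 by (simp add: pr_def inner_diff_right)
 have prH: "pr x = x" if "a <.> x = 0" for x using that by (simp add: pr_def)
 have pr_scale: "pr (t *R x) = t *R pr x" for t x by (simp add: pr_def algebra_simps)
 have "bounded_linear (%x. x - (((1 / (a <.> a)) *R a) <.> x) *R a)"
  by (intro bounded_linear_sub bounded_linear_ident bounded_linear_scaleR_const bounded_linear_inner_right)
 then have bl: "bounded_linear pr" unfolding pr_def by simp
 define g where "g i x = j i (pr x) / k" for i x
 have g_pol: "rpoly (g i)" if "i : I" for i
 proof -
  have "rpoly (%x. j i (pr x) * (1 / k))" by (intro rpoly_mult rpoly_const rpoly_comp[OF j(1)[OF that] bl])
  then show ?thesis by (simp add: g_def[abs_def])
 qed
 have gH: "k * g i x = j i x" if "a <.> x = 0" for i x using k by (simp add: g_def prH[OF that])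
 define th' where "th' i x = (if i = i0 then (a <.> x) *R th i0 x else th i x - g i x *R th i0 x)" for i x
 have th: "th i : tangent_fields U A" if "i : I" for i using free_basisD(2)[OF basis that] .
 have th'A: "th' i : tangent_fields U A" if i: "i : I" for i
 proof (cases "i = i0")
  case True
  then have "th' i = (%x. (a <.> x) *R th i0 x)" by (auto simp: th'_def)
  then show ?thesis using tangent_fields_mult[OF U th[OF i0(1)] rpoly_inner] by simp
 next
  case False
  have "rpoly (%x. - g i x)" by (intro real_polynomial_function_minus g_pol i)
  then have "(%x. th i x + (- g i x) *R th i0 x) : tangent_fields U A"
   by (intro tangent_fields_add[OF U] tangent_fields_mult[OF U] th i i0)
  then show ?thesis using False by (simp add: th'_def[abs_def])
 qed
 have th'a: "a <.> th' i x = 0" if i: "i : I" and x: "a <.> x = 0" for i x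
  using j(2)[OF i x] j(2)[OF i0(1) x] jk[OF x] gH[OF x, of i] x
  by (auto simp: th'_def inner_diff_right mult.commute)
 \<comment> \<open>Translates coefficients for \<open>th'\<close> into coefficients for
   \<open>th\<close>, so that spanning and independence are inherited.\<close>
 have sum_split: "(SUM i:I. h i *R th' i x) = (SUM i:I. (if i = i0 then (a <.> x) * h i0 - (SUM i:I - {i0}. h i * g i x) else h i) *R th i x)"
  for h :: "'i => real" and x
 proof -
  have fI: "finite I" using free_basisD(1)[OF basis] .
  have "(SUM i:I. h i *R th' i x) = h i0 *R th' i0 x + (SUM i:I - {i0}. h i *R th' i x)"
   by (rule sum.remove[OF fI i0(1)])
  also have "(SUM i:I - {i0}. h i *R th' i x) = (SUM i:I - {i0}. h i *R th i x - (h i * g i x) *R th i0 x)"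
   by (rule sum.cong) (auto simp: th'_def scaleR_diff_right)
  also have "... = (SUM i:I - {i0}. h i *R th i x) - (SUM i:I - {i0}. h i * g i x) *R th i0 x"
   by (simp add: sum_subtractf scaleR_sum_left)
  also have "h i0 *R th' i0 x = ((a <.> x) * h i0) *R th i0 x" by (simp add: th'_def mult.commute)
  finally show ?thesis
   by (subst (2) sum.remove[OF fI i0(1)]) (simp add: scaleR_diff_left)
 qed
 have "free_basis U (insert a A) I (e(i0 := Suc d)) th'"
  unfolding free_basis_def
 proof (intro conjI ballI allI impI)
  show "finite I" using free_basisD(1)[OF basis] .
  fix i assume i: "i : I"
  show "th' i : tangent_fields U (insert a A)"
   using th'A[OF i] th'a[OF i] unfolding tangent_fields_def by auto
  show "th' i (t *R x) = t ^ (e(i0 := Suc d)) i *R th' i x" for t x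
  proof (cases "i = i0")
   case True
   then show ?thesis using free_basisD(3)[OF basis i0(1)] ei0 by (simp add: th'_def mult_ac)
  next
   case False
   show ?thesis
   proof (cases "e i < d")
    case True
    then have "g i x = 0" for x using j(3)[OF i pr] by (simp add: g_def)
    then show ?thesis using False free_basisD(3)[OF basis i] by (simp add: th'_def)
   next
    case F: False
    have "g i (t *R x) = t ^ (e i - d) * g i x" using j(4)[OF i pr] F by (simp add: g_def pr_scale)
    moreover have "t ^ e i = t ^ (e i - d) * t ^ d" using F by (simp flip: power_add)
    ultimately show ?thesis using False free_basisD(3)[OF basis i] free_basisD(3)[OF basis i0(1)] ei0
     by (simp add: th'_def algebra_simps)
   qed
  qed
 next
  fix \<zeta> assume z: "\<zeta> : tangent_fields U (insert a A)"
  then have zA: "\<zeta> : tangent_fields U A" using tangent_fields_antimono[of A "insert a A"] by blast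
  obtain f where f: "!!i. i : I ==> rpoly (f i)" "!!x. \<zeta> x = (SUM i:I. f i x *R th i x)"
   using free_basisD(4)[OF basis zA] by blast
  \<comment> \<open>On the hyperplane, \<open>k * h\<close> is the combination of the quotients
    given by a field tangent to it, hence zero; so \<open>h\<close> is divisible by \<open>a\<close>
    and its quotient becomes the coefficient of the replaced field.\<close>
  define h where "h x = f i0 x + (SUM i:I - {i0}. f i x * g i x)" for x
  have h_pol: "rpoly h" unfolding h_def by (intro rpoly_add rpoly_sum rpoly_mult f g_pol i0) auto
  have "h x = 0" if x: "a <.> x = 0" for x
  proof -
   have "0 = (SUM i:I. f i x * j i x)"
    by (rule combination_on_H[where j=j and f=f and et=\<zeta> and q="%_. 0", OF j(2,1) f rpoly_const, symmetric]) (use tangent_fieldsD(3)[OF z] x in auto)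
   also have "... = f i0 x * j i0 x + (SUM i:I - {i0}. f i x * j i x)"
    by (rule sum.remove[OF free_basisD(1)[OF basis] i0(1)])
   also have "(SUM i:I - {i0}. f i x * j i x) = k * (SUM i:I - {i0}. f i x * g i x)"
    by (simp add: gH[OF x, symmetric] sum_distrib_left mult_ac)
   also have "f i0 x * j i0 x + ... = k * h x"
    by (simp add: h_def jk[OF x] distrib_left mult_ac)
   finally show ?thesis using k by simp
  qed
  then obtain h' where h': "rpoly h'" "ALL x:UNIV. h x = (a <.> x) * h' x"
   using rpoly_divide_linear[OF h_pol subspace_UNIV, of a] by blast
  show "EX f. (ALL i:I. rpoly (f i)) & (ALL x. \<zeta> x = (SUM i:I. f i x *R th' i x))"
  proof (intro exI conjI ballI allI)
   let ?f = "%i. if i = i0 then h' else f i"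
   show "rpoly (?f i)" if "i : I" for i using f h' that by auto
   fix x
   have "(SUM i:I. ?f i x *R th' i x) = (SUM i:I. (if i = i0 then (a <.> x) * h' x - (SUM i:I - {i0}. ?f i x * g i x) else ?f i x) *R th i x)"
    unfolding sum_split by simp
   also have "(SUM i:I - {i0}. ?f i x * g i x) = (SUM i:I - {i0}. f i x * g i x)" by (rule sum.cong) auto
   also have "(a <.> x) * h' x - (SUM i:I - {i0}. f i x * g i x) = f i0 x" using h'(2) by (simp add: h_def flip: h'(2)[rule_format])
   also have "(SUM i:I. (if i = i0 then f i0 x else ?f i x) *R th i x) = \<zeta> x" unfolding f(2) by (rule sum.cong) auto
   finally show "\<zeta> x = (SUM i:I. ?f i x *R th' i x)" ..
  qed
 next
  fix f i x
  assume f: "ALL i:I. rpoly (f i)" and 0: "ALL x. (SUM i:I. f i x *R th' i x) = 0" and i: "i : I"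
  let ?h = "%i x. if i = i0 then (a <.> x) * f i0 x - (SUM i:I - {i0}. f i x * g i x) else f i x"
  have h0: "?h i x = 0" if "i : I" for i x
  proof (rule free_basisD(5)[OF basis _ _ that])
   fix i assume i: "i : I"
   show "rpoly (?h i)"
   proof (cases "i = i0")
    case True
    have "rpoly (%x. (a <.> x) * f i0 x - (SUM i:I - {i0}. f i x * g i x))"
     by (intro real_polynomial_function_diff rpoly_sum rpoly_mult rpoly_inner g_pol) (use f i0 in auto)
    then show ?thesis using True by simp
   qed (use f i in simp)
  next
   fix x
   show "(SUM i:I. ?h i x *R th i x) = 0"
    using 0[rule_format, of x] unfolding sum_split .
  qed
  show "f i x = 0"
  proof (cases "i = i0")
   case False
   then show ?thesis using h0[OF i, of x] by simp
  next
   case True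
   have others: "f i x = 0" if "i : I - {i0}" for i x using h0[of i x] that by auto
   have "(a <.> y) * f i0 y = 0" for y using h0[OF i0(1), of y] others by simp
   then have "f i0 x = 0"
    by (intro rpoly_domain[OF rpoly_inner _ subspace_UNIV, of "f i0" a a]) (use f i0 a0 in auto)
   then show ?thesis using True by simp
  qed
 qed
 then show ?thesis using i0(1) ei0 by blast
qed

text \<open>If no quotient were a nonzero constant, only those of positive degree would survive. The
  local fields, multiplied by the hyperplanes that miss the point, put products of representatives
  into the ideal of these quotients; such products have no common zero in the section of
  \<open>W\<close> but 0, so there would be at least as many quotients as dimensions.\<close>

lemma local_to_global:
 fixes W :: "'e set"
 assumes W: "subspace W" and few: "card {i:I. e i > d} < dim {x:W. a <.> x = 0}"
  and loc: "!!x. x : W ==> a <.> x = 0 ==> x ~= 0 ==>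
   EX et:tangent_fields U {K:A. K <.> x = 0}. ALL y. a <.> y = 0 --> a <.> et y = (PROD K:{K:A - C. K <.> x = 0}. K <.> y)"
 shows "EX et:tangent_fields U A. ALL y. a <.> y = 0 --> a <.> et y = b y"
proof -
 obtain j where "quotients j" using quotients_exist by blast
 note j = quotientsD[OF this]
 have fI: "finite I" using free_basisD(1)[OF basis] .
 have "EX i:I. e i = d & j i 0 ~= 0"
 proof (rule ccontr)
  assume no: "~ ?thesis"
  let ?Z = "{x:W. a <.> x = 0}" and ?I = "{i:I. e i > d}"
  have jz: "j i x = 0" if "i : I" "i ~: ?I" "a <.> x = 0" for i x
  proof (cases "e i = d")
   case True
   then have "j i 0 = j i x" using j(4)[OF that(1,3), of 0] by simp
   then show ?thesis using no that(1) True by auto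
  next
   case False
   then show ?thesis using j(3)[OF that(1,3)] that by auto
  qed
  have q: "EX h. (ALL i:?I. rpoly (h i)) & (ALL y:?Z. (PROD K:{K:C. K <.> x ~= 0}. K <.> y) = (SUM i:?I. h i y * j i y))"
   if x: "x : ?Z" "x ~= 0" for x
  proof -
   let ?q = "%y. PROD K:{K:C. K <.> x ~= 0}. K <.> y"
   obtain et where et: "et : tangent_fields U {K:A. K <.> x = 0}"
    "!!y. a <.> y = 0 ==> a <.> et y = (PROD K:{K:A - C. K <.> x = 0}. K <.> y)" using loc[of x] x by auto
   \<comment> \<open>Multiplying by all hyperplanes that miss \<open>x\<close> makes the local field
     global. Its value on \<open>a\<close> becomes \<open>b\<close> times the product of the
     representatives that miss \<open>x\<close>.\<close>
   define r where "r y = (PROD K:{K:A. K <.> x ~= 0}. K <.> y)" for y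
   define \<zeta> where "\<zeta> y = r y *R et y" for y
   have zA: "\<zeta> : tangent_fields U A"
    unfolding \<zeta>_def
   proof (rule tangent_fields_mult_ext[OF U et(1)])
    show "rpoly r" unfolding r_def by (rule rpoly_prod_inner)
    show "r y = 0" if "K : A" "K ~: {K : A. K <.> x = 0}" "K <.> y = 0" for K y
     unfolding r_def using that finA by (intro prod_zero) auto
   qed
   have zb: "a <.> \<zeta> y = b y * ?q y" if y: "a <.> y = 0" for y
   proof -
    have "{K:A. K <.> x ~= 0} Un {K:A - C. K <.> x = 0} = (A - C) Un {K:C. K <.> x ~= 0}"
     using C unfolding transversal_def by auto
    moreover have "finite C" using C finA unfolding transversal_def by (auto intro: finite_subset)
    ultimately have "r y * (PROD K:{K:A - C. K <.> x = 0}. K <.> y) = b y * ?q y"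
     unfolding r_def using finA
     by (subst (1 2) prod.union_disjoint[symmetric]) auto
    then show ?thesis using et(2)[OF y] by (simp add: \<zeta>_def)
   qed
   obtain f where f: "!!i. i : I ==> rpoly (f i)" "!!x. \<zeta> x = (SUM i:I. f i x *R th i x)"
    using free_basisD(4)[OF basis zA] by blast
   have "?q y = (SUM i:?I. f i y * j i y)" if y: "y : ?Z" for y
   proof -
    have "?q y = (SUM i:I. f i y * j i y)"
     by (rule combination_on_H[where j=j and f=f and et=\<zeta> and q="?q", OF j(2,1) f rpoly_prod_inner zb, symmetric]) (use y in auto)
    also have "... = (SUM i:?I. f i y * j i y)"
     by (rule sum.mono_neutral_right) (use fI jz y in auto)
    finally show ?thesis .
   qed
   then show ?thesis by (intro exI[of _ f]) (use f in auto)
  qed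
  have finC: "finite C" using C finA unfolding transversal_def by (auto intro: finite_subset)
  have "dim ?Z <= card ?I"
  proof (rule too_few_forms[where g=j and a="%i. e i - d" and \<L>="(%x. {K:C. K <.> x ~= 0}) ` (?Z - {0})"])
   show "subspace ?Z" by (rule subspace_kernel_on[OF W])
   show "finite ?I" using fI by simp
   show "finite ((%x. {K:C. K <.> x ~= 0}) ` (?Z - {0}))"
    by (rule finite_subset[of _ "Pow C"]) (use finC in auto)
   show "finite L" if "L : (%x. {K:C. K <.> x ~= 0}) ` (?Z - {0})" for L using that finC by auto
   show "EX h. (ALL j:?I. rpoly (h j)) & (ALL x:?Z. (PROD l:L. l <.> x) = (SUM i:?I. h i x * j i x))"
    if "L : (%x. {K:C. K <.> x ~= 0}) ` (?Z - {0})" for L using that q by blast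
  qed (use j in auto)
  then show False using few by simp
 qed
 then obtain i where i: "i : I" "e i = d" "j i 0 ~= 0" by blast
 show ?thesis
 proof (rule bexI)
  show "(%x. (1 / j i 0) *R th i x) : tangent_fields U A"
   by (intro tangent_fields_mult[OF U] free_basisD(2)[OF basis] i rpoly_const)
  show "ALL y. a <.> y = 0 --> a <.> (1 / j i 0) *R th i y = b y"
  proof (intro allI impI)
   fix y assume y: "a <.> y = 0"
   have "j i 0 = j i y" using j(4)[OF i(1) y, of 0] i by simp
   then show "a <.> (1 / j i 0) *R th i y = b y" using j(2)[OF i(1) y] i by simp
  qed
 qed
qed

end

section \<open>Finite root systems\<close>

text \<open>In a relation the terms with positive coefficients sum to the same vector
  \<open>x\<close> as the negated others. Obtuseness gives \<open>x <.> x <= 0\<close>, and pairing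
  with \<open>c\<close> then kills every coefficient.\<close>

lemma obtuse_independent:
 fixes T :: "'v::euclidean_space set"
 assumes T: "finite T" and obt: "!!s t. s : T ==> t : T ==> s ~= t ==> s <.> t <= 0"
  and c: "!!t. t : T ==> c <.> t > 0"
 shows "independent T"
proof
 assume "dependent T"
 then obtain u where u: "EX v:T. u v ~= 0" "(SUM v:T. u v *R v) = 0" using dependent_finite[OF T] by blast
 define x where "x = (SUM v:{v:T. u v > 0}. u v *R v)"
 define y where "y = (SUM v:{v:T. u v < 0}. (- u v) *R v)"
 have "(SUM v:T. u v *R v) = (SUM v:{v:T. u v > 0} Un {v:T. u v < 0}. u v *R v)"
  using T by (intro sum.mono_neutral_right) auto
 also have "... = x - y" using T unfolding x_def y_def
  by (subst sum.union_disjoint) (auto simp: sum_negf)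
 finally have xy: "x = y" using u by simp
 have "x <.> x = x <.> y" using xy by simp
 also have "... <= 0" unfolding x_def y_def inner_sum_left inner_sum_right
 proof (intro sum_nonpos)
  fix v w assume v: "v : {v:T. u v > 0}" and w: "w : {v:T. u v < 0}"
  then have "v <.> w <= 0" by (intro obt) auto
  then show "u v *R v <.> (- u w) *R w <= 0" using v w
   by (auto simp: mult_nonneg_nonpos mult_nonpos_nonpos)
 qed
 finally have x0: "x = 0" by (metis inner_ge_zero inner_eq_zero_iff order_antisym)
 have "c <.> x = (SUM v:{v:T. u v > 0}. u v * (c <.> v))" by (simp add: x_def inner_sum_right)
 then have "ALL v:{v:T. u v > 0}. u v * (c <.> v) = 0"
  using x0 T c by (subst sum_nonneg_eq_0_iff[symmetric]) (auto intro!: mult_nonneg_nonneg less_imp_le)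
 then have 1: "~ u v > 0" if "v : T" for v using c that by fastforce
 have "c <.> y = (SUM v:{v:T. u v < 0}. (- u v) * (c <.> v))" unfolding y_def inner_sum_right by simp
 then have "ALL v:{v:T. u v < 0}. (- u v) * (c <.> v) = 0"
  using x0 xy T c by (subst sum_nonneg_eq_0_iff[symmetric]) (auto intro!: mult_nonpos_nonneg less_imp_le simp: mult_le_0_iff)
 then have "~ u v < 0" if "v : T" for v using c that by fastforce
 then show False using 1 u(1) by force
qed

section \<open>Reflections, convex cones and order ideals\<close>

lemma refl_root_inner: "refl_root a x <.> y = x <.> y - 2 * (x <.> a) / (a <.> a) * (a <.> y)"
 by (simp add: refl_root_def inner_diff_left)

lemma refl_root_isometry: "refl_root a x <.> refl_root a y = x <.> y"
proof (cases "a = 0")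
 case False
 then show ?thesis by (simp add: refl_root_def inner_diff_left inner_diff_right inner_commute field_simps)
qed (simp add: refl_root_def)

lemma refl_root_refl_root [simp]: "refl_root a (refl_root a x) = x"
proof (cases "a = 0")
 case False
 then have "a <.> a ~= 0" by simp
 then show ?thesis by (simp add: refl_root_def inner_diff_left diff_divide_distrib algebra_simps flip: scaleR_left.add)
qed (simp add: refl_root_def)

lemma refl_root_adjoint: "refl_root a x <.> y = x <.> refl_root a y"
 by (metis refl_root_isometry refl_root_refl_root)

lemma refl_root_self: "a ~= 0 ==> refl_root a a = - a"
 by (simp add: refl_root_def algebra_simps scaleR_2)

lemma linear_refl_root: "linear (refl_root a)"
 by (rule linearI) (simp_all add: refl_root_def inner_add_left add_divide_distrib algebra_simps)

inductive_set conic_span :: "'v::real_vector set => 'v set" for X where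
 conic_0: "0 : conic_span X"
| conic_step: "x : X ==> t >= 0 ==> y : conic_span X ==> t *R x + y : conic_span X"

lemma conic_base: "x : X ==> x : conic_span X"
 using conic_step[of x X 1 0, OF _ _ conic_0] by simp

lemma conic_add: "x : conic_span X ==> y : conic_span X ==> x + y : conic_span X"
 by (induction x rule: conic_span.induct) (auto simp: add.assoc intro: conic_step)

lemma conic_scale: "x : conic_span X ==> t >= 0 ==> t *R x : conic_span X"
proof (induction x rule: conic_span.induct)
 case (conic_step x s y)
 then show ?case using conic_span.conic_step[of x X "t * s" "t *R y"] by (simp add: scaleR_add_right)
qed (simp add: conic_0)

lemma conic_sum: "(!!i. i : I ==> f i : conic_span X) ==> (SUM i:I. f i) : conic_span X"
 by (induction I rule: infinite_finite_induct) (auto intro: conic_0 conic_add)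

lemma conic_mono:
 assumes "linear f" "!!x. x : X ==> f x : conic_span Y" "x : conic_span X"
 shows "f x : conic_span Y"
 using assms(3)
proof (induction x rule: conic_span.induct)
 case conic_0
 then show ?case using assms(1) by (simp add: linear_0 conic_span.conic_0)
next
 case (conic_step x t y)
 then show ?case using assms(1,2) by (simp add: linear_add linear_scale conic_add conic_scale)
qed

lemma conic_nonneg: "x : conic_span X ==> (!!y. y : X ==> f y >= 0) ==> linear f ==> f x >= (0::real)"
 by (induction x rule: conic_span.induct) (auto simp: linear_0 linear_add linear_scale)

lemma conic_span: "x : conic_span X ==> x : span X"
 by (induction x rule: conic_span.induct) (auto intro: span_zero span_add span_scale span_base)

text \<open>The order is given by the cone over \<open>P\<close> itself, without reference to simple
  roots, so the same notion serves finite and affine positive roots.\<close>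

definition order_ideal_in :: "'v::real_vector set => 'v set => bool" where
 "order_ideal_in P J \<longleftrightarrow> J \<subseteq> P & (ALL be:J. ALL ga:P. be - ga : conic_span P --> ga : J)"

text \<open>The roots need not span and need not be irreducible, and \<open>c\<close> is any regular
  vector: subsystems and the systems seen from a point are again instances.\<close>

locale root_sys =
 fixes Ph :: "(real^'n) set" and c :: "real^'n"
 assumes fin: "finite Ph" and nz: "0 ~: Ph"
  and refl: "a : Ph ==> b : Ph ==> refl_root a b : Ph"
  and int: "a : Ph ==> b : Ph ==> 2 * (b <.> a) / (a <.> a) : \<int>"
  and red: "a : Ph ==> t *R a : Ph ==> t = 1 \<or> t = -1"
  and reg: "a : Ph ==> c <.> a ~= 0"
begin

definition pos :: "(real^'n) set" where "pos = {al:Ph. c <.> al > 0}"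

text \<open>The simple roots, obtained as the indecomposable positive roots.\<close>

definition base :: "(real^'n) set" where "base = {al:pos. ~ (EX be:pos. EX ga:pos. al = be + ga)}"

text \<open>The pairing with the half sum of positive coroots. It is linear and equals 1 on simple
  roots (\<open>ht_base\<close>), hence is the usual height; in this form it arises directly from
  counting intersections.\<close>

definition ht :: "real^'n => real" where "ht x = (SUM be:pos. (x <.> be) / (be <.> be))"

definition level :: "nat => (real^'n) set" where "level t = {be:pos. ht be = real t}"

lemma sub_root_sys:
 assumes "Ps \<subseteq> Ph" "!!a b. a : Ps ==> b : Ps ==> refl_root a b : Ps" "!!a. a : Ps ==> c' <.> a ~= 0"
 shows "root_sys Ps c'"
proof
 show "finite Ps" using assms(1) fin by (rule finite_subset)
 show "t = 1 \<or> t = - 1" if "a : Ps" "t *R a : Ps" for a t using red that assms(1) by blast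
 show "2 * (b <.> a) / (a <.> a) : \<int>" if "a : Ps" "b : Ps" for a b using int[of a b] that assms(1) by blast
qed (use nz assms in auto)

lemma root_nz: "a : Ph ==> a ~= 0" "a : Ph ==> a <.> a > 0" using nz by auto

lemma neg: "a : Ph ==> - a : Ph" using refl[of a a] root_nz by (simp add: refl_root_self)

lemma neg_iff [simp]: "- a : Ph \<longleftrightarrow> a : Ph" using neg[of a] neg[of "- a"] by auto

lemma pos_root: "a : pos ==> a : Ph" by (simp add: pos_def)

lemma finite_pos: "finite pos" using fin by (simp add: pos_def)

lemma pos_or_neg: "a : Ph ==> a : pos \<or> - a : pos"
 using reg[of a] by (auto simp: pos_def)

lemma not_pos_neg: "a : pos ==> - a ~: pos" by (simp add: pos_def)

lemma proportional_eq:
 assumes "a : pos" "b : pos" "a = t *R b"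
 shows "a = b"
 using assms red[of b t] not_pos_neg[of b] by (auto simp: pos_def)

text \<open>Both Cartan integers are positive. If one is 1, a reflection produces the difference up
  to sign; if both were at least 2, then \<open>(a - b) <.> (a - b) <= 0\<close>.\<close>

lemma root_diff:
 assumes a: "a : Ph" and b: "b : Ph" and ab: "a <.> b > 0" "a ~= b"
 shows "a - b : Ph"
proof -
 have aa: "a <.> a > 0" and bb: "b <.> b > 0" using a b root_nz by auto
 obtain m n :: int where m: "2 * (a <.> b) / (b <.> b) = m" and n: "2 * (a <.> b) / (a <.> a) = n"
  using int[OF b a] int[OF a b] by (metis Ints_cases inner_commute)
 have "real_of_int m > 0" "real_of_int n > 0" unfolding m[symmetric] n[symmetric] using aa bb ab by simp_all
 then have mn: "m >= 1" "n >= 1" by auto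
 show ?thesis
 proof (cases "m = 1 \<or> n = 1")
  case True
  then show ?thesis
  proof
   assume "m = 1"
   then have "refl_root b a = a - b" unfolding refl_root_def m by simp
   then show ?thesis using refl[OF b a] by simp
  next
   assume "n = 1"
   then have "refl_root a b = b - a" unfolding refl_root_def inner_commute[of b a] n by simp
   then have "- (a - b) : Ph" using refl[OF a b] by simp
   then show ?thesis by (simp only: neg_iff)
  qed
 next
  case False
  then have "real_of_int m >= 2" "real_of_int n >= 2" using mn by auto
  then have "a <.> b >= b <.> b" "a <.> b >= a <.> a"
   unfolding m[symmetric] n[symmetric] using aa bb by (simp_all add: field_simps)
  then have "(a - b) <.> (a - b) <= 0" by (simp add: inner_diff_left inner_diff_right inner_commute)
  then have "a = b" by (metis inner_ge_zero inner_eq_zero_iff order_antisym right_minus_eq)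
  then show ?thesis using ab by simp
 qed
qed

lemma base_pos: "s : base ==> s : pos" by (simp add: base_def)

lemma finite_base: "finite base" using finite_pos by (simp add: base_def)

lemma base_obtuse:
 assumes "s : base" "t : base" "s ~= t"
 shows "s <.> t <= 0"
proof (rule ccontr)
 assume "~ s <.> t <= 0"
 then have d: "s - t : Ph" using root_diff assms base_pos pos_root by simp
 show False
 proof (cases "s - t : pos")
  case True
  then have "s = (s - t) + t" "s - t : pos" "t : pos" using assms base_pos by auto
  then show False using assms(1) unfolding base_def by blast
 next
  case False
  then have "t - s : pos" using pos_or_neg[OF d] by simp
  moreover have "t = (t - s) + s" "s : pos" using assms base_pos by auto
  ultimately show False using assms(2) unfolding base_def by blast
 qed
qed

lemma base_independent: "independent base"
 by (rule obtuse_independent[OF finite_base base_obtuse, of c]) (auto simp: base_def pos_def)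

lemma base_coeffs_unique:
 assumes "(SUM s:base. u s *R s) = (SUM s:base. w s *R s)" "s : base"
 shows "u s = w s"
proof -
 have "(SUM s:base. (u s - w s) *R s) = 0" using assms(1) by (simp add: scaleR_diff_left sum_subtractf)
 then have "u s - w s = 0"
  using independentD[OF base_independent finite_base subset_refl, of "%s. u s - w s" s] assms(2) by simp
 then show ?thesis by simp
qed

lemma pos_combination:
 assumes "p : pos"
 shows "EX n::(real^'n) => nat. p = (SUM s:base. real (n s) *R s)"
 using assms
proof (induction "card {q:pos. c <.> q < c <.> p}" arbitrary: p rule: less_induct)
 case less
 show ?case
 proof (cases "p : base")
  case True
  have "p = (SUM s:base. real (if s = p then 1 else 0) *R s)"
   using True finite_base by (simp add: if_distrib[of real] if_distrib[of "%u. u *R _"] sum.delta cong: if_cong)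
  then show ?thesis by (rule exI[of _ "%s. if s = p then 1 else 0"])
 next
  case False
  then obtain q r where qr: "q : pos" "r : pos" "p = q + r" using less.prems unfolding base_def by blast
  have lt: "c <.> q < c <.> p" "c <.> r < c <.> p" using qr by (auto simp: pos_def inner_add_right)
  have cq: "card {q':pos. c <.> q' < c <.> q} < card {q:pos. c <.> q < c <.> p}"
   by (rule psubset_card_mono) (use finite_pos lt qr in auto)
  have cr: "card {q':pos. c <.> q' < c <.> r} < card {q:pos. c <.> q < c <.> p}"
   by (rule psubset_card_mono) (use finite_pos lt qr in auto)
  obtain n :: "(real^'n) => nat" where "q = (SUM s:base. real (n s) *R s)"
   using less.hyps[OF cq qr(1)] by blast
  moreover obtain m :: "(real^'n) => nat" where "r = (SUM s:base. real (m s) *R s)"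
   using less.hyps[OF cr qr(2)] by blast
  ultimately have "p = (SUM s:base. real (n s + m s) *R s)" using qr by (simp add: scaleR_add_left sum.distrib)
  then show ?thesis by (rule exI[of _ "%s. n s + m s"])
 qed
qed

lemma pos_in_span_base:
 assumes "p : pos"
 shows "p : span base"
proof -
 obtain n where n: "p = (SUM s:base. real (n s) *R s)" using pos_combination[OF assms] by blast
 show ?thesis unfolding n by (intro span_sum span_scale span_base)
qed

lemma root_in_span_base: "p : Ph ==> p : span base"
 using pos_or_neg[of p] pos_in_span_base[of p] pos_in_span_base[of "- p"] span_neg[of "- p"] by auto

lemma span_base_eq: "span base = span Ph"
proof
 show "span base \<subseteq> span Ph" by (rule span_mono) (auto simp: base_def pos_def)
 show "span Ph \<subseteq> span base" by (rule span_minimal) (use root_in_span_base in auto)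
qed

lemma card_base: "card base = dim Ph"
 by (metis base_independent dim_eq_card_independent dim_span span_base_eq)

text \<open>The reflection changes only the coefficient of \<open>s\<close>, and \<open>b\<close>
  has a positive coefficient at another simple root, so its image cannot be negative.\<close>

lemma base_refl_pos:
 assumes s: "s : base" and b: "b : pos" "b ~= s"
 shows "refl_root s b : pos"
proof (rule ccontr)
 assume n: "refl_root s b ~: pos"
 have sPh: "s : Ph" using s base_pos pos_root by blast
 obtain n where n': "b = (SUM s:base. real (n s) *R s)" using pos_combination[OF b(1)] by blast
 have "EX t:base. t ~= s & n t > 0"
 proof (rule ccontr)
  assume "~ ?thesis"
  then have "b = (SUM t:base. if t = s then real (n s) *R s else 0)"
   unfolding n' by (intro sum.cong) auto
  then have "b = real (n s) *R s" using s finite_base by (simp add: sum.delta)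
  then show False using proportional_eq[OF b(1) base_pos[OF s]] b(2) by blast
 qed
 then obtain t where t: "t : base" "t ~= s" "n t > 0" by blast
 let ?k = "2 * (b <.> s) / (s <.> s)"
 have "refl_root s b : Ph" using refl[OF sPh] b(1) pos_root by blast
 then have "- refl_root s b : pos" using n pos_or_neg by blast
 then obtain m where m: "- refl_root s b = (SUM s:base. real (m s) *R s)" using pos_combination by blast
 have "(SUM u:base. (if u = s then ?k else 0) *R u) = ?k *R s"
  using s finite_base by (simp add: if_distrib[of "%u. u *R _"] sum.delta cong: if_cong)
 then have "(SUM u:base. (if u = s then ?k else 0) *R u) = b - refl_root s b" by (simp add: refl_root_def)
 also have "... = b + (- refl_root s b)" by simp
 also have "... = (SUM u:base. (real (n u) + real (m u)) *R u)"
  unfolding m by (subst (1) n') (simp add: scaleR_add_left sum.distrib)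
 finally have "(if t = s then ?k else 0) = real (n t) + real (m t)"
  using base_coeffs_unique[of "%u. if u = s then ?k else 0" "%u. real (n u) + real (m u)" t] t(1) by simp
 then show False using t by simp
qed

lemma linear_ht: "linear ht"
 by (rule linearI) (simp_all add: ht_def inner_add_left add_divide_distrib sum.distrib sum_distrib_left)

text \<open>The reflection in \<open>s\<close> permutes the other positive roots and negates their
  weights, so only the term of \<open>s\<close> itself survives.\<close>

lemma ht_base:
 assumes s: "s : base"
 shows "ht s = 1"
proof -
 let ?w = "%b. (s <.> b) / (b <.> b)"
 have sPh: "s : Ph" "s ~= 0" using s base_pos pos_root root_nz by blast+
 have "(SUM b:pos - {s}. ?w b) = (SUM b:pos - {s}. - ?w b)"
 proof (rule sum.reindex_bij_witness[of _ "refl_root s" "refl_root s"])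
  fix b assume b: "b : pos - {s}"
  show "refl_root s (refl_root s b) = b" by simp
  show "refl_root s b : pos - {s}"
  proof -
   have "refl_root s b ~= s"
   proof
    assume "refl_root s b = s"
    then have "b = - s" by (metis refl_root_refl_root refl_root_self sPh(2))
    then show False using b not_pos_neg[OF base_pos[OF s]] by auto
   qed
   then show ?thesis using base_refl_pos[OF s] b by auto
  qed
  then show "refl_root s (refl_root s b) = b" "refl_root s b : pos - {s}" by auto
  have "s <.> refl_root s b = - (s <.> b)" using refl_root_adjoint[of s s b] refl_root_self[OF sPh(2)] by simp
  then show "- ?w (refl_root s b) = ?w b" by (simp add: refl_root_isometry)
 qed
 then have "(SUM b:pos - {s}. ?w b) = 0" by (simp add: sum_negf)
 moreover have "ht s = ?w s + (SUM b:pos - {s}. ?w b)"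
  unfolding ht_def by (rule sum.remove[OF finite_pos base_pos[OF s]])
 ultimately show ?thesis using sPh by simp
qed

lemma ht_pos:
 assumes "p : pos"
 shows "EX t>=1. ht p = real t"
proof -
 obtain n where n: "p = (SUM s:base. real (n s) *R s)" using pos_combination[OF assms] by blast
 have "ht p = (SUM s:base. real (n s) * ht s)"
  by (subst n) (simp add: linear_sum[OF linear_ht] linear_scale[OF linear_ht])
 also have "... = real (SUM s:base. n s)" by (simp add: ht_base)
 finally have h: "ht p = real (SUM s:base. n s)" .
 have "(SUM s:base. n s) ~= 0"
 proof
  assume "(SUM s:base. n s) = 0"
  then have "p = 0" using n finite_base by simp
  then show False using assms pos_root root_nz by blast
 qed
 then show ?thesis using h by (intro exI[of _ "SUM s:base. n s"]) auto
qed

lemma ht_pos_ge1: "p : pos ==> ht p >= 1" using ht_pos[of p] by auto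

lemma ht_neg: "ht (- x) = - ht x" using linear_neg[OF linear_ht] by simp

lemma ht_root: "a : Ph ==> \<bar>ht a\<bar> >= 1"
 using pos_or_neg[of a] ht_pos_ge1[of a] ht_pos_ge1[of "- a"] by (auto simp: ht_neg)

lemma ht_conic: "x : conic_span pos ==> ht x >= 0"
 by (rule conic_nonneg[where f=ht, OF _ _ linear_ht]) (use ht_pos_ge1 in force)+

text \<open>Since \<open>p <.> p > 0\<close>, some simple root has positive inner product with
  \<open>p\<close>; subtracting it gives a root, which stays positive because \<open>s\<close> is
  indecomposable.\<close>

lemma nonbase_diff:
 assumes p: "p : pos" "p ~: base"
 shows "EX s:base. p - s : pos"
proof -
 obtain n where n: "p = (SUM s:base. real (n s) *R s)" using pos_combination[OF p(1)] by blast
 have "0 < p <.> p" using p pos_root root_nz by blast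
 also have "p <.> p = (SUM s:base. real (n s) * (p <.> s))" by (subst (2) n) (simp add: inner_sum_right)
 finally have "EX s:base. real (n s) * (p <.> s) > 0" by (metis (no_types, lifting) not_less sum_nonpos)
 then obtain s where s: "s : base" "p <.> s > 0" by (metis mult_nonneg_nonpos not_less of_nat_0_le_iff)
 have sp: "s : pos" using s base_pos by blast
 have d: "p - s : Ph" using root_diff[of p s] s p sp pos_root by blast
 have "p - s : pos"
 proof (rule ccontr)
  assume "p - s ~: pos"
  then have "s - p : pos" using pos_or_neg[OF d] by simp
  then have "s = p + (s - p)" "s - p : pos" by auto
  then show False using s(1) p(1) unfolding base_def by blast
 qed
 then show ?thesis using s by blast
qed

lemma base_iff_level: "base = level 1"
proof (intro equalityI subsetI)
 fix p assume "p : level 1"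
 then have p: "p : pos" "ht p = 1" by (auto simp: level_def)
 show "p : base"
 proof (rule ccontr)
  assume "p ~: base"
  then obtain s where s: "s : base" "p - s : pos" using nonbase_diff p by blast
  have "ht p = ht (p - s) + ht s" using linear_diff[OF linear_ht] by simp
  then show False using ht_pos_ge1[OF s(2)] ht_base[OF s(1)] p by simp
 qed
qed (auto simp: level_def ht_base base_pos)

text \<open>Two roots of equal height at an acute angle would differ by a root of height zero. Hence
  each level is independent and has at most rank many elements.\<close>

lemma level_obtuse:
 assumes "a : level t" "b : level t" "a ~= b"
 shows "a <.> b <= 0"
proof (rule ccontr)
 assume "~ a <.> b <= 0"
 then have "a - b : Ph" using root_diff assms pos_root by (auto simp: level_def)
 moreover have "ht (a - b) = 0" using assms linear_diff[OF linear_ht] by (simp add: level_def)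
 ultimately show False using ht_root by fastforce
qed

lemma level_independent: "independent (level t)"
 by (rule obtuse_independent[OF _ level_obtuse, of _ _ c]) (auto simp: level_def pos_def fin)

lemma finite_level: "finite (level t)" using finite_pos by (simp add: level_def)

lemma card_level_le: "card (level t) <= dim Ph"
proof -
 have "card (level t) = dim (level t)" using dim_eq_card_independent[OF level_independent] by simp
 also have "... <= dim Ph" by (rule dim_subset) (auto simp: level_def pos_def)
 finally show ?thesis .
qed

lemma pos_cases_level: "p : pos ==> EX t>=1. p : level t"
 using ht_pos[of p] by (auto simp: level_def)

text \<open>Four times the squared cosine is a product of two Cartan integers, here a positive
  integer.\<close>

lemma base_cos_le:
 assumes s: "s : base" "t : base" "s ~= t" "s <.> t ~= 0"
 shows "(s <.> t) / (norm s * norm t) <= - 1/2"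
proof -
 have st: "s : Ph" "t : Ph" using s base_pos pos_root by auto
 have ss: "s <.> s > 0" "t <.> t > 0" using st root_nz by auto
 obtain m n :: int where m: "2 * (s <.> t) / (t <.> t) = m" and n: "2 * (s <.> t) / (s <.> s) = n"
  using int[OF st(2) st(1)] int[OF st(1) st(2)] by (metis Ints_cases inner_commute)
 define x where "x = (s <.> t) / (norm s * norm t)"
 have neg: "s <.> t < 0" using base_obtuse[OF s(1-3)] s(4) by simp
 have x2: "4 * x\<^sup>2 = real_of_int (m * n)"
  unfolding of_int_mult m[symmetric] n[symmetric] x_def
  by (simp add: power2_eq_square dot_square_norm field_simps)
 have x0: "x < 0" unfolding x_def using neg st root_nz by (simp add: divide_neg_pos)
 then have "4 * x\<^sup>2 > 0" by simp
 then have "real_of_int (m * n) > 0" unfolding x2 .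
 then have "m * n >= 1" by (simp only: of_int_0_less_iff)
 then have "real_of_int (m * n) >= 1" by (simp only: of_int_1_le_iff)
 then have "(1/2)\<^sup>2 <= (- x)\<^sup>2" using x2 by (simp add: power_divide)
 then have "1/2 <= - x" using x0 by (intro power2_le_imp_le[of "1/2" "- x"]) auto
 then show ?thesis unfolding x_def by linarith
qed

text \<open>The Dynkin graph is a forest: the sum of the unit vectors of \<open>T\<close> is
  nonzero, and its squared length is at most the number of vertices minus the number of
  edges.\<close>

lemma base_cos_sum:
 assumes T: "T \<subseteq> base" "T ~= {}"
 shows "(SUM s:T. real (card {t:T - {s}. s <.> t ~= 0})) < 2 * real (card T)"
proof -
 have finT: "finite T" using T finite_base finite_subset by blast
 let ?k = "%s t. (s <.> t) / (norm s * norm t)"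
 define u where "u = (SUM s:T. (1 / norm s) *R s)"
 have nzT: "norm s > 0" if "s : T" for s using that T base_pos pos_root root_nz by auto
 have "u ~= 0"
 proof
  assume "u = 0"
  moreover have "independent T" using base_independent T independent_mono by blast
  ultimately have "1 / norm s = 0" if "s : T" for s
   using independentD[OF _ finT subset_refl, of "%s. 1 / norm s" s] that by (simp add: u_def)
  then show False using T nzT by fastforce
 qed
 then have "0 < u <.> u" by simp
 also have "u <.> u = (SUM s:T. SUM t:T. ?k s t)" unfolding u_def inner_sum_left inner_sum_right
  by (simp add: inner_commute mult.commute)
 also have "... <= (SUM s:T. 1 - real (card {t:T - {s}. s <.> t ~= 0}) / 2)"
 proof (rule sum_mono)
  fix s assume s: "s : T"
  have "(SUM t:T. ?k s t) = ?k s s + (SUM t:T - {s}. ?k s t)" by (rule sum.remove[OF finT s])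
  also have "?k s s = 1" using nzT[OF s] by (simp add: dot_square_norm power2_eq_square)
  also have "(SUM t:T - {s}. ?k s t) = (SUM t:{t:T - {s}. s <.> t ~= 0}. ?k s t)"
   by (rule sum.mono_neutral_right) (use finT in auto)
  also have "... <= (SUM t:{t:T - {s}. s <.> t ~= 0}. - 1/2)"
   by (rule sum_mono) (rule base_cos_le, use s T in auto)
  finally show "(SUM t:T. ?k s t) <= 1 - real (card {t:T - {s}. s <.> t ~= 0}) / 2" by simp
 qed
 also have "... = real (card T) - (SUM s:T. real (card {t:T - {s}. s <.> t ~= 0})) / 2"
  by (simp add: sum_subtractf sum_divide_distrib)
 finally show ?thesis by simp
qed

lemma base_leaf:
 assumes T: "T \<subseteq> base" "T ~= {}"
 shows "EX s:T. card {t:T - {s}. s <.> t ~= 0} <= 1"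
proof (rule ccontr)
 assume "~ ?thesis"
 then have "(SUM s:T. 2) <= (SUM s:T. real (card {t:T - {s}. s <.> t ~= 0}))" by (intro sum_mono) force
 then show False using base_cos_sum[OF T] by simp
qed

text \<open>A root of height 2 is a sum of two adjacent simple roots, and a forest has fewer edges
  than vertices.\<close>

lemma card_level2_less:
 assumes "Ph ~= {}"
 shows "card (level 2) < dim Ph"
proof -
 have bne: "base ~= {}"
 proof
  assume "base = {}"
  then have "Ph \<subseteq> {0}" using root_in_span_base by auto
  then show False using assms nz by blast
 qed
 \<comment> \<open>Ordered edges, so every root of height 2 accounts for two elements.\<close>
 define E where "E = Sigma base (%s. {t:base - {s}. s <.> t ~= 0})"
 have "real (card E) = (SUM s:base. real (card {t:base - {s}. s <.> t ~= 0}))"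
  unfolding E_def by (subst card_SigmaI) (use finite_base in auto)
 then have cE: "card E < 2 * card base" using base_cos_sum[OF subset_refl bne] by linarith
 have finE: "finite E" unfolding E_def using finite_base by auto
 have "ALL p:level 2. EX q. fst q + snd q = p & q : E"
 proof
  fix p assume p: "p : level 2"
  then have pp: "p : pos" "ht p = 2" by (auto simp: level_def)
  then have "p ~: base" using ht_base by fastforce
  then obtain s where s: "s : base" "p - s : pos" using nonbase_diff pp by blast
  define t where "t = p - s"
  have "ht t = 1" using linear_diff[OF linear_ht, of p s] ht_base[OF s(1)] pp by (simp add: t_def)
  then have t: "t : base" using s by (simp add: base_iff_level level_def t_def)
  have pst: "p = s + t" by (simp add: t_def)
  have "s ~= t"
  proof
   assume "s = t"
   then have "2 *R s : Ph" using pst pp pos_root by (simp add: scaleR_2)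
   then show False using red[of s 2] s base_pos pos_root by auto
  qed
  moreover have "s <.> t ~= 0"
  proof
   assume "s <.> t = 0"
   then have "refl_root t p = s - t" using root_nz(1)[OF pos_root[OF base_pos[OF t]]]
    by (simp add: refl_root_def pst inner_add_left algebra_simps scaleR_2)
   then have "s - t : Ph" using refl[of t p] pp t base_pos pos_root by metis
   moreover have "ht (s - t) = 0" using s t ht_base linear_diff[OF linear_ht] by simp
   ultimately show False using ht_root by fastforce
  qed
  ultimately show "EX q. fst q + snd q = p & q : E"
   using s t pst by (intro exI[of _ "(s, t)"]) (auto simp: E_def)
 qed
 then obtain f where f: "!!p. p : level 2 ==> fst (f p) + snd (f p) = p & f p : E" by metis
 let ?f' = "%p. prod.swap (f p)"
 have injf: "inj_on f (level 2)" by (rule inj_onI) (metis f)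
 have "inj_on ?f' (level 2)" by (rule inj_onI) (metis f swap_swap)
 with injf have "card (f ` level 2 Un ?f' ` level 2) = card (level 2) + card (level 2)"
 proof (subst card_Un_disjoint)
  show "f ` level 2 Int ?f' ` level 2 = {}"
  proof (rule ccontr)
   assume "f ` level 2 Int ?f' ` level 2 ~= {}"
   then obtain p q where pq: "p : level 2" "q : level 2" "f p = prod.swap (f q)" by blast
   then have "p = q" using f[OF pq(1)] f[OF pq(2)] by (metis add.commute fst_swap snd_swap)
   then have "fst (f p) = snd (f p)" using pq(3) by (metis fst_swap)
   then show False using f[OF pq(1)] by (auto simp: E_def)
  qed
 qed (use finite_level in \<open>auto simp: card_image\<close>)
 moreover have "prod.swap q : E" if "q : E" for q using that by (cases q) (auto simp: E_def inner_commute)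
 then have "?f' ` level 2 \<subseteq> E" using f by (intro image_subsetI) blast
 moreover have "f ` level 2 \<subseteq> E" using f by auto
 ultimately have "2 * card (level 2) <= card E"
  using card_mono[OF finE, of "f ` level 2 Un ?f' ` level 2"] by auto
 then show ?thesis using cE card_base by simp
qed

text \<open>If rank many roots had height \<open>t >= 3\<close>, they would be the simple roots of
  the subsystem inside their lattice, whose height function is then \<open>ht / t\<close>. Twice
  that height is integral on every root, but it equals \<open>2 / t\<close> on a simple
  root.\<close>

lemma card_level_less:
 assumes ne: "Ph ~= {}" and t: "t >= 2"
 shows "card (level t) < dim Ph"
proof (cases "t = 2")
 case True
 then show ?thesis using card_level2_less[OF ne] by simp
next
 case False
 then have t3: "t >= 3" using t by simp
 show ?thesis
 proof (rule ccontr)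
  assume "~ ?thesis"
  then have cT: "card (level t) = dim Ph" using card_level_le[of t] by simp
  let ?T = "level t"
  have Tpos: "?T \<subseteq> pos" by (auto simp: level_def)
  have spT: "span ?T = span Ph"
  proof -
   have "span ?T \<subseteq> span Ph" by (rule span_mono) (auto simp: level_def pos_def)
   moreover have "dim (span Ph) <= dim (span ?T)" using cT dim_eq_card_independent[OF level_independent] by simp
   ultimately show ?thesis using subspace_dim_equal[of "span ?T" "span Ph"] by simp
  qed
  \<comment> \<open>Roots that are integral combinations of the level; each of their heights is a
    multiple of \<open>t\<close>, so the members of the level are indecomposable here.\<close>
  define Ps where "Ps = {be:Ph. EX n. be = (SUM ta:?T. real_of_int (n ta) *R ta)}"
  interpret Q: root_sys Ps c
  proof (rule sub_root_sys)
   show "Ps \<subseteq> Ph" by (auto simp: Ps_def)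
   show "c <.> a ~= 0" if "a : Ps" for a using that reg by (auto simp: Ps_def)
   fix a b assume a: "a : Ps" and b: "b : Ps"
   then have ab: "a : Ph" "b : Ph" by (auto simp: Ps_def)
   obtain n m where nm: "a = (SUM ta:?T. real_of_int (n ta) *R ta)" "b = (SUM ta:?T. real_of_int (m ta) *R ta)"
    using a b unfolding Ps_def by blast
   obtain k :: int where k: "2 * (b <.> a) / (a <.> a) = k" using int[OF ab] by (metis Ints_cases)
   have "refl_root a b = b - real_of_int k *R a" by (simp add: refl_root_def k)
   also have "... = (SUM ta:?T. real_of_int (m ta - k * n ta) *R ta)"
    by (subst nm(1), subst nm(2)) (simp add: scaleR_sum_right scaleR_diff_left sum_subtractf)
   finally have "EX n. refl_root a b = (SUM ta:?T. real_of_int (n ta) *R ta)"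
    by (rule exI[of _ "%ta. m ta - k * n ta"])
   then show "refl_root a b : Ps" using refl[OF ab] by (simp add: Ps_def)
  qed
  have "Ps \<subseteq> Ph" by (auto simp: Ps_def)
  then have Qpos: "Q.pos \<subseteq> pos" unfolding Q.pos_def pos_def by blast
  have ht_ge: "ht be >= real t" if b: "be : Q.pos" for be
  proof -
   have "be : Ps" using b Q.pos_root by blast
   then obtain n where n: "be = (SUM ta:?T. real_of_int (n ta) *R ta)" unfolding Ps_def by blast
   have "ht be = (SUM ta:?T. real_of_int (n ta) * ht ta)"
    by (subst n) (simp add: linear_sum[OF linear_ht] linear_scale[OF linear_ht])
   also have "... = (SUM ta:?T. real_of_int (n ta) * real t)" by (rule sum.cong) (auto simp: level_def)
   finally have h: "ht be = real_of_int (SUM ta:?T. n ta) * real t" by (simp add: sum_distrib_right)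
   have "ht be > 0" using ht_pos_ge1 b Qpos by fastforce
   then have "real_of_int (SUM ta:?T. n ta) > 0" unfolding h using t by (metis mult_nonpos_nonneg not_less of_nat_0_le_iff)
   then have "(SUM ta:?T. n ta) >= 1" by (simp only: of_int_0_less_iff)
   then have "1 * real t <= real_of_int (SUM ta:?T. n ta) * real t" by (intro mult_right_mono) linarith+
   then show ?thesis using h by simp
  qed
  have T_base: "?T \<subseteq> Q.base"
  proof
   fix ta assume ta: "ta : ?T"
   have "ta = (SUM si:?T. real_of_int (if si = ta then 1 else 0) *R si)"
    using ta finite_level by (simp add: if_distrib[of real_of_int] if_distrib[of "%u. u *R _"] sum.delta cong: if_cong)
   then have "EX n. ta = (SUM ta:?T. real_of_int (n ta) *R ta)"
    by (rule exI[of _ "%si. if si = ta then 1 else 0"])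
   moreover have tp: "ta : Ph" "c <.> ta > 0" using ta by (auto simp: level_def pos_def)
   ultimately have "ta : Ps" unfolding Ps_def by blast
   then have Qp: "ta : Q.pos" using tp unfolding Q.pos_def by blast
   moreover have False if "be : Q.pos" "ga : Q.pos" "ta = be + ga" for be ga
    using ht_ge[OF that(1)] ht_ge[OF that(2)] that(3) ta t linear_add[OF linear_ht, of be ga] by (simp add: level_def)
   ultimately show "ta : Q.base" unfolding Q.base_def by blast
  qed
  have Qht: "Q.ht ta = ht ta / real t" if "ta : ?T" for ta
   using Q.ht_base T_base that t by (auto simp: level_def)
  have "linear (%x. ht x / real t)" using linear_ht by (simp add: linear_iff add_divide_distrib)
  then have eq: "Q.ht x = ht x / real t" if "x : span ?T" for x
   using linear_eq_on_span[OF Q.linear_ht _ Qht that] by simp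
  obtain s where s: "s : base" using root_in_span_base ne nz by (metis all_not_in_conv singletonD span_empty)
  then have "s : span ?T" unfolding spT by (intro span_base) (auto simp: base_def pos_def)
  then have h1: "Q.ht s = 1 / real t" using eq ht_base[OF s] by simp
  \<comment> \<open>Each summand is a Cartan integer of the full system, even when \<open>s\<close>
    lies outside the subsystem.\<close>
  have "(SUM be:Q.pos. 2 * (s <.> be) / (be <.> be)) : \<int>"
   by (intro Ints_sum int) (use Qpos pos_root s base_pos in auto)
  moreover have "(SUM be:Q.pos. 2 * (s <.> be) / (be <.> be)) = 2 * Q.ht s"
   unfolding Q.ht_def by (simp add: sum_distrib_left)
  ultimately obtain k :: int where k: "2 / real t = k" using h1 by (metis Ints_cases times_divide_eq_right mult.right_neutral)
  have "real_of_int k > 0" "real_of_int k < 1" unfolding k[symmetric] using t3 by auto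
  then show False by simp
 qed
qed

lemma order_ideal_inD:
 assumes "order_ideal_in pos J"
 shows "J \<subseteq> pos" "be : J ==> ga : pos ==> be - ga : conic_span pos ==> ga : J"
 using assms unfolding order_ideal_in_def by auto

text \<open>In rank two there is a single root of each height above one, so an ideal is determined by its size.\<close>

lemma rank2_ideal_card:
 assumes r2: "dim Ph = 2" and J: "order_ideal_in pos J" and a: "a : pos" "a ~: J" and aJ: "order_ideal_in pos (insert a J)"
 shows "J ~= {} ==> real (card J) = ht a" "J = {} ==> ht a = 1"
proof -
 have ne: "Ph ~= {}" using a pos_root by blast
 have cb: "card (level 1) = 2" using card_base r2 by (simp add: base_iff_level)
 have uniq: "p = q" if "p : level t" "q : level t" "t >= 2" for p q t
 proof -
  have "card (level t) <= 1" using card_level_less[OF ne that(3)] r2 by simp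
  then show ?thesis using that finite_level card_le_Suc0_iff_eq by (metis One_nat_def)
 qed
 \<comment> \<open>In rank two every root of height at least 2 dominates all roots of smaller
   height, so the order is determined by the height there.\<close>
 have below: "ALL q. q : pos --> ht q < ht p --> p - q : conic_span pos" if "p : level t" "t >= 2" for p t
  using that(2,1)
 proof (induction t arbitrary: p rule: dec_induct)
  case base
  then have p: "p : pos" "ht p = 2" by (auto simp: level_def)
  then have "p ~: base" using ht_base by fastforce
  then obtain s where s: "s : base" "p - s : pos" using nonbase_diff p by blast
  define s' where "s' = p - s"
  have hs': "ht s' = 1" using linear_diff[OF linear_ht, of p s] ht_base[OF s(1)] p by (simp add: s'_def)
  then have s': "s' : base" using s by (simp add: base_iff_level level_def s'_def)
  have pss: "p = s + s'" by (simp add: s'_def)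
  have "s ~= s'"
  proof
   assume "s = s'"
   then have "2 *R s : Ph" using pss p pos_root by (simp add: scaleR_2)
   then show False using red[of s 2] s base_pos pos_root by auto
  qed
  then have "base = {s, s'}" using cb s(1) s' finite_base
   by (intro card_seteq[symmetric]) (auto simp: base_iff_level)
  show ?case
  proof (intro allI impI)
   fix q assume q: "q : pos" "ht q < ht p"
   then obtain n where "ht q = real n" "n >= 1" using ht_pos by blast
   then have "ht q = 1" using q p by simp
   then have "q : base" using q by (simp add: base_iff_level level_def)
   then have "p - q = s \<or> p - q = s'" using \<open>base = {s, s'}\<close> pss by auto
   then show "p - q : conic_span pos" using conic_base[of s pos] conic_base[of s' pos] s s' base_pos by auto
  qed
 next
  case (step n)
  then have p: "p : pos" "ht p = Suc n" by (auto simp: level_def)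
  then have "p ~: base" using ht_base[of p] step by auto
  then obtain s where s: "s : base" "p - s : pos" using nonbase_diff p by blast
  have hs: "ht (p - s) = n" using linear_diff[OF linear_ht, of p s] ht_base[OF s(1)] p by simp
  then have lev: "p - s : level n" using s by (simp add: level_def)
  have sc: "s : conic_span pos" using s base_pos conic_base by blast
  show ?case
  proof (intro allI impI)
   fix q assume q: "q : pos" "ht q < ht p"
   then obtain k where k: "ht q = real k" "k >= 1" using ht_pos by blast
   then have "k <= n" using q p by simp
   show "p - q : conic_span pos"
   proof (cases "k = n")
    case True
    then have "q = p - s" using uniq[OF _ lev step(1)] q k by (auto simp: level_def)
    then show ?thesis using sc by simp
   next
    case False
    then have "ht q < ht (p - s)" using \<open>k <= n\<close> k hs by simp
    then have "p - s - q : conic_span pos" using step.IH[OF lev] q by blast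
    then have "p - s - q + s : conic_span pos" using sc by (rule conic_add)
    then show ?thesis by (simp add: algebra_simps)
   qed
  qed
 qed
 have lev_ne: "level k ~= {}" if "p : level t" "1 <= k" "k <= t" for p t k
  using that(3,2,1)
 proof (induction arbitrary: p rule: inc_induct)
  case (step n)
  have "EX q. q : level (Suc n)"
   using step.IH step.prems step.hyps by auto
  then obtain q where q: "q : level (Suc n)" by blast
  then have qp: "q : pos" "ht q = Suc n" by (auto simp: level_def)
  then have "q ~: base" using ht_base[of q] step by auto
  then obtain s where s: "s : base" "q - s : pos" using nonbase_diff qp by blast
  have "ht (q - s) = n" using linear_diff[OF linear_ht, of q s] ht_base[OF s(1)] qp by simp
  then have "q - s : level n" using s by (simp add: level_def)
  then show ?case by blast
 qed auto
 obtain n where n: "a : level n" "n >= 1" using pos_cases_level[OF a(1)] by blast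
 have han: "ht a = real n" using n by (simp add: level_def)
 have Jpos: "J \<subseteq> pos" using order_ideal_inD(1)[OF J] .
 have inJ: "q : J" if "q : pos" "a - q : conic_span pos" "q ~= a" for q
  using order_ideal_inD(2)[OF aJ, of a q] that by auto
 have notabove: "q - a ~: conic_span pos" if "q : J" for q
  using order_ideal_inD(2)[OF J that a(1)] a(2) by blast
 have htJ: "ht q < ht a \<or> (ht q = 1 & ht a = 1)" if q: "q : J" for q
 proof -
  obtain k where k: "q : level k" "k >= 1" using pos_cases_level q Jpos by blast
  then have hk: "ht q = real k" by (simp add: level_def)
  have qa: "q ~= a" using q a by blast
  have "k <= n"
  proof (rule ccontr)
   assume "~ k <= n"
   then have "k >= 2" "ht a < ht q" using n han hk by auto
   then show False using below[OF k(1)] a notabove[OF q] by blast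
  qed
  moreover have "k = 1" if "k = n"
   using uniq[of q n a] k n that qa by fastforce
  ultimately show ?thesis using hk han by fastforce
 qed
 have n2: "J = {q:pos. ht q < ht a} & real (card J) = ht a" if "n >= 2"
 proof -
  have J_eq: "J = {q:pos. ht q < ht a}"
  proof (intro equalityI subsetI)
   fix q assume "q : J"
   then show "q : {q:pos. ht q < ht a}" using htJ[of q] Jpos han that by auto
  next
   fix q assume "q : {q:pos. ht q < ht a}"
   then show "q : J" using below[OF n(1) that] by (intro inJ) auto
  qed
  also have "... = (UN k:{1..<n}. level k)"
  proof (intro equalityI subsetI)
   fix q assume q: "q : {q:pos. ht q < ht a}"
   then obtain k where "q : level k" "k >= 1" using pos_cases_level by blast
   then show "q : (UN k:{1..<n}. level k)" using q han by (auto simp: level_def)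
  qed (auto simp: level_def han)
  finally have "card J = (SUM k:{1..<n}. card (level k))"
  proof (simp only:, intro card_UN_disjoint ballI impI)
   show "level i Int level j = {}" if "i ~= j" for i j using that by (auto simp: level_def)
  qed (simp_all add: finite_level)
  also have "... = card (level 1) + (SUM k:{2..<n}. card (level k))"
   using that sum.atLeast_Suc_lessThan[of 1 n "%k. card (level k)"] by (simp add: numeral_2_eq_2)
  also have "(SUM k:{2..<n}. card (level k)) = (SUM k:{2..<n}. 1)"
  proof (rule sum.cong)
   fix k assume k: "k : {2..<n}"
   have "level k ~= {}" using lev_ne[OF n(1)] k by auto
   then have "card (level k) >= 1" using finite_level by (simp add: Suc_le_eq card_gt_0_iff)
   moreover have "card (level k) <= 1" using card_level_less[OF ne, of k] k r2 by simp
   ultimately show "card (level k) = 1" by simp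
  qed simp
  finally show ?thesis using J_eq cb that han by simp
 qed
 have n1: "card J <= 1" if "n = 1"
 proof -
  have "J \<subseteq> level 1 - {a}"
  proof
   fix q assume q: "q : J"
   then have "ht q = 1" using htJ[of q] han that ht_pos_ge1[of q] Jpos by auto
   then show "q : level 1 - {a}" using q Jpos a by (auto simp: level_def)
  qed
  then have "card J <= card (level 1 - {a})" using finite_level by (intro card_mono) auto
  also have "... = 1" using n cb that finite_level by simp
  finally show ?thesis .
 qed
 show "real (card J) = ht a" if "J ~= {}"
 proof (cases "n >= 2")
  case False
  then have "n = 1" using n by simp
  moreover have "card J >= 1" using that Jpos finite_pos finite_subset by (simp add: Suc_le_eq card_gt_0_iff) blast
  ultimately show ?thesis using n1 han by simp
 qed (use n2 in blast)
 show "ht a = 1" if "J = {}"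
 proof (cases "n >= 2")
  case True
  then show ?thesis using n2 that han by simp
 qed (use n han in simp)
qed

end

section \<open>Affine roots and intersection counts\<close>

lemma two_equations:
 fixes u w :: "'v::euclidean_space"
 assumes "u ~= 0" "w ~: span {u}"
 shows "EX v. u <.> v = s & w <.> v = t"
proof -
 obtain x where x: "u <.> x = 0" "w <.> x ~= 0" using separating_vector[OF assms(2)] by auto
 have "u ~: span {w}"
 proof
  assume "u : span {w}"
  then obtain k where k: "u = k *R w" by (auto simp: span_singleton)
  then have "k ~= 0" using assms by auto
  then have "w = (1 / k) *R u" using k by simp
  then have "w : span {u}" using span_singleton by blast
  then show False using assms by simp
 qed
 then obtain y where y: "w <.> y = 0" "u <.> y ~= 0" using separating_vector[of u "{w}"] by auto
 let ?v = "(t / (w <.> x)) *R x + (s / (u <.> y)) *R y"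
 have "u <.> ?v = s & w <.> ?v = t" using x y by (simp add: inner_add_right)
 then show ?thesis by blast
qed

text \<open>Lets one half of a symmetric set be exchanged for another, for instance the roots with
  positive pairing for the positive roots.\<close>

lemma even_half_sum:
 fixes g :: "'v::real_vector => real"
 assumes X: "finite X" "!!x. x : X ==> - x : X" and g: "!!x. g (- x) = g x"
  and Y: "Y \<subseteq> X" "!!x. x : X ==> g x ~= 0 ==> x : Y \<longleftrightarrow> - x ~: Y"
 shows "(SUM x:X. g x) = 2 * (SUM x:Y. g x)"
proof -
 let ?i = "%x. if x : Y then (1::real) else 0"
 have "(SUM x:X. g x) = (SUM x:X. ?i x * g x + ?i (- x) * g x)"
  by (rule sum.cong) (use Y(2) in force)+
 also have "... = (SUM x:X. ?i x * g x) + (SUM x:X. ?i (- x) * g x)" by (rule sum.distrib)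
 also have "(SUM x:X. ?i (- x) * g x) = (SUM x:X. ?i x * g x)"
  by (rule sum.reindex_bij_witness[of _ uminus uminus]) (use X g in auto)
 also have "(SUM x:X. ?i x * g x) = (SUM x:Y. g x)"
  using X(1) Y(1) by (intro sum.mono_neutral_cong_right) auto
 finally show ?thesis by simp
qed

text \<open>The bound places \<open>c\<close> so close to the origin that an affine root is positive
  at \<open>c\<close> exactly when its level is positive, or is zero with a positive
  gradient.\<close>

locale affine_sys = root_sys Ph c for Ph :: "(real^'n) set" and c +
 assumes small: "a : Ph ==> \<bar>c <.> a\<bar> < 1"
begin

definition apos :: "((real^'n) \<times> real) set" where
 "apos = {f. fst f : Ph & snd f : \<int> & c <.> fst f + snd f > 0}"

text \<open>The affine function with gradient \<open>be\<close> that vanishes at \<open>v\<close>.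
  When \<open>be <.> v\<close> is an integer and \<open>be\<close> is a root, this is an affine root
  through \<open>v\<close>.\<close>

definition lift :: "real^'n => real^'n => (real^'n) \<times> real" where
 "lift v be = (be, - (be <.> v))"

lemma linear_lift: "linear (lift v)"
 by (rule linearI) (simp_all add: lift_def inner_add_left)

lemma apos_int_iff:
 "(be, real_of_int k) : apos \<longleftrightarrow> be : Ph & (k >= 1 \<or> (k = 0 & be : pos))"
proof -
 have "c <.> be + real_of_int k > 0 \<longleftrightarrow> k >= 1 \<or> (k = 0 & c <.> be > 0)" if b: "be : Ph"
 proof -
  have sm: "- 1 < c <.> be" "c <.> be < 1" using small[OF b] by auto
  consider "k >= 1" | "k = 0" | "k <= -1" by linarith
  then show ?thesis
  proof cases
   case 1
   then have "real_of_int k >= 1" by simp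
   then show ?thesis using 1 sm by linarith
  next
   case 3
   then have "real_of_int k <= -1" by linarith
   then show ?thesis using 3 sm by linarith
  qed simp
 qed
 then show ?thesis by (auto simp: apos_def pos_def)
qed

lemma aposE:
 assumes "f : apos"
 obtains be k where "f = (be, real_of_int k)" "be : Ph" "k >= 1 \<or> (k = 0 & be : pos)"
proof -
 obtain k where k: "snd f = real_of_int k" using assms by (auto simp: apos_def elim: Ints_cases)
 have "f = (fst f, real_of_int k)" using k by (metis prod.collapse)
 then show ?thesis using assms apos_int_iff[of "fst f" k] that by metis
qed

lemma apos_snd_nonneg: "f : apos ==> snd f >= 0"
 by (elim aposE) auto

lemma apos_nz: "f : apos ==> fst f ~= 0" "f : apos ==> f ~= 0"
 using root_nz by (auto simp: apos_def)

lemma apos_proportional: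
 assumes "f : apos" "g : apos" "f = t *R g"
 shows "f = g"
proof -
 have "t = 1 \<or> t = -1" using red[of "fst g" t] assms by (auto simp: apos_def)
 moreover have "t ~= -1"
 proof
  assume "t = -1"
  then show False using assms by (simp add: apos_def)
 qed
 ultimately show ?thesis using assms by simp
qed

text \<open>The gradients of the affine roots through \<open>v\<close> form a root system.
  Positivity at \<open>c\<close> of an affine root through \<open>v\<close> is positivity of its
  gradient at \<open>c - v\<close>.\<close>

lemma local_root_sys:
 assumes "subspace L"
 shows "root_sys {ga:Ph. ga : L & ga <.> v : \<int>} (c - v)"
proof (rule sub_root_sys)
 fix a b assume a: "a : {ga:Ph. ga : L & ga <.> v : \<int>}" and b: "b : {ga:Ph. ga : L & ga <.> v : \<int>}"
 then have k: "2 * (b <.> a) / (a <.> a) : \<int>" using int[of a b] by simp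
 have "refl_root a b : L" unfolding refl_root_def using a b assms by (auto intro!: subspace_diff subspace_scale)
 moreover have "refl_root a b <.> v : \<int>"
  unfolding refl_root_inner using a b by (intro Ints_diff Ints_mult[OF k]) auto
 ultimately show "refl_root a b : {ga:Ph. ga : L & ga <.> v : \<int>}" using a b refl by auto
next
 fix a assume a: "a : {ga:Ph. ga : L & ga <.> v : \<int>}"
 then obtain k :: int where k: "a <.> v = k" by (auto elim: Ints_cases)
 show "(c - v) <.> a ~= 0"
 proof
  assume "(c - v) <.> a = 0"
  then have ck: "c <.> a = k" using k by (simp add: inner_diff_left inner_commute[of v])
  then have "\<bar>real_of_int k\<bar> < 1" using small[of a] a by simp
  then have "k = 0" by linarith
  then show False using reg[of a] a ck by simp
 qed
qed auto

lemma local_pos_iff: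
 assumes "subspace L"
 shows "ga : root_sys.pos {ga:Ph. ga : L & ga <.> v : \<int>} (c - v) \<longleftrightarrow> ga : L & lift v ga : apos"
 unfolding root_sys.pos_def[OF local_root_sys[OF assms]]
 by (auto simp: apos_def lift_def inner_diff_left inner_commute[of v] minus_in_Ints_iff)

lemma local_ideal:
 assumes L: "subspace L" and B: "order_ideal_in apos B"
 shows "order_ideal_in (root_sys.pos {ga:Ph. ga : L & ga <.> v : \<int>} (c - v)) {ga:L. lift v ga : B}"
 unfolding order_ideal_in_def
proof (intro conjI subsetI ballI impI)
 have BA: "B \<subseteq> apos" using B by (simp add: order_ideal_in_def)
 then show "ga : root_sys.pos {ga:Ph. ga : L & ga <.> v : \<int>} (c - v)" if "ga : {ga:L. lift v ga : B}" for ga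
  using that by (auto simp: local_pos_iff[OF L])
 fix be ga assume b: "be : {ga:L. lift v ga : B}" and g: "ga : root_sys.pos {ga:Ph. ga : L & ga <.> v : \<int>} (c - v)"
  and c: "be - ga : conic_span (root_sys.pos {ga:Ph. ga : L & ga <.> v : \<int>} (c - v))"
 have "lift v (be - ga) : conic_span apos"
  by (rule conic_mono[OF linear_lift _ c]) (auto simp: local_pos_iff[OF L] intro: conic_base)
 then have "lift v be - lift v ga : conic_span apos" using linear_diff[OF linear_lift] by metis
 then show "ga : {ga:L. lift v ga : B}"
  using B b g unfolding order_ideal_in_def by (auto simp: local_pos_iff[OF L])
qed

lemma span_pair_np:
 assumes a: "a : apos" and b: "b : apos" "fst b ~: span {fst a}" and f: "f : apos" "f : span {a, b}" "f ~= a"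
 shows "fst f ~: span {fst a}" "b : span {a, f}"
proof -
 obtain p q where pq: "f = p *R a + q *R b" using f(2) by (rule span_pairE)
 have q: "q ~= 0"
 proof
  assume "q = 0"
  then show False using apos_proportional[OF f(1) a, of p] pq f(3) by simp
 qed
 show "fst f ~: span {fst a}"
 proof
  assume "fst f : span {fst a}"
  then obtain k where "p *R fst a + q *R fst b = k *R fst a" using pq by (auto simp: span_singleton)
  then have "q *R fst b = (k - p) *R fst a" by (simp add: algebra_simps)
  then have "fst b = (1 / q) *R ((k - p) *R fst a)" using q by (metis divideR_right inverse_eq_divide scaleR_left_imp_eq)
  then have "fst b = ((k - p) / q) *R fst a" by simp
  then show False using b span_singleton by blast
 qed
 have "b = (- (p / q)) *R a + (1 / q) *R f" using pq q by (simp add: scaleR_add_right)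
 then show "b : span {a, f}" using span_pairI by metis
qed

text \<open>Two affine roots with independent gradients meet in a point \<open>v\<close>, and their
  class is the lift of a rank two system there. The weighted sum is the height of the new root minus
  one, and \<open>rank2_ideal_card\<close> turns it into the number of old hyperplanes minus the
  representative.\<close>

lemma class_count:
 assumes B: "order_ideal_in apos B" and a: "a : apos" "a ~: B" "order_ideal_in apos (insert a B)"
  and b: "b : apos" "fst b ~: span {fst a}"
 shows "finite (apos Int span {a, b})"
  "(SUM f:apos Int span {a, b} - {a}. (fst a <.> fst f) / (fst f <.> fst f)) =
   (if B Int span {a, b} = {} then 0 else real (card (B Int span {a, b})) - 1)"
proof -
 let ?al = "fst a" and ?be = "fst b" and ?Y = "apos Int span {a, b}"
 obtain v where v: "?al <.> v = - snd a" "?be <.> v = - snd b"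
  using two_equations[OF apos_nz(1)[OF a(1)] b(2)] by blast
 let ?L = "span {?al, ?be}"
 let ?Ps = "{ga:Ph. ga : ?L & ga <.> v : \<int>}"
 have L: "subspace ?L" by simp
 interpret Q: root_sys ?Ps "c - v" by (rule local_root_sys[OF L])
 have la: "lift v ?al = a" and lb: "lift v ?be = b" using v by (auto simp: lift_def prod_eq_iff)
 have span_iff: "lift v ga : span {a, b} \<longleftrightarrow> ga : ?L" for ga
 proof
  assume "lift v ga : span {a, b}"
  then obtain p q where "lift v ga = p *R a + q *R b" by (rule span_pairE)
  then have "ga = p *R ?al + q *R ?be" by (auto simp: lift_def prod_eq_iff)
  then show "ga : ?L" using span_pairI by metis
 next
  assume "ga : ?L"
  then obtain p q where "ga = p *R ?al + q *R ?be" by (rule span_pairE)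
  then have "lift v ga = p *R a + q *R b"
   by (simp add: linear_add[OF linear_lift] linear_scale[OF linear_lift] la lb)
  then show "lift v ga : span {a, b}" using span_pairI by metis
 qed
 have lift_of: "f = lift v (fst f)" if f: "f : span {a, b}" for f
 proof -
  obtain p q where "f = p *R a + q *R b" using f by (rule span_pairE)
  then show ?thesis by (simp add: lift_def prod_eq_iff inner_add_left v)
 qed
 have inj: "inj_on (lift v) X" for X by (auto simp: inj_on_def lift_def)
 have Yeq: "?Y = lift v ` Q.pos"
 proof (intro equalityI subsetI)
  fix f assume f: "f : ?Y"
  then have e: "f = lift v (fst f)" using lift_of by blast
  then have "fst f : Q.pos" using f span_iff[of "fst f"] local_pos_iff[OF L, of "fst f" v] by simp
  then show "f : lift v ` Q.pos" using e by blast
 next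
  fix f assume "f : lift v ` Q.pos"
  then obtain ga where "f = lift v ga" "ga : Q.pos" by blast
  then show "f : ?Y" using span_iff[of ga] local_pos_iff[OF L, of ga v] by simp
 qed
 show "finite ?Y" unfolding Yeq using Q.finite_pos by simp
 let ?J = "{ga:?L. lift v ga : B}"
 have BA: "B \<subseteq> apos" using B by (simp add: order_ideal_in_def)
 have Jeq: "B Int span {a, b} = lift v ` ?J"
 proof (intro equalityI subsetI)
  fix f assume f: "f : B Int span {a, b}"
  then have e: "f = lift v (fst f)" using lift_of by blast
  then have "fst f : ?J" using f span_iff[of "fst f"] by simp
  then show "f : lift v ` ?J" using e by blast
 next
  fix f assume "f : lift v ` ?J"
  then show "f : B Int span {a, b}" using span_iff by blast
 qed
 have al: "?al : Q.pos" using a la by (simp add: local_pos_iff[OF L] span_base)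
 have "?Ps \<subseteq> ?L" by auto
 then have "dim ?Ps <= dim {?al, ?be}" using dim_subset[of ?Ps ?L] by (simp only: dim_span)
 also have "... <= 2" by (rule order_trans[OF dim_le_card']) (auto simp: card_insert_if)
 finally have d2: "dim ?Ps <= 2" .
 have be: "?be : Q.pos" using b lb by (simp add: local_pos_iff[OF L] span_base)
 have "independent {?be, ?al}" using b apos_nz[OF a(1)] by (simp add: independent_insert)
 moreover have "{?be, ?al} \<subseteq> ?Ps" using al be Q.pos_root by blast
 moreover have "?be ~= ?al" using b(2) by (metis singletonI span_base)
 then have "card {?be, ?al} = 2" by simp
 ultimately have "2 <= dim ?Ps" using independent_card_le_dim[of "{?be, ?al}" ?Ps] by linarith
 then have dim2: "dim ?Ps = 2" using d2 by simp
 have aJ: "?al ~: ?J" using a la by auto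
 have "insert ?al ?J = {ga:?L. lift v ga : insert a B}" using la by (auto simp: span_base) (auto simp: lift_def)
 then have J': "order_ideal_in Q.pos (insert ?al ?J)" using local_ideal[OF L a(3), of v] by simp
 note r2 = Q.rank2_ideal_card[OF dim2 local_ideal[OF L B] al aJ J']
 have "(SUM f:?Y - {a}. (?al <.> fst f) / (fst f <.> fst f)) = (SUM ga:Q.pos - {?al}. (?al <.> ga) / (ga <.> ga))"
 proof -
  have "?Y - {a} = lift v ` (Q.pos - {?al})" unfolding Yeq image_set_diff[OF inj[of UNIV]] using la by simp
  then show ?thesis by (simp only: sum.reindex[OF inj] o_def) (simp add: lift_def)
 qed
 also have "... = Q.ht ?al - 1"
  unfolding Q.ht_def using sum.remove[OF Q.finite_pos al, of "%ga. (?al <.> ga) / (ga <.> ga)"] apos_nz[OF a(1)] by simp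
 also have "... = (if B Int span {a, b} = {} then 0 else real (card (B Int span {a, b})) - 1)"
  using r2 inj unfolding Jeq by (auto simp: card_image)
 finally show "(SUM f:?Y - {a}. (?al <.> fst f) / (fst f <.> fst f)) = (if B Int span {a, b} = {} then 0 else real (card (B Int span {a, b})) - 1)" .
qed

section \<open>Affine reflections and the degree of Terao's polynomial\<close>

definition arefl :: "(real^'n) \<times> real => (real^'n) \<times> real => (real^'n) \<times> real" where
 "arefl a f = f - (2 * (fst f <.> fst a) / (fst a <.> fst a)) *R a"

text \<open>The sum over all affine roots would be infinite; the inversions form the finite part
  left after cancellation in each class. Roots parallel to \<open>a\<close> are excluded, since they
  do not meet it at a finite point.\<close>

definition inversions :: "(real^'n) \<times> real => ((real^'n) \<times> real) set" where
 "inversions a = {f:apos. arefl a f ~: apos & fst f ~: span {fst a}}"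

lemma fst_arefl: "fst (arefl a f) = refl_root (fst a) (fst f)"
 by (simp add: arefl_def refl_root_def)

lemma arefl_arefl:
 assumes "fst a ~= 0"
 shows "arefl a (arefl a f) = f"
proof -
 have "refl_root (fst a) (fst f) <.> fst a = - (fst f <.> fst a)"
  using refl_root_adjoint[of "fst a" "fst f" "fst a"] refl_root_self[OF assms] by simp
 then have "arefl a (arefl a f) = arefl a f - (2 * - (fst f <.> fst a) / (fst a <.> fst a)) *R a"
  unfolding arefl_def[of a "arefl a f"] fst_arefl by simp
 then show ?thesis by (simp add: arefl_def)
qed

text \<open>The reflection pairs the roots of the class that it keeps positive, with opposite
  weights.\<close>

lemma class_inversion_sum:
 assumes a: "a : apos" and b: "b : apos" "fst b ~: span {fst a}" and fin: "finite (apos Int span {a, b})"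
 shows "(SUM f:apos Int span {a, b} - {a}. (fst a <.> fst f) / (fst f <.> fst f)) =
  (SUM f:inversions a Int span {a, b}. (fst a <.> fst f) / (fst f <.> fst f))"
proof -
 let ?Y = "apos Int span {a, b}" and ?w = "%f. (fst a <.> fst f) / (fst f <.> fst f)"
 let ?Z = "{f:?Y. f ~= a & arefl a f : apos}"
 have a0: "fst a ~= 0" using apos_nz a by blast
 have sa: "arefl a a = - a" using a0 by (simp add: arefl_def scaleR_2)
 have "- a ~: apos" using a by (auto simp: apos_def)
 then have inv: "inversions a Int span {a, b} = (?Y - {a}) - ?Z"
  using span_pair_np(1)[OF a b] by (auto simp: inversions_def span_base)
 have "(SUM f:?Z. ?w f) = (SUM f:?Z. - ?w f)"
 proof (rule sum.reindex_bij_witness[of _ "arefl a" "arefl a"])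
  fix f assume f: "f : ?Z"
  show r: "arefl a (arefl a f) = f" by (rule arefl_arefl[OF a0])
  then show "arefl a (arefl a f) = f" .
  have "arefl a f : span {a, b}" unfolding arefl_def using f by (intro span_diff span_scale) (auto intro: span_base)
  moreover have "arefl a f ~= a" using r sa f \<open>- a ~: apos\<close> by auto
  ultimately show "arefl a f : ?Z" using f r by auto
  then show "arefl a f : ?Z" .
  have "fst a <.> refl_root (fst a) (fst f) = - (fst a <.> fst f)"
   using refl_root_adjoint[of "fst a" "fst a" "fst f"] refl_root_self[OF a0] by simp
  then show "- ?w (arefl a f) = ?w f" by (simp add: fst_arefl refl_root_isometry)
 qed
 then have "(SUM f:?Z. ?w f) = 0" by (simp add: sum_negf)
 moreover have "(SUM f:?Y - {a}. ?w f) = (SUM f:(?Y - {a}) - ?Z. ?w f) + (SUM f:?Z. ?w f)"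
  by (rule sum.subset_diff) (use fin in auto)
 ultimately show ?thesis using inv by simp
qed

text \<open>Both sides split over the classes modulo \<open>a\<close>; a class meeting
  \<open>B\<close> loses exactly its representative, which is the value given by
  \<open>class_count\<close>.\<close>

lemma nonparallel_count:
 assumes B: "order_ideal_in apos B" "finite B" and a: "a : apos" "a ~: B" "order_ideal_in apos (insert a B)"
  and C: "transversal {f:B. fst f ~: span {fst a}} C a" and fin: "finite (inversions a)"
 shows "real (card ({f:B. fst f ~: span {fst a}} - C)) = (SUM f:inversions a. (fst a <.> fst f) / (fst f <.> fst f))"
proof -
 let ?B = "{f:B. fst f ~: span {fst a}}" and ?w = "%f. (fst a <.> fst f) / (fst f <.> fst f)"
 have BA: "B \<subseteq> apos" using B by (simp add: order_ideal_in_def)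
 have finC: "C \<subseteq> ?B" "finite C" using C B(2) by (auto simp: transversal_def intro: finite_subset)
 \<comment> \<open>The class as a set of positive affine roots, not only of members of
   \<open>B\<close>: inversions outside \<open>B\<close> have to be grouped as well.\<close>
 define cl where "cl f = span {a, f} Int apos - {a}" for f
 let ?N = "?B Un inversions a"
 define \<K> where "\<K> = cl ` ?N"
 have finN: "finite ?N" using B fin by simp
 have fK: "finite \<K>" unfolding \<K>_def using finN by simp
 have Nnp: "f : apos" "fst f ~: span {fst a}" if "f : ?N" for f using that BA by (auto simp: inversions_def)
 have cl_eq: "cl g = cl f" if f: "f : ?N" and g: "g : cl f" for f g
 proof -
  have g': "g : apos" "g : span {a, f}" "g ~= a" using g by (auto simp: cl_def)
  have "f : span {a, g}" by (rule span_pair_np(2)[OF a(1) Nnp[OF f] g'])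
  then have "span {a, g} = span {a, f}" using g'(2) by (intro equalityI; metis span_pair_trans subsetI)
  then show ?thesis by (simp add: cl_def)
 qed
 have self: "f : cl f" if "f : ?N" for f
 proof -
  have "f ~= a" using Nnp[OF that] by (auto simp: span_base)
  then show ?thesis using Nnp[OF that] by (auto simp: cl_def span_base)
 qed
 have disj: "X Int Y = {}" if XY: "X : \<K>" "Y : \<K>" "X ~= Y" for X Y
 proof (rule ccontr)
  assume "X Int Y ~= {}"
  then obtain g where g: "g : X" "g : Y" by blast
  obtain f f' where f: "f : ?N" "X = cl f" "f' : ?N" "Y = cl f'" using XY(1,2) unfolding \<K>_def by blast
  have "cl g = X" "cl g = Y" using cl_eq[OF f(1)] cl_eq[OF f(3)] f g by blast+
  then show False using XY(3) by simp
 qed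
 have inv_cover: "inversions a = (UN X:\<K>. inversions a Int X)" using self unfolding \<K>_def by blast
 have B_cover: "?B - C = (UN X:\<K>. (?B Int X) - C)" using self unfolding \<K>_def by blast
 have each: "(SUM f:inversions a Int X. ?w f) = real (card ((?B Int X) - C))" if X: "X : \<K>" for X
 proof -
  obtain b where b: "b : ?N" "X = cl b" using X unfolding \<K>_def by blast
  note b' = Nnp[OF b(1)]
  note cc = class_count[OF B(1) a b']
  have "a ~: inversions a" by (auto simp: inversions_def span_base)
  then have "inversions a Int X = inversions a Int span {a, b}" using b(2) by (auto simp: cl_def inversions_def)
  then have s: "(SUM f:inversions a Int X. ?w f) = (if B Int span {a, b} = {} then 0 else real (card (B Int span {a, b})) - 1)"
   using class_inversion_sum[OF a(1) b' cc(1)] cc(2) by simp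
  have BX: "?B Int X = B Int span {a, b}"
   using b(2) BA a(2) span_pair_np(1)[OF a(1) b'] by (auto simp: cl_def)
  show ?thesis
  proof (cases "B Int span {a, b} = {}")
   case True
   then show ?thesis using s BX by simp
  next
   case False
   then obtain g where g: "g : ?B" "g : X" using BX by blast
   obtain k where k: "k : C" "g : span {a, k}" using C g(1) unfolding transversal_def by blast
   have kB: "k : ?B" using k finC by blast
   have ka: "k : apos" "fst k ~: span {fst a}" using kB BA by auto
   have clg: "cl g = X" using cl_eq[OF b(1)] g b(2) by simp
   have "g ~= a" using g(2) b(2) by (auto simp: cl_def)
   then have "k : span {a, g}" using span_pair_np(2)[OF a(1) ka _ k(2)] g BA by blast
   moreover have "k ~= a" using ka by (auto simp: span_base)
   ultimately have kX: "k : X" using clg ka by (auto simp: cl_def)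
   have clk: "cl k = X" using cl_eq[OF b(1)] kX b(2) by simp
   have "(?B Int X) Int C = {k}"
   proof (intro equalityI subsetI)
    fix l assume l: "l : (?B Int X) Int C"
    then have "l : span {a, k}" using clk by (auto simp: cl_def)
    then show "l : {k}" using C l k unfolding transversal_def by blast
   qed (use kX kB k in auto)
   then have "card ((?B Int X) - C) = card (?B Int X) - 1"
    using card_Diff_subset_Int[of "?B Int X" C] by simp
   moreover have "card (?B Int X) >= 1" using g B(2) by (simp add: Suc_le_eq card_gt_0_iff) blast
   ultimately show ?thesis using s False BX by (simp add: of_nat_diff)
  qed
 qed
 have "(SUM f:inversions a. ?w f) = (SUM X:\<K>. SUM f:inversions a Int X. ?w f)"
  by (subst inv_cover, rule sum.UNION_disjoint) (use fK fin disj in auto)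
 also have "... = (SUM X:\<K>. real (card ((?B Int X) - C)))" using each by simp
 also have "... = real (card (?B - C))"
  by (subst B_cover, subst card_UN_disjoint) (use fK B(2) disj in auto)
 finally show ?thesis by simp
qed

text \<open>Half of the sum of the products of opposite Cartan integers over the positive roots. In
  the irreducible case it is the Coxeter number (\<open>cox_eq\<close>).\<close>

definition cox :: "real^'n => real" where
 "cox al = (SUM be:pos. ((al <.> be) / (be <.> be)) * (2 * (be <.> al) / (al <.> al)))"

lemma refl_root_minus: "refl_root al (- x) = - refl_root al x"
 using linear_neg[OF linear_refl_root] by blast

lemma refl_neg_pos:
 assumes "al : pos" "be : Ph"
 shows "0 < be <.> al ==> be ~: pos ==> refl_root al be ~: pos" "be <.> al < 0 ==> be : pos ==> refl_root al be : pos"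
proof -
 have aa: "al <.> al > 0" "c <.> al > 0" using assms root_nz by (auto simp: pos_def)
 have e: "c <.> refl_root al be = c <.> be - 2 * (be <.> al) / (al <.> al) * (c <.> al)"
  by (simp add: refl_root_def inner_diff_right)
 show "refl_root al be ~: pos" if "0 < be <.> al" "be ~: pos"
 proof -
  have "c <.> be <= 0" using that assms by (simp add: pos_def)
  moreover have "2 * (be <.> al) / (al <.> al) * (c <.> al) > 0" using that aa by simp
  ultimately show ?thesis using e by (simp add: pos_def)
 qed
 show "refl_root al be : pos" if "be <.> al < 0" "be : pos"
 proof -
  have "c <.> be > 0" using that assms by (simp add: pos_def)
  moreover have "2 * (be <.> al) / (al <.> al) * (c <.> al) < 0" using that aa by (simp add: mult_neg_pos divide_neg_pos)
  ultimately show ?thesis using e refl[of al be] assms by (auto simp: pos_def)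
 qed
qed

text \<open>For a fixed gradient the levels of the inversions form an integer interval, whose length
  grows with \<open>M\<close> in proportion to a Cartan integer. Summation with weights gives
  \<open>cox\<close> as slope and the height as constant term.\<close>

lemma inversions_sum:
 assumes a: "(al, real_of_int M) : apos"
 shows "finite (inversions (al, real_of_int M))"
  "(SUM f:inversions (al, real_of_int M). (al <.> fst f) / (fst f <.> fst f)) =
   real_of_int M * (cox al - 2) + ht al - (if al : pos then 1 else -1)"
proof -
 let ?a = "(al, real_of_int M)"
 have al: "al : Ph" and M: "M >= 1 \<or> (M = 0 & al : pos)" using a apos_int_iff by auto
 have aa: "al <.> al > 0" using al root_nz by blast
 define ka where "ka be = 2 * (be <.> al) / (al <.> al)" for be
 define w where "w be = (al <.> be) / (be <.> be)" for be
 define ki where "ki be = \<lfloor>ka be\<rfloor>" for be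
 \<comment> \<open>The least level at which an affine root with gradient \<open>be\<close> is
   positive.\<close>
 define n where "n be = (if be : pos then 0 else 1 :: int)" for be
 let ?r = "refl_root al"
 let ?Ph = "Ph - {al, - al}"
 have ki: "ka be = real_of_int (ki be)" if "be : Ph" for be
  using int[OF al that] unfolding ki_def ka_def by simp
 have sgn_k: "ka be > 0 \<longleftrightarrow> be <.> al > 0" "ka be < 0 \<longleftrightarrow> be <.> al < 0" "ka be = 0 \<longleftrightarrow> be <.> al = 0" for be
  unfolding ka_def using aa by (simp_all only: pos_less_divide_eq pos_divide_less_eq divide_eq_0_iff) auto
 have np: "be ~: span {al} \<longleftrightarrow> be : ?Ph" if b: "be : Ph" for be
 proof -
  have "al : span {al}" "- al : span {al}" by (auto intro: span_neg span_base)
  moreover have "be = al \<or> be = - al" if "be : span {al}"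
  proof -
   obtain t where "be = t *R al" using \<open>be : span {al}\<close> by (auto simp: span_singleton)
   then show ?thesis using red[OF al, of t] b by auto
  qed
  ultimately show ?thesis using b by auto
 qed
 \<comment> \<open>From the least positive level up to the last level that reflection makes
   non-positive; the interval is empty when the Cartan integer is not positive.\<close>
 define K where "K be = {n be .. ki be * M - 1 + n (?r be)}" for be
 have memK: "(be, real_of_int k) : inversions ?a \<longleftrightarrow> k : K be" if b: "be : ?Ph" for be k
 proof -
  have bPh: "be : Ph" using b by simp
  have "arefl ?a (be, real_of_int k) = (?r be, real_of_int (k - ki be * M))"
   using ki[OF bPh] by (simp add: arefl_def refl_root_def ka_def)
  then have "(be, real_of_int k) : inversions ?a \<longleftrightarrow>
   (k >= 1 \<or> (k = 0 & be : pos)) & ~ (k - ki be * M >= 1 \<or> (k - ki be * M = 0 & ?r be : pos))"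
   using b bPh np[OF bPh] refl[OF al bPh] by (simp add: inversions_def apos_int_iff del: of_int_diff of_int_mult)
  also have "... \<longleftrightarrow> k : K be"
  proof -
   have "(k >= 1 \<or> (k = 0 & s)) & ~ (k - q >= 1 \<or> (k - q = 0 & t)) \<longleftrightarrow>
    k : {(if s then 0 else 1) .. q - 1 + (if t then 0 else 1)}" for q and s t :: bool by auto
   then show ?thesis unfolding K_def n_def .
  qed
  finally show ?thesis .
 qed
 have inv: "inversions ?a = (%(be, k). (be, real_of_int k)) ` Sigma ?Ph K"
 proof (intro equalityI subsetI)
  fix f assume f: "f : inversions ?a"
  then have "f : apos" by (simp add: inversions_def)
  then obtain be k where bk: "f = (be, real_of_int k)" "be : Ph" by (rule aposE)
  then have "be : ?Ph" using f np[OF bk(2)] by (simp add: inversions_def)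
  then show "f : (%(be, k). (be, real_of_int k)) ` Sigma ?Ph K" using memK[of be k] f bk by auto
 next
  fix f assume "f : (%(be, k). (be, real_of_int k)) ` Sigma ?Ph K"
  then show "f : inversions ?a" using memK by auto
 qed
 have finS: "finite (Sigma ?Ph K)" using fin by (auto simp: K_def)
 show "finite (inversions ?a)" unfolding inv using finS by simp
 have "inj_on (%(be, k). (be, real_of_int k)) (Sigma ?Ph K)" by (auto simp: inj_on_def)
 then have "(SUM f:inversions ?a. w (fst f)) = (SUM (be, k):Sigma ?Ph K. w be)"
  unfolding inv by (subst sum.reindex) (auto intro!: sum.cong)
 also have "... = (SUM be:?Ph. SUM k:K be. w be)" by (rule sum.Sigma[symmetric]) (use fin in \<open>auto simp: K_def\<close>)
 also have "... = (SUM be:?Ph. if ka be > 0 then w be * (ka be * M + real_of_int (n (?r be)) - real_of_int (n be)) else 0)"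
 proof (rule sum.cong)
  fix be assume b: "be : ?Ph"
  then have bPh: "be : Ph" by simp
  let ?u = "ki be * M + n (?r be) - n be"
  have cK: "(SUM k:K be. w be) = real (nat ?u) * w be" by (simp add: K_def algebra_simps)
  have n01: "n x = 0 \<or> n x = 1" for x by (simp add: n_def)
  consider "ka be > 0" | "ka be = 0" | "ka be < 0" by linarith
  then show "(SUM k:K be. w be) = (if ka be > 0 then w be * (ka be * M + real_of_int (n (?r be)) - real_of_int (n be)) else 0)"
  proof cases
   case 1
   then have k1: "ki be >= 1" using ki[OF bPh] by simp
   have "?u >= 0"
   proof (cases "M = 0")
    case True
    then show ?thesis using M refl_neg_pos(1)[of al be] bPh 1 sgn_k(1) by (auto simp: n_def)
   next
    case False
    then have "M >= 1" using M by auto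
    then have "ki be * M >= 1" using k1 by (metis mult_mono' mult_1 zero_le_one)
    then show ?thesis using n01[of be] n01[of "?r be"] by auto
   qed
   then show ?thesis using 1 cK ki[OF bPh] by simp
  next
   case 2
   then have "w be = 0" using sgn_k(3) by (simp add: w_def inner_commute)
   then show ?thesis by simp
  next
   case 3
   then have k1: "ki be <= -1" using ki[OF bPh] by simp
   have "?u <= 0"
   proof (cases "M = 0")
    case True
    then show ?thesis using M refl_neg_pos(2)[of al be] bPh 3 sgn_k(2) by (auto simp: n_def)
   next
    case False
    then have "M >= 1" using M by auto
    then have "(- ki be) * M >= 1" using k1 mult_mono'[of 1 "- ki be" 1 M] by simp
    then show ?thesis using n01[of be] n01[of "?r be"] by auto
   qed
   then show ?thesis using 3 cK by simp
  qed
 qed simp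
 finally have total: "(SUM f:inversions ?a. w (fst f)) =
  (SUM be:?Ph. if ka be > 0 then w be * (ka be * M + real_of_int (n (?r be)) - real_of_int (n be)) else 0)" .
 define F where "F = {be:?Ph. ka be > 0}"
 have finF: "finite F" using fin by (simp add: F_def)
 have "(SUM be:?Ph. if ka be > 0 then w be * (ka be * M + real_of_int (n (?r be)) - real_of_int (n be)) else 0) =
  (SUM be:F. w be * (ka be * M + real_of_int (n (?r be)) - real_of_int (n be)))"
  unfolding F_def by (rule sum.inter_filter[symmetric]) (simp add: fin)
 also have "... = M * (SUM be:F. w be * ka be) + (SUM be:F. w be * real_of_int (n (?r be))) - (SUM be:F. w be * real_of_int (n be))"
  by (simp add: sum_distrib_left sum.distrib sum_subtractf algebra_simps)
 finally have S: "(SUM f:inversions ?a. w (fst f)) =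
  M * (SUM be:F. w be * ka be) + (SUM be:F. w be * real_of_int (n (?r be))) - (SUM be:F. w be * real_of_int (n be))"
  using total by simp
 have n_neg: "n (- be) = 1 - n be" if "be : Ph" for be
  using pos_or_neg[OF that] not_pos_neg[of be] by (auto simp: n_def)
 have r_al: "?r al = - al" using refl_root_self aa by auto
 \<comment> \<open>Reindexing by the involution \<open>be -> - refl_root al be\<close>, which
   preserves \<open>F\<close> and the weights and swaps the two sign indicators.\<close>
 have "(SUM be:F. w be * real_of_int (n (?r be))) = (SUM be:F. w be * real_of_int (1 - n be))"
 proof (rule sum.reindex_bij_witness[of _ "%x. - ?r x" "%x. - ?r x"])
  fix be assume b: "be : F"
  then have bPh: "be : Ph" by (simp add: F_def)
  show i: "- ?r (- ?r be) = be" by (simp add: refl_root_minus)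
  then show "- ?r (- ?r be) = be" .
  have "?r be <.> al = - (be <.> al)" using refl_root_adjoint[of al be al] r_al by simp
  then have kk: "ka (- ?r be) = ka be" by (simp add: ka_def)
  have "- ?r be ~= al"
  proof
   assume "- ?r be = al"
   then have "be = al" using i r_al by simp
   then show False using b by (simp add: F_def)
  qed
  moreover have "- ?r be ~= - al"
  proof
   assume "- ?r be = - al"
   then have "?r be = al" by simp
   then have "be = - al" using refl_root_refl_root[of al be] r_al by simp
   then show False using b by (simp add: F_def)
  qed
  ultimately show m: "- ?r be : F" using b refl[OF al bPh] kk by (simp add: F_def)
  then show "- ?r be : F" .
  have "al <.> ?r be = - (al <.> be)" using refl_root_adjoint[of al al be] r_al by simp
  then have "w (- ?r be) = w be" by (simp add: w_def refl_root_isometry)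
  moreover have "1 - n (- ?r be) = n (?r be)" using n_neg[OF refl[OF al bPh]] by simp
  ultimately show "w (- ?r be) * real_of_int (1 - n (- ?r be)) = w be * real_of_int (n (?r be))" by simp
 qed
 then have S2: "(SUM be:F. w be * real_of_int (n (?r be))) - (SUM be:F. w be * real_of_int (n be)) =
  (SUM be:F. w be * (1 - 2 * real_of_int (n be)))"
  by (simp add: sum_subtractf[symmetric] algebra_simps)
 let ?P = "pos - {al, - al}"
 have half: "(SUM be:F. g be) = (SUM be:?P. g be)" if ev: "!!x. x : Ph ==> g (- x) = g x" and w0: "!!x. w x = 0 ==> g x = 0"
  for g :: "real^'n => real"
 proof -
  define g' where "g' x = (if x : Ph then g x else 0)" for x
  have ev': "g' (- x) = g' x" for x using ev by (simp add: g'_def)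
  have w_k: "w x = 0 \<longleftrightarrow> ka x = 0" if "x : Ph" for x using sgn_k(3) root_nz[OF that] by (simp add: w_def inner_commute)
  have "(SUM x:?Ph. g' x) = 2 * (SUM x:F. g' x)"
  proof (rule even_half_sum[where g=g', OF _ _ ev'])
   fix x assume x: "x : ?Ph" "g' x ~= 0"
   then have "ka x ~= 0" using w0 w_k[of x] by (auto simp: g'_def)
   moreover have "ka (- x) = - ka x" by (simp add: ka_def)
   ultimately show "x : F \<longleftrightarrow> - x ~: F" using x by (auto simp: F_def)
  qed (use fin in \<open>auto simp: F_def\<close>)
  moreover have "(SUM x:?Ph. g' x) = 2 * (SUM x:?P. g' x)"
  proof (rule even_half_sum[where g=g', OF _ _ ev'])
   fix x assume x: "x : ?Ph" "g' x ~= 0"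
   then show "x : ?P \<longleftrightarrow> - x ~: ?P" using pos_or_neg[of x] not_pos_neg[of x] by auto
  qed (use fin pos_root in auto)
  moreover have "(SUM x:F. g' x) = (SUM x:F. g x)" by (rule sum.cong) (auto simp: g'_def F_def)
  moreover have "(SUM x:?P. g' x) = (SUM x:?P. g x)" by (rule sum.cong) (auto simp: g'_def pos_root)
  ultimately show ?thesis by simp
 qed
 have wneg: "w (- x) = - w x" and kneg: "ka (- x) = - ka x" for x by (simp_all add: w_def ka_def)
 have S1: "(SUM be:F. w be * ka be) = (SUM be:?P. w be * ka be)" by (rule half) (auto simp: wneg kneg)
 have "(SUM be:F. w be * (1 - 2 * real_of_int (n be))) = (SUM be:?P. w be * (1 - 2 * real_of_int (n be)))"
  by (rule half) (auto simp: wneg n_neg algebra_simps)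
 also have "... = (SUM be:?P. w be)" by (rule sum.cong) (auto simp: n_def)
 finally have S3: "(SUM be:F. w be * (1 - 2 * real_of_int (n be))) = (SUM be:?P. w be)" .
 \<comment> \<open>The pair \<open>al\<close>, \<open>- al\<close> is missing from the sum; its
   contribution is the 2 subtracted from \<open>cox al\<close> and the sign subtracted from the
   height.\<close>
 have w1: "w al = 1" "ka al = 2" using aa by (auto simp: w_def ka_def)
 define \<epsilon> where "\<epsilon> = (if al : pos then al else - al)"
 have eps: "\<epsilon> : pos" "?P = pos - {\<epsilon>}"
  using pos_or_neg[OF al] not_pos_neg[of al] not_pos_neg[of "- al"] by (auto simp: \<epsilon>_def)
 have "cox al = w \<epsilon> * ka \<epsilon> + (SUM be:?P. w be * ka be)"
  unfolding cox_def eps(2) w_def ka_def by (rule sum.remove[OF finite_pos eps(1)])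
 then have C1: "(SUM be:?P. w be * ka be) = cox al - 2" using w1 by (simp add: \<epsilon>_def wneg kneg split: if_splits)
 have "ht al = w \<epsilon> + (SUM be:?P. w be)"
  unfolding ht_def eps(2) w_def by (rule sum.remove[OF finite_pos eps(1)])
 then have C2: "(SUM be:?P. w be) = ht al - (if al : pos then 1 else -1)" using w1 by (simp add: \<epsilon>_def wneg split: if_splits)
 show "(SUM f:inversions ?a. (al <.> fst f) / (fst f <.> fst f)) = real_of_int M * (cox al - 2) + ht al - (if al : pos then 1 else -1)"
  using S S1 S2 S3 C1 C2 by (simp add: w_def)
qed

end

section \<open>Ideal arrangements\<close>

text \<open>Finite arrangements are placed in the space of the cone with a dummy last coordinate, so
  that the local and the global statements speak about the same space.\<close>

definition emb :: "real^'n => (real^'n) \<times> real" where "emb x = (x, 0)"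

lemma emb_simps [simp]: "fst (emb x) = x" "snd (emb x) = 0" "emb x <.> y = x <.> fst y" "y <.> emb x = fst y <.> x"
 "emb x = emb z \<longleftrightarrow> x = z"
 by (auto simp: emb_def inner_prod_def)

lemma linear_emb: "linear emb"
 by (rule linearI) (simp_all add: emb_def)

lemma inj_emb: "inj_on emb X"
 by (auto simp: inj_on_def)

text \<open>The field whose quotient by Terao's polynomial is the constant 1, the input that
  \<open>free_basis_add\<close> needs.\<close>

definition unit_on :: "'e::euclidean_space set => 'e set => 'e set => 'e => bool" where
 "unit_on U A C a \<longleftrightarrow> (EX et:tangent_fields U A. ALL y. a <.> y = 0 --> a <.> et y = (PROD K:A - C. K <.> y))"

lemma tangent_fields_mono_range: "U \<subseteq> U' ==> tangent_fields U A \<subseteq> tangent_fields U' A"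
 unfolding tangent_fields_def by auto

lemma dim_kernel_ge:
 fixes W :: "'e::euclidean_space set"
 assumes W: "subspace W"
 shows "dim W <= dim {x:W. k <.> x = 0} + 1"
proof (cases "ALL x:W. k <.> x = 0")
 case True
 then have "{x:W. k <.> x = 0} = W" by auto
 then show ?thesis by simp
next
 case False
 let ?Z = "{x:W. k <.> x = 0}"
 obtain w where w: "w : W" "k <.> w ~= 0" using False by blast
 have "W \<subseteq> span (insert w ?Z)"
 proof
  fix x assume x: "x : W"
  let ?t = "(k <.> x) / (k <.> w)"
  have "x - ?t *R w : ?Z" using x w W by (auto simp: subspace_diff subspace_scale inner_diff_right)
  then have "x - ?t *R w : span (insert w ?Z)" by (intro span_base) auto
  moreover have "?t *R w : span (insert w ?Z)" by (intro span_scale span_base) auto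
  ultimately have "(x - ?t *R w) + ?t *R w : span (insert w ?Z)" by (rule span_add)
  then show "x : span (insert w ?Z)" by simp
 qed
 then have "dim W <= dim (insert w ?Z)" using dim_subset[of W "span (insert w ?Z)"] by simp
 also have "... <= dim ?Z + 1" by (simp add: dim_insert)
 finally show ?thesis .
qed

text \<open>Starting point of both inductions: when all normals vanish on \<open>U\<close>, an
  orthonormal basis of \<open>U\<close> gives constant basis fields.\<close>

lemma constant_basis:
 fixes U :: "'e::euclidean_space set"
 assumes U: "subspace U" and A: "!!K u. K : A ==> u : U ==> K <.> u = 0"
 shows "EX (I::nat set) th. free_basis U A I (%_. 0) th & card I = dim U"
proof -
 obtain B where B: "B \<subseteq> U" "pairwise orthogonal B" "!!x. x : B ==> norm x = 1" "independent B" "card B = dim U" "span B = U"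
  using orthonormal_basis_subspace[OF U] by metis
 have finB: "finite B" using B(4) independent_imp_finite by blast
 obtain f :: "nat => 'e" where f: "bij_betw f {0..<card B} B" using ex_bij_betw_nat_finite[OF finB] by blast
 let ?I = "{0..<card B}"
 have fB: "f i : B" if "i : ?I" for i using f that by (auto simp: bij_betw_def)
 have orth: "f i <.> f j = (if i = j then 1 else 0)" if "i : ?I" "j : ?I" for i j
 proof (cases "i = j")
  case True
  then show ?thesis using B(3)[OF fB[OF that(1)]] by (simp add: dot_square_norm)
 next
  case False
  then have "f i ~= f j" using f that by (auto simp: bij_betw_def inj_on_def)
  then show ?thesis using False B(2) fB[OF that(1)] fB[OF that(2)] by (auto simp: pairwise_def orthogonal_def)
 qed
 have expand: "(SUM i:?I. (f i <.> x) *R f i) = x" if "x : U" for x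
 proof -
  have "(SUM i:?I. (f i <.> x) *R f i) = (SUM b:B. (b <.> x) *R b)"
   by (rule sum.reindex_bij_betw[OF f])
  also have "... = x" using orthonormal_basis_expand[OF B(2,3) _ finB, of x] that B(6) by (simp add: inner_commute)
  finally show ?thesis .
 qed
 have "free_basis U A ?I (%_. 0) (%i x. f i)"
  unfolding free_basis_def
 proof (intro conjI ballI allI impI)
  fix i assume "i : ?I"
  then have fU: "f i : U" using fB B(1) by blast
  show "(%x. f i) : tangent_fields U A"
   by (rule tangent_fieldsI) (use fU A in \<open>auto intro: rpoly_const\<close>)
 next
  fix et assume et: "et : tangent_fields U A"
  show "EX g. (ALL i:?I. rpoly (g i)) & (ALL x. et x = (SUM i:?I. g i x *R f i))"
   by (rule exI[of _ "%i x. f i <.> et x"]) (simp add: tangent_fieldsD(4)[OF et] expand[OF tangent_fieldsD(2)[OF et]])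
 next
  fix g i x assume 0: "ALL x. (SUM i:?I. g i x *R f i) = 0" and i: "i : ?I"
  have "0 = f i <.> (SUM j:?I. g j x *R f j)" using 0 by simp
  also have "... = (SUM j:?I. if j = i then g i x else 0)"
   unfolding inner_sum_right by (rule sum.cong) (use orth[OF i] in auto)
  also have "... = g i x" using i by simp
  finally show "g i x = 0" by simp
 qed simp_all
 moreover have "card ?I = dim U" using B(5) by simp
 ultimately show ?thesis by blast
qed

text \<open>Through a point of the kernel of \<open>a\<close>, a class modulo \<open>a\<close>
  passes either entirely or not at all, so localisation keeps its representative.\<close>

lemma transversal_local:
 assumes A: "arr (insert a A)" "a ~: A" and C: "transversal A C a" and x: "a <.> x = 0"
 shows "transversal {K:A. K <.> x = 0} {K:C. K <.> x = 0} a"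
proof -
 have CA: "C \<subseteq> A" using C by (simp add: transversal_def)
 have "EX c:{K:C. K <.> x = 0}. K : span {a, c}" if K: "K : A" "K <.> x = 0" for K
 proof -
  obtain c where c: "c : C" "K : span {a, c}" using C K unfolding transversal_def by blast
  have "c : span {a, K}" using arr_class_sym[OF A K(1) _ c(2)] c CA by blast
  then obtain u v where "c = u *R a + v *R K" by (rule span_pairE)
  then have "c <.> x = 0" using x K by (simp add: inner_add_left)
  then show ?thesis using c by blast
 qed
 then show ?thesis using C unfolding transversal_def by blast
qed

section \<open>Order ideals of affine roots, level by level\<close>

context affine_sys
begin

text \<open>All levels below \<open>M\<close> are complete and level \<open>M\<close> carries the
  gradients \<open>Th\<close>. For natural \<open>m\<close>, \<open>stage m Ph\<close> and
  \<open>stage (m + 1) {}\<close> agree.\<close>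

definition stage :: "real => (real^'n) set => ((real^'n) \<times> real) set" where
 "stage M Th = {f:apos. snd f < M \<or> (snd f = M & fst f : Th)}"

definition lower :: "(real^'n) set => bool" where
 "lower Th \<longleftrightarrow> Th \<subseteq> Ph & (ALL be:Th. ALL ga:Ph. be - ga : conic_span pos --> ga : Th)"

lemma conic_apos:
 assumes "f : conic_span apos"
 shows "snd f >= 0 & (snd f = 0 --> fst f : conic_span pos)"
 using assms
proof (induction f rule: conic_span.induct)
 case conic_0
 then show ?case by (simp add: conic_span.conic_0)
next
 case (conic_step f t g)
 have s: "snd f >= 0" using apos_snd_nonneg conic_step by blast
 have 1: "snd (t *R f + g) >= 0" using s conic_step by simp
 have "fst (t *R f + g) : conic_span pos" if "snd (t *R f + g) = 0"
 proof -
  have ts: "t * snd f >= 0" using s conic_step by simp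
  moreover have "snd g >= 0" "t * snd f + snd g = 0" using that conic_step by auto
  ultimately have g0: "snd g = 0" and tf: "t * snd f = 0" by linarith+
  then have gc: "fst g : conic_span pos" using conic_step by blast
  show ?thesis
  proof (cases "t = 0")
   case True
   then show ?thesis using gc by simp
  next
   case False
   then have "snd f = 0" using tf by simp
   then have "fst f : pos" using conic_step(1) by (auto simp: apos_def pos_def)
   then show ?thesis using gc conic_step by (simp add: conic_span.conic_step)
  qed
 qed
 then show ?case using 1 by blast
qed

text \<open>Levels of positive affine roots are nonnegative, so a smaller root has a smaller level
  or the same level; in the second case the difference involves only roots of level zero, where the
  finite order decides.\<close>

lemma stage_ideal:
 assumes Th: "lower Th"
 shows "order_ideal_in apos (stage M Th)"
 unfolding order_ideal_in_def
proof (intro conjI ballI impI)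
 show "stage M Th \<subseteq> apos" by (auto simp: stage_def)
 fix f g assume f: "f : stage M Th" and g: "g : apos" and c: "f - g : conic_span apos"
 have ca: "snd g <= snd f" "snd f = snd g ==> fst f - fst g : conic_span pos" using conic_apos[OF c] by auto
 show "g : stage M Th"
 proof (cases "snd g < M")
  case False
  then have e: "snd g = M" "snd f = M" "fst f : Th" using f ca(1) by (auto simp: stage_def)
  then have "fst f - fst g : conic_span pos" using ca(2) by simp
  then have "fst g : Th" using Th e(3) g unfolding lower_def apos_def by blast
  then show ?thesis using g e by (simp add: stage_def)
 qed (use g in \<open>simp add: stage_def\<close>)
qed

lemma insert_stage: "(al, M) : apos ==> insert (al, M) (stage M Th) = stage M (insert al Th)"
 by (auto simp: stage_def)

lemma lower_ideal:
 assumes "order_ideal_in pos J"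
 shows "lower (J Un uminus ` pos)"
 unfolding lower_def
proof (intro conjI ballI impI)
 show "J Un uminus ` pos \<subseteq> Ph" using assms pos_root by (auto simp: order_ideal_in_def)
 fix be ga assume b: "be : J Un uminus ` pos" and g: "ga : Ph" and c: "be - ga : conic_span pos"
 show "ga : J Un uminus ` pos"
 proof (cases "ga : pos")
  case True
  have "c <.> (be - ga) >= 0"
   by (rule conic_nonneg[where f="%x. c <.> x", OF c]) (auto simp: pos_def bounded_linear.linear[OF bounded_linear_inner_right])
  then have "c <.> be > 0" using True by (simp add: inner_diff_right pos_def)
  then have "be : J" using b by (auto simp: pos_def)
  then show ?thesis using assms True c unfolding order_ideal_in_def by blast
 next
  case False
  then have "- ga : pos" using pos_or_neg[OF g] by blast
  then show ?thesis by (metis UnI2 imageI minus_minus)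
 qed
qed

lemma stage_zero:
 assumes "J \<subseteq> pos"
 shows "stage 0 (J Un uminus ` pos) = emb ` J"
proof (intro equalityI subsetI)
 fix f assume f: "f : stage 0 (J Un uminus ` pos)"
 then have f': "f : apos" "snd f = 0" "fst f : J Un uminus ` pos" using apos_snd_nonneg[of f] by (auto simp: stage_def)
 then have "fst f : pos" by (auto simp: apos_def pos_def)
 then have "fst f : J" using f'(3) not_pos_neg by fastforce
 moreover have "f = emb (fst f)" using f'(2) by (simp add: emb_def prod_eq_iff)
 ultimately show "f : emb ` J" by blast
next
 fix f assume "f : emb ` J"
 then show "f : stage 0 (J Un uminus ` pos)" using assms by (auto simp: stage_def emb_def apos_def pos_def)
qed

end

section \<open>Ideal arrangements of finite root systems\<close>

context root_sys
begin

text \<open>Scaling \<open>c\<close> by a large factor keeps the positive system and makes the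
  affine counting lemmas available.\<close>

lemma normalize_exists: "EX c'. affine_sys Ph c' & root_sys.pos Ph c' = pos"
proof -
 define B where "B = 1 + (SUM be:Ph. \<bar>c <.> be\<bar>)"
 have B1: "B >= 1" unfolding B_def by (simp add: sum_nonneg)
 have lt: "\<bar>c <.> a\<bar> < B" if "a : Ph" for a
  unfolding B_def using member_le_sum[of a Ph "%be. \<bar>c <.> be\<bar>"] that fin by auto
 interpret N: root_sys Ph "(1 / B) *R c"
 proof (rule sub_root_sys)
  show "((1 / B) *R c) <.> a ~= 0" if "a : Ph" for a using reg[OF that] B1 by simp
 qed (simp_all add: refl)
 have "affine_sys Ph ((1 / B) *R c)"
  by unfold_locales (use lt B1 in \<open>auto simp: field_simps\<close>)
 moreover have "N.pos = pos" unfolding N.pos_def pos_def using B1 by (auto simp: zero_less_divide_iff)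
 ultimately show ?thesis by blast
qed

lemma pos_nonproportional:
 assumes "a : pos" "b : pos" "a ~= b"
 shows "a ~: span {b}"
 using proportional_eq[OF assms(1,2)] assms(3) by (auto simp: span_singleton)

lemma arr_emb:
 assumes "J \<subseteq> pos"
 shows "arr (emb ` J)"
 unfolding arr_def
proof (intro conjI ballI impI)
 show "finite (emb ` J)" using assms finite_pos finite_subset by blast
 show "0 ~: emb ` J" using assms pos_root root_nz by (force simp: emb_def zero_prod_def)
 fix K L assume "K : emb ` J" "L : emb ` J" "K : span {L}"
 then obtain a b t where ab: "K = emb a" "L = emb b" "a : J" "b : J" "emb a = t *R emb b" by (auto simp: span_singleton)
 then have "a = t *R b" by (simp add: emb_def)
 moreover have "a : pos" "b : pos" using ab(3,4) assms by auto
 ultimately have "a = b" using proportional_eq by blast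
 then show "K = L" using ab(1,2) by simp
qed

lemma central_count:
 assumes J: "order_ideal_in pos J" and a: "a : pos" "a ~: J" "order_ideal_in pos (insert a J)"
  and C: "transversal (emb ` J) C (emb a)"
 shows "real (card (emb ` J - C)) = ht a - 1"
proof -
 obtain c' where c': "affine_sys Ph c'" "root_sys.pos Ph c' = pos" using normalize_exists by blast
 interpret N: affine_sys Ph c' by (rule c'(1))
 have P: "N.pos = pos" by (rule c'(2))
 have H: "N.ht = ht" unfolding N.ht_def[abs_def] ht_def[abs_def] P ..
 have Jp: "J \<subseteq> pos" using order_ideal_inD(1)[OF J] .
 let ?a = "(a, real_of_int 0)"
 have aa: "?a : N.apos" unfolding N.apos_int_iff using a P pos_root by simp
 have B: "order_ideal_in N.apos (emb ` J)"
  using N.stage_ideal[OF N.lower_ideal, of J 0] J N.stage_zero[of J] Jp P by simp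
 have B': "order_ideal_in N.apos (insert ?a (emb ` J))"
  using N.stage_ideal[OF N.lower_ideal, of "insert a J" 0] a N.stage_zero[of "insert a J"] Jp P by (simp add: emb_def)
 have np: "{f:emb ` J. fst f ~: span {fst ?a}} = emb ` J"
 proof -
  have "x ~: span {a}" if "x : J" for x using pos_nonproportional[of x a] that Jp a(1,2) by blast
  then show ?thesis by (intro equalityI subsetI) (auto simp del: Collect_mem_eq elim!: imageE)
 qed
 have "real (card ({f:emb ` J. fst f ~: span {fst ?a}} - C)) = (SUM f:N.inversions ?a. (fst ?a <.> fst f) / (fst f <.> fst f))"
 proof (rule N.nonparallel_count[OF B _ aa _ B'])
  show "finite (emb ` J)" using Jp finite_pos finite_subset by blast
  show "?a ~: emb ` J" using a(2) by (auto simp: emb_def)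
  show "transversal {f:emb ` J. fst f ~: span {fst ?a}} C ?a" using C unfolding np by (simp add: emb_def)
  show "finite (N.inversions ?a)" by (rule N.inversions_sum(1)[OF aa])
 qed
 also have "... = ht a - 1" using N.inversions_sum(2)[OF aa] a P H by simp
 finally show ?thesis unfolding np .
qed

text \<open>The exponents form the partition dual to the numbers of roots of each height in the
  ideal.\<close>

definition ideal_exponents :: "(real^'n) set => bool" where
 "ideal_exponents J \<longleftrightarrow> (EX (I::nat set) e th. free_basis (emb ` span Ph) (emb ` J) I e th & card I = dim Ph &
   (ALL t>=1. card {i:I. e i >= t} = card (J Int level t)))"

definition ideal_units :: bool where
 "ideal_units \<longleftrightarrow> (ALL J a C. order_ideal_in pos J --> a : pos --> a ~: J --> order_ideal_in pos (insert a J) -->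
   transversal (emb ` J) C (emb a) --> unit_on (emb ` span Ph) (emb ` J) C (emb a))"

lemma subspace_emb_span: "subspace (emb ` span Ph)"
 by (rule linear_subspace_image[OF linear_emb]) simp

lemma dim_emb_span: "dim (emb ` span Ph) = dim Ph"
 using dim_image_eq[OF linear_emb inj_emb, of "span Ph"] by simp

text \<open>The component of \<open>s\<close> orthogonal to the other simple roots,
  rescaled.\<close>

lemma fundamental_coweight:
 assumes s: "s : base"
 shows "EX w:span Ph. s <.> w = 1 & (ALL t:base - {s}. t <.> w = 0)"
proof -
 have ns: "s ~: span (base - {s})" using base_independent s unfolding dependent_def by blast
 obtain y z where yz: "y : span (base - {s})" "!!w. w : span (base - {s}) ==> orthogonal z w" "s = y + z"
  using orthogonal_subspace_decomp_exists[of "base - {s}" s] by metis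
 have z0: "z ~= 0" using yz ns by auto
 have "y <.> z = 0" using yz(1,2) by (simp add: orthogonal_def inner_commute)
 then have sz: "s <.> z = z <.> z" using yz(3) by (simp add: inner_add_left)
 have "y : span base" using yz(1) span_mono[of "base - {s}" base] by blast
 then have "s - y : span base" using s span_base[of s base] by (intro span_diff)
 then have "z : span Ph" using yz(3) by (simp add: span_base_eq)
 then have "(1 / (z <.> z)) *R z : span Ph" by (rule span_scale)
 moreover have "t <.> z = 0" if "t : base - {s}" for t using yz(2)[OF span_base[OF that]] by (simp add: orthogonal_def inner_commute)
 ultimately show ?thesis using sz z0 by (intro bexI[of _ "(1 / (z <.> z)) *R z"]) auto
qed

text \<open>For a simple root the constant field given by its fundamental coweight works. For larger
  height, the local fields come from the proper subsystem of roots vanishing at the point, and the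
  number of exponents exceeding the degree is below the number of roots of that height, which is
  itself below the rank.\<close>

lemma central_unit:
 assumes IH: "!!Ps. Ps \<subset> Ph ==> root_sys Ps c ==> root_sys.ideal_units Ps c"
  and ex: "ideal_exponents J"
  and J: "order_ideal_in pos J" and a: "a : pos" "a ~: J" "order_ideal_in pos (insert a J)"
  and C: "transversal (emb ` J) C (emb a)"
 shows "unit_on (emb ` span Ph) (emb ` J) C (emb a)"
proof -
 let ?U = "emb ` span Ph" and ?A = "emb ` J"
 have Jp: "J \<subseteq> pos" using order_ideal_inD(1)[OF J] .
 obtain t where t: "t >= 1" "ht a = real t" using ht_pos[OF a(1)] by blast
 have cnt: "card (?A - C) = t - 1" using central_count[OF J a C] t by linarith
 have A: "arr (insert (emb a) ?A)" using arr_emb[of "insert a J"] Jp a by simp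
 have aA: "emb a ~: ?A" using a by auto
 show ?thesis
 proof (cases "t = 1")
  case True
  have ab: "a : base" using t a True by (simp add: base_iff_level level_def)
  obtain w where w: "w : span Ph" "a <.> w = 1" "!!s. s : base - {a} ==> s <.> w = 0" using fundamental_coweight[OF ab] by blast
  have wJ: "be <.> w = 0" if b: "be : J" for be
  proof -
   obtain n where n: "be = (SUM s:base. real (n s) *R s)" using pos_combination b Jp by blast
   \<comment> \<open>A root of the ideal that involves \<open>a\<close> would dominate
     \<open>a\<close> and force it into the ideal.\<close>
   have na: "n a = 0"
   proof (rule ccontr)
    assume "n a ~= 0"
    have "be - a = (SUM s:base. real (n s) *R s) - (SUM s:base. (if s = a then 1 else 0) *R s)"
     using ab finite_base n by (simp add: if_distrib[of "%u. u *R _"] sum.delta cong: if_cong)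
    also have "... = (SUM s:base. (real (n s) - (if s = a then 1 else 0)) *R s)"
     by (simp only: scaleR_diff_left sum_subtractf)
    also have "... : conic_span pos"
     by (intro conic_sum conic_scale conic_base base_pos) (use \<open>n a ~= 0\<close> in auto)
    finally show False using order_ideal_inD(2)[OF J b a(1)] a(2) by blast
   qed
   have "be <.> w = (SUM s:base. real (n s) * (s <.> w))" by (subst n) (simp add: inner_sum_left)
   also have "... = 0" using w(3) na by (intro sum.neutral) (metis DiffI mult_zero_left mult_zero_right of_nat_0 singletonD)
   finally show ?thesis .
  qed
  have "?A - C = {}" using cnt True arrD(1)[OF A] by simp
  then have "(PROD K:?A - C. K <.> y) = 1" for y by (simp only: prod.empty)
  moreover have "(%x. emb w) : tangent_fields ?U ?A"
   by (rule tangent_fieldsI) (use w wJ in \<open>auto intro: rpoly_const\<close>)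
  ultimately show ?thesis unfolding unit_on_def using w by (intro bexI[of _ "%x. emb w"]) auto
 next
  case False
  then have t2: "t >= 2" using t by simp
  obtain I :: "nat set" and e th where b: "free_basis ?U ?A I e th" "card I = dim Ph"
   "!!t. t >= 1 ==> card {i:I. e i >= t} = card (J Int level t)" using ex unfolding ideal_exponents_def by blast
  interpret ad: addition ?U ?A C "emb a" I e th "t - 1"
   by unfold_locales (use subspace_emb_span A aA C b cnt in auto)
  have "EX et:tangent_fields ?U ?A. ALL y. emb a <.> y = 0 --> emb a <.> et y = (PROD K:?A - C. K <.> y)"
  proof (rule ad.local_to_global[of ?U])
   show "subspace ?U" by (rule subspace_emb_span)
   have "{i:I. t - 1 < e i} = {i:I. t <= e i}" using t by auto
   then have "card {i:I. t - 1 < e i} = card (J Int level t)" using b(3)[OF t(1)] by simp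
   \<comment> \<open>One unit is gained here because \<open>a\<close> itself is outside the ideal;
     together with the strict bound on the level it compensates the dimension lost by passing to the
     hyperplane.\<close>
   moreover have "card (insert a (J Int level t)) <= card (level t)"
    using a t finite_level by (intro card_mono) (auto simp: level_def)
   then have "card (J Int level t) + 1 <= card (level t)" using a finite_level by simp
   moreover have "card (level t) < dim Ph" using card_level_less[OF _ t2] a pos_root by blast
   moreover have "dim Ph <= dim {x:?U. emb a <.> x = 0} + 1" using dim_kernel_ge[OF subspace_emb_span] dim_emb_span by metis
   ultimately show "card {i:I. t - 1 < e i} < dim {x:?U. emb a <.> x = 0}" by linarith
  next
   fix x assume x: "x : ?U" "emb a <.> x = 0" "x ~= 0"
   then obtain v where v: "v : span Ph" "x = emb v" "v ~= 0" by (auto simp: emb_def zero_prod_def)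
   define Ps where "Ps = {be:Ph. be <.> v = 0}"
   have "Ps ~= Ph"
   proof
    assume "Ps = Ph"
    then have "Ph \<subseteq> {y. v <.> y = 0}" by (auto simp: Ps_def inner_commute)
    then have "span Ph \<subseteq> {y. v <.> y = 0}" by (rule span_minimal) (rule subspace_hyperplane)
    then show False using v by auto
   qed
   then have ss: "Ps \<subset> Ph" by (auto simp: Ps_def)
   interpret Q: root_sys Ps c
   proof (rule sub_root_sys)
    show "refl_root a b : Ps" if "a : Ps" "b : Ps" for a b
     using that refl[of a b] by (simp add: Ps_def refl_root_inner)
   qed (use ss reg in auto)
   have Qp: "Q.pos = pos Int Ps" unfolding Q.pos_def pos_def using ss by blast
   have idl: "order_ideal_in Q.pos (X Int Ps)" if X: "order_ideal_in pos X" for X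
    unfolding order_ideal_in_def
   proof (intro conjI ballI impI)
    show "X Int Ps \<subseteq> Q.pos" using order_ideal_inD(1)[OF X] Qp by blast
    fix be ga assume bg: "be : X Int Ps" "ga : Q.pos" "be - ga : conic_span Q.pos"
    have "be - ga : conic_span pos"
     by (rule conic_mono[OF linear_ident _ bg(3), of pos]) (use Qp conic_base in blast)
    then show "ga : X Int Ps" using order_ideal_inD(2)[OF X, of be ga] bg Qp by blast
   qed
   have aP: "a : Ps" using x v a pos_root by (simp add: Ps_def)
   have eqA: "{K:?A. K <.> x = 0} = emb ` (J Int Ps)" using v Jp pos_root by (auto simp: Ps_def)
   have "unit_on (emb ` span Ps) (emb ` (J Int Ps)) {K:C. K <.> x = 0} (emb a)"
   proof -
    have 1: "order_ideal_in Q.pos (J Int Ps)" by (rule idl[OF J])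
    have "insert a (J Int Ps) = insert a J Int Ps" using aP by auto
    then have 2: "order_ideal_in Q.pos (insert a (J Int Ps))" using idl[OF a(3)] by simp
    have 3: "transversal (emb ` (J Int Ps)) {K:C. K <.> x = 0} (emb a)"
     using transversal_local[OF A aA C x(2)] unfolding eqA .
    show ?thesis using IH[OF ss Q.root_sys_axioms] 1 2 3 a aP unfolding Q.ideal_units_def Qp by blast
   qed
   then obtain et where et: "et : tangent_fields (emb ` span Ps) (emb ` (J Int Ps))"
    "ALL y. emb a <.> y = 0 --> emb a <.> et y = (PROD K:emb ` (J Int Ps) - {K:C. K <.> x = 0}. K <.> y)"
    unfolding unit_on_def by blast
   have "emb ` span Ps \<subseteq> ?U" using span_mono[of Ps Ph] ss by blast
   then have "et : tangent_fields ?U {K:?A. K <.> x = 0}"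
    using et(1) tangent_fields_mono_range unfolding eqA by blast
   moreover have "emb ` (J Int Ps) - {K:C. K <.> x = 0} = {K:?A - C. K <.> x = 0}" unfolding eqA[symmetric] by auto
   ultimately show "EX et:tangent_fields ?U {K:?A. K <.> x = 0}. ALL y. emb a <.> y = 0 --> emb a <.> et y = (PROD K:{K:?A - C. K <.> x = 0}. K <.> y)"
    using et(2) by auto
  qed
  then show ?thesis unfolding unit_on_def .
 qed
qed

text \<open>Terao's polynomial has degree \<open>t - 1\<close> for a root of height
  \<open>t\<close>, so one exponent moves from \<open>t - 1\<close> to \<open>t\<close>, exactly as
  adding a box at height \<open>t\<close> changes the dual partition.\<close>

lemma ideal_exponents_insert:
 assumes ex: "ideal_exponents J" and J: "order_ideal_in pos J" and a: "a : pos" "a ~: J" "order_ideal_in pos (insert a J)"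
  and un: "!!C. transversal (emb ` J) C (emb a) ==> unit_on (emb ` span Ph) (emb ` J) C (emb a)"
 shows "ideal_exponents (insert a J)"
proof -
 let ?U = "emb ` span Ph" and ?A = "emb ` J"
 have Jp: "J \<subseteq> pos" using order_ideal_inD(1)[OF J] .
 obtain t where t: "t >= 1" "ht a = real t" using ht_pos[OF a(1)] by blast
 have A: "arr (insert (emb a) ?A)" using arr_emb[of "insert a J"] Jp a by simp
 have aA: "emb a ~: ?A" using a by auto
 obtain C where C: "transversal ?A C (emb a)" using transversal_exists[OF A aA] by blast
 have cnt: "card (?A - C) = t - 1" using central_count[OF J a C] t by linarith
 obtain I :: "nat set" and e th where b: "free_basis ?U ?A I e th" "card I = dim Ph"
  "!!t. t >= 1 ==> card {i:I. e i >= t} = card (J Int level t)" using ex unfolding ideal_exponents_def by blast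
 interpret ad: addition ?U ?A C "emb a" I e th "t - 1"
  by unfold_locales (use subspace_emb_span A aA C b cnt in auto)
 obtain et where "et : tangent_fields ?U ?A" "ALL y. emb a <.> y = 0 --> emb a <.> et y = (PROD K:?A - C. K <.> y)"
  using un[OF C] unfolding unit_on_def by blast
 then obtain i th' where i: "i : I" "e i = t - 1" "free_basis ?U (insert (emb a) ?A) I (e(i := Suc (t - 1))) th'"
  using ad.free_basis_add by blast
 have finI: "finite I" using free_basisD(1)[OF b(1)] .
 have "card {k:I. (e(i := t)) k >= s} = card (insert a J Int level s)" if s: "s >= 1" for s
 proof (cases "s = t")
  case True
  have "{k:I. (e(i := t)) k >= s} = insert i {k:I. e k >= s}" using i True by auto
  moreover have "i ~: {k:I. e k >= s}" using i True t by auto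
  ultimately have "card {k:I. (e(i := t)) k >= s} = Suc (card {k:I. e k >= s})" using finI by simp
  also have "... = Suc (card (J Int level s))" using b(3)[OF s] by simp
  also have "... = card (insert a (J Int level s))" using a finite_level by simp
  also have "insert a (J Int level s) = insert a J Int level s" using t a True by (auto simp: level_def)
  finally show ?thesis .
 next
  case False
  have "{k:I. (e(i := t)) k >= s} = {k:I. e k >= s}" using i False t by auto
  moreover have "insert a J Int level s = J Int level s" using t False by (auto simp: level_def)
  ultimately show ?thesis using b(3)[OF s] by simp
 qed
 moreover have "Suc (t - 1) = t" using t by simp
 ultimately show ?thesis unfolding ideal_exponents_def using i(3) b(2) by (intro exI[of _ I] exI[of _ "e(i := t)"] exI[of _ th']) simp
qed

lemma ideal_exponents_empty: "ideal_exponents {}"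
proof -
 obtain I :: "nat set" and th where "free_basis (emb ` span Ph) (emb ` {}) I (%_. 0) th" "card I = dim (emb ` span Ph)"
  using constant_basis[OF subspace_emb_span, of "emb ` {}"] by auto
 then show ?thesis unfolding ideal_exponents_def dim_emb_span
  by (intro exI[of _ I] exI[of _ "%_. 0"] exI[of _ th]) auto
qed

lemma conic_ht_zero:
 assumes "x : conic_span pos"
 shows "ht x = 0 ==> x = 0"
 using assms
proof (induction x rule: conic_span.induct)
 case (conic_step x t y)
 have x1: "ht x >= 1" and y0: "ht y >= 0" using ht_pos_ge1 ht_conic conic_step by blast+
 have "t * ht x + ht y = 0"
  using conic_step(5) by (simp add: linear_add[OF linear_ht] linear_scale[OF linear_ht])
 moreover have "t * ht x >= 0" using x1 conic_step(2) by simp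
 ultimately have "t * ht x = 0" "ht y = 0" using y0 by linarith+
 then show ?case using x1 conic_step(4) by auto
qed simp

text \<open>A root of maximal height can be taken away: whatever lies above it in the ideal has the
  same height and therefore coincides with it.\<close>

lemma ideal_remove_max:
 assumes J: "order_ideal_in pos J" "J ~= {}"
 shows "EX a:J. order_ideal_in pos (J - {a})"
proof -
 have Jp: "J \<subseteq> pos" "finite J" using order_ideal_inD(1)[OF J(1)] finite_pos finite_subset by auto
 have "Max (ht ` J) : ht ` J" by (rule Max_in) (use J Jp in auto)
 then obtain a where a: "a : J" "ht a = Max (ht ` J)" by auto
 have amax: "ht b <= ht a" if "b : J" for b unfolding a(2) using that Jp by simp
 have "order_ideal_in pos (J - {a})"
  unfolding order_ideal_in_def
 proof (intro conjI ballI impI)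
  show "J - {a} \<subseteq> pos" using Jp by blast
  fix be ga assume b: "be : J - {a}" and g: "ga : pos" and c: "be - ga : conic_span pos"
  have "ga : J" using order_ideal_inD(2)[OF J(1)] b g c by blast
  moreover have "ga ~= a"
  proof
   assume ga: "ga = a"
   then have "ht (be - ga) <= 0" using amax[of be] b linear_diff[OF linear_ht, of be ga] by simp
   then have "be - ga = 0" using conic_ht_zero[OF c] ht_conic[OF c] by simp
   then have "be = a" using ga by simp
   then show False using b by blast
  qed
  ultimately show "ga : J - {a}" by blast
 qed
 then show ?thesis using a by blast
qed

end

text \<open>Two nested inductions: the fields for proper subsystems give the unit fields at points
  away from the origin, and the ideal is built up root by root. The vector \<open>c\<close> stays
  fixed because the subsystems inherit it.\<close>

theorem ideal_arrangements_free:
 assumes "root_sys Ph c"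
 shows "root_sys.ideal_units Ph c & (ALL J. order_ideal_in (root_sys.pos Ph c) J --> root_sys.ideal_exponents Ph c J)"
 using assms
proof (induction "card Ph" arbitrary: Ph rule: less_induct)
 case less
 interpret root_sys Ph c by (rule less.prems)
 have IH: "root_sys.ideal_units Ps c" if "Ps \<subset> Ph" "root_sys Ps c" for Ps
  using less.hyps[OF psubset_card_mono[OF fin that(1)] that(2)] by blast
 have unit: "unit_on (emb ` span Ph) (emb ` J) C (emb a)"
  if "ideal_exponents J" "order_ideal_in pos J" "a : pos" "a ~: J" "order_ideal_in pos (insert a J)" "transversal (emb ` J) C (emb a)" for J a C
  using central_unit[OF IH that] .
 have ex: "ideal_exponents J" if "order_ideal_in pos J" for J
  using that
 proof (induction "card J" arbitrary: J)
  case 0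
  then have "J = {}" using order_ideal_inD(1)[OF 0(2)] finite_pos finite_subset by fastforce
  then show ?case using ideal_exponents_empty by simp
 next
  case (Suc n)
  then have "J ~= {}" by auto
  then obtain a where a: "a : J" "order_ideal_in pos (J - {a})" using ideal_remove_max[OF Suc(3)] by blast
  have fJ: "finite J" using Suc(2) card.infinite by fastforce
  have ap: "a : pos" using a order_ideal_inD(1)[OF Suc(3)] by blast
  have e: "ideal_exponents (J - {a})" using Suc(1)[OF _ a(2)] Suc(2) a(1) fJ by simp
  have ins: "insert a (J - {a}) = J" using a by blast
  have "ideal_exponents (insert a (J - {a}))"
   by (rule ideal_exponents_insert[OF e a(2) ap]) (use unit[OF e a(2) ap] Suc(3) ins in auto)
  then show ?case using ins by simp
 qed
 have "ideal_units" unfolding ideal_units_def using unit ex by blast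
 then show ?case using ex by blast
qed

section \<open>Evaluating polynomial functions at complex points\<close>

definition re_vec :: "complex^'n => real^'n" where "re_vec z = (\<chi> i. Re (z $ i))"
definition im_vec :: "complex^'n => real^'n" where "im_vec z = (\<chi> i. Im (z $ i))"

definition line_poly :: "(real^'n => real) => complex^'n => complex poly => bool" where
 "line_poly f z p \<longleftrightarrow> (ALL t. complex_of_real (f (re_vec z + t *R im_vec z)) = poly p (complex_of_real t))"

text \<open>Polynomial functions are evaluated at a complex point through the univariate polynomial
  on the real line \<open>re + t im\<close>, at \<open>t = i\<close>; the polynomial is determined
  because it is known at all real \<open>t\<close>.\<close>

definition cev :: "(real^'n => real) => complex^'n => complex" where
 "cev f z = poly (SOME p. line_poly f z p) \<i>"

definition cvec :: "real^'n => complex^'n" where "cvec x = (\<chi> i. complex_of_real (x $ i))"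

text \<open>The complex bilinear extension of the inner product, without conjugation.\<close>

definition cdot :: "real^'n => complex^'n => complex" where
 "cdot a z = (SUM i:UNIV. complex_of_real (a $ i) * z $ i)"

definition cev_field :: "(real^'n => real^'n) => complex^'n => complex^'n" where
 "cev_field et z = (\<chi> i. cev (%v. et v $ i) z)"

text \<open>The complexification of a real linear map, acting on real and imaginary parts.\<close>

definition cmap :: "(real^'n => real^'n) => complex^'n => complex^'n" where
 "cmap T z = (\<chi> i. Complex (T (re_vec z) $ i) (T (im_vec z) $ i))"

lemma line_poly_exists:
 assumes "rpoly f"
 shows "EX p. line_poly f z p"
 using assms unfolding line_poly_def
proof (induction f rule: real_polynomial_function.induct)
 case (linear f)
 then have "ALL t. complex_of_real (f (re_vec z + t *R im_vec z)) = poly [:complex_of_real (f (re_vec z)), complex_of_real (f (im_vec z)):] (complex_of_real t)"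
  by (simp add: bounded_linear.linear linear_add linear_scale)
 then show ?case by (rule exI)
next
 case (const c)
 have "ALL t::real. complex_of_real c = poly [:complex_of_real c:] (complex_of_real t)" by simp
 then show ?case by (rule exI)
next
 case (add f g)
 then obtain p q where "ALL t. complex_of_real (f (re_vec z + t *R im_vec z)) = poly p (complex_of_real t)"
  "ALL t. complex_of_real (g (re_vec z + t *R im_vec z)) = poly q (complex_of_real t)" by blast
 then have "ALL t. complex_of_real (f (re_vec z + t *R im_vec z) + g (re_vec z + t *R im_vec z)) = poly (p + q) (complex_of_real t)" by simp
 then show ?case by (rule exI)
next
 case (mult f g)
 then obtain p q where "ALL t. complex_of_real (f (re_vec z + t *R im_vec z)) = poly p (complex_of_real t)"
  "ALL t. complex_of_real (g (re_vec z + t *R im_vec z)) = poly q (complex_of_real t)" by blast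
 then have "ALL t. complex_of_real (f (re_vec z + t *R im_vec z) * g (re_vec z + t *R im_vec z)) = poly (p * q) (complex_of_real t)" by simp
 then show ?case by (rule exI)
qed

lemma line_poly_unique:
 assumes "line_poly f z p" "line_poly f z q"
 shows "p = q"
proof (rule ccontr)
 assume "p ~= q"
 then have "finite {x. poly (p - q) x = 0}" by (intro poly_roots_finite) simp
 moreover have "range complex_of_real \<subseteq> {x. poly (p - q) x = 0}"
  using assms unfolding line_poly_def by auto
 ultimately have "finite (range complex_of_real)" by (rule rev_finite_subset)
 moreover have "inj complex_of_real" by (simp add: inj_def)
 ultimately show False using infinite_UNIV_char_0 finite_imageD by blast
qed

lemma cev_eq:
 assumes "line_poly f z p"
 shows "cev f z = poly p \<i>"
proof -
 have "line_poly f z (SOME p. line_poly f z p)" using assms by (rule someI)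
 then have "(SOME p. line_poly f z p) = p" using assms by (rule line_poly_unique)
 then show ?thesis by (simp add: cev_def)
qed

lemma cev_add: "rpoly f ==> rpoly g ==> cev (%x. f x + g x) z = cev f z + cev g z"
proof -
 assume "rpoly f" "rpoly g"
 then obtain p q where pq: "line_poly f z p" "line_poly g z q" using line_poly_exists by metis
 then have "line_poly (%x. f x + g x) z (p + q)" by (simp add: line_poly_def)
 from cev_eq[OF this] show ?thesis using cev_eq[OF pq(1)] cev_eq[OF pq(2)] by simp
qed

lemma cev_mult: "rpoly f ==> rpoly g ==> cev (%x. f x * g x) z = cev f z * cev g z"
proof -
 assume "rpoly f" "rpoly g"
 then obtain p q where pq: "line_poly f z p" "line_poly g z q" using line_poly_exists by metis
 then have "line_poly (%x. f x * g x) z (p * q)" by (simp add: line_poly_def)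
 from cev_eq[OF this] show ?thesis using cev_eq[OF pq(1)] cev_eq[OF pq(2)] by simp
qed

lemma cev_const: "cev (%x. c) z = complex_of_real c"
proof -
 have "line_poly (%x. c) z [:complex_of_real c:]" by (simp add: line_poly_def)
 then show ?thesis using cev_eq by fastforce
qed

lemma cev_sum: "(!!i. i : I ==> rpoly (f i)) ==> cev (%x. SUM i:I. f i x) z = (SUM i:I. cev (f i) z)"
proof (induction I rule: infinite_finite_induct)
 case (insert a I)
 then show ?case using cev_add[of "f a" "%x. SUM i:I. f i x" z] by (simp add: rpoly_sum)
qed (simp_all add: cev_const)

lemma cev_prod: "(!!i. i : I ==> rpoly (f i)) ==> cev (%x. PROD i:I. f i x) z = (PROD i:I. cev (f i) z)"
proof (induction I rule: infinite_finite_induct)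
 case (insert a I)
 then show ?case using cev_mult[of "f a" "%x. PROD i:I. f i x" z] by (simp add: rpoly_prod)
qed (simp_all add: cev_const)

lemma cev_power: "rpoly f ==> cev (%x. f x ^ n) z = cev f z ^ n"
proof (induction n)
 case (Suc n)
 then show ?case using cev_mult[of f "%x. f x ^ n" z] by (simp add: rpoly_power)
qed (simp add: cev_const)

lemma cev_inner: "cev (%x. a <.> x) z = cdot a z"
proof -
 have "line_poly (%x. a <.> x) z [:complex_of_real (a <.> re_vec z), complex_of_real (a <.> im_vec z):]"
  by (simp add: line_poly_def inner_add_right)
 then have "cev (%x. a <.> x) z = complex_of_real (a <.> re_vec z) + \<i> * complex_of_real (a <.> im_vec z)"
  using cev_eq by fastforce
 also have "... = (SUM i:UNIV. complex_of_real (a $ i) * z $ i)"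
  by (simp add: inner_vec_def re_vec_def im_vec_def sum_distrib_left flip: sum.distrib)
    (intro sum.cong refl, simp add: complex_eq_iff)
 finally show ?thesis by (simp add: cdot_def)
qed

lemma rpoly_component:
 assumes "polynomial_function (et :: real^'n => real^'n)"
 shows "rpoly (%v. et v $ i)" "rpoly (%v. a <.> et v)"
proof -
 show "rpoly (%v. a <.> et v)" for a using assms by (simp add: polynomial_function_inner_iff)
 from this[of "axis i 1"] show "rpoly (%v. et v $ i)" by (simp add: inner_axis inner_commute[of "axis i 1"])
qed

lemma cev_field_sum_scale:
 assumes f: "!!i. i : I ==> rpoly (f i)" and th: "!!i. i : I ==> polynomial_function (th i)"
 shows "cev_field (%v. SUM i:I. f i v *R th i v) z = (SUM i:I. cev (f i) z *s cev_field (th i) z)"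
proof -
 have "cev (%v. (SUM i:I. f i v *R th i v) $ k) z = (SUM i:I. cev (f i) z * cev (%v. th i v $ k) z)" for k
 proof -
  have "cev (%v. (SUM i:I. f i v *R th i v) $ k) z = cev (%v. SUM i:I. f i v * th i v $ k) z" by simp
  also have "... = (SUM i:I. cev (%v. f i v * th i v $ k) z)" by (rule cev_sum) (intro rpoly_mult f rpoly_component th)
  also have "... = (SUM i:I. cev (f i) z * cev (%v. th i v $ k) z)"
   by (intro sum.cong refl cev_mult f rpoly_component th)
  finally show ?thesis .
 qed
 then show ?thesis by (simp add: vec_eq_iff cev_field_def)
qed

lemma re_im_cmap: "re_vec (cmap T z) = T (re_vec z)" "im_vec (cmap T z) = T (im_vec z)"
 by (simp_all add: cmap_def re_vec_def im_vec_def vec_eq_iff)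

lemma cev_comp_linear:
 assumes "linear T"
 shows "cev (%v. f (T v)) z = cev f (cmap T z)"
 unfolding cev_def line_poly_def re_im_cmap using assms by (simp add: linear_add linear_scale)

lemma cmap_component:
 assumes T: "linear T"
 shows "cmap T z $ i = (SUM j:UNIV. complex_of_real (T (axis j 1) $ i) * z $ j)"
proof -
 have exp: "T x $ i = (SUM j:UNIV. x $ j * T (axis j 1) $ i)" for x
 proof -
  have "T x = T (SUM j:UNIV. x $ j *s axis j 1)" by (simp add: basis_expansion)
  also have "... = (SUM j:UNIV. x $ j *R T (axis j 1))" using T by (simp add: linear_sum linear_scale scalar_mult_eq_scaleR)
  finally show ?thesis by simp
 qed
 show ?thesis
  using exp[of "re_vec z"] exp[of "im_vec z"]
  by (simp add: cmap_def complex_eq_iff re_vec_def im_vec_def mult.commute)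
qed

lemma cev_field_comp_left:
 assumes T: "linear T" and et: "polynomial_function et"
 shows "cev_field (%v. T (et v)) z = cmap T (cev_field et z)"
proof -
 have "cev (%v. T (et v) $ i) z = (SUM j:UNIV. complex_of_real (T (axis j 1) $ i) * cev (%v. et v $ j) z)" for i
 proof -
  have e: "T x $ i = (SUM j:UNIV. T (axis j 1) $ i * x $ j)" for x
  proof -
   have "T x = T (SUM j:UNIV. x $ j *s axis j 1)" by (simp add: basis_expansion)
   also have "... = (SUM j:UNIV. x $ j *R T (axis j 1))" using T by (simp add: linear_sum linear_scale scalar_mult_eq_scaleR)
   finally show ?thesis by (simp add: mult.commute)
  qed
  have "cev (%v. T (et v) $ i) z = cev (%v. SUM j:UNIV. T (axis j 1) $ i * et v $ j) z"
   by (rule arg_cong[where f="%f. cev f z"], rule ext, rule e)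
  also have "... = (SUM j:UNIV. cev (%v. T (axis j 1) $ i * et v $ j) z)"
   by (rule cev_sum) (intro rpoly_mult rpoly_const rpoly_component et)
  also have "... = (SUM j:UNIV. complex_of_real (T (axis j 1) $ i) * cev (%v. et v $ j) z)"
   by (intro sum.cong refl) (simp add: cev_mult[OF rpoly_const rpoly_component(1)[OF et]] cev_const)
  finally show ?thesis .
 qed
 then show ?thesis by (simp add: vec_eq_iff cmap_component[OF T] cev_field_def)
qed

lemma cev_field_comp_right:
 assumes "linear T"
 shows "cev_field (%v. et (T v)) z = cev_field et (cmap T z)"
 unfolding cev_field_def vec_eq_iff by (simp add: cev_comp_linear[OF assms, of "%v. et v $ i" z for i])

lemma cdot_scale: "cdot a (k *s z) = k * cdot a z"
 by (simp add: cdot_def sum_distrib_left mult_ac)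

lemma homogeneous_expansion:
 fixes f :: "real^'n => real"
 assumes f: "rpoly f" and hom: "!!t x. f (t *R x) = t ^ e * f x"
 shows "EX F c. finite F & (ALL mu:F. (SUM b:Basis. mu b) = e) & (ALL x. f x = (SUM mu:F. c mu * monomial_on Basis mu x))"
proof -
 have "expandable (Basis :: (real^'n) set) f"
 proof (rule rpoly_expandable[OF f finite_Basis])
  fix x :: "real^'n"
  have "(SUM b:Basis. (b <.> x) *R b) = (SUM b:Basis. (x <.> b) *R b)" by (intro sum.cong refl) (simp only: inner_commute)
  then show "(SUM b:Basis. (b <.> x) *R b) = x" using euclidean_representation[of x] by (simp only:)
 qed
 then obtain F c where F: "finite F" "!!x. f x = (SUM mu:F. c mu * monomial_on Basis mu x)"
  unfolding expandable_def by auto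
 let ?d = "%mu. SUM b:(Basis :: (real^'n) set). mu b"
 let ?F = "{mu:F. ?d mu = e}"
 have "f x = (SUM mu:?F. c mu * monomial_on Basis mu x)" for x
 proof -
  let ?p = "(SUM mu:F. Polynomial.monom (c mu * monomial_on Basis mu x) (?d mu)) - Polynomial.monom (f x) e"
  have "poly ?p t = 0" for t
   using hom[of t x] F(2)[of "t *R x"] by (simp add: poly_sum poly_monom monomial_on_scale mult_ac)
  then have "?p = 0" using poly_all_0_iff_0 by blast
  then have "coeff ?p e = 0" by simp
  then have "f x = (SUM mu:F. if ?d mu = e then c mu * monomial_on Basis mu x else 0)" by (simp add: coeff_sum)
  then show ?thesis using F(1) by (simp add: sum.inter_filter)
 qed
 then show ?thesis using F(1) by (intro exI[of _ ?F] exI[of _ c]) auto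
qed

text \<open>Complex scaling changes the real line on which \<open>cev\<close> is based, so the claim
  is checked on the expansion into monomials of degree \<open>e\<close>.\<close>

lemma cev_homogeneous:
 assumes f: "rpoly f" and hom: "!!t x. f (t *R x) = t ^ e * f x"
 shows "cev f (k *s z) = k ^ e * cev f z"
proof -
 obtain F c where F: "finite F" "!!mu. mu : F ==> (SUM b:Basis. mu b) = e" "!!x. f x = (SUM mu:F. c mu * monomial_on Basis mu x)"
  using homogeneous_expansion[OF assms] by blast
 have ev: "cev f w = (SUM mu:F. complex_of_real (c mu) * (PROD b:Basis. cdot b w ^ mu b))" for w
 proof -
  have "f = (%x. SUM mu:F. c mu * monomial_on Basis mu x)" using F(3) by auto
  then have "cev f w = cev (%x. SUM mu:F. c mu * monomial_on Basis mu x) w" by simp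
  also have "... = (SUM mu:F. cev (%x. c mu * monomial_on Basis mu x) w)"
   by (rule cev_sum) (intro rpoly_mult rpoly_const rpoly_monomial_on)
  also have "... = (SUM mu:F. complex_of_real (c mu) * (PROD b:Basis. cdot b w ^ mu b))"
  proof (rule sum.cong)
   fix mu
   have "cev (%x. monomial_on Basis mu x) w = (PROD b:Basis. cdot b w ^ mu b)"
    unfolding monomial_on_def
    by (subst cev_prod) (auto simp: cev_power[OF rpoly_inner] cev_inner intro: rpoly_power rpoly_inner)
   then show "cev (%x. c mu * monomial_on Basis mu x) w = complex_of_real (c mu) * (PROD b:Basis. cdot b w ^ mu b)"
    using cev_mult[OF rpoly_const rpoly_monomial_on, of "c mu" Basis mu w] by (simp add: cev_const)
  qed simp
  finally show ?thesis .
 qed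
 have "(PROD b:Basis. cdot b (k *s z) ^ mu b) = k ^ e * (PROD b:Basis. cdot b z ^ mu b)" if "mu : F" for mu
  using F(2)[OF that] by (simp add: cdot_scale power_mult_distrib prod.distrib flip: power_sum)
 then show ?thesis unfolding ev by (simp add: sum_distrib_left mult_ac)
qed

lemma cev_field_homogeneous:
 assumes et: "polynomial_function et" and hom: "!!t x. et (t *R x) = t ^ e *R et x"
 shows "cev_field et (k *s z) = k ^ e *s cev_field et z"
proof -
 have "cev (%v. et v $ i) (k *s z) = k ^ e * cev (%v. et v $ i) z" for i
  by (rule cev_homogeneous[OF rpoly_component(1)[OF et]]) (simp add: hom)
 then show ?thesis by (simp add: cev_field_def vec_eq_iff)
qed

text \<open>A dependent member could be eliminated, and then too few vectors would span the
  independent family \<open>x\<close>.\<close>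

lemma spanning_family_independent:
 fixes u :: "'i => 'f::field^'n"
 assumes I: "finite I" and K: "finite K" "card I <= card K"
  and x: "!!c. (SUM k:K. c k *s x k) = 0 ==> ALL k:K. c k = 0"
  and sp: "!!k. k : K ==> EX b. x k = (SUM i:I. b i *s u i)"
  and z: "(SUM i:I. c i *s u i) = 0" and i: "i : I"
 shows "c i = 0"
proof (rule ccontr)
 assume ci: "c i ~= 0"
 obtain b where b: "!!k. k : K ==> x k = (SUM i:I. b k i *s u i)" using sp by metis
 have "c i *s u i + (SUM j:I - {i}. c j *s u j) = 0" using z sum.remove[OF I i, of "%i. c i *s u i"] by simp
 then have "c i *s u i = - (SUM j:I - {i}. c j *s u j)" by (simp add: eq_neg_iff_add_eq_0)
 then have "u i = (1 / c i) *s - (SUM j:I - {i}. c j *s u j)"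
  using ci by (metis divide_self_if times_divide_eq_left vector_smult_assoc vector_smult_lid mult.left_neutral)
 also have "... = (SUM j:I - {i}. (- (c j / c i)) *s u j)"
  by (simp add: vec.scale_sum_right sum_negf vector_smult_assoc vec.scale_minus_right vec.scale_minus_left)
 finally have ui: "u i = (SUM j:I - {i}. (- (c j / c i)) *s u j)" .
 define b' where "b' k j = b k j - b k i * (c j / c i)" for k j
 have xb': "x k = (SUM j:I - {i}. b' k j *s u j)" if "k : K" for k
 proof -
  have "x k = b k i *s u i + (SUM j:I - {i}. b k j *s u j)" using b[OF that] sum.remove[OF I i] by metis
  also have "b k i *s u i = (SUM j:I - {i}. (- (b k i * (c j / c i))) *s u j)"
   by (subst ui) (simp add: vec.scale_sum_right vector_smult_assoc)
  finally show ?thesis by (simp add: b'_def vec.scale_left_diff_distrib sum_subtractf vec.scale_minus_left sum_negf)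
 qed
 have "card (I - {i}) < card K" using K(2) I i card_Diff1_less[OF I i] by linarith
 then obtain d where d: "EX k:K. d k ~= 0" "ALL j:I - {i}. (SUM k:K. d k * b' k j) = 0"
  using nontrivial_left_kernel[of "I - {i}" K b'] I K by blast
 have "(SUM k:K. d k *s x k) = (SUM k:K. SUM j:I - {i}. (d k * b' k j) *s u j)"
  by (intro sum.cong refl) (simp add: xb' vec.scale_sum_right vector_smult_assoc)
 also have "... = (SUM j:I - {i}. (SUM k:K. d k * b' k j) *s u j)"
  by (subst sum.swap) (simp add: vec.scale_sum_left)
 also have "... = 0" using d(2) by simp
 finally show False using x d(1) by blast
qed

text \<open>Expanding one eigenbasis in another, a coefficient between different eigenvalues
  vanishes, so each eigenspace injects. Used for an eigenbasis and its complex conjugate.\<close>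

lemma independent_eigenvalue_count:
 fixes u w :: "'i => complex^'n" and g :: "complex^'n => complex^'n"
 assumes I: "finite I"
  and g: "!!c v. g (SUM i:I. c i *s v i) = (SUM i:I. c i *s g (v i))"
  and ug: "!!i. i : I ==> g (u i) = l i *s u i" and wg: "!!i. i : I ==> g (w i) = m i *s w i"
  and ui: "!!c. (SUM i:I. c i *s u i) = 0 ==> ALL i:I. c i = 0" and wi: "!!c. (SUM i:I. c i *s w i) = 0 ==> ALL i:I. c i = 0"
  and sp: "!!i. i : I ==> EX b. u i = (SUM j:I. b j *s w j)"
 shows "card {i:I. l i = k} <= card {i:I. m i = k}"
proof (rule ccontr)
 assume lt: "~ ?thesis"
 obtain b where b: "!!i. i : I ==> u i = (SUM j:I. b i j *s w j)" using sp by metis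
 have b0: "b i j * (l i - m j) = 0" if "i : I" "j : I" for i j
 proof -
  have "(SUM j:I. (b i j * l i) *s w j) = l i *s u i" by (simp add: b[OF that(1)] vec.scale_sum_right vector_smult_assoc mult.commute)
  also have "... = g (SUM j:I. b i j *s w j)" using ug[OF that(1)] b[OF that(1)] by simp
  also have "... = (SUM j:I. (b i j * m j) *s w j)" unfolding g by (intro sum.cong refl) (simp add: wg vector_smult_assoc)
  finally have "(SUM j:I. (b i j * (l i - m j)) *s w j) = 0"
   by (simp add: right_diff_distrib vec.scale_left_diff_distrib sum_subtractf)
  then show ?thesis using wi[of "%j. b i j * (l i - m j)"] that(2) by blast
 qed
 let ?I = "{i:I. l i = k}" and ?J = "{i:I. m i = k}"
 obtain d where d: "EX i:?I. d i ~= 0" "ALL j:?J. (SUM i:?I. d i * b i j) = 0"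
  using nontrivial_left_kernel[of ?J ?I b] lt I by auto
 define d' where "d' i = (if l i = k then d i else 0)" for i
 have "(SUM i:I. d' i *s u i) = (SUM i:I. SUM j:I. (d' i * b i j) *s w j)"
  by (intro sum.cong refl) (simp add: b vec.scale_sum_right vector_smult_assoc)
 also have "... = (SUM j:I. (SUM i:I. d' i * b i j) *s w j)" by (subst sum.swap) (simp add: vec.scale_sum_left)
 also have "... = 0"
 proof (rule sum.neutral, rule ballI)
  fix j assume j: "j : I"
  have "(SUM i:I. d' i * b i j) = (SUM i:?I. d i * b i j)"
   unfolding d'_def using I by (intro sum.mono_neutral_cong_right) auto
  also have "... = 0"
  proof (cases "m j = k")
   case False
   then have "b i j = 0" if "i : ?I" for i using b0[OF _ j, of i] that by auto
   then show ?thesis by (intro sum.neutral) simp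
  qed (use d(2) j in auto)
  finally show "(SUM i:I. d' i * b i j) *s w j = 0" by simp
 qed
 finally have "ALL i:I. d' i = 0" by (rule ui)
 then show False using d(1) by (auto simp: d'_def split: if_splits)
qed

section \<open>A regular eigenvector of a Coxeter element\<close>

fun cox_elt :: "(real^'n) list => real^'n => real^'n" where
 "cox_elt [] x = x"
| "cox_elt (s # l) x = refl_root s (cox_elt l x)"

lemma linear_cox_elt: "linear (cox_elt l)"
proof (induction l)
 case Nil
 then show ?case by (simp add: linear_iff)
next
 case (Cons s l)
 have "linear (refl_root s \<circ> cox_elt l)" by (rule linear_compose[OF Cons linear_refl_root])
 then show ?case by (simp add: o_def cox_elt.simps(2)[abs_def])
qed

lemma cox_elt_append: "cox_elt (l @ m) x = cox_elt l (cox_elt m x)"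
 by (induction l) auto

lemma cox_elt_rev: "cox_elt (rev l) (cox_elt l x) = x"
 by (induction l) (auto simp: cox_elt_append)

lemma cox_elt_rev': "cox_elt l (cox_elt (rev l) x) = x"
 using cox_elt_rev[of "rev l"] by simp

lemma cox_elt_adjoint: "cox_elt l x <.> y = x <.> cox_elt (rev l) y"
 by (induction l arbitrary: y) (auto simp: cox_elt_append refl_root_adjoint)

lemma cox_elt_diff_span: "cox_elt l x - x : span (set l)"
proof (induction l)
 case Nil
 then show ?case by (simp add: span_zero)
next
 case (Cons s l)
 have "cox_elt (s # l) x - x = (cox_elt l x - x) - (2 * (cox_elt l x <.> s) / (s <.> s)) *R s"
  by (simp add: refl_root_def)
 also have "... : span (set (s # l))"
 proof (rule span_diff)
  show "cox_elt l x - x : span (set (s # l))" using Cons span_mono[of "set l" "set (s # l)"] by auto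
 qed (auto intro: span_scale span_base)
 finally show ?case .
qed

text \<open>The first reflection moves by a multiple of \<open>t\<close>, the others by a vector of
  the span of their roots. By independence both displacements vanish, so each reflection fixes
  \<open>x\<close>.\<close>

lemma cox_elt_fixed:
 assumes "cox_elt l x = x" "independent (set l)" "distinct l" "s : set l"
 shows "s <.> x = 0"
 using assms
proof (induction l)
 case (Cons t l)
 let ?y = "cox_elt l x" and ?k = "2 * (cox_elt l x <.> t) / (t <.> t)"
 have t0: "t ~= 0" using Cons.prems(2) dependent_zero by auto
 have "?y - ?k *R t = x" using Cons.prems(1) by (simp add: refl_root_def)
 then have "?k *R t = ?y - x" by (simp add: algebra_simps)
 then have kt: "?k *R t : span (set l)" using cox_elt_diff_span[of l x] by simp
 have tn: "t ~: span (set l)" using Cons.prems(2,3) by (simp add: independent_insert)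
 have k0: "?k = 0"
 proof (rule ccontr)
  assume "?k ~= 0"
  then have "t = (1 / ?k) *R (?k *R t)" by simp
  then show False using kt tn span_scale by metis
 qed
 have yx: "?y = x" using \<open>?y - ?k *R t = x\<close> unfolding k0 by simp
 then have tx: "t <.> x = 0" using k0 t0 by (simp add: inner_commute)
 have "independent (set l)" using Cons.prems(2) independent_mono[of "set (t # l)" "set l"] by auto
 then show ?case using Cons.IH[OF yx] Cons.prems(3,4) tx by auto
qed simp

section \<open>Signs of roots and the Dynkin graph\<close>

context root_sys
begin

lemma cox_elt_root: "set l \<subseteq> Ph ==> be : Ph ==> cox_elt l be : Ph"
 by (induction l) (auto intro: refl)

text \<open>A simple reflection changes the sign only of its own root, so a positive root that ends
  up non-positive passes through a letter of the word.\<close>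

lemma cox_elt_inversion:
 assumes "set l \<subseteq> base" "be : pos" "cox_elt l be ~: pos"
 shows "EX l1 s l2. l = l1 @ s # l2 & cox_elt l2 be = s"
 using assms
proof (induction l)
 case (Cons s l)
 show ?case
 proof (cases "cox_elt l be : pos")
  case True
  then have "cox_elt l be = s" using base_refl_pos[of s "cox_elt l be"] Cons.prems by auto
  then show ?thesis by (intro exI[of _ "[]"]) auto
 next
  case False
  then obtain l1 t l2 where "l = l1 @ t # l2" "cox_elt l2 be = t" using Cons by auto
  then show ?thesis by (intro exI[of _ "s # l1"] exI[of _ t] exI[of _ l2]) auto
 qed
qed simp

text \<open>A forest carries a potential for any orientation of its edges, built by removing a leaf.
  \<open>phi\<close> drops by one along each edge in the direction of growing
  \<open>rk\<close>.\<close>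

lemma base_gauge:
 fixes rk :: "real^'n => nat"
 assumes "T \<subseteq> base" "inj_on rk base"
 shows "EX \<phi>::real^'n => int. ALL s:T. ALL t:T. s <.> t ~= 0 --> rk t < rk s --> \<phi> t = \<phi> s + 1"
 using assms(1)
proof (induction "card T" arbitrary: T)
 case 0
 then have "T = {}" using finite_base finite_subset by fastforce
 then show ?case by simp
next
 case (Suc n)
 then have "T ~= {}" by auto
 then obtain s where s: "s : T" "card {t:T - {s}. s <.> t ~= 0} <= 1" using base_leaf Suc.prems by blast
 have finT: "finite T" using Suc.prems finite_base finite_subset by blast
 have "n = card (T - {s})" using Suc.hyps(2) s(1) finT by simp
 moreover have "T - {s} \<subseteq> base" using Suc.prems by blast
 ultimately obtain \<phi> where \<phi>: "ALL u:T - {s}. ALL t:T - {s}. u <.> t ~= 0 --> rk t < rk u --> \<phi> t = \<phi> u + (1::int)"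
  using Suc.hyps(1)[of "T - {s}"] by blast
 let ?N = "{t:T - {s}. s <.> t ~= 0}"
 have finN: "finite ?N" using finT by simp
 obtain k where k: "!!t. t : ?N ==> rk t < rk s ==> \<phi> t = k + 1" "!!t. t : ?N ==> rk s < rk t ==> k = \<phi> t + 1"
 proof (cases "?N = {}")
  case True
  then show ?thesis using that[of 0] by blast
 next
  case False
  then obtain t where t: "t : ?N" by blast
  have cN: "card ?N <= Suc 0" using s(2) by simp
  have "ALL a:?N. ALL b:?N. a = b" using cN card_le_Suc0_iff_eq[OF finN] by blast
  then have N: "u = t" if "u : ?N" for u using that t by blast
  show ?thesis
  proof (cases "rk t < rk s")
   case True
   show ?thesis by (rule that[of "\<phi> t - 1"]) (use N True in fastforce)+
  next
   case False
   show ?thesis by (rule that[of "\<phi> t + 1"]) (use N False in fastforce)+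
  qed
 qed
 have "ALL u:T. ALL t:T. u <.> t ~= 0 --> rk t < rk u --> (\<phi>(s := k)) t = (\<phi>(s := k)) u + 1"
 proof (intro ballI impI)
  fix u t assume ut: "u : T" "t : T" "u <.> t ~= 0" "rk t < rk u"
  then have "u ~= t" by auto
  consider "u = s" | "t = s" "u ~= s" | "u ~= s" "t ~= s" by blast
  then show "(\<phi>(s := k)) t = (\<phi>(s := k)) u + 1"
  proof cases
   case 1
   then have "t : ?N" using ut \<open>u ~= t\<close> by auto
   then show ?thesis using k(1)[of t] 1 ut \<open>u ~= t\<close> by auto
  next
   case 2
   then have "u : ?N" using ut by (auto simp: inner_commute)
   then show ?thesis using k(2)[of u] 2 ut by auto
  next
   case 3
   then show ?thesis using \<phi> ut by auto
  qed
 qed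
 then show ?case by blast
qed

text \<open>Reflecting \<open>q + s\<close> in \<open>s\<close> gives \<open>q - s\<close>, which
  has a negative coefficient at \<open>s\<close>; its negative would decompose the simple root
  \<open>s\<close>.\<close>

lemma no_mixed_root:
 assumes s: "s : base" and q: "q : pos" "q + s : Ph" "q <.> s = 0"
  and w: "s <.> w = 1" "!!t. t : base - {s} ==> t <.> w = 0" "q <.> w = 0"
 shows False
proof -
 have s0: "s <.> s > 0" "s : Ph" using s base_pos pos_root root_nz by blast+
 have "refl_root s (q + s) = q - s"
  using q(3) s0 by (simp add: refl_root_def inner_add_left algebra_simps scaleR_2)
 then have r: "q - s : Ph" using refl[OF s0(2) q(2)] by simp
 show False
 proof (cases "q - s : pos")
  case True
  then obtain n where n: "q - s = (SUM t:base. real (n t) *R t)" using pos_combination by blast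
  have "(q - s) <.> w = (SUM t:base. real (n t) * (t <.> w))" unfolding n by (simp add: inner_sum_left)
  also have "... >= 0"
  proof (rule sum_nonneg)
   fix t assume "t : base"
   then have "t <.> w >= 0" using w by (cases "t = s") auto
   then show "real (n t) * (t <.> w) >= 0" by simp
  qed
  finally show False using w by (simp add: inner_diff_left)
 next
  case False
  then have "s - q : pos" using pos_or_neg[OF r] by simp
  then have "s = q + (s - q)" "s - q : pos" by auto
  then show False using s q(1) unfolding base_def by blast
 qed
qed

text \<open>If the simple roots split orthogonally, every positive root lies over one part, by
  induction on the height, and the whole system splits.\<close>

lemma base_connected:
 assumes irr: "irreducible_root_system Ph" and X: "X \<subseteq> base" "X ~= {}"
  and orth: "!!s t. s : X ==> t : base - X ==> s <.> t = 0"
 shows "X = base"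
proof (rule ccontr)
 assume "X ~= base"
 let ?Y = "base - X"
 have Y: "?Y ~= {}" using X \<open>X ~= base\<close> by blast
 have sorth: "x <.> y = 0" if x: "x : span X" and y: "y : span ?Y" for x y
 proof -
  have 1: "s <.> y = 0" if "s : X" for s
  proof -
   have "span ?Y \<subseteq> {y. s <.> y = 0}" by (rule span_minimal[OF _ subspace_hyperplane]) (use orth[OF that] in blast)
   then show ?thesis using y by blast
  qed
  have "span X \<subseteq> {x. y <.> x = 0}" by (rule span_minimal[OF _ subspace_hyperplane]) (use 1 in \<open>simp add: subset_iff inner_commute[of y]\<close>)
  then show ?thesis using x by (auto simp: inner_commute)
 qed
 have mixed: False if s: "s : base" "s ~: Z" and Z: "Z \<subseteq> base" and q: "q : pos" "q : span Z" "q + s : Ph" "q <.> s = 0" for s q Z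
 proof -
  obtain w where w: "s <.> w = 1" "!!t. t : base - {s} ==> t <.> w = 0" using fundamental_coweight[OF s(1)] by blast
  have "span Z \<subseteq> {x. w <.> x = 0}"
   by (rule span_minimal[OF _ subspace_hyperplane]) (use w(2) s(2) Z in \<open>auto simp: inner_commute[of w]\<close>)
  then have "q <.> w = 0" using q(2) by (auto simp: inner_commute)
  then show False using no_mixed_root[OF s(1) q(1,3,4) w] by blast
 qed
 have pos_split: "p : span X \<or> p : span ?Y" if "p : level t" for p t
  using that
 proof (induction t arbitrary: p)
  case 0
  then show ?case using ht_pos_ge1[of p] by (simp add: level_def)
 next
  case (Suc t)
  then have p: "p : pos" "ht p = real (Suc t)" by (auto simp: level_def)
  show ?case
  proof (cases "p : base")
   case True
   then show ?thesis using X span_base[of p X] span_base[of p ?Y] by blast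
  next
   case False
   then obtain s where s: "s : base" "p - s : pos" using nonbase_diff p by blast
   have "p - s : level t" using s p linear_diff[OF linear_ht, of p s] ht_base[OF s(1)] by (simp add: level_def)
   then have ps: "p - s : span X \<or> p - s : span ?Y" using Suc.IH by blast
   have pp: "(p - s) + s : Ph" using p pos_root by simp
   show ?thesis
   proof (cases "s : X")
    case True
    then have sX: "s : span X" by (rule span_base)
    have "p - s ~: span ?Y"
    proof
     assume a: "p - s : span ?Y"
     then have "(p - s) <.> s = 0" using sorth[OF sX a] by (simp add: inner_commute)
     then show False using mixed[of s ?Y "p - s"] s True a pp by blast
    qed
    then have "p - s + s : span X" using ps sX by (intro span_add) auto
    then show ?thesis by simp
   next
    case False
    then have sY: "s : span ?Y" using s span_base[of s ?Y] by blast
    have "p - s ~: span X"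
    proof
     assume a: "p - s : span X"
     then have "(p - s) <.> s = 0" using sorth[OF a sY] by simp
     then show False using mixed[of s X "p - s"] s False X a pp by blast
    qed
    then have "p - s + s : span ?Y" using ps sY by (intro span_add) auto
    then show ?thesis by simp
   qed
  qed
 qed
 have split: "be : span X \<or> be : span ?Y" if b: "be : Ph" for be
 proof -
  have "p : span X \<or> p : span ?Y" if "p : pos" for p using pos_cases_level[OF that] pos_split by blast
  then show ?thesis using pos_or_neg[OF b] span_neg[of "- be" X] span_neg[of "- be" ?Y] by auto
 qed
 let ?A = "Ph Int span X" and ?B = "Ph Int span ?Y"
 have "?A ~= {}" using X base_pos pos_root span_base[of _ X] by blast
 moreover have "?B ~= {}" using Y base_pos pos_root span_base[of _ ?Y] by blast
 moreover have "?A Un ?B = Ph" using split by blast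
 moreover have "?A Int ?B = {}"
 proof (rule ccontr)
  assume "?A Int ?B ~= {}"
  then obtain x where "x : Ph" "x : span X" "x : span ?Y" by blast
  then show False using sorth[of x x] root_nz by auto
 qed
 moreover have "ALL a:?A. ALL b:?B. a <.> b = 0" using sorth by blast
 ultimately show False using irr unfolding irreducible_root_system_def by metis
qed

text \<open>\<open>y\<close> is a positive eigenvector of twice the identity minus the Cartan
  matrix. It minimises the Gram form of the unit simple roots: replacing coordinates by absolute
  values does not increase that form, since off-diagonal entries are nonpositive, and connectedness
  excludes zero coordinates.\<close>

lemma perron_frobenius_base:
 assumes irr: "irreducible_root_system Ph"
 shows "EX y ka. (ALL s:base. y s > 0) & 0 <= ka & ka < (2::real) &
  (ALL t:base. (SUM s:base - {t}. - (2 * (s <.> t) / (t <.> t)) * y s) = ka * y t)"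
proof -
 let ?L = "span base"
 have bne: "base ~= {}"
 proof
  assume "base = {}"
  then have "Ph \<subseteq> {0}" using root_in_span_base by auto
  then show False using irr nz unfolding irreducible_root_system_def by blast
 qed
 obtain B where B: "B \<subseteq> ?L" "pairwise orthogonal B" "!!x. x : B ==> norm x = 1" "independent B" "card B = dim ?L" "span B = ?L"
  using orthonormal_basis_subspace[of ?L] by auto
 have finB: "finite B" using B(4) independent_imp_finite by blast
 have "card base = card B" using B(5) dim_eq_card_independent[OF base_independent] by simp
 then obtain g where g: "bij_betw g base B" using finite_same_card_bij[OF finite_base finB] by blast
 have gB: "g s : B" if "s : base" for s using g that by (auto simp: bij_betw_def)
 have gL: "g s : ?L" if "s : base" for s using gB[OF that] B(1) by blast
 have gg: "g s <.> g t = (if s = t then 1 else 0)" if "s : base" "t : base" for s t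
 proof (cases "s = t")
  case True
  then show ?thesis using B(3)[OF gB[OF that(1)]] by (simp add: dot_square_norm)
 next
  case False
  then have "g s ~= g t" using g that by (auto simp: bij_betw_def inj_on_def)
  then show ?thesis using False B(2) gB[OF that(1)] gB[OF that(2)] by (auto simp: pairwise_def orthogonal_def)
 qed
 have expand: "(SUM s:base. (x <.> g s) *R g s) = x" if "x : ?L" for x
 proof -
  have "(SUM s:base. (x <.> g s) *R g s) = (SUM b:B. (x <.> b) *R b)" by (rule sum.reindex_bij_betw[OF g])
  also have "... = x" using orthonormal_basis_expand[OF B(2,3) _ finB, of x] that B(6) by simp
  finally show ?thesis .
 qed
 define u where "u s = (1 / norm s) *R s" for s :: "real^'n"
 have ns: "norm s > 0" if "s : base" for s using that base_pos pos_root root_nz by auto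
 have uu: "u s <.> u s = 1" if "s : base" for s using ns[OF that] by (simp add: u_def dot_square_norm power2_eq_square)
 have uneg: "u s <.> u t <= 0" if "s : base" "t : base" "s ~= t" for s t
  using base_obtuse[OF that] by (simp add: u_def mult_nonneg_nonpos divide_nonpos_nonneg)
 \<comment> \<open>Sends the orthonormal vectors \<open>g s\<close> to the unit simple roots, so
   that \<open>W x <.> W x\<close> is the Gram form in the coordinates of \<open>x\<close>.\<close>
 define W where "W x = (SUM s:base. (x <.> g s) *R u s)" for x
 have linW: "linear W"
  by (rule linearI) (simp_all add: W_def inner_add_left scaleR_add_left sum.distrib scaleR_sum_right)
 have WW: "W x <.> W x = (SUM s:base. SUM t:base. (x <.> g s) * (x <.> g t) * (u s <.> u t))" for x
 proof -
  have "W x <.> W x = (SUM s:base. ((x <.> g s) *R u s) <.> W x)" by (subst W_def) (rule inner_sum_left)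
  also have "... = (SUM s:base. SUM t:base. ((x <.> g s) *R u s) <.> ((x <.> g t) *R u t))" by (subst W_def) (simp only: inner_sum_right)
  finally show ?thesis by (simp add: mult_ac)
 qed
 have sub: "subspace ?L" by simp
 let ?K = "sphere 0 1 Int ?L"
 have "compact ?K" by (intro compact_Int_closed closed_subspace) auto
 moreover have "?K ~= {}" using bne gL gB B(3) by (metis IntI all_not_in_conv mem_sphere_0)
 moreover have "continuous_on ?K (%x. W x <.> W x)"
  by (intro continuous_intros linear_continuous_on) (simp_all add: linW linear_conv_bounded_linear[symmetric])
 ultimately obtain x0 where x0: "x0 : ?K" "!!x. x : ?K ==> W x0 <.> W x0 <= W x <.> W x"
  using continuous_attains_inf[of ?K "%x. W x <.> W x"] by blast
 define m where "m = W x0 <.> W x0"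
 have ge: "m * (x <.> x) <= W x <.> W x" if x: "x : ?L" for x
 proof (cases "x = 0")
  case True
  then show ?thesis by simp
 next
  case False
  have "(1 / norm x) *R x : ?K" using False x by (simp add: span_scale)
  then have "m <= W ((1 / norm x) *R x) <.> W ((1 / norm x) *R x)" using x0(2) by (simp add: m_def)
  also have "... = (W x <.> W x) / (x <.> x)"
   using False by (simp add: linear_scale[OF linW] dot_square_norm[of x] power2_eq_square)
  finally show ?thesis using False by (simp add: pos_le_divide_eq)
 qed
 define a where "a s = \<bar>x0 <.> g s\<bar>" for s
 define x1 where "x1 = (SUM s:base. a s *R g s)"
 have x1L: "x1 : ?L" unfolding x1_def by (intro span_sum span_scale gL)
 have x1g: "x1 <.> g t = a t" if t: "t : base" for t
 proof -
  have "x1 <.> g t = (SUM s:base. if s = t then a t else 0)"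
   unfolding x1_def inner_sum_left
  proof (rule sum.cong[OF HOL.refl])
   fix s assume s: "s : base"
   show "(a s *R g s) <.> g t = (if s = t then a t else 0)" unfolding inner_scaleR_left gg[OF s t] by simp
  qed
  then show ?thesis using t finite_base by simp
 qed
 have norm_exp: "x <.> x = (SUM s:base. (x <.> g s)\<^sup>2)" if "x : ?L" for x
 proof -
  have "x <.> x = x <.> (SUM s:base. (x <.> g s) *R g s)" using expand[OF that] by simp
  then show ?thesis by (simp add: inner_sum_right power2_eq_square)
 qed
 have x0L: "x0 : ?L" "x0 <.> x0 = 1" using x0(1) by (auto simp: dot_square_norm)
 have x1x1: "x1 <.> x1 = 1"
 proof -
  have "x1 <.> x1 = (SUM s:base. (x0 <.> g s)\<^sup>2)" unfolding norm_exp[OF x1L] by (intro sum.cong HOL.refl) (simp add: x1g a_def)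
  then show ?thesis using norm_exp[OF x0L(1)] x0L(2) by simp
 qed
 have "W x1 <.> W x1 <= W x0 <.> W x0"
  unfolding WW
 proof (intro sum_mono)
  fix s t assume st: "s : base" "t : base"
  show "(x1 <.> g s) * (x1 <.> g t) * (u s <.> u t) <= (x0 <.> g s) * (x0 <.> g t) * (u s <.> u t)"
  proof (cases "s = t")
   case True
   then show ?thesis using st by (simp add: x1g a_def)
  next
   case False
   have "(x0 <.> g s) * (x0 <.> g t) <= a s * a t" unfolding a_def by (metis abs_ge_self abs_mult)
   then have "a s * a t * (u s <.> u t) <= (x0 <.> g s) * (x0 <.> g t) * (u s <.> u t)"
    using uneg[OF st False] by (rule mult_right_mono_neg)
   then show ?thesis using st by (simp add: x1g)
  qed
 qed
 then have W1: "W x1 <.> W x1 = m" using ge[OF x1L] x1x1 by (simp add: m_def)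
 have sq: "(p + t *R q) <.> (p + t *R q) = p <.> p + 2 * t * (p <.> q) + t\<^sup>2 * (q <.> q)" for p q :: "real^'n" and t
  by (simp add: inner_add_left inner_add_right inner_commute[of q p] power2_eq_square distrib_left)
 \<comment> \<open>The stationarity condition at the minimiser \<open>x1\<close>, derived from the
   one-variable quadratic inequality below.\<close>
 have lag: "W x1 <.> W y = m * (x1 <.> y)" if y: "y : ?L" for y
 proof -
  define A where "A = 2 * (W x1 <.> W y - m * (x1 <.> y))"
  define D where "D = W y <.> W y - m * (y <.> y)"
  have D0: "D >= 0" using ge[OF y] by (simp add: D_def)
  have q: "t * A + t\<^sup>2 * D >= 0" for t
  proof -
   have "x1 + t *R y : ?L" using x1L y by (intro span_add span_scale)
   then have "m * ((x1 + t *R y) <.> (x1 + t *R y)) <= W (x1 + t *R y) <.> W (x1 + t *R y)" by (rule ge)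
   also have "W (x1 + t *R y) = W x1 + t *R W y" by (simp only: linear_add[OF linW] linear_scale[OF linW])
   finally have "m * (1 + 2 * t * (x1 <.> y) + t\<^sup>2 * (y <.> y)) <= m + 2 * t * (W x1 <.> W y) + t\<^sup>2 * (W y <.> W y)"
    unfolding sq x1x1 W1 .
   then have "0 <= m + 2 * t * (W x1 <.> W y) + t\<^sup>2 * (W y <.> W y) - m * (1 + 2 * t * (x1 <.> y) + t\<^sup>2 * (y <.> y))" by simp
   also have "... = t * A + t\<^sup>2 * D" unfolding A_def D_def by algebra
   finally show ?thesis .
  qed
  \<comment> \<open>Inserting \<open>t = - A / (D + 1)\<close> into the inequality leaves
    \<open>- k * k >= 0\<close>.\<close>
  define k where "k = A / (D + 1)"
  have Ak: "A = k * (D + 1)" using D0 by (simp add: k_def)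
  have "- k * A + (- k)\<^sup>2 * D = - (k * k)" unfolding Ak power2_eq_square by algebra
  then have "k * k <= 0" using q[of "- k"] by simp
  then have "k = 0" using zero_le_square[of k] by (metis antisym mult_eq_0_iff)
  then have "A = 0" using Ak by simp
  then show ?thesis by (simp add: A_def)
 qed
 have Wg: "W (g t) = u t" if t: "t : base" for t
 proof -
  have "W (g t) = (SUM s:base. if s = t then u t else 0)"
   unfolding W_def
  proof (rule sum.cong[OF HOL.refl])
   fix s assume s: "s : base"
   show "(g t <.> g s) *R u s = (if s = t then u t else 0)" unfolding gg[OF t s] by simp
  qed
  then show ?thesis using t finite_base by simp
 qed
 have eig: "(SUM s:base. a s * (u s <.> u t)) = m * a t" if t: "t : base" for t
 proof -
  have "(SUM s:base. a s * (u s <.> u t)) = W x1 <.> u t"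
   unfolding W_def inner_sum_left by (intro sum.cong HOL.refl) (simp add: x1g)
  also have "... = m * a t" using lag[OF gL[OF t]] Wg[OF t] x1g[OF t] by simp
  finally show ?thesis .
 qed
 have a0: "a s >= 0" for s by (simp add: a_def)
 have "EX s:base. a s ~= 0"
 proof (rule ccontr)
  assume "~ ?thesis"
  then have "x1 = 0" by (simp add: x1_def)
  then show False using x1x1 by simp
 qed
 then obtain s1 where s1: "s1 : base" "a s1 > 0" using a0 by (metis less_le)
 have mpos: "m > 0"
 proof -
  have "W x1 ~= 0"
  proof
   assume W0: "W x1 = 0"
   have "W x1 = (SUM s:base. (a s / norm s) *R s)" unfolding W_def by (intro sum.cong HOL.refl) (simp add: x1g u_def)
   then have "a s1 / norm s1 = 0"
    using independentD[OF base_independent finite_base subset_refl, of "%s. a s / norm s" s1] W0 s1 by simp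
   then show False using s1 ns[OF s1(1)] by simp
  qed
  then show ?thesis using W1 by (metis inner_gt_zero_iff)
 qed
 have off: "(SUM s:base - {t}. - (u s <.> u t) * a s) = (1 - m) * a t" if t: "t : base" for t
 proof -
  have "m * a t = a t * (u t <.> u t) + (SUM s:base - {t}. a s * (u s <.> u t))"
   using eig[OF t] sum.remove[OF finite_base t, of "%s. a s * (u s <.> u t)"] by simp
  then show ?thesis using uu[OF t] by (simp add: sum_negf algebra_simps)
 qed
 have m1: "m <= 1"
 proof -
  have "0 <= (SUM s:base - {s1}. - (u s <.> u s1) * a s)"
   by (intro sum_nonneg mult_nonneg_nonneg a0) (use uneg[OF _ s1(1)] in auto)
  then have "0 <= (1 - m) * a s1" using off[OF s1(1)] by simp
  then show ?thesis using s1 by (simp add: zero_le_mult_iff)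
 qed
 define X where "X = {s:base. a s > 0}"
 have "X = base"
 proof (rule base_connected[OF irr])
  show "X \<subseteq> base" "X ~= {}" using s1 by (auto simp: X_def)
  fix s t assume s: "s : X" and t: "t : base - X"
  have at: "a t = 0" using t a0[of t] by (auto simp: X_def)
  have tb: "t : base" using t by simp
  have "(SUM s:base - {t}. - (u s <.> u t) * a s) = 0" using off[OF tb] at by simp
  then have "ALL s:base - {t}. - (u s <.> u t) * a s = 0"
   by (subst sum_nonneg_eq_0_iff[symmetric]) (use finite_base a0 uneg[OF _ tb] in \<open>auto intro!: mult_nonpos_nonneg\<close>)
  moreover have "s : base - {t}" "a s > 0" using s t by (auto simp: X_def)
  ultimately have "u s <.> u t = 0" by fastforce
  then show "s <.> t = 0" using ns[OF tb] ns[of s] s by (auto simp: u_def X_def)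
 qed
 then have apos: "a s > 0" if "s : base" for s using that by (auto simp: X_def)
 show ?thesis
 proof (intro exI conjI ballI)
  show "a s / norm s > 0" if "s : base" for s using apos[OF that] ns[OF that] by simp
  show "0 <= 2 * (1 - m)" "2 * (1 - m) < 2" using m1 mpos by auto
  fix t assume t: "t : base"
  have "(SUM s:base - {t}. - (2 * (s <.> t) / (t <.> t)) * (a s / norm s)) = (SUM s:base - {t}. (2 / norm t) * (- (u s <.> u t) * a s))"
   using ns[OF t] by (intro sum.cong HOL.refl) (simp add: u_def dot_square_norm[of t] power2_eq_square)
  also have "... = (2 / norm t) * ((1 - m) * a t)" unfolding sum_distrib_left[symmetric] off[OF t] ..
  finally show "(SUM s:base - {t}. - (2 * (s <.> t) / (t <.> t)) * (a s / norm s)) = 2 * (1 - m) * (a t / norm t)" by simp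
 qed
qed

end

section \<open>Complexified linear maps\<close>

lemma cdot_Complex: "cdot a z = Complex (a <.> re_vec z) (a <.> im_vec z)"
 by (simp add: cdot_def complex_eq_iff inner_vec_def re_vec_def im_vec_def)

lemma cdot_cmap_adjoint:
 assumes "!!x. a <.> T x = b <.> x"
 shows "cdot a (cmap T z) = cdot b z"
 by (simp only: cdot_Complex re_im_cmap assms)

lemma cdot_cvec: "cdot a (cvec x) = complex_of_real (a <.> x)"
 by (simp add: cdot_def cvec_def inner_vec_def)

lemma cdot_add: "cdot a (z + w) = cdot a z + cdot a w"
 by (simp add: cdot_def distrib_left sum.distrib)

lemma cdot_sum: "cdot a (SUM i:I. z i) = (SUM i:I. cdot a (z i))"
 by (induction I rule: infinite_finite_induct) (simp_all add: cdot_add, simp_all add: cdot_def)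

lemma cmap_sum_scale:
 assumes "linear T"
 shows "cmap T (SUM i:I. c i *s v i) = (SUM i:I. c i *s cmap T (v i))"
proof -
 have "(SUM j:UNIV. complex_of_real (T (axis j 1) $ k) * (SUM i:I. c i * v i $ j)) = (SUM i:I. c i * (SUM j:UNIV. complex_of_real (T (axis j 1) $ k) * v i $ j))" for k
  unfolding sum_distrib_left by (subst sum.swap) (intro sum.cong refl, simp add: mult_ac)
 then show ?thesis by (simp add: vec_eq_iff cmap_component[OF assms])
qed

lemma cmap_compose: "cmap S (cmap T z) = cmap (%x. S (T x)) z"
 by (simp add: cmap_def[of S] cmap_def[of "%x. S (T x)"] re_im_cmap)

lemma cmap_id: "(!!x. T x = x) ==> cmap T z = z"
 by (simp add: cmap_def vec_eq_iff re_vec_def im_vec_def)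

lemma cmap_refl_root: "cmap (refl_root s) w = w - (2 * cdot s w / complex_of_real (s <.> s)) *s cvec s"
proof (rule vec_eq_iff[THEN iffD2], rule allI)
 fix i
 have C: "Complex (p - 2 * a / d * c) (q - 2 * b / d * c) = Complex p q - (2 * Complex a b / complex_of_real d) * complex_of_real c"
  for p q a b c d
  by (rule complex_eqI) (simp_all add: Re_divide_of_real Im_divide_of_real)
 have R: "refl_root s x $ i = x $ i - 2 * (s <.> x) / (s <.> s) * s $ i" for x
  unfolding refl_root_def inner_commute[of x s] by simp
 have wi: "Complex (re_vec w $ i) (im_vec w $ i) = w $ i" by (simp add: re_vec_def im_vec_def)
 have "cmap (refl_root s) w $ i = Complex (re_vec w $ i - 2 * (s <.> re_vec w) / (s <.> s) * s $ i) (im_vec w $ i - 2 * (s <.> im_vec w) / (s <.> s) * s $ i)"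
  unfolding cmap_def vec_lambda_beta R ..
 also have "... = w $ i - (2 * cdot s w / complex_of_real (s <.> s)) * complex_of_real (s $ i)"
  unfolding C wi cdot_Complex ..
 finally show "cmap (refl_root s) w $ i = (w - (2 * cdot s w / complex_of_real (s <.> s)) *s cvec s) $ i"
  unfolding cvec_def vector_minus_component vector_smult_component vec_lambda_beta .
qed

lemma linear_funpow: "linear (f :: 'a::real_vector => 'a) ==> linear (f ^^ k)"
proof (induction k)
 case 0
 then show ?case by (simp add: linear_iff)
next
 case (Suc k)
 then show ?case using linear_compose[of "f ^^ k" f] by (simp add: o_def)
qed

section \<open>Orbits of a Coxeter element and its regular eigenvector\<close>

context root_sys
begin

lemma cox_elt_finite_order:
 assumes l: "set l \<subseteq> Ph"
 shows "EX N>0. ALL x:span Ph. (cox_elt l ^^ N) x = x"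
proof -
 let ?c = "cox_elt l"
 have inPhi: "(?c ^^ k) be : Ph" if "be : Ph" for k be
  by (induction k) (auto intro: cox_elt_root[OF l] that)
 have injc: "inj ?c" by (rule inj_on_inverseI[of _ "cox_elt (rev l)"]) (simp add: cox_elt_rev)
 let ?F = "%k. restrict (?c ^^ k) Ph"
 have "range ?F \<subseteq> (\<Pi>\<^sub>E be\<in>Ph. Ph)" using inPhi by auto
 then have "finite (range ?F)" using finite_PiE[OF fin, of "%_. Ph"] fin finite_subset by blast
 then have "~ inj ?F" using range_inj_infinite by blast
 then obtain i j where ij: "?F i = ?F j" "i < j" unfolding inj_on_def by (metis linorder_neqE_nat)
 have "(?c ^^ (j - i)) be = be" if b: "be : Ph" for be
 proof -
  have "(?c ^^ i) be = (?c ^^ j) be" using fun_cong[OF ij(1), of be] b by simp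
  also have "... = (?c ^^ (i + (j - i))) be" using ij(2) by simp
  also have "... = (?c ^^ i) ((?c ^^ (j - i)) be)" by (simp only: funpow_add o_apply)
  finally show ?thesis using inj_fn[OF injc, of i] by (metis injD)
 qed
 then have "(?c ^^ (j - i)) x = id x" if "x : span Ph" for x
  by (intro linear_eq_on_span[OF linear_funpow[OF linear_cox_elt] linear_id _ that]) simp
 then show ?thesis using ij(2) by (intro exI[of _ "j - i"]) auto
qed

text \<open>Without a change of sign from positive to non-positive the whole orbit would have one
  sign. Its sum is fixed by the Coxeter element, hence zero, while the heights would add up to
  something nonzero.\<close>

lemma cox_elt_orbit:
 assumes ds: "distinct ds" "set ds = base" and b: "be : Ph"
 shows "EX k. (cox_elt ds ^^ k) be : pos & (cox_elt ds ^^ Suc k) be ~: pos"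
proof (rule ccontr)
 assume no: "~ ?thesis"
 let ?c = "cox_elt ds"
 have bp: "set ds \<subseteq> Ph" using ds(2) base_pos pos_root by blast
 obtain N where N: "N > 0" "!!x. x : span Ph ==> (?c ^^ N) x = x" using cox_elt_finite_order[OF bp] by blast
 have inPhi: "(?c ^^ k) be : Ph" for k by (induction k) (auto intro: cox_elt_root[OF bp] b)
 have step: "(?c ^^ k) be : pos ==> (?c ^^ (k + j)) be : pos" for k j
  using no by (induction j) auto
 have per: "(?c ^^ (k + N * j)) be = (?c ^^ k) be" for k j
  using funpow_mod_eq[OF N(2)[OF span_base[OF b]], of k] funpow_mod_eq[OF N(2)[OF span_base[OF b]], of "k + N * j"] by simp
 \<comment> \<open>\<open>N\<close> is a period of the orbit, so the Coxeter element merely shifts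
   the summation.\<close>
 define S where "S = (SUM k<N. (?c ^^ k) be)"
 have "?c S = (SUM k<N. (?c ^^ Suc k) be)" unfolding S_def using linear_sum[OF linear_cox_elt] by simp
 also have "... = S + (?c ^^ N) be - be"
  unfolding S_def using sum.lessThan_Suc[of "%k. (?c ^^ k) be" N] sum.lessThan_Suc_shift[of "%k. (?c ^^ k) be" N]
  by (simp add: algebra_simps)
 finally have cS: "?c S = S" using N(2)[OF span_base[OF b]] by simp
 have sS: "s <.> S = 0" if "s : base" for s
  using cox_elt_fixed[OF cS _ ds(1), of s] base_independent ds(2) that by simp
 have SL: "S : span base" unfolding S_def by (intro span_sum root_in_span_base inPhi)
 have "span base \<subseteq> {x. S <.> x = 0}"
  by (rule span_minimal[OF _ subspace_hyperplane]) (use sS in \<open>simp add: subset_iff inner_commute[of S]\<close>)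
 then have S0: "S = 0" using SL by auto
 have htS: "(SUM k<N. ht ((?c ^^ k) be)) = 0"
  using linear_sum[OF linear_ht, of "%k. (?c ^^ k) be" "{..<N}"] S0 linear_0[OF linear_ht] by (simp add: S_def)
 have ne: "{..<N} ~= {}" using N(1) by auto
 show False
 proof (cases "EX k. (?c ^^ k) be : pos")
  case True
  then obtain k where k: "(?c ^^ k) be : pos" by blast
  have "(?c ^^ j) be : pos" for j
  proof -
   have "k <= j + N * k" using N(1) by (metis le_add2 mult_le_mono1 nat_mult_1 order_trans Suc_leI One_nat_def)
   then have "(?c ^^ (j + N * k)) be : pos" using step[OF k, of "j + N * k - k"] by simp
   then show ?thesis using per by simp
  qed
  then have "(SUM k<N. ht ((?c ^^ k) be)) > 0" using ht_pos_ge1 ne by (intro sum_pos) (auto intro: less_le_trans[OF zero_less_one])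
  then show False using htS by simp
 next
  case False
  have "ht ((?c ^^ k) be) < 0" for k
  proof -
   have "- (?c ^^ k) be : pos" using pos_or_neg[OF inPhi[of k]] False by blast
   then show ?thesis using ht_pos_ge1[of "- (?c ^^ k) be"] linear_neg[OF linear_ht, of "(?c ^^ k) be"] by simp
  qed
  then have "(SUM k<N. - ht ((?c ^^ k) be)) > 0" using ne by (intro sum_pos) auto
  then show False using htS by (simp add: sum_negf)
 qed
qed

lemma takeWhile_rank:
 assumes "distinct ds" "ds = p @ s # q"
 shows "length (takeWhile (%u. u ~= s) ds) = length p"
proof -
 have "s ~: set p" using assms by auto
 then show ?thesis using assms(2) by (subst assms(2), subst takeWhile_append2) auto
qed

text \<open>The positive eigenvector \<open>y\<close> is twisted by phases from the potential
  \<open>phi\<close>, so that applying one simple reflection of the word multiplies exactly one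
  coefficient by \<open>mu\<close>. Regularity follows since each orbit of roots passes through an
  inversion of the word, where the pairing is visibly nonzero.\<close>

theorem regular_eigenvector:
 assumes irr: "irreducible_root_system Ph" and ds: "distinct ds" "set ds = base"
 shows "EX mu z. mu ~= 1 & norm mu = 1 & cmap (cox_elt ds) z = mu *s z & (ALL be:Ph. cdot be z ~= 0)"
proof -
 obtain y ka where y: "!!s. s : base ==> y s > 0" and ka: "0 <= ka" "ka < (2::real)"
  and eig: "!!t. t : base ==> (SUM s:base - {t}. - (2 * (s <.> t) / (t <.> t)) * y s) = ka * y t"
  using perron_frobenius_base[OF irr] by blast
 define rk where "rk s = length (takeWhile (%u. u ~= s) ds)" for s
 have rk: "rk s = length p" if "ds = p @ s # q" for p s q unfolding rk_def by (rule takeWhile_rank[OF ds(1) that])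
 have injrk: "inj_on rk base"
 proof (rule inj_onI)
  fix s t assume st: "s : base" "t : base" "rk s = rk t"
  obtain p q where p: "ds = p @ s # q" using split_list[of s ds] st(1) ds(2) by blast
  obtain p' q' where p': "ds = p' @ t # q'" using split_list[of t ds] st(2) ds(2) by blast
  have "length p = length p'" using rk[OF p] rk[OF p'] st(3) by simp
  then show "s = t" using p p' by simp
 qed
 obtain \<phi> :: "real^'n => int" where \<phi>: "!!s t. s : base ==> t : base ==> s <.> t ~= 0 ==> rk t < rk s ==> \<phi> t = \<phi> s + 1"
  using base_gauge[OF subset_refl injrk] by blast
 \<comment> \<open>The angle with \<open>ka = 2 cos ta\<close>; then
   \<open>mu = exp (2 i ta)\<close> satisfies \<open>1 + mu = exp (i ta) ka\<close>.\<close>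
 define ta where "ta = arccos (ka / 2)"
 have ta: "0 < ta" "ta <= pi / 2" "cos ta = ka / 2"
 proof -
  show "cos ta = ka / 2" unfolding ta_def using ka by (intro cos_arccos) auto
  show "0 < ta" unfolding ta_def using ka arccos_less_arccos[of "ka / 2" 1] by simp
  show "ta <= pi / 2" unfolding ta_def using ka by (intro arccos_le_pi2) auto
 qed
 define mu where "mu = cis (2 * ta)"
 have mu1: "mu ~= 1"
 proof
  assume "mu = 1"
  then have "cos (2 * ta) = 1" by (simp add: mu_def complex_eq_iff)
  then have "(sin ta)\<^sup>2 = 0" by (simp add: cos_double_sin)
  then have "sin ta = 0" by simp
  moreover have "sin ta > 0" using ta pi_gt_zero by (intro sin_gt_zero) linarith+
  ultimately show False by simp
 qed
 have mu0: "mu ~= 0" "norm mu = 1" by (simp_all add: mu_def)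
 have muka: "1 + mu = cis ta * complex_of_real ka"
 proof -
  have "ka = 2 * cos ta" using ta(3) by simp
  then show ?thesis by (simp add: mu_def complex_eq_iff cos_double_cos sin_double power2_eq_square)
 qed
 \<comment> \<open>Neighbours earlier in the word carry one phase step more, later ones one step
   less. Once the later ones have been multiplied by \<open>mu\<close>, all neighbours of a simple
   root have the same phase.\<close>
 define x where "x s = cis (ta * real_of_int (\<phi> s)) * complex_of_real (y s)" for s
 have x0: "x s ~= 0" if "s : base" for s using y[OF that] by (simp add: x_def)
 define k where "k l s = (if s : set l then mu else 1)" for l :: "(real^'n) list" and s
 define Z where "Z l = (SUM s:base. (k l s * x s) *s cvec s)" for l
 \<comment> \<open>The neighbours contribute \<open>- (1 + mu) x t\<close> and the root itself
   \<open>2 x t\<close>, so the next reflection turns the coefficient \<open>x t\<close> into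
   \<open>mu * x t\<close>.\<close>
 have key: "2 * cdot t (Z l) / complex_of_real (t <.> t) = (1 - mu) * x t" if d: "ds = pre @ t # l" for pre t l
 proof -
  have t: "t : base" using d ds(2) by auto
  have t0: "t <.> t > 0" using t base_pos pos_root root_nz by auto
  have dist: "t ~: set l" "t ~: set pre" "set pre Int set l = {}" using ds(1) d by auto
  have A: "k l s * x s * complex_of_real (- (2 * (s <.> t) / (t <.> t))) =
    cis ta * cis (ta * real_of_int (\<phi> t)) * complex_of_real (- (2 * (s <.> t) / (t <.> t)) * y s)" if s: "s : base - {t}" for s
  proof (cases "s <.> t = 0")
   case True
   then show ?thesis by simp
  next
   case False
   have sds: "s : set pre \<or> s : set l" using s d ds(2) by auto
   have "k l s * x s = cis ta * cis (ta * real_of_int (\<phi> t)) * complex_of_real (y s)"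
    using sds
   proof
    assume sp: "s : set pre"
    then obtain p q where "pre = p @ s # q" using split_list[of s pre] by blast
    then have "rk s < rk t" using rk[of p s "q @ t # l"] rk[OF d] d by simp
    then have "\<phi> s = \<phi> t + 1" using \<phi>[of t s] s t False by (simp add: inner_commute[of t])
    moreover have "s ~: set l" using sp dist by blast
    ultimately show ?thesis by (simp add: k_def x_def cis_mult distrib_left add.commute)
   next
    assume sl: "s : set l"
    then obtain p q where "l = p @ s # q" using split_list[of s l] by blast
    then have "rk t < rk s" using rk[of "pre @ t # p" s q] rk[OF d] d by simp
    then have "\<phi> t = \<phi> s + 1" using \<phi>[of s t] s t False by simp
    then show ?thesis using sl by (simp add: k_def x_def mu_def cis_mult distrib_left mult.assoc[symmetric] add.commute)
   qed
   then show ?thesis by simp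
  qed
  have "2 * cdot t (Z l) / complex_of_real (t <.> t) = (SUM s:base. k l s * x s * complex_of_real (2 * (s <.> t) / (t <.> t)))"
   unfolding Z_def cdot_sum cdot_scale cdot_cvec sum_distrib_left sum_divide_distrib
  proof (rule sum.cong[OF HOL.refl])
   fix s
   have "2 * (a * b) / c = a * ((2 * b) / c)" for a b c :: complex by simp
   then show "2 * (k l s * x s * complex_of_real (t <.> s)) / complex_of_real (t <.> t) = k l s * x s * complex_of_real (2 * (s <.> t) / (t <.> t))"
    unfolding inner_commute[of t s] of_real_divide of_real_mult of_real_numeral .
  qed
  also have "... = k l t * x t * complex_of_real (2 * (t <.> t) / (t <.> t)) + (SUM s:base - {t}. k l s * x s * complex_of_real (2 * (s <.> t) / (t <.> t)))"
   by (rule sum.remove[OF finite_base t])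
  also have "k l t * x t * complex_of_real (2 * (t <.> t) / (t <.> t)) = 2 * x t" using t0 dist by (simp add: k_def)
  also have "(SUM s:base - {t}. k l s * x s * complex_of_real (2 * (s <.> t) / (t <.> t))) = - (SUM s:base - {t}. k l s * x s * complex_of_real (- (2 * (s <.> t) / (t <.> t))))"
   by (simp add: sum_negf)
  also have "(SUM s:base - {t}. k l s * x s * complex_of_real (- (2 * (s <.> t) / (t <.> t)))) =
    (SUM s:base - {t}. cis ta * cis (ta * real_of_int (\<phi> t)) * complex_of_real (- (2 * (s <.> t) / (t <.> t)) * y s))"
   by (rule sum.cong[OF HOL.refl]) (rule A)
  also have "... = cis ta * cis (ta * real_of_int (\<phi> t)) * complex_of_real (ka * y t)"
   unfolding sum_distrib_left[symmetric] of_real_sum[symmetric] eig[OF t] ..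
  also have "... = (1 + mu) * x t" by (simp add: muka x_def)
  finally show ?thesis by (simp add: algebra_simps)
 qed
 define z where "z = Z []"
 have step: "cmap (cox_elt l) z = Z l" if "ds = pre @ l" for pre l
  using that
 proof (induction l arbitrary: pre)
  case Nil
  then show ?case by (simp add: z_def cmap_id)
 next
  case (Cons t l)
  have IH: "cmap (cox_elt l) z = Z l" using Cons.IH[of "pre @ [t]"] Cons.prems by simp
  have t: "t : base" using Cons.prems ds(2) by auto
  have tl: "t ~: set l" using Cons.prems ds(1) by auto
  have "cmap (cox_elt (t # l)) z = cmap (refl_root t) (Z l)" unfolding IH[symmetric] cmap_compose by (rule arg_cong[where f="%f. cmap f z"]) (simp add: fun_eq_iff)
  also have "... = Z l + ((mu - 1) * x t) *s cvec t"
   unfolding cmap_refl_root key[OF Cons.prems] by (simp add: vec_eq_iff algebra_simps)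
  also have "... = Z (t # l)"
  proof -
   have "Z l = (k l t * x t) *s cvec t + (SUM s:base - {t}. (k l s * x s) *s cvec s)"
    unfolding Z_def by (rule sum.remove[OF finite_base t])
   moreover have "Z (t # l) = (k (t # l) t * x t) *s cvec t + (SUM s:base - {t}. (k (t # l) s * x s) *s cvec s)"
    unfolding Z_def by (rule sum.remove[OF finite_base t])
   moreover have "(SUM s:base - {t}. (k (t # l) s * x s) *s cvec s) = (SUM s:base - {t}. (k l s * x s) *s cvec s)"
    by (intro sum.cong HOL.refl) (auto simp: k_def)
   ultimately show ?thesis using tl by (simp add: k_def vec_eq_iff algebra_simps)
  qed
  finally show ?case .
 qed
 have cz: "cmap (cox_elt ds) z = mu *s z"
 proof -
  have "cmap (cox_elt ds) z = Z ds" using step[of "[]" ds] by simp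
  also have "... = (SUM s:base. mu *s ((k [] s * x s) *s cvec s))"
   unfolding Z_def by (intro sum.cong HOL.refl) (simp add: k_def ds(2) vector_smult_assoc)
  finally show ?thesis by (simp add: z_def Z_def vec.scale_sum_right)
 qed
 \<comment> \<open>Transporting the pairing along the word reduces it to a simple root paired with a
   partial stage \<open>Z\<close>, where it is a nonzero multiple of \<open>x s\<close>.\<close>
 have inv: "cdot be z ~= 0" if b: "be : pos" "cox_elt ds be ~: pos" for be
 proof -
  obtain l1 s l2 where l: "ds = l1 @ s # l2" "cox_elt l2 be = s" using cox_elt_inversion[OF _ b] ds(2) by blast
  have sb: "s : base" using l ds(2) by auto
  have "be = cox_elt (rev l2) s" using l(2) cox_elt_rev by metis
  then have "s <.> cox_elt l2 v = be <.> v" for v using cox_elt_adjoint[of "rev l2" s v] by simp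
  then have "cdot s (cmap (cox_elt l2) z) = cdot be z" by (rule cdot_cmap_adjoint)
  then have "cdot be z = cdot s (Z l2)" using step[of "l1 @ [s]" l2] l(1) by simp
  moreover have "cdot s (Z l2) ~= 0" using key[OF l(1)] mu1 x0[OF sb] by auto
  ultimately show ?thesis by simp
 qed
 have shift: "cdot (cox_elt ds be) z = 0" if "cdot be z = 0" for be
 proof -
  have "cox_elt ds be <.> cox_elt ds v = be <.> v" for v by (simp add: cox_elt_adjoint cox_elt_rev)
  then have "cdot (cox_elt ds be) (cmap (cox_elt ds) z) = cdot be z" by (rule cdot_cmap_adjoint)
  then have "mu * cdot (cox_elt ds be) z = 0" using that by (simp add: cz cdot_scale)
  then show ?thesis using mu0 by simp
 qed
 have "cdot be z ~= 0" if b: "be : Ph" for be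
 proof
  assume b0: "cdot be z = 0"
  have all0: "cdot ((cox_elt ds ^^ k) be) z = 0" for k by (induction k) (auto simp: b0 shift)
  obtain k where "(cox_elt ds ^^ k) be : pos" "cox_elt ds ((cox_elt ds ^^ k) be) ~: pos"
   using cox_elt_orbit[OF ds b] by auto
  then show False using inv all0 by blast
 qed
 then show ?thesis using mu1 mu0 cz by blast
qed

text \<open>Every orbit contains an inversion of the word, and an inversion is determined by a
  position in it; so a position and a power below \<open>n\<close> determine the root.\<close>

lemma card_root_le:
 assumes ds: "distinct ds" "set ds = base" and n: "n > 0" "!!x. x : span Ph ==> (cox_elt ds ^^ n) x = x"
 shows "card Ph <= card base * n"
proof -
 let ?c = "cox_elt ds"
 let ?g = "%(k, j). (?c ^^ k) (cox_elt (rev (drop (Suc j) ds)) (ds ! j))"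
 have bp: "set ds \<subseteq> Ph" using ds(2) base_pos pos_root by blast
 have "Ph \<subseteq> ?g ` ({..<n} \<times> {..<length ds})"
 proof
  fix be assume b: "be : Ph"
  obtain k where k: "(?c ^^ k) be : pos" "?c ((?c ^^ k) be) ~: pos" using cox_elt_orbit[OF ds b] by auto
  then obtain l1 s l2 where l: "ds = l1 @ s # l2" "cox_elt l2 ((?c ^^ k) be) = s"
   using cox_elt_inversion[OF _ k] ds(2) by blast
  let ?ga = "(?c ^^ k) be"
  have g: "?ga = cox_elt (rev (drop (Suc (length l1)) ds)) (ds ! length l1)"
   using l cox_elt_rev[of l2 ?ga] by simp
  have per: "(?c ^^ (n * q)) be = be" for q
   using funpow_mod_eq[OF n(2)[OF span_base[OF b]], of "n * q"] by simp
  have inPhi: "(?c ^^ i) be : Ph" for i by (induction i) (auto intro: cox_elt_root[OF bp] b)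
  define m where "m = n * k - k"
  have mk: "m + k = n * k" using n(1) by (simp add: m_def)
  have b1: "(?c ^^ m) ?ga = be" using per[of k] mk by (metis funpow_add o_apply)
  have "(?c ^^ m) ?ga = (?c ^^ (m mod n)) ?ga"
   using funpow_mod_eq[OF n(2)[OF span_base[OF inPhi[of k]]], of m] by simp
  then have "be = ?g (m mod n, length l1)" using b1 g by simp
  then show "be : ?g ` ({..<n} \<times> {..<length ds})" using n(1) l(1) by (intro image_eqI[of _ _ "(m mod n, length l1)"]) auto
 qed
 then have "card Ph <= card (?g ` ({..<n} \<times> {..<length ds}))" by (intro card_mono) auto
 also have "... <= card ({..<n} \<times> {..<length ds})" by (rule card_image_le) auto
 also have "... = card base * n" using ds distinct_card[of ds] by simp
 finally show ?thesis .
qed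

end

section \<open>The duality of heights\<close>

lemma cev_scale_poly:
 assumes "rpoly F"
 shows "EX p. (ALL s::real. cev F (complex_of_real s *s z) = poly p (complex_of_real s)) & coeff p 0 = complex_of_real (F 0)"
 using assms
proof (induction F rule: real_polynomial_function.induct)
 case (linear f)
 define a where "a = (SUM b:Basis. f b *R b)"
 have "f x = a <.> x" for x
 proof -
  have "f x = f (SUM b:Basis. (x <.> b) *R b)" by (simp add: euclidean_representation)
  also have "... = (SUM b:Basis. (x <.> b) * f b)"
   using bounded_linear.linear[OF linear] by (simp add: linear_sum linear_scale)
  also have "... = a <.> x" unfolding a_def inner_sum_left by (intro sum.cong refl) (simp add: inner_commute mult.commute)
  finally show ?thesis .
 qed
 then have f: "f = (%x. a <.> x)" by auto
 show ?case unfolding f cev_inner cdot_scale by (intro exI[of _ "[:0, cdot a z:]"]) simp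
next
 case (const c)
 show ?case unfolding cev_const by (intro exI[of _ "[:complex_of_real c:]"]) simp
next
 case (add f g)
 then obtain p q where "ALL s. cev f (complex_of_real s *s z) = poly p (complex_of_real s)" "coeff p 0 = complex_of_real (f 0)"
  "ALL s. cev g (complex_of_real s *s z) = poly q (complex_of_real s)" "coeff q 0 = complex_of_real (g 0)" by blast
 then show ?case unfolding cev_add[OF add.hyps] by (intro exI[of _ "p + q"]) simp
next
 case (mult f g)
 then obtain p q where "ALL s. cev f (complex_of_real s *s z) = poly p (complex_of_real s)" "coeff p 0 = complex_of_real (f 0)"
  "ALL s. cev g (complex_of_real s *s z) = poly q (complex_of_real s)" "coeff q 0 = complex_of_real (g 0)" by blast
 then show ?case unfolding cev_mult[OF mult.hyps] by (intro exI[of _ "p * q"]) (simp add: coeff_mult_0)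
qed

text \<open>Along the complex ray through \<open>z\<close> only the coefficient of degree
  \<open>d\<close> counts. Since the \<open>F j\<close> vanish at 0, fields of degree at least
  \<open>d\<close> contribute nothing to it.\<close>

lemma homogeneous_combination:
 assumes I: "finite I" and et: "polynomial_function et" "!!t x. et (t *R x) = t ^ d *R et x"
  and th: "!!j. j : I ==> polynomial_function (th j)" "!!j t x. j : I ==> th j (t *R x) = t ^ e j *R th j x"
  and F: "!!j. j : I ==> rpoly (F j)" "!!j. j : I ==> F j 0 = 0" and eq: "!!x. et x = (SUM j:I. F j x *R th j x)"
 shows "EX c. cev_field et z = (SUM j:{j:I. e j < d}. c j *s cev_field (th j) z)"
proof -
 have "ALL j:I. EX p. (ALL s::real. cev (F j) (complex_of_real s *s z) = poly p (complex_of_real s)) & coeff p 0 = 0"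
  using cev_scale_poly[OF F(1)] F(2) by (metis of_real_0)
 then obtain p where p: "!!j s. j : I ==> cev (F j) (complex_of_real s *s z) = poly (p j) (complex_of_real s)"
  "!!j. j : I ==> coeff (p j) 0 = 0" by metis
 have etf: "et = (%x. SUM j:I. F j x *R th j x)" using eq by auto
 have ev: "complex_of_real s ^ d * cev_field et z $ k = (SUM j:I. poly (p j) (complex_of_real s) * (complex_of_real s ^ e j * cev_field (th j) z $ k))" for s k
 proof -
  have "cev_field et (complex_of_real s *s z) = (SUM j:I. cev (F j) (complex_of_real s *s z) *s cev_field (th j) (complex_of_real s *s z))"
   by (subst etf) (rule cev_field_sum_scale[OF F(1) th(1)])
  also have "... = (SUM j:I. poly (p j) (complex_of_real s) *s (complex_of_real s ^ e j *s cev_field (th j) z))"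
   by (intro sum.cong refl) (simp add: p(1) cev_field_homogeneous[OF th(1) th(2)])
  finally have "complex_of_real s ^ d *s cev_field et z = (SUM j:I. poly (p j) (complex_of_real s) *s (complex_of_real s ^ e j *s cev_field (th j) z))"
   unfolding cev_field_homogeneous[OF et] .
  then have "(complex_of_real s ^ d *s cev_field et z) $ k = (SUM j:I. poly (p j) (complex_of_real s) *s (complex_of_real s ^ e j *s cev_field (th j) z)) $ k" by simp
  then show ?thesis by (simp add: mult.assoc)
 qed
 let ?J = "{j:I. e j < d}"
 have "cev_field et z $ k = (SUM j:?J. coeff (p j) (d - e j) * cev_field (th j) z $ k)" for k
 proof -
  define q where "q = Polynomial.monom (cev_field et z $ k) d - (SUM j:I. p j * Polynomial.monom (cev_field (th j) z $ k) (e j))"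
  have "poly q (complex_of_real s) = 0" for s
   using ev[of s k] by (simp add: q_def poly_sum poly_monom mult_ac)
  then have inf: "range complex_of_real \<subseteq> {x. poly q x = 0}" by auto
  have "q = 0"
  proof (rule ccontr)
   assume "q ~= 0"
   then have "finite (range complex_of_real)" using inf poly_roots_finite finite_subset by blast
   moreover have "inj complex_of_real" by (simp add: inj_def)
   ultimately show False using infinite_UNIV_char_0 finite_imageD by blast
  qed
  then have "coeff q d = 0" by simp
  then have "cev_field et z $ k = (SUM j:I. coeff (p j * Polynomial.monom (cev_field (th j) z $ k) (e j)) d)"
   by (simp add: q_def coeff_sum)
  also have "... = (SUM j:?J. coeff (p j) (d - e j) * cev_field (th j) z $ k)"
  proof (rule sum.mono_neutral_cong_right[OF I])
   show "?J \<subseteq> I" by auto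
   show "ALL j:I - ?J. coeff (p j * Polynomial.monom (cev_field (th j) z $ k) (e j)) d = 0"
   proof
    fix j assume j: "j : I - ?J"
    have "coeff (Polynomial.monom (cev_field (th j) z $ k) (e j) * p j) d = 0"
     using j p(2)[of j] by (cases "d = e j") (auto simp: coeff_monom_mult)
    then show "coeff (p j * Polynomial.monom (cev_field (th j) z $ k) (e j)) d = 0" by (simp add: mult.commute)
   qed
   fix j assume "j : ?J"
   then show "coeff (p j * Polynomial.monom (cev_field (th j) z $ k) (e j)) d = coeff (p j) (d - e j) * cev_field (th j) z $ k"
    by (subst mult.commute) (simp add: coeff_monom_mult)
  qed
  finally show ?thesis .
 qed
 then have "cev_field et z = (SUM j:?J. coeff (p j) (d - e j) *s cev_field (th j) z)" by (simp add: vec_eq_iff)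
 then show ?thesis by (rule exI[of _ "%j. coeff (p j) (d - e j)"])
qed

text \<open>Returns from the embedded arrangement to the original space by setting the dummy
  coordinate to zero.\<close>

lemma free_basis_restrict:
 fixes W :: "(real^'n) set"
 assumes fb: "free_basis (emb ` W) (emb ` J) I e th"
 shows "EX th'. (ALL i:I. th' i : tangent_fields W J & (ALL t x. th' i (t *R x) = t ^ e i *R th' i x)) &
  (ALL et:tangent_fields W J. EX f. (ALL i:I. rpoly (f i)) & (ALL x. et x = (SUM i:I. f i x *R th' i x)))"
proof -
 define th' where "th' i v = fst (th i (emb v))" for i v
 have bl: "bounded_linear emb" using linear_emb by (simp add: linear_conv_bounded_linear)
 have bf: "bounded_linear (fst :: (real^'n) \<times> real => real^'n)" by (rule bounded_linear_fst)
 have D: "th' i : tangent_fields W J" if i: "i : I" for i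
 proof (rule tangent_fieldsI)
  note T = free_basisD(2)[OF fb i]
  show "rpoly (%x. u <.> th' i x)" for u
   using rpoly_comp[OF tangent_fieldsD(4)[OF T, of "emb u"] bl] by (simp add: th'_def)
  show "th' i x : W" for x using tangent_fieldsD(2)[OF T, of "emb x"] by (auto simp: th'_def)
  show "K <.> th' i x = 0" if "K : J" "K <.> x = 0" for K x
   using tangent_fieldsD(3)[OF T, of "emb K" "emb x"] that by (simp add: th'_def)
 qed
 have gen: "EX f. (ALL i:I. rpoly (f i)) & (ALL x. et x = (SUM i:I. f i x *R th' i x))" if et: "et : tangent_fields W J" for et
 proof -
  have "(%x. emb (et (fst x))) : tangent_fields (emb ` W) (emb ` J)"
  proof (rule tangent_fieldsI)
   show "rpoly (%x::(real^'n) \<times> real. u <.> emb (et (fst x)))" for u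
    using rpoly_comp[OF tangent_fieldsD(4)[OF et, of "fst u"] bf] by simp
   show "emb (et (fst x)) : emb ` W" for x using tangent_fieldsD(2)[OF et] by blast
   show "K <.> emb (et (fst x)) = 0" if "K : emb ` J" "K <.> x = 0" for K x
    using that tangent_fieldsD(3)[OF et] by auto
  qed
  from free_basisD(4)[OF fb this] obtain f where f: "ALL i:I. rpoly (f i)" "ALL x. emb (et (fst x)) = (SUM i:I. f i x *R th i x)" by blast
  have "et v = (SUM i:I. f i (emb v) *R th' i v)" for v
  proof -
   have "et v = fst (emb (et (fst (emb v))))" by simp
   also have "... = fst (SUM i:I. f i (emb v) *R th i (emb v))" by (rule arg_cong[OF f(2)[rule_format]])
   also have "... = (SUM i:I. f i (emb v) *R th' i v)" by (simp add: fst_sum th'_def)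
   finally show ?thesis .
  qed
  moreover have "ALL i:I. rpoly (%v. f i (emb v))" using rpoly_comp[OF _ bl] f(1) by blast
  ultimately show ?thesis by (intro exI[of _ "%i v. f i (emb v)"]) simp
 qed
 have hom: "th' i (t *R x) = t ^ e i *R th' i x" if "i : I" for i t x
  using free_basisD(3)[OF fb that, of t "emb x"] linear_scale[OF linear_emb, of t x] by (simp add: th'_def)
 show ?thesis by (intro exI[of _ th'] conjI ballI allI D hom gen)
qed

text \<open>The action of a group element on fields; reversing the word gives the inverse
  element.\<close>

definition act :: "(real^'n) list => (real^'n => real^'n) => real^'n => real^'n" where
 "act l et v = cox_elt l (et (cox_elt (rev l) v))"

lemma act_append: "act (l @ m) et = act l (act m et)"
 by (simp add: act_def fun_eq_iff cox_elt_append)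

section \<open>The reflection group acting on tangent fields\<close>

context root_sys
begin

abbreviation "D \<equiv> tangent_fields (span Ph) Ph"

definition generators :: "'i set => ('i => nat) => ('i => real^'n => real^'n) => bool" where
 "generators I e th \<longleftrightarrow> finite I & card I = dim Ph &
   (ALL i:I. th i : D & (ALL t x. th i (t *R x) = t ^ e i *R th i x)) &
   (ALL et:D. EX f. (ALL i:I. rpoly (f i)) & (ALL x. et x = (SUM i:I. f i x *R th i x)))"

lemma generatorsD:
 assumes "generators I e th"
 shows "finite I" "card I = dim Ph" "i : I ==> th i : D" "i : I ==> th i (t *R x) = t ^ e i *R th i x"
  "et : D ==> EX f. (ALL i:I. rpoly (f i)) & (ALL x. et x = (SUM i:I. f i x *R th i x))"
 using assms unfolding generators_def by simp_all

lemma generators_exist: "EX (I::nat set) e th. generators I e th & (ALL t>=1. card {i:I. e i >= t} = card (level t))"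
proof -
 have id: "order_ideal_in pos pos" unfolding order_ideal_in_def by blast
 have "ideal_exponents pos" using ideal_arrangements_free[OF root_sys_axioms] id by blast
 then obtain I :: "nat set" and e th where b: "free_basis (emb ` span Ph) (emb ` pos) I e th" "card I = dim Ph"
  and lv: "ALL t>=1. card {i:I. e i >= t} = card (pos Int level t)" unfolding ideal_exponents_def by blast
 obtain th' where t: "ALL i:I. th' i : tangent_fields (span Ph) pos & (ALL t x. th' i (t *R x) = t ^ e i *R th' i x)"
  "ALL et:tangent_fields (span Ph) pos. EX f. (ALL i:I. rpoly (f i)) & (ALL x. et x = (SUM i:I. f i x *R th' i x))"
  using free_basis_restrict[OF b(1)] by blast
 have "K <.> et x = 0" if K: "K : Ph" "K <.> x = 0" and et: "et : tangent_fields (span Ph) pos" for K et x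
  using tangent_fieldsD(3)[OF et, of K x] tangent_fieldsD(3)[OF et, of "- K" x] pos_or_neg[OF K(1)] K(2) by auto
 then have "tangent_fields (span Ph) pos \<subseteq> D" by (auto intro!: tangent_fieldsI dest: tangent_fieldsD(2,4))
 moreover have "D \<subseteq> tangent_fields (span Ph) pos" by (rule tangent_fields_antimono) (use pos_root in blast)
 ultimately have D: "tangent_fields (span Ph) pos = D" by blast
 have "generators I e th'" unfolding generators_def
  by (intro conjI free_basisD(1)[OF b(1)] b(2) t[unfolded D])
 moreover have "pos Int level t = level t" for t by (auto simp: level_def)
 ultimately show ?thesis using lv by (intro exI[of _ I] exI[of _ e] exI[of _ th']) simp
qed

lemma act_field:
 assumes l: "set l \<subseteq> Ph" and et: "et : D"
 shows "act l et : D"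
proof (rule tangent_fieldsI)
 have bl: "bounded_linear (cox_elt l)" for l :: "(real^'n) list" using linear_cox_elt by (simp add: linear_conv_bounded_linear)
 show "rpoly (%x. u <.> act l et x)" for u
  using rpoly_comp[OF tangent_fieldsD(4)[OF et, of "cox_elt (rev l) u"] bl[of "rev l"]] cox_elt_adjoint[of "rev l" u]
  by (simp add: act_def)
 show "act l et x : span Ph" for x
 proof -
  let ?y = "et (cox_elt (rev l) x)"
  have "cox_elt l ?y - ?y : span Ph" using cox_elt_diff_span[of l ?y] span_mono[OF l] by blast
  then have "(cox_elt l ?y - ?y) + ?y : span Ph" using tangent_fieldsD(2)[OF et] by (intro span_add) auto
  then show ?thesis by (simp add: act_def)
 qed
 fix K x assume K: "K : Ph" "K <.> x = 0"
 have "cox_elt (rev l) K : Ph" using cox_elt_root[of "rev l" K] l K by simp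
 moreover have "cox_elt (rev l) K <.> cox_elt (rev l) x = 0" using cox_elt_adjoint[of "rev l" K "cox_elt (rev l) x"] cox_elt_rev'[of l x] K by simp
 ultimately have "cox_elt (rev l) K <.> et (cox_elt (rev l) x) = 0" using tangent_fieldsD(3)[OF et] by blast
 then show "K <.> act l et x = 0" using cox_elt_adjoint[of "rev l" K] by (simp add: act_def)
qed

text \<open>On the kernel of \<open>al\<close> a tangent field agrees with its reflected version, so
  the difference is divisible by \<open>al\<close>. That the quotient is again tangent shows that
  the group acts trivially modulo polynomials vanishing at 0.\<close>

lemma reflection_difference:
 assumes a: "al : Ph" and et: "et : D"
 shows "EX et':D. ALL v. et v - act [al] et v = (al <.> v) *R et' v"
proof -
 let ?s = "refl_root al"
 have a0: "al ~= 0" "al <.> al > 0" using a root_nz by auto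
 have act: "act [al] et v = ?s (et (?s v))" for v by (simp add: act_def)
 have fixd: "?s v = v" if "al <.> v = 0" for v using that by (simp add: refl_root_def inner_commute[of v])
 have A: "act [al] et : D" using act_field[of "[al]" et] a et by simp
 define \<delta> where "\<delta> v = et v - act [al] et v" for v
 have \<delta>0: "\<delta> v = 0" if "al <.> v = 0" for v
  using tangent_fieldsD(3)[OF et a that] fixd[OF that] fixd[of "et v"] by (simp add: \<delta>_def act)
 have \<delta>p: "rpoly (%v. u <.> \<delta> v)" for u
  using real_polynomial_function_diff[OF tangent_fieldsD(4)[OF et, of u] tangent_fieldsD(4)[OF A, of u]] by (simp add: \<delta>_def inner_diff_right)
 have \<delta>s: "\<delta> v : span Ph" for v unfolding \<delta>_def using tangent_fieldsD(2)[OF et] tangent_fieldsD(2)[OF A] by (intro span_diff)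
 have "EX g. rpoly g & (ALL v. u <.> \<delta> v = (al <.> v) * g v)" for u
  using rpoly_divide_linear[OF \<delta>p[of u] subspace_UNIV, of al] \<delta>0 by simp
 then obtain g where g: "!!u. rpoly (g u)" "!!u v. u <.> \<delta> v = (al <.> v) * g u v" by metis
 obtain B where B: "B \<subseteq> span Ph" "pairwise orthogonal B" "!!x. x : B ==> norm x = 1" "independent B" "card B = dim (span Ph)" "span B = span Ph"
  using orthonormal_basis_subspace[of "span Ph"] by auto
 have finB: "finite B" using B(4) independent_imp_finite by blast
 define et' where "et' v = (SUM b:B. g b v *R b)" for v
 have eq: "\<delta> v = (al <.> v) *R et' v" for v
 proof -
  have "\<delta> v = (SUM b:B. (\<delta> v <.> b) *R b)" using orthonormal_basis_expand[OF B(2,3) _ finB, of "\<delta> v"] \<delta>s B(6) by simp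
  also have "... = (SUM b:B. (al <.> v) *R (g b v *R b))"
   by (intro sum.cong HOL.refl) (simp add: inner_commute[of "\<delta> v"] g(2))
  finally show ?thesis by (simp add: et'_def scaleR_sum_right)
 qed
 have et'p: "rpoly (%v. u <.> et' v)" for u unfolding et'_def inner_sum_right inner_scaleR_right by (intro rpoly_intros g)
 \<comment> \<open>Tangency to the kernel of \<open>al\<close> itself: with
   \<open>al <.> et v = (al <.> v) * q v\<close> the quotient has the value
   \<open>q v - q (refl_root al v)\<close>, which vanishes on that kernel.\<close>
 have case_a: "al <.> et' x = 0" if x: "al <.> x = 0" for x
 proof -
  obtain q where q: "rpoly q" "!!v. al <.> et v = (al <.> v) * q v"
   using rpoly_divide_linear[OF tangent_fieldsD(4)[OF et, of al] subspace_UNIV, of al] tangent_fieldsD(3)[OF et a] by auto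
  have bl: "bounded_linear ?s" using linear_refl_root by (simp add: linear_conv_bounded_linear)
  have as: "al <.> ?s w = - (al <.> w)" for w using a0 by (simp add: refl_root_def inner_diff_right inner_commute[of w])
  have "(al <.> v) * (al <.> et' v) = (al <.> v) * (q v - q (?s v))" for v
  proof -
   have "(al <.> v) * (al <.> et' v) = al <.> \<delta> v" by (simp add: eq)
   also have "... = al <.> et v + al <.> et (?s v)" by (simp add: \<delta>_def act inner_diff_right as)
   also have "... = (al <.> v) * (q v - q (?s v))" unfolding q(2) as by (simp add: right_diff_distrib)
   finally show ?thesis .
  qed
  then have "al <.> et' x = q x - q (?s x)"
   by (intro rpoly_cancel[OF rpoly_inner[of al] et'p[of al] _ subspace_UNIV, where z=al])
    (use a0 in \<open>auto intro!: real_polynomial_function_diff q(1) rpoly_comp[OF q(1) bl]\<close>)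
  then show ?thesis using fixd[OF x] by simp
 qed
 have "et' : D"
 proof (rule tangent_fieldsI[OF et'p])
  show "et' x : span Ph" for x unfolding et'_def using B(1) by (intro span_sum span_scale) blast
  fix K x assume K: "K : Ph" "K <.> x = 0"
  show "K <.> et' x = 0"
  proof (cases "al : span {K}")
   case True
   then obtain k where k: "al = k *R K" by (auto simp: span_singleton)
   then have k0: "k ~= 0" using a0 by auto
   have "al <.> x = 0" using K(2) k by simp
   then have "al <.> et' x = 0" by (rule case_a)
   then show ?thesis using k k0 by simp
  next
   case False
   then obtain w where w: "K <.> w = 0" "al <.> w ~= 0" using separating_vector[OF False] by auto
   show ?thesis
   proof (rule rpoly_domain[OF rpoly_inner[of al] et'p[of K] subspace_hyperplane[of K]])
    fix v assume v: "v : {x. K <.> x = 0}"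
    have "(al <.> v) * (K <.> et' v) = K <.> \<delta> v" by (simp add: eq)
    also have "... = 0" unfolding \<delta>_def using tangent_fieldsD(3)[OF et K(1)] tangent_fieldsD(3)[OF A K(1)] v by (simp add: inner_diff_right)
    finally show "(al <.> v) * (K <.> et' v) = 0" .
   qed (use w K in auto)
  qed
 qed
 then show ?thesis using eq unfolding \<delta>_def by blast
qed

lemma act_difference:
 assumes G: "generators I e th" and l: "set l \<subseteq> Ph" and et: "et : D"
 shows "EX F. (ALL j:I. rpoly (F j) & F j 0 = 0) & (ALL v. et v - act l et v = (SUM j:I. F j v *R th j v))"
 using l
proof (induction l)
 case Nil
 have "ALL j:I. rpoly (%v::real^'n. 0::real)" by (simp add: rpoly_const)
 then show ?case by (intro exI[of _ "%_ _. 0"]) (simp add: act_def)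
next
 case (Cons a l)
 then obtain F where F: "ALL j:I. rpoly (F j) & F j 0 = 0" "ALL v. et v - act l et v = (SUM j:I. F j v *R th j v)" by auto
 have a: "a : Ph" "set l \<subseteq> Ph" using Cons.prems by auto
 obtain et' where et': "et' : D" "ALL v. act l et v - act [a] (act l et) v = (a <.> v) *R et' v"
  using reflection_difference[OF a(1) act_field[OF a(2) et]] by blast
 obtain f where f: "ALL i:I. rpoly (f i)" "ALL x. et' x = (SUM i:I. f i x *R th i x)" using generatorsD(5)[OF G et'(1)] by blast
 have "et v - act (a # l) et v = (SUM j:I. (F j v + (a <.> v) * f j v) *R th j v)" for v
 proof -
  have "et v - act (a # l) et v = (et v - act l et v) + (act l et v - act [a] (act l et) v)"
   using act_append[of "[a]" l et] by simp
  also have "... = (SUM j:I. F j v *R th j v) + (a <.> v) *R (SUM i:I. f i v *R th i v)"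
   using F(2) et'(2) f(2) by simp
  finally show ?thesis by (simp add: scaleR_sum_right scaleR_add_left sum.distrib)
 qed
 moreover have "ALL j:I. rpoly (%v. F j v + (a <.> v) * f j v) & F j 0 + (a <.> 0) * f j 0 = 0"
  using F(1) f(1) by (auto intro!: rpoly_add rpoly_mult rpoly_inner)
 ultimately show ?case by (intro exI[of _ "%j v. F j v + (a <.> v) * f j v"]) simp
qed

lemma cox_elt_id_extend:
 assumes l: "set l \<subseteq> Ph" and N: "!!x. x : span Ph ==> (cox_elt l ^^ N) x = x"
 shows "(cox_elt l ^^ N) x = x"
proof -
 obtain y z where yz: "y : span Ph" "!!w. w : span Ph ==> orthogonal z w" "x = y + z"
  using orthogonal_subspace_decomp_exists[of Ph x] by metis
 have "cox_elt m z = z" if "set m \<subseteq> Ph" for m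
  using that
 proof (induction m)
  case (Cons a m)
  then have "z <.> a = 0" using yz(2)[OF span_base[of a Ph]] by (simp add: orthogonal_def)
  then show ?case using Cons by (simp add: refl_root_def)
 qed simp
 then have "cox_elt l z = z" using l by blast
 then have "(cox_elt l ^^ N) z = z" by (induction N) auto
 then show ?thesis using N[OF yz(1)] yz(3) linear_add[OF linear_funpow[OF linear_cox_elt]] by metis
qed

end

section \<open>Complex conjugation and spans of complex families\<close>

definition cnjv :: "complex^'n => complex^'n" where "cnjv w = (\<chi> i. cnj (w $ i))"

lemma cnjv_sum_scale: "cnjv (SUM i:I. c i *s v i) = (SUM i:I. cnj (c i) *s cnjv (v i))"
 by (simp add: cnjv_def vec_eq_iff)

lemma cnjv_cvec: "cnjv (cvec x) = cvec x" by (simp add: cnjv_def cvec_def vec_eq_iff)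

lemma cnjv_cnjv: "cnjv (cnjv x) = x" by (simp add: cnjv_def vec_eq_iff)

lemma cmap_cnjv:
 assumes "linear T"
 shows "cmap T (cnjv w) = cnjv (cmap T w)"
 by (simp add: vec_eq_iff cmap_component[OF assms] cnjv_def)

lemma span_family:
 assumes "finite I" "x : vec.span (u ` I)"
 shows "EX c. x = (SUM i:I. c i *s u i)"
proof -
 let ?S = "{x. EX c. x = (SUM i:I. c i *s u i)}"
 have "vec.span (u ` I) \<subseteq> ?S"
 proof (rule vec.span_minimal)
  show "u ` I \<subseteq> ?S"
  proof clarify
   fix i assume i: "i : I"
   have "u i = (SUM j:I. if j = i then u i else 0)" using assms(1) i by simp
   also have "... = (SUM j:I. (if j = i then 1 else 0) *s u j)" by (intro sum.cong refl) simp
   finally show "EX c. u i = (SUM j:I. c j *s u j)" by (rule exI[of _ "%j. if j = i then 1 else 0"])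
  qed
  show "vec.subspace ?S"
  proof (rule vec.subspaceI)
   show "0 : ?S" by (auto intro!: exI[of _ "%_. 0"])
   fix x y assume "x : ?S" "y : ?S"
   then obtain c d where "x = (SUM i:I. c i *s u i)" "y = (SUM i:I. d i *s u i)" by auto
   then have "x + y = (SUM i:I. (c i + d i) *s u i)" by (simp add: vec.scale_left_distrib sum.distrib)
   then show "x + y : ?S" by (auto intro!: exI[of _ "%i. c i + d i"])
  next
   fix k x assume "x : ?S"
   then obtain c where "x = (SUM i:I. c i *s u i)" by auto
   then have "k *s x = (SUM i:I. (k * c i) *s u i)" by (simp add: vec.scale_sum_right vector_smult_assoc)
   then show "k *s x : ?S" by (auto intro!: exI[of _ "%i. k * c i"])
  qed
 qed
 then show ?thesis using assms(2) by auto
qed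

lemma span_family_sum: "(SUM i:I. c i *s u i) : vec.span (u ` I)"
 by (intro vec.span_sum vec.span_scale vec.span_base) auto

text \<open>Equal fibre sizes mean equal multisets of values.\<close>

lemma fiber_sum_eq:
 fixes f :: "nat => nat"
 assumes I: "finite I" and eq: "!!k. card {i:I. a i = k} = card {i:I. b i = k}"
 shows "(SUM i:I. f (a i)) = (SUM i:I. f (b i))"
proof -
 have "image_mset a (mset_set I) = image_mset b (mset_set I)"
  by (rule multiset_eqI) (simp add: count_image_mset_eq_card_vimage[OF I] eq)
 then have "sum_mset (image_mset f (image_mset a (mset_set I))) = sum_mset (image_mset f (image_mset b (mset_set I)))" by simp
 then show ?thesis by (simp add: sum_unfold_sum_mset image_mset.compositionality o_def)
qed

lemma cev_field_const: "cev_field (%v. w) z = cvec w"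
 by (simp add: cev_field_def cev_const cvec_def)

lemma cev_field_scale:
 assumes "rpoly f" "polynomial_function th"
 shows "cev_field (%v. f v *R th v) z = cev f z *s cev_field th z"
 using cev_field_sum_scale[of "{()}" "%_. f" "%_. th" z] assms by simp

lemma cev_field_add:
 assumes "polynomial_function th" "polynomial_function et"
 shows "cev_field (%v. th v + et v) z = cev_field th z + cev_field et z"
 by (simp add: cev_field_def vec_eq_iff cev_add[OF rpoly_component(1)[OF assms(1)] rpoly_component(1)[OF assms(2)]])

lemma cmap_funpow_eigen:
 assumes "linear T" "cmap T z = mu *s z"
 shows "cmap (T ^^ k) z = mu ^ k *s z"
proof (induction k)
 case 0
 show ?case by (simp add: cmap_id)
next
 case (Suc k)
 have "cmap (T ^^ Suc k) z = cmap T (cmap (T ^^ k) z)" unfolding cmap_compose by (simp add: o_def)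
 also have "... = cmap T (mu ^ k *s z)" by (simp only: Suc)
 also have "... = mu ^ k *s cmap T z" using cmap_sum_scale[OF assms(1), of "%_. mu ^ k" "%_. z" "{()}"] by simp
 finally show ?case by (simp add: assms(2) vector_smult_assoc mult.commute o_def)
qed

lemma cvec_span:
 assumes "x : span B"
 shows "cvec x : vec.span (cvec ` B)"
proof -
 have "span B \<subseteq> {x. cvec x : vec.span (cvec ` B)}"
 proof (rule span_minimal)
  show "B \<subseteq> {x. cvec x : vec.span (cvec ` B)}" by (auto intro: vec.span_base)
  have 0: "cvec 0 = 0" "cvec (x + y) = cvec x + cvec y" "cvec (k *R x) = complex_of_real k *s cvec x" for x y :: "real^'n" and k
   by (simp_all add: cvec_def vec_eq_iff)
  show "subspace {x. cvec x : vec.span (cvec ` B)}"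
   unfolding subspace_def mem_Collect_eq 0 by (auto intro: vec.span_zero vec.span_add vec.span_scale)
 qed
 then show ?thesis using assms by blast
qed

lemma orthonormal_cvec_independent:
 assumes B: "pairwise orthogonal B" "!!x. x : B ==> norm x = 1" "finite B" and z: "(SUM b:B. c b *s cvec b) = 0"
 shows "ALL b:B. c b = 0"
proof
 fix a assume a: "a : B"
 have "0 = cdot a (SUM b:B. c b *s cvec b)" unfolding z by (simp add: cdot_def)
 also have "... = (SUM b:B. c b * complex_of_real (a <.> b))" by (simp add: cdot_sum cdot_scale cdot_cvec)
 also have "... = (SUM b:B. if b = a then c a else 0)"
 proof (rule sum.cong[OF refl])
  fix b assume b: "b : B"
  show "c b * complex_of_real (a <.> b) = (if b = a then c a else 0)"
  proof (cases "b = a")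
   case True
   then show ?thesis using B(2)[OF a] by (simp add: dot_square_norm)
  next
   case False
   then have "a <.> b = 0" using B(1) a b unfolding pairwise_def orthogonal_def by auto
   then show ?thesis using False by simp
  qed
 qed
 finally show "c a = 0" using a B(3) by simp
qed

context root_sys
begin

text \<open>Multiplying a constant field by the product of all roots makes it tangent, and that
  product does not vanish at a regular point.\<close>

lemma regular_values_span:
 assumes G: "generators I e th" and z: "!!be. be : Ph ==> cdot be z ~= 0" and w: "w : span Ph"
 shows "cvec w : vec.span ((%i. cev_field (th i) z) ` I)"
proof -
 let ?Q = "%v::real^'n. PROD be:Ph. be <.> v"
 have "(%v. ?Q v *R w) : D"
 proof (rule tangent_fieldsI)
  show "rpoly (%v. u <.> (?Q v *R w))" for u
   unfolding inner_scaleR_right by (intro rpoly_mult rpoly_const rpoly_prod_inner)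
  show "?Q x *R w : span Ph" for x using w by (rule span_scale)
  show "K <.> (?Q x *R w) = 0" if "K : Ph" "K <.> x = 0" for K x
   using that fin by (auto simp: prod_zero_iff)
 qed
 from generatorsD(5)[OF G this] obtain f where f: "ALL i:I. rpoly (f i)" "ALL x. ?Q x *R w = (SUM i:I. f i x *R th i x)" by blast
 have pc: "polynomial_function (%v. w)" by (simp add: polynomial_function_inner_iff rpoly_const)
 have "cev ?Q z *s cvec w = cev_field (%v. ?Q v *R w) z"
  using cev_field_scale[OF rpoly_prod_inner pc, of Ph z] by (simp add: cev_field_const)
 also have "... = cev_field (%v. SUM i:I. f i v *R th i v) z" using f(2) by simp
 also have "... = (SUM i:I. cev (f i) z *s cev_field (th i) z)"
  by (rule cev_field_sum_scale) (use f(1) tangent_fieldsD(1)[OF generatorsD(3)[OF G]] in auto)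
 finally have "cev ?Q z *s cvec w = (SUM i:I. cev (f i) z *s cev_field (th i) z)" .
 then have "cev ?Q z *s cvec w : vec.span ((%i. cev_field (th i) z) ` I)" by (simp add: span_family_sum)
 moreover have "cev ?Q z = (PROD be:Ph. cdot be z)"
  by (subst cev_prod) (auto simp: cev_inner intro: rpoly_inner)
 then have "cev ?Q z ~= 0" using z fin by simp
 ultimately show ?thesis using vec.span_scale[of "cev ?Q z *s cvec w" _ "1 / cev ?Q z"] by (simp add: vector_smult_assoc)
qed

text \<open>Summation over the cyclic group of the Coxeter element. The result is congruent to
  \<open>N\<close> times the generator modulo coefficients vanishing at 0, because each translate is
  congruent to the generator.\<close>

lemma equivariant_generators:
 assumes G: "generators I e th" and ds: "set ds \<subseteq> Ph" and N: "N > 0" "!!x. (cox_elt ds ^^ N) x = x"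
  and i: "i : I"
 shows "EX si:D. (ALL t x. si (t *R x) = t ^ e i *R si x) & (ALL v. cox_elt ds (si v) = si (cox_elt ds v)) &
  (EX F. (ALL j:I. rpoly (F j) & F j 0 = 0) & (ALL v. real N *R th i v - si v = (SUM j:I. F j v *R th j v)))"
proof -
 define w where "w k = concat (replicate k ds)" for k
 have wS: "w (Suc k) = ds @ w k" for k by (simp add: w_def)
 have wl: "set (w k) \<subseteq> Ph" for k using ds by (auto simp: w_def)
 have cw: "cox_elt (w k) x = (cox_elt ds ^^ k) x" for k x
  by (induction k) (auto simp: wS cox_elt_append, simp add: w_def)
 have wN: "act (w N) et = et" for et
 proof
  fix v
  have "cox_elt (rev (w N)) v = cox_elt (rev (w N)) (cox_elt (w N) v)" by (simp add: cw N(2))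
  then have "cox_elt (rev (w N)) v = v" by (simp add: cox_elt_rev)
  then show "act (w N) et v = et v" by (simp add: act_def cw N(2))
 qed
 have w0: "act (w 0) et = et" for et by (simp add: act_def w_def fun_eq_iff)
 note T = generatorsD(3)[OF G i]
 define si where "si v = (SUM k<N. act (w k) (th i) v)" for v
 have A: "act (w k) (th i) : D" for k by (rule act_field[OF wl T])
 have "si : D"
 proof (rule tangent_fieldsI)
  show "rpoly (%x. u <.> si x)" for u unfolding si_def inner_sum_right by (intro rpoly_sum tangent_fieldsD(4)[OF A])
  show "si x : span Ph" for x unfolding si_def by (intro span_sum tangent_fieldsD(2)[OF A])
  show "K <.> si x = 0" if "K : Ph" "K <.> x = 0" for K x
   unfolding si_def inner_sum_right using tangent_fieldsD(3)[OF A that] by simp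
 qed
 moreover have "si (t *R x) = t ^ e i *R si x" for t x
  unfolding si_def scaleR_sum_right
  by (intro sum.cong HOL.refl) (simp add: act_def linear_scale[OF linear_cox_elt] generatorsD(4)[OF G i])
 moreover have "cox_elt ds (si v) = si (cox_elt ds v)" for v
 proof -
  let ?a = "%k. act (w k) (th i) (cox_elt ds v)"
  have "cox_elt ds (si v) = (SUM k<N. cox_elt ds (act (w k) (th i) v))" unfolding si_def by (rule linear_sum[OF linear_cox_elt])
  also have "... = (SUM k<N. ?a (Suc k))"
  proof (rule sum.cong[OF HOL.refl])
   fix k
   have "?a (Suc k) = act ds (act (w k) (th i)) (cox_elt ds v)" by (simp add: wS act_append)
   then show "cox_elt ds (act (w k) (th i) v) = ?a (Suc k)" by (simp add: act_def[of ds] cox_elt_rev)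
  qed
  also have "... = (SUM k<N. ?a k) + ?a N - ?a 0"
   using sum.lessThan_Suc[of ?a N] sum.lessThan_Suc_shift[of ?a N] by (simp add: algebra_simps)
  finally show ?thesis by (simp add: si_def wN w0)
 qed
 moreover have "EX F. (ALL j:I. rpoly (F j) & F j 0 = 0) & (ALL v. real N *R th i v - si v = (SUM j:I. F j v *R th j v))"
 proof -
  have "ALL k. EX F. (ALL j:I. rpoly (F j) & F j 0 = 0) & (ALL v. th i v - act (w k) (th i) v = (SUM j:I. F j v *R th j v))"
   using act_difference[OF G wl T] by blast
  then obtain F where F: "!!k j. j : I ==> rpoly (F k j)" "!!k j. j : I ==> F k j 0 = 0"
   "!!k v. th i v - act (w k) (th i) v = (SUM j:I. F k j v *R th j v)" by metis
  have "real N *R th i v - si v = (SUM j:I. (SUM k<N. F k j v) *R th j v)" for v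
  proof -
   have "real N *R th i v - si v = (SUM k<N. th i v - act (w k) (th i) v)" by (simp add: si_def sum_subtractf sum_constant_scaleR del: sum_constant)
   also have "... = (SUM k<N. SUM j:I. F k j v *R th j v)" by (simp only: F(3))
   also have "... = (SUM j:I. SUM k<N. F k j v *R th j v)" by (rule sum.swap)
   finally show ?thesis by (simp add: scaleR_sum_left)
  qed
  moreover have "ALL j:I. rpoly (%v. SUM k<N. F k j v) & (SUM k<N. F k j 0) = 0" using F by (auto intro!: rpoly_sum)
  ultimately show ?thesis by (intro exI[of _ "%j v. SUM k<N. F k j v"]) simp
 qed
 ultimately show ?thesis by blast
qed

text \<open>An equivariant field of degree \<open>e i\<close>, evaluated at an eigenvector
  \<open>z\<close>, is an eigenvector for \<open>mu ^ e i\<close>.\<close>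

lemma eigenbasis:
 assumes G: "generators I e th" and ds: "set ds \<subseteq> Ph" and N: "N > 0" "!!x. (cox_elt ds ^^ N) x = x"
  and z: "!!be. be : Ph ==> cdot be z ~= 0" "cmap (cox_elt ds) z = mu *s z"
 shows "EX u. (ALL i:I. cmap (cox_elt ds) (u i) = mu ^ e i *s u i & (ALL B. span B = span Ph --> u i : vec.span (cvec ` B))) &
  (ALL w:span Ph. cvec w : vec.span (u ` I))"
proof -
 have "ALL i:I. EX si. si : D & (ALL t x. si (t *R x) = t ^ e i *R si x) & (ALL v. cox_elt ds (si v) = si (cox_elt ds v)) &
  (EX F. (ALL j:I. rpoly (F j) & F j 0 = 0) & (ALL v. real N *R th i v - si v = (SUM j:I. F j v *R th j v)))"
  using equivariant_generators[OF G ds N] by blast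
 from bchoice[OF this] obtain si where s: "ALL i:I. si i : D & (ALL t x. si i (t *R x) = t ^ e i *R si i x) &
  (ALL v. cox_elt ds (si i v) = si i (cox_elt ds v)) &
  (EX F. (ALL j:I. rpoly (F j) & F j 0 = 0) & (ALL v. real N *R th i v - si i v = (SUM j:I. F j v *R th j v)))" ..
 have si: "!!i. i : I ==> si i : D" "!!i t x. i : I ==> si i (t *R x) = t ^ e i *R si i x"
  "!!i v. i : I ==> cox_elt ds (si i v) = si i (cox_elt ds v)"
  "!!i. i : I ==> EX F. (ALL j:I. rpoly (F j) & F j 0 = 0) & (ALL v. real N *R th i v - si i v = (SUM j:I. F j v *R th j v))"
  using s by blast+
 define u where "u i = cev_field (si i) z" for i
 have eig: "cmap (cox_elt ds) (u i) = mu ^ e i *s u i" if i: "i : I" for i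
 proof -
  note p = tangent_fieldsD(1)[OF si(1)[OF i]]
  have "cmap (cox_elt ds) (u i) = cev_field (%v. cox_elt ds (si i v)) z" unfolding u_def by (rule cev_field_comp_left[OF linear_cox_elt p, symmetric])
  also have "... = cev_field (%v. si i (cox_elt ds v)) z" by (simp only: si(3)[OF i])
  also have "... = cev_field (si i) (mu *s z)" unfolding cev_field_comp_right[OF linear_cox_elt] z(2) ..
  also have "... = mu ^ e i *s u i" unfolding u_def by (rule cev_field_homogeneous[OF p si(2)[OF i]])
  finally show ?thesis .
 qed
 have uB: "u i : vec.span (cvec ` B)" if i: "i : I" and B: "span B = span Ph" for i B
 proof -
  obtain C where C: "C \<subseteq> span Ph" "pairwise orthogonal C" "!!x. x : C ==> norm x = 1" "independent C" "card C = dim (span Ph)" "span C = span Ph"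
   using orthonormal_basis_subspace[of "span Ph"] by auto
  have finC: "finite C" using C(4) independent_imp_finite by blast
  have "si i v = (SUM b:C. (b <.> si i v) *R b)" for v
   using orthonormal_basis_expand[OF C(2,3) _ finC, of "si i v"] tangent_fieldsD(2)[OF si(1)[OF i], of v] C(6)
   by (simp add: inner_commute[of _ "si i v"])
  then have "u i = cev_field (%v. SUM b:C. (b <.> si i v) *R b) z" unfolding u_def by simp
  also have "... = (SUM b:C. cev (%v. b <.> si i v) z *s cev_field (%v. b) z)"
   by (rule cev_field_sum_scale) (simp_all add: tangent_fieldsD(4)[OF si(1)[OF i]] polynomial_function_inner_iff rpoly_const)
  finally have "u i = (SUM b:C. cev (%v. b <.> si i v) z *s cvec b)" by (simp add: cev_field_const)
  then show ?thesis using cvec_span[of _ B] C(1) B by (auto intro!: vec.span_sum vec.span_scale)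
 qed
 \<comment> \<open>The values of the equivariant fields still span: modulo generators of smaller
   degree they agree with \<open>N\<close> times the values of the original ones.\<close>
 have gen: "cev_field (th i) z : vec.span (u ` I)" if "i : I" for i
  using that
 proof (induction "e i" arbitrary: i rule: less_induct)
  case less
  obtain F where F: "ALL j:I. rpoly (F j) & F j 0 = 0" "ALL v. real N *R th i v - si i v = (SUM j:I. F j v *R th j v)"
   using si(4)[OF less.prems] by blast
  note T = generatorsD(3)[OF G less.prems] and S = si(1)[OF less.prems]
  define et where "et v = real N *R th i v + (-1) *R si i v" for v
  have p1: "polynomial_function (%v. real N *R th i v)" "polynomial_function (%v. (-1) *R si i v)"
   using tangent_fieldsD(4)[OF T] tangent_fieldsD(4)[OF S] unfolding polynomial_function_inner_iff inner_scaleR_right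
   by (auto intro!: rpoly_mult rpoly_const)
  have etz: "cev_field et z = of_nat N *s cev_field (th i) z + (-1) *s u i"
   unfolding et_def u_def cev_field_add[OF p1] cev_field_scale[OF rpoly_const tangent_fieldsD(1)[OF T]]
    cev_field_scale[OF rpoly_const tangent_fieldsD(1)[OF S]] cev_const by simp
  have "EX c. cev_field et z = (SUM j:{j:I. e j < e i}. c j *s cev_field (th j) z)"
  proof (rule homogeneous_combination[OF generatorsD(1)[OF G]])
   show "polynomial_function et" unfolding et_def using p1 by (rule polynomial_function_add)
   show "et (t *R x) = t ^ e i *R et x" for t x
    by (simp add: et_def generatorsD(4)[OF G less.prems] si(2)[OF less.prems] scaleR_diff_right)
   show "et x = (SUM j:I. F j x *R th j x)" for x using F(2) by (simp add: et_def)
  qed (use F(1) tangent_fieldsD(1)[OF generatorsD(3)[OF G]] generatorsD(4)[OF G] in auto)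
  then obtain c where c: "cev_field et z = (SUM j:{j:I. e j < e i}. c j *s cev_field (th j) z)" by blast
  have "cev_field et z : vec.span (u ` I)"
   unfolding c by (intro vec.span_sum vec.span_scale) (use less.hyps in auto)
  then have "cev_field et z + u i : vec.span (u ` I)" using less.prems by (intro vec.span_add) (auto intro: vec.span_base)
  moreover have "cev_field et z + u i = of_nat N *s cev_field (th i) z" unfolding etz by (simp add: vec_eq_iff)
  ultimately have "(1 / of_nat N) *s (of_nat N *s cev_field (th i) z) : vec.span (u ` I)" by (metis vec.span_scale)
  then show ?case using N(1) by (simp add: vector_smult_assoc)
 qed
 have "cvec w : vec.span (u ` I)" if "w : span Ph" for w
 proof -
  have "vec.span ((%i. cev_field (th i) z) ` I) \<subseteq> vec.span (u ` I)"
   by (rule vec.span_minimal) (use gen in auto)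
  then show ?thesis using regular_values_span[OF G z(1) that] by blast
 qed
 then show ?thesis using eig uB by (intro exI[of _ u]) blast
qed

end

lemma order_of_root_of_unity:
 fixes mu :: complex
 assumes "N > 0" "mu ^ N = 1" "mu ~= 1"
 shows "EX n>=2. ALL k. mu ^ k = 1 \<longleftrightarrow> n dvd k"
proof -
 define n where "n = (LEAST n. n > 0 & mu ^ n = 1)"
 have n: "n > 0" "mu ^ n = 1" using LeastI[of "%n. n > 0 & mu ^ n = 1" N] assms unfolding n_def by auto
 have least: "n <= k" if "k > 0" "mu ^ k = 1" for k unfolding n_def using that by (intro Least_le) auto
 have "n dvd k" if k: "mu ^ k = 1" for k
 proof -
  have "mu ^ k = mu ^ (n * (k div n) + k mod n)" by simp
  then have "mu ^ (k mod n) = 1" using n(2) k by (simp only: power_add power_mult) simp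
  then show ?thesis using least[of "k mod n"] n(1) by (metis mod_less_divisor not_le dvd_eq_mod_eq_0 gr0I)
 qed
 moreover have "mu ^ k = 1" if "n dvd k" for k using that n(2) by (auto simp: power_mult elim!: dvdE)
 moreover have "n ~= 1" using n(2) assms(3) by auto
 ultimately show ?thesis using n(1) by (intro exI[of _ n]) auto
qed

section \<open>Duality of the height partition\<close>

context root_sys
begin

lemma card_root: "card Ph = 2 * card pos"
proof -
 have "Ph = pos Un uminus ` pos"
 proof
  show "Ph \<subseteq> pos Un uminus ` pos"
  proof
   fix x assume "x : Ph"
   then show "x : pos Un uminus ` pos" using pos_or_neg[of x] by (metis Un_iff add.inverse_inverse image_eqI)
  qed
  show "pos Un uminus ` pos \<subseteq> Ph" using pos_root neg by blast
 qed
 moreover have "pos Int uminus ` pos = {}" using not_pos_neg by fastforce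
 moreover have "card (uminus ` pos) = card pos" by (rule card_image) simp
 ultimately show ?thesis using card_Un_disjoint[OF finite_pos finite_imageI[OF finite_pos]] by (metis mult_2)
qed

text \<open>The eigenvalues \<open>mu ^ e i\<close> of the real Coxeter element are stable under
  conjugation, so the residues of the exponents modulo the order \<open>n\<close> of
  \<open>mu\<close> are symmetric under \<open>r -> n - r\<close>. Counting roots forces the
  exponents to equal their residues; the symmetry then passes to the dual partition, the
  heights.\<close>

theorem height_duality:
 assumes irr: "irreducible_root_system Ph" and ds: "distinct ds" "set ds = base"
 shows "EX n>=2. (ALL x. (cox_elt ds ^^ n) x = x) & (ALL k>0. (ALL x. (cox_elt ds ^^ k) x = x) --> n <= k) &
  2 * card pos = n * dim Ph & (ALL t>=n. level t = {}) &
  (ALL t>=1. t <= n --> card (level t) + card (level (n + 1 - t)) = dim Ph)"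
proof -
 let ?c = "cox_elt ds"
 have ne: "Ph ~= {}" using irr unfolding irreducible_root_system_def by blast
 have dsP: "set ds \<subseteq> Ph" using ds(2) base_pos pos_root by blast
 obtain mu z where mu: "mu ~= 1" "norm mu = 1" and cz: "cmap ?c z = mu *s z" and reg: "!!be. be : Ph ==> cdot be z ~= 0"
  using regular_eigenvector[OF irr ds] by blast
 obtain N where N: "N > 0" "!!x. x : span Ph ==> (?c ^^ N) x = x" using cox_elt_finite_order[OF dsP] by blast
 have Nid: "(?c ^^ N) x = x" for x using cox_elt_id_extend[OF dsP N(2)] .
 have root1: "mu ^ k = 1" if k: "!!x. (?c ^^ k) x = x" for k
 proof -
  have "cmap (?c ^^ k) z = z" by (rule cmap_id) (rule k)
  then have "mu ^ k *s z = z" using cmap_funpow_eigen[OF linear_cox_elt cz] by simp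
  moreover obtain be where b: "be : Ph" using ne by blast
  ultimately have "mu ^ k * cdot be z = cdot be z" by (metis cdot_scale)
  then show ?thesis using reg[OF b] by simp
 qed
 obtain n where n: "n >= 2" "!!k. mu ^ k = 1 \<longleftrightarrow> n dvd k"
  using order_of_root_of_unity[OF N(1) root1[OF Nid] mu(1)] by blast
 obtain I :: "nat set" and e th where G: "generators I e th" and lv: "!!t. t >= 1 ==> card {i:I. e i >= t} = card (level t)"
  using generators_exist by blast
 note finI = generatorsD(1)[OF G] and cardI = generatorsD(2)[OF G]
 obtain u where u: "!!i. i : I ==> cmap ?c (u i) = mu ^ e i *s u i"
  "!!i B. i : I ==> span B = span Ph ==> u i : vec.span (cvec ` B)" "!!w. w : span Ph ==> cvec w : vec.span (u ` I)"
  using eigenbasis[OF G dsP N(1) Nid reg cz] by blast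
 obtain B where B: "B \<subseteq> span Ph" "pairwise orthogonal B" "!!x. x : B ==> norm x = 1" "independent B" "card B = dim (span Ph)" "span B = span Ph"
  using orthonormal_basis_subspace[of "span Ph"] by auto
 have finB: "finite B" using B(4) independent_imp_finite by blast
 have cB: "card I <= card B" using B(5) cardI by simp
 define w where "w i = cnjv (u i)" for i
 have cvec_u: "EX b. cvec x = (SUM i:I. b i *s u i)" if "x : span Ph" for x
  using span_family[OF finI u(3)[OF that]] .
 have cvec_w: "EX b. cvec x = (SUM i:I. b i *s w i)" if x: "x : span Ph" for x
 proof -
  obtain b where b: "cvec x = (SUM i:I. b i *s u i)" using cvec_u[OF x] by blast
  have "cvec x = cnjv (cvec x)" by (simp add: cnjv_cvec)
  also have "... = (SUM i:I. cnj (b i) *s w i)" unfolding b cnjv_sum_scale w_def ..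
  finally show ?thesis by (rule exI[of _ "%i. cnj (b i)"])
 qed
 have indB: "!!c. (SUM b:B. c b *s cvec b) = 0 ==> ALL b:B. c b = 0" by (rule orthonormal_cvec_independent[OF B(2,3) finB])
 have ui: "ALL i:I. c i = 0" if "(SUM i:I. c i *s u i) = 0" for c
  using spanning_family_independent[OF finI finB cB indB _ that] cvec_u B(1) by blast
 have wi: "ALL i:I. c i = 0" if "(SUM i:I. c i *s w i) = 0" for c
  using spanning_family_independent[OF finI finB cB indB _ that] cvec_w B(1) by blast
 have wspan: "cvec ` B \<subseteq> vec.span (w ` I)"
 proof clarify
  fix b assume "b : B"
  then obtain d where "cvec b = (SUM i:I. d i *s w i)" using cvec_w[of b] B(1) by blast
  then show "cvec b : vec.span (w ` I)" using span_family_sum[of d w I] by simp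
 qed
 have uspan: "cvec ` B \<subseteq> vec.span (u ` I)" using u(3) B(1) by blast
 have uw: "EX b. u i = (SUM j:I. b j *s w j)" if i: "i : I" for i
 proof (rule span_family[OF finI])
  show "u i : vec.span (w ` I)" using u(2)[OF i B(6)] vec.span_minimal[OF wspan vec.subspace_span] by blast
 qed
 have wu: "EX b. w i = (SUM j:I. b j *s u j)" if i: "i : I" for i
 proof -
  obtain b where b: "u i = (SUM j:I. b j *s w j)" using uw[OF i] by blast
  have "w i = (SUM j:I. cnj (b j) *s u j)" unfolding w_def[of i] b cnjv_sum_scale unfolding w_def cnjv_cnjv ..
  then show ?thesis by (rule exI[of _ "%j. cnj (b j)"])
 qed
 have wg: "cmap ?c (w i) = cnj mu ^ e i *s w i" if i: "i : I" for i
 proof -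
  have "cmap ?c (w i) = cnjv (mu ^ e i *s u i)" unfolding w_def cmap_cnjv[OF linear_cox_elt] u(1)[OF i] ..
  also have "... = cnj mu ^ e i *s w i" by (simp add: w_def cnjv_def vec_eq_iff)
  finally show ?thesis .
 qed
 \<comment> \<open>The eigenbasis and its conjugate span the same space, so eigenvalue
   multiplicities agree in both directions.\<close>
 have cnt: "card {i:I. mu ^ e i = k} = card {i:I. cnj mu ^ e i = k}" for k
  by (rule antisym)
   (rule independent_eigenvalue_count[OF finI cmap_sum_scale[OF linear_cox_elt] u(1) wg ui wi uw], assumption+,
    rule independent_eigenvalue_count[OF finI cmap_sum_scale[OF linear_cox_elt] wg u(1) wi ui wu], assumption+)
 \<comment> \<open>An eigenvalue 1 would give a vector fixed by every simple reflection, hence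
   orthogonal to all roots.\<close>
 have nofix: "mu ^ e i ~= 1" if i: "i : I" for i
 proof
  assume "mu ^ e i = 1"
  then have "cmap ?c (u i) = u i" using u(1)[OF i] by simp
  then have "?c (re_vec (u i)) = re_vec (u i)" "?c (im_vec (u i)) = im_vec (u i)" by (metis re_im_cmap)+
  then have "s <.> re_vec (u i) = 0" "s <.> im_vec (u i) = 0" if "s : base" for s
   using cox_elt_fixed[of ds _ s] base_independent ds that by simp_all
  then have s0: "cdot s (u i) = 0" if "s : base" for s using that by (simp add: cdot_Complex complex_eq_iff)
  have "span base \<subseteq> {x. cdot x (u i) = 0}"
   by (rule span_minimal) (use s0 in \<open>auto simp: subspace_def cdot_Complex complex_eq_iff inner_add_left\<close>)
  then have b0: "cdot b (u i) = 0" if "b : B" for b using that B(1) span_base_eq by blast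
  obtain d where d: "u i = (SUM b:B. d b *s cvec b)" using span_family[OF finB u(2)[OF i B(6)]] by blast
  have "d a = 0" if a: "a : B" for a
  proof -
   have "(SUM b:B. d b * complex_of_real (a <.> b)) = cdot a (u i)" unfolding d by (simp add: cdot_sum cdot_scale cdot_cvec)
   then have "(SUM b:B. d b * complex_of_real (a <.> b)) = 0" using b0[OF a] by simp
   moreover have "(SUM b:B. d b * complex_of_real (a <.> b)) = (SUM b:B. if b = a then d a else 0)"
   proof (rule sum.cong[OF HOL.refl])
    fix b assume b: "b : B"
    show "d b * complex_of_real (a <.> b) = (if b = a then d a else 0)"
    proof (cases "b = a")
     case True
     then show ?thesis using B(3)[OF a] by (simp add: dot_square_norm)
    next
     case False
     then have "a <.> b = 0" using B(2) a b unfolding pairwise_def orthogonal_def by auto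
     then show ?thesis using False by simp
    qed
   qed
   ultimately show ?thesis using a finB by simp
  qed
  then have "u i = 0" unfolding d by simp
  then have "(SUM j:I. (if j = i then 1 else 0) *s u j) = 0" by (intro sum.neutral) auto
  then show False using ui[of "%j. if j = i then 1 else 0"] i by auto
 qed
 \<comment> \<open>The eigenbasis spans the complexification, and the \<open>n\<close>-th power of
   each eigenvalue is 1; so \<open>n\<close> is also the order of the Coxeter element.\<close>
 have nid: "(?c ^^ n) x = x" if x: "x : span Ph" for x
 proof -
  obtain b where b: "cvec x = (SUM i:I. b i *s u i)" using cvec_u[OF x] by blast
  have "cmap (?c ^^ n) (cvec x) = (SUM i:I. b i *s cmap (?c ^^ n) (u i))"
   unfolding b by (rule cmap_sum_scale[OF linear_funpow[OF linear_cox_elt]])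
  also have "... = (SUM i:I. b i *s u i)"
  proof (rule sum.cong[OF HOL.refl])
   fix i assume i: "i : I"
   have "(mu ^ e i) ^ n = 1" using n(2)[of "e i * n"] by (simp add: power_mult)
   then show "b i *s cmap (?c ^^ n) (u i) = b i *s u i" using cmap_funpow_eigen[OF linear_cox_elt u(1)[OF i], of n] by simp
  qed
  finally have "re_vec (cmap (?c ^^ n) (cvec x)) = re_vec (cvec x)" using b by simp
  moreover have "re_vec (cvec x) = x" by (simp add: re_vec_def cvec_def vec_eq_iff)
  ultimately show ?thesis by (simp add: re_im_cmap)
 qed
 have nid': "(?c ^^ n) x = x" for x using cox_elt_id_extend[OF dsP nid] .
 have nmin: "n <= k" if "k > 0" "!!x. (?c ^^ k) x = x" for k
  using n(2)[of k] root1[OF that(2)] that(1) by (auto intro: dvd_imp_le)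
 define r where "r i = e i mod n" for i
 have r: "0 < r i" "r i < n" if "i : I" for i
  using nofix[OF that] n by (auto simp: r_def dvd_eq_mod_eq_0)
 have mur: "mu ^ e i = mu ^ r i" for i
 proof -
  have "mu ^ e i = mu ^ (n * (e i div n) + r i)" by (simp add: r_def)
  also have "... = (mu ^ n) ^ (e i div n) * mu ^ r i" by (simp only: power_add power_mult)
  finally show ?thesis using n(2)[of n] by simp
 qed
 have mu0: "mu ~= 0" using mu(2) by auto
 have cnjmu: "cnj mu * mu = 1" using mu(2) complex_norm_square[of mu] by (simp add: mult.commute)
 have fib1: "{i:I. r i = k} = {i:I. mu ^ e i = mu ^ k}" if k: "0 < k" "k < n" for k
 proof -
  have "r i = k" if i: "i : I" and eq: "mu ^ r i = mu ^ k" for i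
  proof -
   have no: False if ab: "a < b" "b < n" "mu ^ a = mu ^ b" for a b
   proof -
    have "mu ^ b = mu ^ a * mu ^ (b - a)" using ab(1) by (simp flip: power_add)
    then have "mu ^ (b - a) = 1" using ab(3) mu0 by simp
    then have "n dvd b - a" using n(2) by blast
    then show False using ab dvd_imp_le[of n "b - a"] by linarith
   qed
   show ?thesis using no[of "r i" k] no[of k "r i"] r[OF i] k eq by (metis linorder_neqE_nat)
  qed
  then show ?thesis unfolding mur by auto
 qed
 have fib2: "{i:I. n - r i = k} = {i:I. cnj mu ^ e i = mu ^ k}" if k: "0 < k" "k < n" for k
 proof -
  have "n - r i = k \<longleftrightarrow> cnj mu ^ e i = mu ^ k" if i: "i : I" for i
  proof -
   have one: "cnj mu ^ e i * mu ^ e i = 1" using cnjmu by (simp flip: power_mult_distrib)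
   have "cnj mu ^ e i = mu ^ k \<longleftrightarrow> cnj mu ^ e i * mu ^ e i = mu ^ k * mu ^ e i" using mu0 by simp
   also have "... \<longleftrightarrow> mu ^ (k + r i) = 1" unfolding one power_add mur[of i, symmetric] by auto
   also have "... \<longleftrightarrow> n dvd k + r i" by (rule n(2))
   also have "... \<longleftrightarrow> n - r i = k"
   proof
    assume "n dvd k + r i"
    then obtain q where q: "k + r i = n * q" by (auto elim: dvdE)
    have "q < 2"
    proof (rule ccontr)
     assume "~ q < 2"
     then have "n * 2 <= n * q" by (intro mult_le_mono2) simp
     then show False using q r[OF i] k by linarith
    qed
    moreover have "q ~= 0"
    proof
     assume "q = 0"
     then show False using q k by simp
    qed
    ultimately have "q = 1" by simp
    then show "n - r i = k" using q by simp
   next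
    assume "n - r i = k"
    then have "k + r i = n" using r[OF i] by simp
    then show "n dvd k + r i" by simp
   qed
   finally show ?thesis by blast
  qed
  then show ?thesis by blast
 qed
 have fib: "card {i:I. r i = k} = card {i:I. n - r i = k}" for k
 proof (cases "0 < k & k < n")
  case True
  then have k: "0 < k" "k < n" by auto
  show ?thesis unfolding fib1[OF k] fib2[OF k] by (rule cnt)
 next
  case False
  then have "{i:I. r i = k} = {}" "{i:I. n - r i = k} = {}" using r by fastforce+
  then show ?thesis by (simp only:)
 qed
 have s1: "(SUM i:I. r i) = (SUM i:I. n - r i)" by (rule fiber_sum_eq[OF finI fib])
 have "(SUM i:I. r i) + (SUM i:I. n - r i) = (SUM i:I. n)"
  unfolding sum.distrib[symmetric] using r(2) by (intro sum.cong HOL.refl) (simp add: less_imp_le)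
 then have s2: "2 * (SUM i:I. r i) = n * dim Ph" using s1 cardI by (simp add: mult.commute)
 have le: "2 * card pos <= n * dim Ph" using card_root_le[OF ds _ nid] n(1) card_root card_base by (simp add: mult.commute)
 \<comment> \<open>Double counting: the sizes of the levels are the columns of the partition whose
   rows are the exponents.\<close>
 have sume: "card pos = (SUM i:I. e i)"
 proof -
  define T where "T = Max (insert 0 (e ` I)) + nat \<lceil>SUM p:pos. ht p\<rceil>"
  have eT: "e i <= T" if "i : I" for i unfolding T_def using finI that by (simp add: trans_le_add1)
  have pT: "EX t:{1..T}. p : level t" if p: "p : pos" for p
  proof -
   obtain t where t: "t >= 1" "p : level t" using pos_cases_level[OF p] by blast
   have "ht p <= (SUM p:pos. ht p)" using finite_pos p ht_pos_ge1 by (intro member_le_sum) force+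
   then have "real t <= (SUM p:pos. ht p)" using t by (simp add: level_def)
   then have "t <= nat \<lceil>SUM p:pos. ht p\<rceil>" by linarith
   then show ?thesis using t by (auto simp: T_def)
  qed
  have "pos = (UN t:{1..T}. level t)" using pT by (auto simp: level_def)
  moreover have "ALL s:{1..T}. ALL t:{1..T}. s ~= t --> level s Int level t = {}" by (auto simp: level_def)
  ultimately have "card pos = (SUM t:{1..T}. card (level t))"
   using card_UN_disjoint[of "{1..T}" level] finite_level by simp
  also have "... = (SUM t:{1..T}. card {i:I. e i >= t})" by (intro sum.cong HOL.refl) (simp add: lv)
  also have "... = (SUM t:{1..T}. SUM i:I. if e i >= t then 1 else 0)"
   using finI by (intro sum.cong HOL.refl) (simp add: sum.If_cases Int_def)
  also have "... = (SUM i:I. SUM t:{1..T}. if e i >= t then 1 else 0)" by (rule sum.swap)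
  also have "... = (SUM i:I. e i)"
  proof (rule sum.cong[OF HOL.refl])
   fix i assume i: "i : I"
   have "(SUM t:{1..T}. if e i >= t then 1 else (0::nat)) = card ({1..T} Int {t. t <= e i})" by (simp add: sum.If_cases)
   also have "{1..T} Int {t. t <= e i} = {1..e i}" using eT[OF i] by auto
   finally show "(SUM t:{1..T}. if e i >= t then 1 else 0) = e i" by simp
  qed
  finally show ?thesis .
 qed
 have re: "r i <= e i" for i by (simp add: r_def)
 \<comment> \<open>Residues never exceed the exponents, yet their sum is already
   \<open>n * dim Ph / 2\<close>, an upper bound for the number of positive roots, which is the sum
   of the exponents.\<close>
 have er: "e i = r i" if i: "i : I" for i
 proof (rule ccontr)
  assume "e i ~= r i"
  then have "r i < e i" using re[of i] by simp
  then have "(SUM i:I. r i) < (SUM i:I. e i)" using finI i re by (intro sum_strict_mono_ex1) auto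
  then show False using s2 le sume by simp
 qed
 have eq: "2 * card pos = n * dim Ph" using s2 sume er by simp
 have lvn: "level t = {}" if "t >= n" for t
 proof -
  have "{i:I. e i >= t} = {}" using er r(2) that by (fastforce simp: not_le)
  then have "card {i:I. e i >= t} = 0" by (simp only: card.empty)
  then have "card (level t) = 0" using lv[of t] that n(1) by simp
  then show ?thesis using finite_level by simp
 qed
 have dual: "card (level t) + card (level (n + 1 - t)) = dim Ph" if t: "t >= 1" "t <= n" for t
 proof -
  let ?f = "%k. if n + 1 - t <= k then 1 else 0 :: nat"
  have "card (level (n + 1 - t)) = card {i:I. e i >= n + 1 - t}" using lv[of "n + 1 - t"] t by simp
  also have "{i:I. e i >= n + 1 - t} = I Int {i. n + 1 - t <= r i}" using er by auto
  also have "card (I Int {i. n + 1 - t <= r i}) = (SUM i:I. ?f (r i))" using finI by (simp add: sum.If_cases)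
  also have "... = (SUM i:I. ?f (n - r i))" by (rule fiber_sum_eq[OF finI fib])
  also have "... = (SUM i:I. if t <= e i then 0 else 1)"
   using er r t by (intro sum.cong HOL.refl) (auto simp: not_le)
  finally have "card (level (n + 1 - t)) = (SUM i:I. if t <= e i then 0 else 1)" .
  moreover have "card (level t) = (SUM i:I. if t <= e i then 1 else 0)" using lv[of t] t finI by (simp add: sum.If_cases Int_def)
  ultimately have "card (level t) + card (level (n + 1 - t)) = (SUM i:I. (if t <= e i then 1 else 0) + (if t <= e i then 0 else 1))"
   by (simp only: sum.distrib)
  also have "... = (SUM i:I. 1)" by (intro sum.cong HOL.refl) simp
  finally show ?thesis using cardI by simp
 qed
 show ?thesis using n(1) nid' nmin eq lvn dual by (intro exI[of _ n]) blast
qed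

lemma irreducible_constant:
 assumes irr: "irreducible_root_system Ph"
  and eq: "!!al be. al : Ph ==> be : Ph ==> al <.> be ~= 0 ==> f al = f be" and ab: "al : Ph" "be : Ph"
 shows "f al = f be"
proof (rule ccontr)
 assume ne: "f al ~= f be"
 let ?A = "{ga:Ph. f ga = f al}" and ?B = "{ga:Ph. f ga ~= f al}"
 have "?A ~= {} & ?B ~= {} & ?A Un ?B = Ph & ?A Int ?B = {} & (ALL a:?A. ALL b:?B. a <.> b = 0)"
 proof (intro conjI)
  show "?A ~= {}" "?B ~= {}" using ab ne by auto
  show "?A Un ?B = Ph" "?A Int ?B = {}" by auto
  show "ALL a:?A. ALL b:?B. a <.> b = 0"
  proof (intro ballI)
   fix a b assume "a : ?A" "b : ?B"
   then show "a <.> b = 0" using eq[of a b] by (cases "a <.> b = 0") auto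
  qed
 qed
 then have "EX A B. A ~= {} & B ~= {} & A Un B = Ph & A Int B = {} & (ALL a:A. ALL b:B. a <.> b = 0)"
  by (intro exI)
 then show False using irr unfolding irreducible_root_system_def by (elim conjE notE)
qed

text \<open>The sum of the projections onto the root lines commutes with all reflections, so by
  irreducibility it is a scalar. Its trace is the number of roots, since each projection has trace
  1.\<close>

lemma root_form_trace:
 assumes irr: "irreducible_root_system Ph" and a: "al : Ph"
 shows "(SUM be:Ph. (al <.> be)\<^sup>2 / ((be <.> be) * (al <.> al))) * real (dim Ph) = real (card Ph)"
proof -
 define T where "T x = (SUM be:Ph. ((x <.> be) / (be <.> be)) *R be)" for x
 have linT: "linear T"
  by (rule linearI) (simp_all add: T_def inner_add_left add_divide_distrib scaleR_add_left sum.distrib scaleR_sum_right)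
 have Tsym: "T x <.> y = x <.> T y" for x y
  unfolding T_def inner_sum_left inner_sum_right by (intro sum.cong HOL.refl) (simp add: inner_commute[of _ y])
 have comm: "refl_root ga (T x) = T (refl_root ga x)" if g: "ga : Ph" for ga x
 proof -
  have g0: "ga ~= 0" using g root_nz by blast
  have "bij_betw (refl_root ga) Ph Ph"
   by (rule bij_betw_byWitness[where f'="refl_root ga"]) (use refl[OF g] refl_root_refl_root g0 in auto)
  have "T (refl_root ga x) = (SUM be:Ph. ((refl_root ga x <.> refl_root ga be) / (refl_root ga be <.> refl_root ga be)) *R refl_root ga be)"
   unfolding T_def by (rule sum.reindex_bij_betw[OF \<open>bij_betw (refl_root ga) Ph Ph\<close>, symmetric])
  also have "... = (SUM be:Ph. ((x <.> be) / (be <.> be)) *R refl_root ga be)"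
   by (simp only: refl_root_isometry)
  also have "... = refl_root ga (T x)"
   unfolding T_def by (simp add: linear_sum[OF linear_refl_root] linear_scale[OF linear_refl_root])
  finally show ?thesis by simp
 qed
 define h where "h ga = (T ga <.> ga) / (ga <.> ga)" for ga
 have Tg: "T ga = h ga *R ga" if g: "ga : Ph" for ga
 proof -
  have g0: "ga ~= 0" using g root_nz by blast
  have "refl_root ga (T ga) = T (- ga)" using comm[OF g] refl_root_self[OF g0] by simp
  also have "... = - T ga" by (rule linear_neg[OF linT])
  finally have "T ga - (2 * h ga) *R ga = - T ga" by (simp add: refl_root_def h_def)
  then have "2 *R T ga = 2 *R (h ga *R ga)" by (simp add: scaleR_2 algebra_simps)
  then show ?thesis by (simp only: scaleR_cancel_left) simp
 qed
 have hh: "h be = h al" if b: "be : Ph" for be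
 proof (rule irreducible_constant[OF irr _ b a])
  fix be ga assume bg: "be : Ph" "ga : Ph" "be <.> ga ~= 0"
  have "h be * (be <.> ga) = h ga * (be <.> ga)" using Tsym[of be ga] Tg[OF bg(1)] Tg[OF bg(2)] by simp
  then show "h be = h ga" using bg(3) by simp
 qed
 have Tx: "T x = h al *R x" if "x : span Ph" for x
 proof (rule linear_eq_on_span[OF linT _ _ that])
  show "linear (%x. h al *R x)" by (rule linear_compose_scale_right) (simp add: linear_ident)
  show "T x = h al *R x" if "x : Ph" for x using Tg[OF that] hh[OF that] by simp
 qed
 obtain B where B: "B \<subseteq> span Ph" "pairwise orthogonal B" "!!x. x : B ==> norm x = 1" "independent B" "card B = dim (span Ph)" "span B = span Ph"
  using orthonormal_basis_subspace[of "span Ph"] by auto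
 have finB: "finite B" using B(4) independent_imp_finite by blast
 have "h al * real (dim Ph) = (SUM b:B. h al * (b <.> b))" using B(3,5) by (simp add: dot_square_norm mult.commute)
 also have "... = (SUM b:B. T b <.> b)" by (intro sum.cong HOL.refl) (use Tx B(1) in auto)
 also have "... = (SUM b:B. SUM be:Ph. (b <.> be)\<^sup>2 / (be <.> be))"
  unfolding T_def inner_sum_left
 proof (rule sum.cong[OF HOL.refl], rule sum.cong[OF HOL.refl])
  fix b be
  show "((b <.> be) / (be <.> be)) *R be <.> b = (b <.> be)\<^sup>2 / (be <.> be)"
   unfolding inner_scaleR_left inner_commute[of be b] power2_eq_square by simp
 qed
 also have "... = (SUM be:Ph. SUM b:B. (b <.> be)\<^sup>2 / (be <.> be))" by (rule sum.swap)
 also have "... = (SUM be:Ph. 1)"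
 proof (rule sum.cong[OF HOL.refl])
  fix be assume b: "be : Ph"
  have "be = (SUM x:B. (be <.> x) *R x)" using orthonormal_basis_expand[OF B(2,3) _ finB, of be] B(6) span_base[OF b] by simp
  then have "be <.> be = (SUM x:B. (be <.> x) *R x) <.> be" by simp
  also have "... = (SUM x:B. (x <.> be)\<^sup>2)"
   unfolding inner_sum_left
  proof (rule sum.cong[OF HOL.refl])
   fix x
   show "(be <.> x) *R x <.> be = (x <.> be)\<^sup>2" unfolding inner_scaleR_left inner_commute[of be x] power2_eq_square ..
  qed
  finally have "(SUM x:B. (x <.> be)\<^sup>2) = be <.> be" by simp
  then show "(SUM x:B. (x <.> be)\<^sup>2 / (be <.> be)) = 1" using root_nz[OF b] by (simp flip: sum_divide_distrib)
 qed
 finally have "h al * real (dim Ph) = real (card Ph)" by simp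
 moreover have "h al = (SUM be:Ph. (al <.> be)\<^sup>2 / ((be <.> be) * (al <.> al)))"
  unfolding h_def T_def inner_sum_left sum_divide_distrib
 proof (rule sum.cong[OF HOL.refl])
  fix be
  show "((al <.> be) / (be <.> be)) *R be <.> al / (al <.> al) = (al <.> be)\<^sup>2 / ((be <.> be) * (al <.> al))"
   unfolding inner_scaleR_left inner_commute[of be al] power2_eq_square by simp
 qed
 ultimately show ?thesis by simp
qed

end

context affine_sys
begin

text \<open>\<open>cox\<close> is the scalar of the preceding trace computation, the number of roots
  divided by the rank, which is \<open>n\<close>.\<close>

lemma cox_eq:
 assumes irr: "irreducible_root_system Ph" and n: "2 * card pos = n * dim Ph" and a: "al : Ph"
 shows "cox al = real n"
proof -
 let ?g = "%be. (al <.> be)\<^sup>2 / ((be <.> be) * (al <.> al))"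
 have "(SUM be:Ph. ?g be) = 2 * (SUM be:pos. ?g be)"
 proof (rule even_half_sum[OF fin])
  show "- x : Ph" if "x : Ph" for x using neg that by blast
  show "?g (- x) = ?g x" for x by simp
  show "pos \<subseteq> Ph" using pos_root by blast
  show "x : pos \<longleftrightarrow> - x ~: pos" if "x : Ph" for x using pos_or_neg[OF that] not_pos_neg[of x] by blast
 qed
 also have "... = cox al" unfolding cox_def sum_distrib_left
 proof (rule sum.cong[OF HOL.refl])
  fix be
  show "2 * ?g be = (al <.> be) / (be <.> be) * (2 * (be <.> al) / (al <.> al))"
   unfolding inner_commute[of be al] power2_eq_square by simp
 qed
 finally have "cox al * real (dim Ph) = real (n * dim Ph)" using root_form_trace[OF irr a] card_root n by simp
 moreover have "dim Ph ~= 0" using a root_nz by (auto simp: dim_eq_0)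
 ultimately show ?thesis by simp
qed

end

section \<open>Affine stages\<close>

text \<open>The linear form \<open>x0\<close>, whose kernel is the hyperplane at infinity.\<close>

definition delta :: "(real^'n) \<times> real" where "delta = (0, 1)"

lemma delta_inner: "delta <.> x = snd x" "x <.> delta = snd x"
 by (simp_all add: delta_def inner_prod_def)

context root_sys
begin

text \<open>A smallest subset that contains \<open>al\<close> and is orthogonal to the rest. A
  reflected root outside it would be orthogonal to the reflecting root and hence unchanged.\<close>

lemma component_exists:
 assumes Ps: "Ps \<subseteq> Ph" "!!a b. a : Ps ==> b : Ps ==> refl_root a b : Ps" and a: "al : Ps"
 shows "\<exists>X\<subseteq>Ps. al : X & irreducible_root_system X & (ALL x:X. ALL y:Ps - X. x <.> y = 0) &
  (ALL x:X. ALL y:X. refl_root x y : X)"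
proof -
 define P where "P X \<longleftrightarrow> X \<subseteq> Ps & al : X & (ALL x:X. ALL y:Ps - X. x <.> y = 0)" for X
 define X where "X = arg_min card P"
 have "P Ps" using a by (auto simp: P_def)
 then have XX: "P X & (ALL Y. P Y --> card X <= card Y)" unfolding X_def by (rule arg_min_nat_lemma)
 have X: "X \<subseteq> Ps" "al : X" using conjunct1[OF XX] by (simp_all add: P_def)
 have orth: "x <.> y = 0" if "x : X" "y : Ps - X" for x y
  using conjunct1[OF XX] that by (simp add: P_def)
 have finX: "finite X" by (rule finite_subset[OF X(1) finite_subset[OF Ps(1) fin]])
 have smaller: "Y = X" if Y: "P Y" "Y \<subseteq> X" for Y
  by (rule card_seteq[OF finX Y(2)]) (rule conjunct2[OF XX, rule_format, OF Y(1)])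
 have irr: "irreducible_root_system X"
  unfolding irreducible_root_system_def
 proof (intro conjI notI)
  assume "X = {}" then show False using X(2) by simp
 next
  assume "EX A B. A ~= {} & B ~= {} & A Un B = X & A Int B = {} & (ALL a:A. ALL b:B. a <.> b = 0)"
  then obtain A B where AB0: "A ~= {} & B ~= {} & A Un B = X & A Int B = {} & (ALL a:A. ALL b:B. a <.> b = 0)"
   by (elim exE)
  have AB: "A ~= {}" "B ~= {}" "A Un B = X" "A Int B = {}" using AB0 by simp_all
  have AB5: "a <.> b = 0" if "a : A" "b : B" for a b using AB0 that by simp
  have no: False if CD: "C Un D = X" "D ~= {}" "C Int D = {}" "!!a b. a : C ==> b : D ==> a <.> b = 0" "al : C" for C D
  proof -
   have CX: "C \<subseteq> X" using CD(1) by blast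
   have "x <.> y = 0" if "x : C" "y : Ps - C" for x y
   proof (cases "y : D")
    case True
    then show ?thesis using CD(4) that(1) by simp
   next
    case False
    then have "y : Ps - X" using that CD(1) by blast
    moreover have "x : X" using CX that(1) by blast
    ultimately show ?thesis using orth by simp
   qed
   then have "P C" using X(1) CX CD(5) by (auto simp: P_def)
   then have "C = X" using smaller CX by simp
   then show False using CD(1-3) by auto
  qed
  show False
  proof (cases "al : A")
   case True
   show False by (rule no[OF AB(3,2,4) AB5 True])
  next
   case False
   then have "al : B" using X(2) AB(3) by auto
   moreover have o: "b <.> a = 0" if "b : B" "a : A" for a b using AB5[OF that(2,1)] by (simp add: inner_commute)
   moreover have "B Un A = X" "B Int A = {}" using AB(3,4) by auto
   ultimately show False using no[of B A, OF _ AB(1) _ o] by simp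
  qed
 qed
 have refl: "refl_root x y : X" if xy: "x : X" "y : X" for x y
 proof (rule ccontr)
  assume n: "refl_root x y ~: X"
  have "refl_root x y : Ps - X" using Ps(2)[of x y] X(1) xy n by auto
  then have "x <.> refl_root x y = 0" using orth xy(1) by simp
  moreover have "x <.> refl_root x y = - (x <.> y)"
  proof -
   have "x ~= 0" using X(1) xy(1) Ps(1) nz by auto
   then show ?thesis by (simp add: refl_root_def inner_diff_right inner_commute[of y])
  qed
  ultimately have "refl_root x y = y" by (simp add: refl_root_def inner_commute[of y])
  then show False using n xy by simp
 qed
 show ?thesis using X irr refl orth by (intro exI[of _ X] conjI ballI)
qed

lemma conic_span_neg_pos:
 assumes "p : pos" "q : pos"
 shows "p - (- q) : conic_span pos"
 using conic_add[OF conic_base[OF assms(1)] conic_base[OF assms(2)]] by simp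

end

context affine_sys
begin

definition aarr :: "nat => (real^'n) set => ((real^'n) \<times> real) set" where
 "aarr M Th = insert delta (stage (real M) Th)"

definition affine_units :: bool where
 "affine_units \<longleftrightarrow> (ALL M Th al C. lower Th --> al : Ph --> al ~: Th --> lower (insert al Th) --> (al, real M) : apos -->
   transversal (aarr M Th) C (al, real M) --> unit_on (emb ` span Ph) (aarr M Th) C (al, real M))"

text \<open>While negative roots are being added the exponents are at most \<open>M * h\<close>, and
  their deficits are dual to the heights still missing; afterwards they are at least
  \<open>M * h\<close>, and their excesses are dual to the heights already added. At
  \<open>Th = - pos\<close> both descriptions say that all exponents equal
  \<open>M * h\<close>.\<close>

definition affine_exponents :: "nat => nat => (real^'n) set => bool" where
 "affine_exponents h M Th \<longleftrightarrow> (EX (I::nat set) e th. free_basis (emb ` span Ph) (aarr M Th) I e th & card I = dim Ph &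
   (Th \<subseteq> uminus ` pos --> (ALL t>=1. card {i:I. e i + t <= M * h} = card ((pos - uminus ` Th) Int level t)) & (ALL i:I. e i <= M * h)) &
   (uminus ` pos \<subseteq> Th --> (ALL t>=1. card {i:I. M * h + t <= e i} = card (Th Int level t)) & (ALL i:I. M * h <= e i)))"

lemma apos_natE:
 assumes "f : apos"
 obtains be k where "f = (be, real k)" "be : Ph" "k >= 1 \<or> (k = 0 & be : pos)"
proof -
 obtain be k where k: "f = (be, real_of_int k)" "be : Ph" "k >= 1 \<or> (k = 0 & be : pos)" using aposE[OF assms] by blast
 have "f = (be, real (nat k))" using k by auto
 moreover have "nat k >= 1 \<or> (nat k = 0 & be : pos)" using k(3) by auto
 ultimately show ?thesis using that k(2) by blast
qed

lemma apos_nat_iff: "(be, real k) : apos \<longleftrightarrow> be : Ph & (k >= 1 \<or> be : pos)"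
 using apos_int_iff[of be "int k"] by auto

lemma finite_stage: "finite (stage (real M) Th)"
proof -
 have "stage (real M) Th \<subseteq> (%(be, k). (be, real k)) ` (Ph \<times> {..M})"
 proof
  fix f assume f: "f : stage (real M) Th"
  then obtain be k where "f = (be, real k)" "be : Ph" unfolding stage_def by (auto elim: apos_natE)
  then show "f : (%(be, k). (be, real k)) ` (Ph \<times> {..M})" using f by (auto simp: stage_def intro!: image_eqI[of _ _ "(be, k)"])
 qed
 then show ?thesis using fin by (meson finite_SigmaI finite_atMost finite_imageI finite_subset)
qed

lemma stage_apos: "stage M Th \<subseteq> apos" by (auto simp: stage_def)

lemma arr_aarr:
 assumes "(al, real M) : apos"
 shows "arr (insert (al, real M) (aarr M Th))"
proof -
 have np: "f = g" if "f : apos" "g : apos" "f : span {g}" for f g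
 proof -
  obtain k where "f = k *R g" using \<open>f : span {g}\<close> by (auto simp: span_singleton)
  then show ?thesis by (rule apos_proportional[OF that(1,2)])
 qed
 have d1: "f ~: span {delta}" if "f : apos" for f using apos_nz(1)[OF that] by (auto simp: span_singleton delta_def)
 have d2: "delta ~: span {f}" if "f : apos" for f
 proof
  assume "delta : span {f}"
  then obtain k where k: "delta = k *R f" by (auto simp: span_singleton)
  then have "k *R fst f = 0" "k * snd f = 1" by (auto simp: delta_def prod_eq_iff)
  then show False using apos_nz(1)[OF that] by auto
 qed
 define S where "S = insert (al, real M) (stage (real M) Th)"
 have S: "S \<subseteq> apos" using assms stage_apos[of "real M" Th] by (auto simp: S_def)
 have eq: "insert (al, real M) (aarr M Th) = insert delta S" by (auto simp: aarr_def S_def)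
 show ?thesis
  unfolding arr_def eq
 proof (intro conjI ballI impI)
  show "finite (insert delta S)" using finite_stage[of M Th] by (simp add: S_def)
  have "(delta::(real^'n) \<times> real) ~= 0" by (simp add: delta_def prod_eq_iff)
  moreover have "0 ~: apos" using apos_nz(2)[of 0] by auto
  ultimately show "0 ~: insert delta S" using S by auto
  fix K L assume KL: "K : insert delta S" "L : insert delta S" "K : span {L}"
  show "K = L"
  proof (cases "K = delta")
   case True
   then show ?thesis using KL S d2[of L] by blast
  next
   case False
   then have "K : apos" using KL S by blast
   then show ?thesis using KL S d1[of K] np[of K L] by blast
  qed
 qed
qed

lemma not_aarr: "(al, real M) : apos ==> al ~: Th ==> (al, real M) ~: aarr M Th"
 using apos_nz(1)[of "(al, real M)"] by (auto simp: aarr_def stage_def delta_def)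

text \<open>Any positive root dominates every negative one, so the negative roots of a level are
  exhausted before a positive root enters.\<close>

lemma lower_cases:
 assumes "lower Th"
 shows "Th \<subseteq> uminus ` pos \<or> uminus ` pos \<subseteq> Th"
proof (cases "Th Int pos = {}")
 case True
 have "x : uminus ` pos" if "x : Th" for x
 proof -
  have "x : Ph" "x ~: pos" using that True assms by (auto simp: lower_def)
  then have "- x : pos" using pos_or_neg by blast
  then show ?thesis by (intro image_eqI[of _ _ "- x"]) auto
 qed
 then show ?thesis by blast
next
 case False
 then obtain p where p: "p : Th" "p : pos" by blast
 have "- q : Th" if q: "q : pos" for q
  using assms p conic_span_neg_pos[OF p(2) q] neg[OF pos_root[OF q]] unfolding lower_def by blast
 then show ?thesis by blast
qed

lemma lower_insert_pos:
 assumes "lower (insert al Th)" "al : pos"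
 shows "uminus ` pos \<subseteq> Th"
proof clarify
 fix q assume q: "q : pos"
 have "- q : insert al Th" using assms conic_span_neg_pos[OF assms(2) q] neg[OF pos_root[OF q]] unfolding lower_def by blast
 then show "- q : Th" using not_pos_neg[OF q] assms(2) by auto
qed

lemma lower_insert_neg:
 assumes "lower Th" "- al : pos" "al ~: Th"
 shows "insert al Th \<subseteq> uminus ` pos" "- al ~: Th"
proof -
 have a: "al : uminus ` pos" using assms(2) by (intro image_eqI[of _ _ "- al"]) auto
 then have "Th \<subseteq> uminus ` pos" using lower_cases[OF assms(1)] assms(3) by blast
 then show 1: "insert al Th \<subseteq> uminus ` pos" using a by blast
 show "- al ~: Th"
 proof
  assume "- al : Th"
  then have "- al : uminus ` pos" using 1 by blast
  then show False using assms(2) not_pos_neg by auto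
 qed
qed

lemma lower_remove_max:
 assumes "lower Th" "X \<subseteq> Th" "X ~= {}" "!!x y. x : X ==> y : Th - X ==> ht y <= ht x"
 shows "EX al:X. lower (Th - {al})"
proof -
 have finX: "finite X" using assms fin unfolding lower_def by (meson finite_subset)
 obtain al where a: "al : X" "!!x. x : X ==> ht x <= ht al"
 proof -
  have "Max (ht ` X) : ht ` X" using finX assms(3) by (intro Max_in) auto
  then obtain al where "al : X" "ht al = Max (ht ` X)" by auto
  then show ?thesis using that finX by simp
 qed
 have "lower (Th - {al})"
  unfolding lower_def
 proof (intro conjI ballI impI)
  show "Th - {al} \<subseteq> Ph" using assms(1) by (auto simp: lower_def)
  fix be ga assume b: "be : Th - {al}" and g: "ga : Ph" and c: "be - ga : conic_span pos"
  have "ga : Th" using assms(1) b g c unfolding lower_def by blast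
  moreover have "ga ~= al"
  proof
   assume g: "ga = al"
   have "ht be <= ht al" using a assms(4) b by blast
   moreover have "ht (be - al) >= 0" using ht_conic c g by blast
   ultimately have "ht (be - al) = 0" using linear_diff[OF linear_ht, of be al] by simp
   then have "be - al = 0" using conic_ht_zero c g by blast
   then show False using b by simp
  qed
  ultimately show "ga : Th - {al}" by blast
 qed
 then show ?thesis using a by blast
qed

text \<open>Hyperplanes not parallel to the new one contribute the inversion sum, with slope
  \<open>h - 2\<close> in \<open>M\<close>. The parallel ones form, together with the hyperplane at
  infinity, a single class, and supply the missing \<open>2 * M\<close> up to the sign
  correction.\<close>

lemma affine_count:
 assumes irr: "irreducible_root_system Ph" and h: "2 * card pos = h * dim Ph"
  and T: "lower Th" "al : Ph" "al ~: Th" "lower (insert al Th)" "(al, real M) : apos"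
  and C: "transversal (aarr M Th) C (al, real M)"
 shows "real (card (aarr M Th - C)) = real (M * h) + ht al - (if al : pos then 1 else 0)"
proof -
 let ?a = "(al, real M)" and ?A = "aarr M Th" and ?S = "stage (real M) Th"
 let ?N = "{f:?S. fst f ~: span {al}}" and ?P = "{f:?S. fst f : span {al}}"
 have a0: "al ~= 0" using T(2) root_nz by blast
 have A: "arr (insert ?a ?A)" by (rule arr_aarr[OF T(5)])
 have aA: "?a ~: ?A" by (rule not_aarr[OF T(5,3)])
 have C1: "C \<subseteq> ?A" "!!K. K : ?A ==> EX c:C. K : span {?a, c}" "!!c c'. c : C ==> c' : C ==> c : span {?a, c'} ==> c = c'"
  using C unfolding transversal_def by blast+
 \<comment> \<open>Modulo the new affine root, any two parallel ones are proportional, and so is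
   \<open>delta\<close>.\<close>
 have par: "K : span {?a, L}" if K: "K : insert delta ?P" and L: "L : insert delta ?P" for K L
 proof -
  have "EX k. fst K = k *R al" using K by (auto simp: delta_def span_singleton intro: exI[of _ 0])
  then obtain k where k: "fst K = k *R al" by blast
  have "EX l. fst L = l *R al" using L by (auto simp: delta_def span_singleton intro: exI[of _ 0])
  then obtain l where l: "fst L = l *R al" by blast
  have "snd L - l * real M ~= 0"
  proof
   assume "snd L - l * real M = 0"
   then have "L = l *R ?a" using l by (simp add: prod_eq_iff)
   then have "L : span {?a}" using span_scale[OF span_base[of ?a "{?a}"], of l] by simp
   moreover have "L : ?A" using L by (auto simp: aarr_def)
   ultimately show False using arrD(3)[OF A, of L ?a] aA by blast
  qed
  then obtain v where v: "snd K - k * real M = v * (snd L - l * real M)" by (metis nonzero_eq_divide_eq)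
  have "K = (k - v * l) *R ?a + v *R L"
   using k l v by (simp add: prod_eq_iff algebra_simps)
  then show ?thesis using span_pairI by metis
 qed
 have nonpar: "fst L ~: span {al}" if K: "K : ?N" and L: "K : span {?a, L}" for K L
 proof
  assume "fst L : span {al}"
  then obtain l where l: "fst L = l *R al" by (auto simp: span_singleton)
  obtain u v where "K = u *R ?a + v *R L" using span_pairE[OF L] by blast
  then have "fst K = (u + v * l) *R al" using l by (simp add: scaleR_add_left)
  then show False using K by (auto simp: span_singleton)
 qed
 have nonpar': "fst K ~: span {al}" if K: "K : ?A" and L: "L : ?N" "K : span {?a, L}" for K L
 proof -
  have "L : ?A" using L by (auto simp: aarr_def)
  then have "L : span {?a, K}" using arr_class_sym[OF A aA K _ L(2)] by blast
  then show ?thesis using nonpar[OF L(1)] by blast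
 qed
 have trN: "transversal ?N (C Int ?N) ?a"
  unfolding transversal_def
 proof (intro conjI ballI impI)
  fix K assume K: "K : ?N"
  then obtain c where c: "c : C" "K : span {?a, c}" using C1(2)[of K] by (auto simp: aarr_def)
  have "c : ?N" using nonpar[OF K c(2)] C1(1) c(1) by (auto simp: aarr_def delta_def span_zero)
  then show "EX c:C Int ?N. K : span {?a, c}" using c by blast
 qed (use C1(3) in blast)+
 have fin1: "finite (inversions ?a)" and sum1: "(SUM f:inversions ?a. (al <.> fst f) / (fst f <.> fst f)) = real M * (cox al - 2) + ht al - (if al : pos then 1 else -1)"
  using inversions_sum[of al "int M"] T(5) by simp_all
 have ins: "order_ideal_in apos (insert ?a ?S)" using stage_ideal[OF T(4)] insert_stage[OF T(5)] by simp
 have aS: "?a ~: ?S" using aA by (simp add: aarr_def)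
 have trN': "transversal {f:?S. fst f ~: span {fst ?a}} (C Int ?N) ?a" using trN by simp
 have "real (card ({f:?S. fst f ~: span {fst ?a}} - (C Int ?N))) = (SUM f:inversions ?a. (fst ?a <.> fst f) / (fst f <.> fst f))"
  by (rule nonparallel_count[OF stage_ideal[OF T(1)] finite_stage T(5) aS ins trN' fin1])
 then have cN: "real (card (?N - C Int ?N)) = real M * (real h - 2) + ht al - (if al : pos then 1 else -1)"
  using sum1 cox_eq[OF irr h T(2)] by simp
 obtain c0 where c0: "c0 : C" "delta : span {?a, c0}" using C1(2)[of delta] by (auto simp: aarr_def)
 have c0P: "c0 : insert delta ?P"
 proof (rule ccontr)
  assume n: "c0 ~: insert delta ?P"
  then have "c0 : ?N" using C1(1) c0(1) by (auto simp: aarr_def)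
  then have "fst delta ~: span {al}" using nonpar'[OF _ _ c0(2)] by (auto simp: aarr_def)
  then show False by (simp add: delta_def span_zero)
 qed
 have Cpar: "C Int insert delta ?P = {c0}"
 proof
  show "C Int insert delta ?P \<subseteq> {c0}" using C1(3)[OF _ c0(1)] par[OF _ c0P] by blast
 qed (use c0 c0P in blast)
 \<comment> \<open>The representative of the parallel class may be \<open>delta\<close> or an affine
   root; in either case the class contributes as many elements as there are parallel affine
   roots.\<close>
 have split: "?A - C = (insert delta ?P - {c0}) Un (?N - C Int ?N)"
  using Cpar by (auto simp: aarr_def delta_def span_zero)
 have dP: "delta ~: ?P" using apos_nz(1) stage_apos by (force simp: delta_def)
 have finP: "finite ?P" "finite ?N" using finite_stage[of M Th] by auto
 have disj: "(insert delta ?P - {c0}) Int (?N - C Int ?N) = {}" by (auto simp: delta_def span_zero)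
 have "card (?A - C) = card (insert delta ?P - {c0}) + card (?N - C Int ?N)"
  unfolding split by (rule card_Un_disjoint) (use finP disj in auto)
 also have "card (insert delta ?P - {c0}) = card ?P" using c0P dP finP by simp
 finally have tot: "card (?A - C) = card ?P + card (?N - C Int ?N)" .
 \<comment> \<open>Both signs occur, and the opposite gradient can be present at level
   \<open>M\<close> itself: this gives \<open>2 * M\<close> parallel roots for positive
   \<open>al\<close> and \<open>2 * M - 1\<close> for negative \<open>al\<close>.\<close>
 have Pset: "?P = (%k. (al, real k)) ` {k. k < M & (k >= 1 \<or> al : pos)} Un (%k. (- al, real k)) ` {k. (k < M \<or> (k = M & - al : Th)) & (k >= 1 \<or> - al : pos)}"
  (is "_ = ?L Un ?R")
 proof
  show "?P \<subseteq> ?L Un ?R"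
  proof
   fix f assume f: "f : ?P"
   then have "f : apos" using stage_apos by blast
   then obtain be k where k: "f = (be, real k)" "be : Ph" "k >= 1 \<or> (k = 0 & be : pos)" by (rule apos_natE)
   obtain u where u: "be = u *R al" using f k(1) by (auto simp: span_singleton)
   then have "u = 1 \<or> u = -1" using red[OF T(2)] k(2) by blast
   then have "be = al \<or> be = - al" using u by auto
   moreover have "k < M \<or> (k = M & be : Th)" using f k(1) by (auto simp: stage_def)
   ultimately show "f : ?L Un ?R" using k T(3) by auto
  qed
  have "x : span {al}" if "x = al \<or> x = - al" for x using that by (auto intro: span_neg span_base)
  then show "?L Un ?R \<subseteq> ?P" using T(2) neg[OF T(2)] by (auto simp: stage_def apos_nat_iff)
 qed
 have injs: "inj_on (%k. (be, real k)) X" for be :: "real^'n" and X by (auto simp: inj_on_def)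
 have "al ~= - al"
 proof
  assume "al = - al"
  then have "al <.> al = - (al <.> al)" by (metis inner_minus_left)
  then show False using a0 by simp
 qed
 then have "?L Int ?R = {}" by blast
 moreover have "finite ?L" "finite ?R" using finP(1) unfolding Pset by auto
 ultimately have cP: "card ?P = card {k. k < M & (k >= 1 \<or> al : pos)} + card {k. (k < M \<or> (k = M & - al : Th)) & (k >= 1 \<or> - al : pos)}"
  unfolding Pset by (simp only: card_Un_disjoint card_image[OF injs])
 show ?thesis
 proof (cases "al : pos")
  case True
  have nT: "- al : Th" using lower_insert_pos[OF T(4) True] True by blast
  have nP: "- al ~: pos" using not_pos_neg[OF True] .
  have "{k. k < M & (k >= 1 \<or> al : pos)} = {..<M}" using True by auto
  moreover have "{k. (k < M \<or> (k = M & - al : Th)) & (k >= 1 \<or> - al : pos)} = {1..M}" using nT nP by auto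
  ultimately have "card ?P = 2 * M" using cP by simp
  then show ?thesis using tot cN True by (simp add: algebra_simps)
 next
  case False
  then have mp: "- al : pos" using pos_or_neg[OF T(2)] by blast
  have M1: "M >= 1" using T(5) False by (simp add: apos_nat_iff)
  have "{k. k < M & (k >= 1 \<or> al : pos)} = {1..<M}" using False by auto
  moreover have "{k. (k < M \<or> (k = M & - al : Th)) & (k >= 1 \<or> - al : pos)} = {..<M}"
   using mp lower_insert_neg(2)[OF T(1) mp T(3)] by auto
  ultimately have "card ?P = (M - 1) + M" using cP by simp
  then have "real (card ?P) = 2 * real M - 1" using M1 by simp
  then show ?thesis using tot cN False by (simp add: algebra_simps)
 qed
qed

end

section \<open>Unit fields near a point and the induction over stages\<close>

context affine_sys
begin

text \<open>After translation to the point \<open>v\<close> the hyperplanes through it are an ideal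
  arrangement of the local finite system, whose unit field is pulled back.\<close>

lemma affine_local_finite:
 assumes T: "lower Th" "al : Ph" "al ~: Th" "lower (insert al Th)" "(al, real M) : apos"
  and C: "transversal (aarr M Th) C (al, real M)" and x: "(al, real M) <.> x = 0" "snd x ~= 0"
 shows "EX et:tangent_fields (emb ` span Ph) {K:aarr M Th. K <.> x = 0}.
  ALL y. (al, real M) <.> y = 0 --> (al, real M) <.> et y = (PROD K:{K:aarr M Th - C. K <.> x = 0}. K <.> y)"
proof -
 let ?a = "(al, real M)" and ?S = "stage (real M) Th"
 define v where "v = (1 / snd x) *R fst x"
 have fx: "fst x = snd x *R v" using x(2) by (simp add: v_def)
 have van: "f <.> x = 0 \<longleftrightarrow> f = lift v (fst f)" for f :: "(real^'n) \<times> real"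
 proof -
  have "f <.> x = snd x * (fst f <.> v + snd f)" by (simp add: inner_prod_def fx algebra_simps)
  then have "f <.> x = 0 \<longleftrightarrow> snd f = - (fst f <.> v)" using x(2) by auto
  then show ?thesis by (simp add: lift_def prod_eq_iff)
 qed
 have al: "lift v al = ?a" using van[of ?a] x(1) by simp
 have inj: "lift v be = lift v ga \<longleftrightarrow> be = ga" for be ga by (auto simp: lift_def)
 define Ps where "Ps = {ga:Ph. ga : UNIV & ga <.> v : \<int>}"
 interpret Q: root_sys Ps "c - v" unfolding Ps_def by (rule local_root_sys[OF subspace_UNIV])
 have Qp: "ga : Q.pos \<longleftrightarrow> lift v ga : apos" for ga using local_pos_iff[OF subspace_UNIV, of ga v] by (simp add: Ps_def)
 define J where "J = {ga. lift v ga : ?S}"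
 have J: "order_ideal_in Q.pos J"
  using local_ideal[OF subspace_UNIV stage_ideal[OF T(1), of "real M"], of v] by (simp add: Ps_def J_def)
 have ins: "order_ideal_in apos (insert ?a ?S)" using stage_ideal[OF T(4), of "real M"] insert_stage[OF T(5)] by simp
 have "{ga:UNIV. lift v ga : insert ?a ?S} = insert al J" unfolding J_def using al inj by (auto simp flip: al)
 then have aJ: "order_ideal_in Q.pos (insert al J)"
  using local_ideal[OF subspace_UNIV ins, of v] by (simp add: Ps_def)
 have aS: "?a ~: ?S" using T(3) by (simp add: stage_def)
 have anJ: "al ~: J" using aS al by (simp add: J_def)
 have aQ: "al : Q.pos" using Qp al T(5) by simp
 let ?A = "{K:aarr M Th. K <.> x = 0}" and ?C = "{K:C. K <.> x = 0}"
 have Ax: "?A = lift v ` J"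
 proof
  show "?A \<subseteq> lift v ` J"
  proof
   fix K assume K: "K : ?A"
   then have "K ~= delta" using x(2) by (auto simp: delta_inner)
   then have "K : ?S" using K by (auto simp: aarr_def)
   moreover have "K = lift v (fst K)" using K van by blast
   ultimately have "fst K : J" by (simp add: J_def)
   then show "K : lift v ` J" using \<open>K = lift v (fst K)\<close> by blast
  qed
  have "lift v ga <.> x = 0" for ga using van[of "lift v ga"] by (simp add: lift_def)
  then show "lift v ` J \<subseteq> ?A" by (auto simp: J_def aarr_def)
 qed
 have tr: "transversal ?A ?C ?a" by (rule transversal_local[OF arr_aarr[OF T(5)] not_aarr[OF T(5,3)] C x(1)])
 define G where "G = {ga:J. lift v ga : C}"
 have GC: "?C = lift v ` G"
 proof -
  have "?C \<subseteq> ?A" using tr unfolding transversal_def by blast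
  then have "?C = {K:lift v ` J. K : C}" unfolding Ax[symmetric] by blast
  then show ?thesis by (auto simp: G_def)
 qed
 have sp: "emb ga : span {emb al, emb be} \<longleftrightarrow> lift v ga : span {?a, lift v be}" for ga be
 proof
  assume "emb ga : span {emb al, emb be}"
  then obtain p q where "emb ga = p *R emb al + q *R emb be" by (rule span_pairE)
  then have "fst (emb ga) = fst (p *R emb al + q *R emb be)" by simp
  then have "lift v ga = p *R lift v al + q *R lift v be" by (simp add: linear_add[OF linear_lift] linear_scale[OF linear_lift])
  then show "lift v ga : span {?a, lift v be}" unfolding al by (metis span_pairI)
 next
  assume "lift v ga : span {?a, lift v be}"
  then obtain p q where "lift v ga = p *R lift v al + q *R lift v be" unfolding al[symmetric] by (rule span_pairE)
  then have "fst (lift v ga) = fst (p *R lift v al + q *R lift v be)" by simp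
  then have "emb ga = p *R emb al + q *R emb be"
   by (simp add: lift_def linear_add[OF linear_emb] linear_scale[OF linear_emb])
  then show "emb ga : span {emb al, emb be}" by (metis span_pairI)
 qed
 have trl: "transversal (emb ` J) (emb ` G) (emb al)"
  unfolding transversal_def
 proof (intro conjI ballI impI)
  show "emb ` G \<subseteq> emb ` J" by (auto simp: G_def)
 next
  fix K assume "K : emb ` J"
  then obtain ga where g: "K = emb ga" "ga : J" by blast
  then have "lift v ga : ?A" unfolding Ax by blast
  then obtain k where "k : ?C" "lift v ga : span {?a, k}" using tr unfolding transversal_def by blast
  then obtain be where "be : G" "lift v ga : span {?a, lift v be}" unfolding GC by blast
  then show "EX c:emb ` G. K : span {emb al, c}" using g(1) sp by blast
 next
  fix K L assume KL: "K : emb ` G" "L : emb ` G" "K : span {emb al, L}"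
  then obtain ga be where g: "K = emb ga" "ga : G" "L = emb be" "be : G" by blast
  then have "lift v ga : span {?a, lift v be}" using sp KL(3) by blast
  moreover have "lift v ga : ?C" "lift v be : ?C" unfolding GC using g by blast+
  ultimately have "lift v ga = lift v be" using tr unfolding transversal_def by blast
  then show "K = L" using g inj by simp
 qed
 have "Q.ideal_units" using ideal_arrangements_free[OF Q.root_sys_axioms] by blast
 then have "unit_on (emb ` span Ps) (emb ` J) (emb ` G) (emb al)" unfolding Q.ideal_units_def using J aQ anJ aJ trl by blast
 then obtain et where et: "et : tangent_fields (emb ` span Ps) (emb ` J)"
  "!!y. emb al <.> y = 0 ==> emb al <.> et y = (PROD K:emb ` J - emb ` G. K <.> y)" unfolding unit_on_def by blast
 define \<pi> where "\<pi> y = emb (fst y - snd y *R v)" for y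
 have "linear \<pi>"
  by (rule linearI) (simp_all add: \<pi>_def emb_def algebra_simps)
 then have bl: "bounded_linear \<pi>" by (simp add: linear_conv_bounded_linear)
 \<comment> \<open>The map behind this identity is the translation by \<open>v\<close> made linear
   with the help of \<open>x0\<close>; it turns affine roots through \<open>v\<close> into central
   ones.\<close>
 have lp: "lift v ga <.> y = emb ga <.> \<pi> y" for ga y
  by (simp add: lift_def \<pi>_def inner_prod_def inner_diff_right mult.commute)
 have le: "lift v ga <.> et y = emb ga <.> et y" for ga y
 proof -
  obtain w where "et y = emb w" using tangent_fieldsD(2)[OF et(1), of y] by blast
  then show ?thesis by (simp add: lift_def)
 qed
 have T1: "(%y. et (\<pi> y)) : tangent_fields (emb ` span Ph) ?A"
 proof (rule tangent_fieldsI)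
  show "rpoly (%y. u <.> et (\<pi> y))" for u by (rule rpoly_comp[OF tangent_fieldsD(4)[OF et(1)] bl])
  have "span Ps \<subseteq> span Ph" by (rule span_mono) (auto simp: Ps_def)
  then show "et (\<pi> y) : emb ` span Ph" for y using tangent_fieldsD(2)[OF et(1), of "\<pi> y"] by blast
  fix K y assume "K : ?A" and Ky: "K <.> y = 0"
  then obtain ga where g: "K = lift v ga" "ga : J" unfolding Ax by blast
  have "emb ga <.> \<pi> y = 0" using Ky g(1) lp by simp
  then show "K <.> et (\<pi> y) = 0" using tangent_fieldsD(3)[OF et(1), of "emb ga" "\<pi> y"] g le by simp
 qed
 have "{K:aarr M Th - C. K <.> x = 0} = ?A - ?C" by blast
 also have "... = lift v ` (J - G)" unfolding Ax GC using inj by (auto simp: image_iff)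
 finally have e1: "{K:aarr M Th - C. K <.> x = 0} = lift v ` (J - G)" .
 have e2: "emb ` J - emb ` G = emb ` (J - G)" by auto
 have i1: "inj_on (lift v) (J - G)" using inj by (auto simp: inj_on_def)
 have "?a <.> et (\<pi> y) = (PROD K:{K:aarr M Th - C. K <.> x = 0}. K <.> y)" if y: "?a <.> y = 0" for y
 proof -
  have "emb al <.> \<pi> y = 0" using y lp[of al y] al by simp
  then have "?a <.> et (\<pi> y) = (PROD K:emb ` (J - G). K <.> \<pi> y)" using et(2) le[of al "\<pi> y"] al e2 by simp
  also have "... = (PROD ga:J - G. emb ga <.> \<pi> y)" by (rule prod.reindex_cong[OF inj_emb]) simp_all
  also have "... = (PROD K:lift v ` (J - G). K <.> y)" by (rule prod.reindex_cong[OF i1, symmetric]) (simp_all add: lp)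
  finally show ?thesis unfolding e1 .
 qed
 then show ?thesis using T1 by (intro bexI[of _ "%y. et (\<pi> y)"]) auto
qed

text \<open>The gradients orthogonal to the direction \<open>v\<close> form a proper subsystem. Its
  irreducible component through \<open>al\<close> supplies the field by induction; the remaining
  components are tangent to any field with values in the span of that component.\<close>

lemma affine_local_infinite:
 assumes IH: "!!Ps. Ps \<subset> Ph ==> irreducible_root_system Ps ==> affine_sys Ps c ==> affine_sys.affine_units Ps c"
  and T: "lower Th" "al : Ph" "al ~: Th" "lower (insert al Th)" "(al, real M) : apos"
  and C: "transversal (aarr M Th) C (al, real M)" and x: "(al, real M) <.> x = 0" "snd x = 0" "fst x : span Ph" "x ~= 0"
 shows "EX et:tangent_fields (emb ` span Ph) {K:aarr M Th. K <.> x = 0}.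
  ALL y. (al, real M) <.> y = 0 --> (al, real M) <.> et y = (PROD K:{K:aarr M Th - C. K <.> x = 0}. K <.> y)"
proof -
 let ?a = "(al, real M)" and ?S = "stage (real M) Th"
 define v where "v = fst x"
 have v: "v : span Ph" "v ~= 0" using x by (auto simp: v_def prod_eq_iff)
 have Kx: "K <.> x = fst K <.> v" for K using x(2) by (simp add: inner_prod_def v_def)
 define Ps where "Ps = {be:Ph. be <.> v = 0}"
 have "Ps ~= Ph"
 proof
  assume "Ps = Ph"
  then have "Ph \<subseteq> {y. v <.> y = 0}" by (auto simp: Ps_def inner_commute)
  then have "span Ph \<subseteq> {y. v <.> y = 0}" by (rule span_minimal) (rule subspace_hyperplane)
  then show False using v by auto
 qed
 then have ss: "Ps \<subset> Ph" by (auto simp: Ps_def)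
 have rP: "refl_root a b : Ps" if "a : Ps" "b : Ps" for a b
  using that refl[of a b] by (simp add: Ps_def refl_root_inner)
 have aP: "al : Ps" using x(1) T(2) Kx[of ?a] by (simp add: Ps_def)
 have "\<exists>X\<subseteq>Ps. al : X & irreducible_root_system X & (ALL x:X. ALL y:Ps - X. x <.> y = 0) & (ALL x:X. ALL y:X. refl_root x y : X)"
  by (rule component_exists[OF _ rP aP]) (use ss in auto)
 then obtain X where X: "X \<subseteq> Ps" "al : X" "irreducible_root_system X" and orth: "ALL x:X. ALL y:Ps - X. x <.> y = 0"
  and rX: "ALL x:X. ALL y:X. refl_root x y : X" by (elim exE conjE)
 have XP: "X \<subset> Ph" using X(1) ss by blast
 have "root_sys X c" by (rule sub_root_sys) (use XP rX reg in auto)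
 moreover have "affine_sys_axioms X c" by (rule affine_sys_axioms.intro) (use small XP in blast)
 ultimately interpret Q: affine_sys X c by (rule affine_sys.intro)
 have Qp: "Q.pos = pos Int X" unfolding Q.pos_def pos_def using XP by blast
 have Qa: "f : Q.apos \<longleftrightarrow> f : apos & fst f : X" for f unfolding Q.apos_def apos_def using XP by auto
 have Qs: "Q.stage (real M) (Th Int X) = {f:?S. fst f : X}" unfolding Q.stage_def stage_def using Qa by auto
 have low: "Q.lower (Z Int X)" if Z: "lower Z" for Z
  unfolding Q.lower_def
 proof (intro conjI ballI impI)
  fix be ga assume bg: "be : Z Int X" "ga : X" "be - ga : conic_span Q.pos"
  have "be - ga : conic_span pos"
   by (rule conic_mono[OF linear_ident _ bg(3), of pos]) (use Qp conic_base in blast)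
  then show "ga : Z Int X" using Z bg XP unfolding lower_def by blast
 qed simp
 have so: "y <.> w = 0" if y: "y : Ps - X" and w: "w : span X" for y w
 proof -
  have "X \<subseteq> {w. y <.> w = 0}"
  proof
   fix z assume "z : X"
   then have "z <.> y = 0" using orth y by simp
   then show "z : {w. y <.> w = 0}" by (simp add: inner_commute)
  qed
  then have "span X \<subseteq> {w. y <.> w = 0}" by (rule span_minimal) (rule subspace_hyperplane)
  then show ?thesis using w by blast
 qed
 define A' where "A' = insert delta {f:?S. fst f : X}"
 define R where "R = {f:?S. fst f : Ps - X}"
 let ?A = "{K:aarr M Th. K <.> x = 0}" and ?C = "{K:C. K <.> x = 0}"
 have SP: "fst f : Ph" if "f : ?S" for f using that by (simp add: stage_def apos_def)
 have Ax: "?A = A' Un R"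
 proof -
  have "fst f <.> v = 0 \<longleftrightarrow> fst f : Ps" if "f : ?S" for f using SP[OF that] by (simp add: Ps_def)
  moreover have "fst (delta :: (real^'n) \<times> real) <.> v = 0" by (simp add: delta_def)
  ultimately show ?thesis unfolding aarr_def A'_def R_def Kx using X(1) by blast
 qed
 have fA: "fst g : span X" if "g : A'" for g using that by (auto simp: A'_def delta_def span_zero span_base)
 have nospan: False if f: "f : R" and g: "g : A'" and fg: "f : span {?a, g}" for f g
 proof -
  obtain u w where "f = u *R ?a + w *R g" using span_pairE[OF fg] by blast
  then have "fst f = u *R al + w *R fst g" by simp
  then have "fst f : span X" using fA[OF g] X(2) by (simp add: span_add span_scale span_base)
  then have "fst f <.> fst f = 0" using so[of "fst f" "fst f"] f by (simp add: R_def)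
  then show False using f SP[of f] root_nz by (auto simp: R_def)
 qed
 have arrA: "arr (insert ?a (aarr M Th))" and aA: "?a ~: aarr M Th" by (rule arr_aarr[OF T(5)], rule not_aarr[OF T(5,3)])
 have tr: "transversal ?A ?C ?a" by (rule transversal_local[OF arrA aA C x(1)])
 have trD: "?C \<subseteq> ?A" "!!K. K : ?A ==> EX k:?C. K : span {?a, k}" "!!k k'. k : ?C ==> k' : ?C ==> k : span {?a, k'} ==> k = k'"
  using tr unfolding transversal_def by blast+
 \<comment> \<open>A hyperplane of another component is orthogonal to \<open>al\<close> and alone in
   its class, hence its own representative, so it does not enter the product defining
   \<open>b\<close>.\<close>
 have RC: "f : ?C" if f: "f : R" for f
 proof -
  have "f : ?A" using f Ax by blast
  then obtain k where k: "k : ?C" "f : span {?a, k}" using trD(2) by blast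
  have kR: "k : R" using trD(1) k nospan[OF f] Ax by blast
  obtain u w where uw: "f = u *R ?a + w *R k" using span_pairE[OF k(2)] by blast
  then have "fst f <.> al = u * (al <.> al) + w * (fst k <.> al)" by (simp add: inner_add_left)
  moreover have "fst f <.> al = 0" "fst k <.> al = 0" using so[OF _ span_base[OF X(2)]] f kR by (simp_all add: R_def)
  ultimately have "u * (al <.> al) = 0" by simp
  then have "u = 0" using root_nz(2)[OF T(2)] by (metis less_irrefl mult_eq_0_iff)
  then have "f = w *R k" using uw by (simp only: scaleR_zero_left add_0_left)
  moreover have "f : apos" "k : apos" using f kR by (auto simp: R_def stage_def)
  ultimately have "f = k" using apos_proportional by blast
  then show ?thesis using k by simp
 qed
 have tr': "transversal A' (?C Int A') ?a"
  unfolding transversal_def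
 proof (intro conjI ballI impI)
  fix K assume K: "K : A'"
  then have "K : ?A" using Ax by blast
  then obtain k where k: "k : ?C" "K : span {?a, k}" using trD(2) by blast
  have "k : A'"
  proof (rule ccontr)
   assume "k ~: A'"
   then have kR: "k : R" using trD(1) k(1) Ax by blast
   have "K : aarr M Th" "k : aarr M Th" using \<open>K : ?A\<close> trD(1) k(1) by blast+
   then have "k : span {?a, K}" using arr_class_sym[OF arrA aA _ _ k(2)] by blast
   then show False using nospan[OF kR K] by blast
  qed
  then show "EX c:?C Int A'. K : span {?a, c}" using k by blast
 qed (use trD(3) in blast)+
 have QA: "Q.aarr M (Th Int X) = A'" unfolding Q.aarr_def Qs A'_def ..
 have "insert al (Th Int X) = insert al Th Int X" using X(2) by blast
 then have l2: "Q.lower (insert al (Th Int X))" using low[OF T(4)] by simp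
 have "Q.affine_units" using IH[OF XP X(3) Q.affine_sys_axioms] .
 then have "unit_on (emb ` span X) A' (?C Int A') ?a"
 proof -
  have n1: "al ~: Th Int X" using T(3) by blast
  have n2: "?a : Q.apos" using Qa[of ?a] T(5) X(2) by simp
  show ?thesis
   using \<open>Q.affine_units\<close>[unfolded Q.affine_units_def, rule_format, OF low[OF T(1)] X(2) n1 l2 n2 tr'[folded QA]]
   unfolding QA .
 qed
 then obtain et where et: "et : tangent_fields (emb ` span X) A'"
  "ALL y. ?a <.> y = 0 --> ?a <.> et y = (PROD K:A' - ?C Int A'. K <.> y)" unfolding unit_on_def by blast
 have "et : tangent_fields (emb ` span Ph) ?A"
 proof (rule tangent_fieldsI[OF tangent_fieldsD(4)[OF et(1)]])
  show "et y : emb ` span Ph" for y using tangent_fieldsD(2)[OF et(1), of y] span_mono[of X Ph] XP by blast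
  fix K y assume K: "K : ?A" "K <.> y = 0"
  show "K <.> et y = 0"
  proof (cases "K : A'")
   case True
   then show ?thesis using tangent_fieldsD(3)[OF et(1)] K by blast
  next
   case False
   then have "K : R" using K Ax by blast
   moreover obtain w where "w : span X" "et y = emb w" using tangent_fieldsD(2)[OF et(1), of y] by blast
   ultimately show ?thesis using so[of "fst K" w] by (simp add: R_def)
  qed
 qed
 moreover have "{K:aarr M Th - C. K <.> x = 0} = A' - ?C Int A'"
 proof -
  have "{K:aarr M Th - C. K <.> x = 0} = ?A - ?C" by blast
  then show ?thesis unfolding Ax using RC by blast
 qed
 ultimately show ?thesis using et(2) by (intro bexI[of _ et]) simp
qed

text \<open>Separates the signs of \<open>al\<close>: with \<open>k\<close> the absolute height, the
  degree is \<open>M * h + k - 1\<close> for positive and \<open>M * h - k\<close> for negative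
  \<open>al\<close>.\<close>

lemma step_degree:
 assumes irr: "irreducible_root_system Ph" and h: "2 * card pos = h * dim Ph"
  and T: "lower Th" "al : Ph" "al ~: Th" "lower (insert al Th)" "(al, real M) : apos"
  and C: "transversal (aarr M Th) C (al, real M)"
 obtains (pos) k where "al : pos" "k >= 1" "al : level k" "card (aarr M Th - C) + 1 = M * h + k"
 | (neg) k where "- al : pos" "k >= 1" "- al : level k" "card (aarr M Th - C) + k = M * h"
proof (cases "al : pos")
 case True
 obtain k where k: "k >= 1" "ht al = real k" using ht_pos[OF True] by blast
 have "real (card (aarr M Th - C)) = real (M * h) + ht al - 1" using affine_count[OF irr h T C] True by simp
 then have "real (card (aarr M Th - C) + 1) = real (M * h + k)" using k(2) by simp
 then have "card (aarr M Th - C) + 1 = M * h + k" by (simp only: of_nat_eq_iff)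
 then show ?thesis using pos(1)[OF True k(1)] True k(2) by (simp add: level_def)
next
 case False
 then have n: "- al : pos" using pos_or_neg[OF T(2)] by blast
 obtain k where k: "k >= 1" "ht (- al) = real k" using ht_pos[OF n] by blast
 have "real (card (aarr M Th - C)) = real (M * h) + ht al" using affine_count[OF irr h T C] False by simp
 then have "real (card (aarr M Th - C) + k) = real (M * h)" using k(2) by (simp add: ht_neg)
 then have "card (aarr M Th - C) + k = M * h" by (simp only: of_nat_eq_iff)
 then show ?thesis using neg(1)[OF n k(1)] n k(2) by (simp add: level_def)
qed

lemma level_disjoint: "x : level s ==> x : level t ==> s = t" by (simp add: level_def)

text \<open>Here at most rank minus one exponents exceed the degree, and the hyperplane has at least
  rank many dimensions because the direction of \<open>x0\<close> is included.\<close>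

lemma affine_unit:
 assumes irr: "irreducible_root_system Ph" and h: "2 * card pos = h * dim Ph"
  and IH: "!!Ps. Ps \<subset> Ph ==> irreducible_root_system Ps ==> affine_sys Ps c ==> affine_sys.affine_units Ps c"
  and T: "lower Th" "al : Ph" "al ~: Th" "lower (insert al Th)" "(al, real M) : apos"
  and C: "transversal (aarr M Th) C (al, real M)" and ex: "affine_exponents h M Th"
 shows "unit_on (emb ` span Ph) (aarr M Th) C (al, real M)"
proof -
 let ?U = "emb ` span Ph" and ?a = "(al, real M)" and ?A = "aarr M Th"
 define d where "d = card (?A - C)"
 obtain I :: "nat set" and e th where b: "free_basis ?U ?A I e th" and cI: "card I = dim Ph"
  and ng: "Th \<subseteq> uminus ` pos ==> (ALL t>=1. card {i:I. e i + t <= M * h} = card ((pos - uminus ` Th) Int level t))"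
  and ps: "uminus ` pos \<subseteq> Th ==> (ALL t>=1. card {i:I. M * h + t <= e i} = card (Th Int level t))"
  using ex unfolding affine_exponents_def by blast
 have finI: "finite I" using free_basisD(1)[OF b] .
 \<comment> \<open>For positive \<open>al\<close> the level of \<open>al\<close> is not yet full.
   For negative \<open>al\<close> that root is still missing, so some exponent does not exceed the
   degree.\<close>
 have few: "card {i:I. d < e i} < dim Ph"
  using irr h T C
 proof (cases rule: step_degree)
  case (pos k)
  have "{i:I. d < e i} = {i:I. M * h + k <= e i}" using pos(4) unfolding d_def by auto
  then have "card {i:I. d < e i} = card (Th Int level k)" using ps[OF lower_insert_pos[OF T(4) pos(1)]] pos(2) by simp
  also have "... < card (level k)" using pos(3) T(3) finite_level by (intro psubset_card_mono) auto
  also have "... <= dim Ph" by (rule card_level_le)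
  finally show ?thesis .
 next
  case (neg k)
  have sub: "Th \<subseteq> uminus ` pos" using lower_insert_neg(1)[OF T(1) neg(1) T(3)] by blast
  have "- al ~: uminus ` Th" using T(3) by auto
  then have "- al : (pos - uminus ` Th) Int level k" using neg by blast
  then have "card ((pos - uminus ` Th) Int level k) ~= 0" using finite_level by auto
  then have "card {i:I. e i + k <= M * h} ~= 0" using ng[OF sub] neg(2) by simp
  then have "{i:I. e i + k <= M * h} ~= {}" by (metis card.empty)
  then obtain i0 where i0: "i0 : I" "e i0 + k <= M * h" by blast
  then have "e i0 <= d" using neg(4) unfolding d_def by linarith
  then have "i0 ~: {i:I. d < e i}" by simp
  then have "{i:I. d < e i} \<subset> I" using i0(1) by blast
  then show ?thesis using psubset_card_mono[OF finI] cI by metis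
 qed
 interpret ad: addition ?U ?A C ?a I e th d
  by unfold_locales (use subspace_emb_span arr_aarr[OF T(5)] not_aarr[OF T(5,3)] C b d_def in auto)
 let ?W = "span Ph \<times> (UNIV :: real set)"
 have W: "subspace ?W" by (intro subspace_Times) auto
 have "dim ?W = dim Ph + 1" using dim_Times[of "span Ph" "UNIV :: real set"] by (simp add: dim_UNIV)
 then have dW: "dim Ph <= dim {x:?W. ?a <.> x = 0}" using dim_kernel_ge[OF W, of ?a] by simp
 have "EX et:tangent_fields ?U ?A. ALL y. ?a <.> y = 0 --> ?a <.> et y = (PROD K:?A - C. K <.> y)"
 proof (rule ad.local_to_global[OF W])
  show "card {i:I. d < e i} < dim {x:?W. ?a <.> x = 0}" using few dW by linarith
  fix x assume x: "x : ?W" "?a <.> x = 0" "x ~= 0"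
  show "EX et:tangent_fields ?U {K:?A. K <.> x = 0}. ALL y. ?a <.> y = 0 --> ?a <.> et y = (PROD K:{K:?A - C. K <.> x = 0}. K <.> y)"
  proof (cases "snd x = 0")
   case True
   have fx: "fst x : span Ph" using x(1) by auto
   show ?thesis by (rule affine_local_infinite[OF IH T C x(2) True fx x(3)])
  next
   case False
   show ?thesis by (rule affine_local_finite[OF T C x(2) False])
  qed
 qed
 then show ?thesis unfolding unit_on_def .
qed

text \<open>For positive \<open>al\<close> one exponent moves from \<open>M * h + k - 1\<close> to
  \<open>M * h + k\<close>; for negative \<open>al\<close> one moves from \<open>M * h - k\<close>
  to \<open>M * h - k + 1\<close>. Both match the change of the height counts.\<close>

lemma affine_exponents_insert:
 assumes irr: "irreducible_root_system Ph" and h: "2 * card pos = h * dim Ph"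
  and IH: "!!Ps. Ps \<subset> Ph ==> irreducible_root_system Ps ==> affine_sys Ps c ==> affine_sys.affine_units Ps c"
  and T: "lower Th" "al : Ph" "al ~: Th" "lower (insert al Th)" "(al, real M) : apos" and ex: "affine_exponents h M Th"
 shows "affine_exponents h M (insert al Th)"
proof -
 let ?U = "emb ` span Ph" and ?a = "(al, real M)" and ?A = "aarr M Th"
 obtain I :: "nat set" and e th where b: "free_basis ?U ?A I e th" and cI: "card I = dim Ph"
  and ng: "Th \<subseteq> uminus ` pos ==> (ALL t>=1. card {i:I. e i + t <= M * h} = card ((pos - uminus ` Th) Int level t)) & (ALL i:I. e i <= M * h)"
  and ps: "uminus ` pos \<subseteq> Th ==> (ALL t>=1. card {i:I. M * h + t <= e i} = card (Th Int level t)) & (ALL i:I. M * h <= e i)"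
  using ex unfolding affine_exponents_def by blast
 have finI: "finite I" using free_basisD(1)[OF b] .
 obtain C where C: "transversal ?A C ?a" using transversal_exists[OF arr_aarr[OF T(5)] not_aarr[OF T(5,3)]] by blast
 define d where "d = card (?A - C)"
 interpret ad: addition ?U ?A C ?a I e th d
  by unfold_locales (use subspace_emb_span arr_aarr[OF T(5)] not_aarr[OF T(5,3)] C b d_def in auto)
 obtain et where et: "et : tangent_fields ?U ?A" "ALL y. ?a <.> y = 0 --> ?a <.> et y = (PROD K:?A - C. K <.> y)"
  using affine_unit[OF irr h IH T C ex] unfolding unit_on_def by blast
 obtain i th' where i: "i : I" "e i = d" and b': "free_basis ?U (insert ?a ?A) I (e(i := Suc d)) th'"
  using ad.free_basis_add[OF et(1)] et(2) by blast
 let ?e = "e(i := Suc d)"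
 have A': "insert ?a ?A = aarr M (insert al Th)" unfolding aarr_def insert_stage[OF T(5), symmetric] by (rule insert_commute)
 note b'' = b'[unfolded A']
 show ?thesis
  using irr h T C
 proof (cases rule: step_degree)
  case (pos k)
  have dk: "d + 1 = M * h + k" using pos(4) by (simp add: d_def)
  have P: "ALL t>=1. card {i:I. M * h + t <= e i} = card (Th Int level t)" "ALL i:I. M * h <= e i"
   using ps[OF lower_insert_pos[OF T(4) pos(1)]] by blast+
  have "card {j:I. M * h + t <= ?e j} = card (insert al Th Int level t)" if t: "t >= 1" for t
  proof (cases "t = k")
   case True
   have "{j:I. M * h + t <= ?e j} = insert i {j:I. M * h + t <= e j}" using i dk True by auto
   moreover have "i ~: {j:I. M * h + t <= e j}" using i dk True by auto
   ultimately have "card {j:I. M * h + t <= ?e j} = Suc (card (Th Int level t))" using P(1) t finI by simp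
   moreover have "insert al Th Int level t = insert al (Th Int level t)" using pos(3) True by auto
   ultimately show ?thesis using T(3) finite_level by simp
  next
   case False
   have "{j:I. M * h + t <= ?e j} = {j:I. M * h + t <= e j}" using i dk False by auto
   moreover have "insert al Th Int level t = Th Int level t" using level_disjoint[OF pos(3)] False by auto
   ultimately show ?thesis using P(1) t by simp
  qed
  moreover have "ALL j:I. M * h <= ?e j" using P(2) dk pos(2) by auto
  moreover have "~ insert al Th \<subseteq> uminus ` pos" using pos(1) not_pos_neg by auto
  ultimately show ?thesis unfolding affine_exponents_def using b'' cI
   by (intro exI[of _ I] exI[of _ ?e] exI[of _ th']) blast
 next
  case (neg k)
  have dk: "d + k = M * h" using neg(4) by (simp add: d_def)
  note sub = lower_insert_neg(1)[OF T(1) neg(1) T(3)]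
  then have "Th \<subseteq> uminus ` pos" by blast
  from ng[OF this] have P: "ALL t>=1. card {i:I. e i + t <= M * h} = card ((pos - uminus ` Th) Int level t)" "ALL i:I. e i <= M * h" by blast+
  have cnt: "card {j:I. ?e j + t <= M * h} = card ((pos - uminus ` insert al Th) Int level t)" if t: "t >= 1" for t
  proof (cases "t = k")
   case True
   have "{j:I. ?e j + t <= M * h} = {j:I. e j + t <= M * h} - {i}" using i dk True by auto
   moreover have "i : {j:I. e j + t <= M * h}" using i dk True by auto
   ultimately have "card {j:I. ?e j + t <= M * h} = card ((pos - uminus ` Th) Int level t) - 1" using P(1) t finI by simp
   moreover have "(pos - uminus ` insert al Th) Int level t = ((pos - uminus ` Th) Int level t) - {- al}" by auto
   moreover have "- al ~: uminus ` Th" using T(3) by auto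
   then have "- al : (pos - uminus ` Th) Int level t" using neg True by blast
   ultimately show ?thesis using finite_level by simp
  next
   case False
   have "{j:I. ?e j + t <= M * h} = {j:I. e j + t <= M * h}" using i dk False by auto
   moreover have "(pos - uminus ` insert al Th) Int level t = (pos - uminus ` Th) Int level t" using level_disjoint[OF neg(3)] False by auto
   ultimately show ?thesis using P(1) t by simp
  qed
  have le: "ALL j:I. ?e j <= M * h" using P(2) dk neg(2) by auto
  \<comment> \<open>The last negative root closes all deficits, so all exponents are
    \<open>M * h\<close> and the second description begins.\<close>
  have full: "(ALL t>=1. card {j:I. M * h + t <= ?e j} = card (insert al Th Int level t)) & (ALL j:I. M * h <= ?e j)"
   if f: "uminus ` pos \<subseteq> insert al Th"
  proof -
   have "p : uminus ` insert al Th" if "p : pos" for p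
   proof -
    have "- p : insert al Th" using f that by blast
    then show ?thesis by (intro image_eqI[of _ _ "- p"]) simp_all
   qed
   then have "(pos - uminus ` insert al Th) Int level 1 = {}" by blast
   then have "card {j:I. ?e j + 1 <= M * h} = 0" using cnt[of 1] by (simp only: card.empty le_refl)
   moreover have "finite {j:I. ?e j + 1 <= M * h}" by (rule finite_subset[OF _ finI]) blast
   ultimately have "{j:I. ?e j + 1 <= M * h} = {}" using card_0_eq by blast
   then have ge: "ALL j:I. M * h <= ?e j" by fastforce
   have "{j:I. M * h + t <= ?e j} = {}" if "t >= 1" for t using le that by fastforce
   moreover have "insert al Th Int level t = {}" for t using sub not_pos_neg by (auto simp: level_def)
   ultimately have "card {j:I. M * h + t <= ?e j} = card (insert al Th Int level t)" if "t >= 1" for t using that by (simp only: card.empty)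
   then show ?thesis using ge by blast
  qed
  show ?thesis unfolding affine_exponents_def using b'' cI cnt le full
   by (intro exI[of _ I] exI[of _ ?e] exI[of _ th']) blast
 qed
qed

text \<open>Roots outside \<open>Th0\<close> have at least the height of those inside, so removing
  one of maximal height keeps the set lower and returns step by step to \<open>Th0\<close>.\<close>

lemma affine_exponents_chain:
 assumes irr: "irreducible_root_system Ph" and h: "2 * card pos = h * dim Ph"
  and IH: "!!Ps. Ps \<subset> Ph ==> irreducible_root_system Ps ==> affine_sys Ps c ==> affine_sys.affine_units Ps c"
  and start: "affine_exponents h M Th0" "M = 0 ==> uminus ` pos \<subseteq> Th0"
  and low: "lower Th" "Th0 \<subseteq> Th" "!!x y. x : Ph - Th0 ==> y : Th0 ==> ht y <= ht x"
 shows "affine_exponents h M Th"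
 using low(1,2)
proof (induction "card (Th - Th0)" arbitrary: Th)
 case 0
 have "finite Th" using "0.prems"(1) fin finite_subset unfolding lower_def by blast
 then have "Th = Th0" using 0 by auto
 then show ?case using start(1) by simp
next
 case (Suc n)
 have TP: "Th \<subseteq> Ph" using Suc.prems(1) unfolding lower_def by blast
 have ne: "Th - Th0 ~= {}" using Suc.hyps(2) by (metis card.empty nat.distinct(1))
 have "EX al:Th - Th0. lower (Th - {al})"
  by (rule lower_remove_max[OF Suc.prems(1) _ ne]) (use low(3) TP in auto)
 then obtain al where a: "al : Th" "al ~: Th0" "lower (Th - {al})" by blast
 have "finite (Th - Th0)" using TP fin finite_subset by blast
 then have "n = card ((Th - {al}) - Th0)" using Suc.hyps(2) a by (metis Diff_insert Diff_insert2 DiffI card_Diff_singleton diff_Suc_1)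
 then have ex: "affine_exponents h M (Th - {al})" using Suc.hyps(1) a Suc.prems(2) by blast
 have ins: "insert al (Th - {al}) = Th" using a by blast
 have aP: "al : Ph" using a TP by blast
 have "al : pos" if "M = 0"
 proof (rule ccontr)
  assume "al ~: pos"
  then have "- al : pos" using pos_or_neg[OF aP] by blast
  then have "- (- al) : Th0" using start(2)[OF that] by blast
  then show False using a by simp
 qed
 then have "(al, real M) : apos" unfolding apos_nat_iff using aP by (cases "M = 0") auto
 then show ?case using affine_exponents_insert[OF irr h IH a(3) aP _ _ _ ex] ins Suc.prems(1) by simp
qed

text \<open>Stages are traversed one after the other; the first begins with the negative roots,
  which contribute nothing at level 0.\<close>

lemma affine_exponents_all:
 assumes irr: "irreducible_root_system Ph" and h: "2 * card pos = h * dim Ph" "!!t. t >= h ==> level t = {}"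
   "!!t. t >= 1 ==> t <= h ==> card (level t) + card (level (h + 1 - t)) = dim Ph"
  and IH: "!!Ps. Ps \<subset> Ph ==> irreducible_root_system Ps ==> affine_sys Ps c ==> affine_sys.affine_units Ps c"
  and T: "lower Th" "M = 0 ==> uminus ` pos \<subseteq> Th"
 shows "affine_exponents h M Th"
proof -
 have lowPhi: "lower Ph" by (simp add: lower_def)
 have negpos: "x : pos" if "x : Ph - uminus ` pos" for x
 proof (rule ccontr)
  assume "x ~: pos"
  then have "- x : pos" using pos_or_neg that by blast
  then have "- (- x) : uminus ` pos" by (rule imageI)
  then show False using that by simp
 qed
 have start: "affine_exponents h 0 (uminus ` pos)"
 proof -
  have "stage 0 (uminus ` pos) = {}" using stage_zero[of "{}"] by simp
  then have A: "aarr 0 (uminus ` pos) = {delta}" by (simp add: aarr_def)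
  obtain I :: "nat set" and th where b: "free_basis (emb ` span Ph) {delta} I (%_. 0) th" "card I = dim (emb ` span Ph)"
  proof -
   have "K <.> u = 0" if "K : {delta}" "u : emb ` span Ph" for K u
    using that(1) delta_inner(1)[of u] imageE[OF that(2)] by (metis emb_simps(2) singletonD)
   from constant_basis[OF subspace_emb_span this] show ?thesis using that by blast
  qed
  have "uminus ` pos Int level t = {}" for t using not_pos_neg by (auto simp: level_def)
  moreover have "card ((pos - uminus ` uminus ` pos) Int level t) = 0" for t
  proof -
   have "(pos - uminus ` uminus ` pos) Int level t = {}" by (auto simp: image_image)
   then show ?thesis by (simp only: card.empty)
  qed
  ultimately show ?thesis unfolding affine_exponents_def A using b dim_emb_span
   by (intro exI[of _ I] exI[of _ "%_. 0"] exI[of _ th]) (simp del: image_Collect)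
 qed
 have htle: "ht y <= ht x" if x: "x : Ph - uminus ` pos" and y: "y : uminus ` pos" for x y
 proof -
  have "ht x >= 1" using ht_pos_ge1 negpos[OF x] by blast
  moreover obtain p where "p : pos" "y = - p" using y by blast
  then have "ht y <= 0" using ht_pos_ge1[of p] by (simp add: ht_neg)
  ultimately show ?thesis by linarith
 qed
 have first: "affine_exponents h 0 Z" if "lower Z" "uminus ` pos \<subseteq> Z" for Z
  by (rule affine_exponents_chain[OF irr h(1) IH start _ that]) (use htle in auto)
 \<comment> \<open>A complete level is the empty beginning of the next one. The duality rewrites the
   excesses over \<open>m * h\<close> as deficits below \<open>(m + 1) * h\<close>.\<close>
 have nxt: "affine_exponents h (Suc m) {}" if ex: "affine_exponents h m Ph" for m
 proof -
  have "f : stage (real (Suc m)) {} \<longleftrightarrow> f : stage (real m) Ph" for f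
  proof -
   have "snd f < real (Suc m) \<longleftrightarrow> snd f < real m \<or> snd f = real m & fst f : Ph" if "f : apos"
    using that by (rule apos_natE) auto
   then show ?thesis by (auto simp: stage_def)
  qed
  then have A: "aarr (Suc m) {} = aarr m Ph" unfolding aarr_def by blast
  have "uminus ` pos \<subseteq> Ph" using neg pos_root by blast
  then obtain I :: "nat set" and e th where b: "free_basis (emb ` span Ph) (aarr m Ph) I e th" and cI: "card I = dim Ph"
   and ps: "!!t. t >= 1 ==> card {i:I. m * h + t <= e i} = card (Ph Int level t)" "!!i. i : I ==> m * h <= e i"
   using ex unfolding affine_exponents_def by blast
  have finI: "finite I" using free_basisD(1)[OF b] .
  have pl: "Ph Int level t = level t" for t using pos_root by (auto simp: level_def)
  have cnt: "card {i:I. e i + t <= Suc m * h} = card (pos Int level t)" if t: "t >= 1" for t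
  proof (cases "t <= h")
   case True
   \<comment> \<open>The complementary condition is \<open>e i >= m * h + (h + 1 - t)\<close>,
     whence the reflected height \<open>h + 1 - t\<close>.\<close>
   have "{i:I. e i + t <= Suc m * h} = I - {i:I. m * h + (h + 1 - t) <= e i}" using True by auto
   then have "card {i:I. e i + t <= Suc m * h} = card I - card {i:I. m * h + (h + 1 - t) <= e i}"
    using finI by (simp add: card_Diff_subset)
   also have "... = dim Ph - card (level (h + 1 - t))" using ps(1)[of "h + 1 - t"] True pl cI by simp
   also have "... = card (level t)" using h(3)[OF t True] by simp
   also have "level t = pos Int level t" by (auto simp: level_def)
   finally show ?thesis .
  next
   case False
   then have "{i:I. e i + t <= Suc m * h} = {}" using ps(2) by fastforce
   moreover have "level t = {}" using h(2) False by simp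
   ultimately show ?thesis by (simp only: Int_empty_right card.empty)
  qed
  have le: "e i <= Suc m * h" if i: "i : I" for i
  proof (rule ccontr)
   assume "~ e i <= Suc m * h"
   then have "i : {i:I. m * h + (h + 1) <= e i}" using i by auto
   moreover have "card {i:I. m * h + (h + 1) <= e i} = 0" using ps(1)[of "h + 1"] h(2)[of "h + 1"] by simp
   moreover have "finite {i:I. m * h + (h + 1) <= e i}" by (rule finite_subset[OF _ finI]) blast
   ultimately show False using card_0_eq by blast
  qed
  have "pos ~= {}"
  proof
   assume "pos = {}"
   then have "Ph = {}" using pos_or_neg by blast
   then show False using irr unfolding irreducible_root_system_def by blast
  qed
  then have "~ uminus ` pos \<subseteq> {}" by blast
  then show ?thesis unfolding affine_exponents_def A using b cI cnt le
   by (intro exI[of _ I] exI[of _ e] exI[of _ th]) simp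
 qed
 have all: "affine_exponents h (Suc m) Z" if ex: "affine_exponents h m Ph" and Z: "lower Z" for m Z
  by (rule affine_exponents_chain[OF irr h(1) IH nxt[OF ex] _ Z]) auto
 have full: "affine_exponents h m Ph" for m
 proof (induction m)
  case 0
  show ?case by (rule first[OF lowPhi]) (use neg pos_root in blast)
 next
  case (Suc m)
  then show ?case using all lowPhi by blast
 qed
 show ?thesis using T first all full by (cases M) auto
qed

end

text \<open>Induction on the number of roots, with \<open>c\<close> fixed: irreducible proper
  subsystems supply the fields at infinity. The number \<open>h\<close> is determined by
  \<open>2 * card pos = h * dim Ph\<close>.\<close>

theorem affine_arrangements_free:
 fixes Ph :: "(real^'n) set"
 assumes "affine_sys Ph c" "irreducible_root_system Ph"
 shows "affine_sys.affine_units Ph c & (ALL h Th M. 2 * card (root_sys.pos Ph c) = h * dim Ph --> affine_sys.lower Ph c Th -->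
  (M = 0 --> uminus ` root_sys.pos Ph c \<subseteq> Th) --> affine_sys.affine_exponents Ph c h M Th)"
 using assms
proof (induction "card Ph" arbitrary: Ph rule: less_induct)
 case less
 interpret affine_sys Ph c by (rule less.prems(1))
 note irr = less.prems(2)
 have IH: "affine_sys.affine_units Ps c" if "Ps \<subset> Ph" "irreducible_root_system Ps" "affine_sys Ps c" for Ps
  using less.hyps[OF psubset_card_mono[OF fin that(1)] that(3,2)] by blast
 obtain ds where ds: "distinct ds" "set ds = base" using finite_distinct_list[OF finite_base] by blast
 obtain n where n: "2 * card pos = n * dim Ph" "ALL t>=n. level t = {}"
  "ALL t>=1. t <= n --> card (level t) + card (level (n + 1 - t)) = dim Ph"
  using height_duality[OF irr ds] by blast
 have d0: "dim Ph ~= 0" using irr nz unfolding irreducible_root_system_def by (auto simp: dim_eq_0)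
 have ex: "affine_exponents n M Th" if "lower Th" "M = 0 ==> uminus ` pos \<subseteq> Th" for M Th
  by (rule affine_exponents_all[OF irr n(1) _ _ IH that]) (use n(2,3) in auto)
 have "affine_units"
  unfolding affine_units_def
 proof (intro allI impI)
  fix M Th al C
  assume T: "lower Th" "al : Ph" "al ~: Th" "lower (insert al Th)" "(al, real M) : apos" "transversal (aarr M Th) C (al, real M)"
  have "uminus ` pos \<subseteq> Th" if "M = 0"
  proof (rule lower_insert_pos[OF T(4)])
   show "al : pos" using T(5) that by (simp add: apos_nat_iff[of al 0, simplified])
  qed
  then show "unit_on (emb ` span Ph) (aarr M Th) C (al, real M)"
   using affine_unit[OF irr n(1) IH T(1-6) ex[OF T(1)]] by blast
 qed
 moreover have "affine_exponents h M Th" if "2 * card pos = h * dim Ph" "lower Th" "M = 0 --> uminus ` pos \<subseteq> Th" for h Th M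
 proof -
  have "h = n" using that(1) n(1) d0 by simp
  show ?thesis unfolding \<open>h = n\<close> by (rule ex[OF that(2)]) (use that(3) in simp)
 qed
 ultimately show ?case by (intro conjI allI impI)
qed

section \<open>Logarithmic derivations as tangent fields\<close>

lemma rpoly_monom: "rpoly (monom e :: real^'m::finite => real)"
proof -
 have "rpoly (%x::real^'m. x $ i)" for i using rpoly_inner[of "axis i (1::real) :: real^'m"] by (simp add: inner_axis' inner_real_def)
 then show ?thesis unfolding monom_def[abs_def] by (intro rpoly_prod rpoly_power)
qed

lemma monomial_on_Basis: "monomial_on Basis mu x = monom (%i. mu (axis i 1)) (x :: real^'m::finite)"
proof -
 have B: "(Basis :: (real^'m) set) = (%i. axis i 1) ` UNIV" by (auto simp: Basis_vec_def)
 have inj: "inj (%i. axis i 1 :: real^'m)" by (auto simp: inj_def axis_eq_axis)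
 show ?thesis unfolding monomial_on_def monom_def B by (subst prod.reindex[OF inj]) (simp add: inner_axis' inner_real_def)
qed

lemma sum_monomials:
 fixes x :: "real^'m::finite"
 assumes F: "finite F"
 shows "EX c'. ALL x. (SUM mu:F. c mu * monomial_on Basis mu x) = (SUM e:(%mu i. mu (axis i 1 :: real^'m)) ` F. c' e * monom e x)"
proof -
 let ?g = "%mu i. mu (axis i 1 :: real^'m)"
 have "(SUM mu:F. c mu * monomial_on Basis mu x) = (SUM e:?g ` F. (SUM mu:{mu:F. ?g mu = e}. c mu) * monom e x)" for x
 proof -
  have "(SUM mu:F. c mu * monomial_on Basis mu x) = (SUM e:?g ` F. SUM mu:{mu:F. ?g mu = e}. c mu * monomial_on Basis mu x)"
   by (rule sum.image_gen[OF F])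
  also have "... = (SUM e:?g ` F. (SUM mu:{mu:F. ?g mu = e}. c mu) * monom e x)"
   by (intro sum.cong refl) (simp add: monomial_on_Basis sum_distrib_right)
  finally show ?thesis .
 qed
 then show ?thesis by (intro exI[of _ "%e. SUM mu:{mu:F. ?g mu = e}. c mu"]) blast
qed

lemma poly_fun_iff_rpoly: "poly_fun f \<longleftrightarrow> rpoly (f :: real^'m::finite => real)"
proof
 assume "poly_fun f"
 then obtain E c where f: "f = (%x. SUM e:E. c e * monom e x)" unfolding poly_fun_def by blast
 show "rpoly f" unfolding f by (intro rpoly_sum rpoly_mult rpoly_const rpoly_monom)
next
 assume f: "rpoly f"
 have "expandable (Basis :: (real^'m) set) f"
 proof (rule rpoly_expandable[OF f finite_Basis])
  fix x :: "real^'m"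
  have "(SUM b:Basis. (b <.> x) *R b) = (SUM b:Basis. (x <.> b) *R b)" by (intro sum.cong refl) (simp only: inner_commute)
  then show "(SUM b:Basis. (b <.> x) *R b) = x" using euclidean_representation[of x] by (simp only:)
 qed
 then obtain F c where F: "finite F" "!!x. f x = (SUM mu:F. c mu * monomial_on Basis mu x)"
  unfolding expandable_def by auto
 obtain c' where c': "ALL x. (SUM mu:F. c mu * monomial_on Basis mu x) = (SUM e:(%mu i. mu (axis i 1 :: real^'m)) ` F. c' e * monom e x)"
  using sum_monomials[OF F(1)] by blast
 have "f = (%x. SUM e:(%mu i. mu (axis i 1 :: real^'m)) ` F. c' e * monom e x)" using F(2) c' by (intro ext) simp
 then show "poly_fun f" unfolding poly_fun_def using finite_imageI[OF F(1)] by blast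
qed

lemma finite_exponents: "finite {e::'m::finite => nat. sum e UNIV = d}"
proof (rule finite_subset)
 show "{e::'m => nat. sum e UNIV = d} \<subseteq> (\<Pi>\<^sub>E i\<in>UNIV. {..d})"
 proof
  fix e :: "'m => nat" assume e: "e : {e. sum e UNIV = d}"
  have "e i <= d" for i using member_le_sum[of i UNIV e] e by simp
  then show "e : (\<Pi>\<^sub>E i\<in>UNIV. {..d})" by (simp add: PiE_iff extensional_def)
 qed
qed (simp add: finite_PiE)

lemma homog_poly_iff: "homog_poly d f \<longleftrightarrow> rpoly f & (ALL t x. f (t *R x) = t ^ d * f (x :: real^'m::finite))"
proof
 assume "homog_poly d f"
 then obtain c where f: "f = (%x. SUM e:{e::'m => nat. sum e UNIV = d}. c e * monom e x)" unfolding homog_poly_def by blast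
 have "rpoly f" unfolding f by (intro rpoly_sum rpoly_mult rpoly_const rpoly_monom)
 moreover have "monom e (t *R x) = t ^ sum e UNIV * monom e x" for e :: "'m => nat" and t x
  by (simp add: monom_def power_mult_distrib prod.distrib power_sum)
 then have "f (t *R x) = t ^ d * f x" for t x
  unfolding f sum_distrib_left by (intro sum.cong refl) simp
 ultimately show "rpoly f & (ALL t x. f (t *R x) = t ^ d * f x)" by blast
next
 assume f: "rpoly f & (ALL t x. f (t *R x) = t ^ d * f x)"
 then obtain F c where F: "finite F" "!!mu. mu : F ==> (SUM b:Basis. mu b) = d" "!!x. f x = (SUM mu:F. c mu * monomial_on Basis mu x)"
  using homogeneous_expansion[of f d] by blast
 let ?G = "(%mu i. mu (axis i 1 :: real^'m)) ` F"
 obtain c' where c': "ALL x. (SUM mu:F. c mu * monomial_on Basis mu x) = (SUM e:?G. c' e * monom e x)"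
  using sum_monomials[OF F(1)] by blast
 have B: "(Basis :: (real^'m) set) = (%i. axis i 1) ` UNIV" by (auto simp: Basis_vec_def)
 have inj: "inj (%i. axis i 1 :: real^'m)" by (auto simp: inj_def axis_eq_axis)
 have sub: "?G \<subseteq> {e. sum e UNIV = d}"
 proof clarify
  fix mu assume "mu : F"
  then have "sum mu ((%i. axis i 1 :: real^'m) ` UNIV) = d" using F(2) B by simp
  then show "(SUM i:UNIV. mu (axis i 1)) = d" by (simp add: sum.reindex[OF inj])
 qed
 have "f x = (SUM e:{e::'m => nat. sum e UNIV = d}. (if e : ?G then c' e else 0) * monom e x)" for x
 proof -
  have "f x = (SUM e:?G. c' e * monom e x)" using F(3) c' by simp
  also have "... = (SUM e:{e::'m => nat. sum e UNIV = d}. (if e : ?G then c' e else 0) * monom e x)"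
   by (rule sum.mono_neutral_cong_left[OF finite_exponents sub]) auto
  finally show ?thesis .
 qed
 then show "homog_poly d f" unfolding homog_poly_def by (intro exI[of _ "%e. if e : ?G then c' e else 0"] ext)
qed

text \<open>A normal of a hyperplane is a multiple of the chosen one, so divisibility for every
  normal reduces to tangency for the chosen normals.\<close>

lemma log_derivations_iff:
 fixes N :: "(real^'m::finite) set"
 assumes "0 ~: N"
 shows "th : log_derivations ((%a. {x. a <.> x = 0}) ` N) \<longleftrightarrow> (%x. \<chi> i. th i x) : tangent_fields UNIV N"
proof -
 let ?t = "%x. \<chi> i. th i x"
 have ap: "apply_lin th a x = a <.> ?t x" for a x by (simp add: apply_lin_def inner_vec_def mult.commute)
 have comp: "(ALL i. poly_fun (th i)) \<longleftrightarrow> (ALL u. rpoly (%x. u <.> ?t x))"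
 proof
  assume p: "ALL i. poly_fun (th i)"
  show "ALL u. rpoly (%x. u <.> ?t x)"
  proof
   fix u
   have "rpoly (%x. SUM i:UNIV. u $ i * th i x)" using p unfolding poly_fun_iff_rpoly by (intro rpoly_sum rpoly_mult rpoly_const) simp
   then show "rpoly (%x. u <.> ?t x)" by (simp add: inner_vec_def)
  qed
 next
  assume p: "ALL u. rpoly (%x. u <.> ?t x)"
  show "ALL i. poly_fun (th i)"
  proof
   fix i
   have "rpoly (%x. axis i 1 <.> ?t x)" using p by blast
   then show "poly_fun (th i)" by (simp add: poly_fun_iff_rpoly inner_axis' inner_real_def)
  qed
 qed
 show ?thesis
 proof
  assume L: "th : log_derivations ((%a. {x. a <.> x = 0}) ` N)"
  show "?t : tangent_fields UNIV N"
  proof (rule tangent_fieldsI)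
   show "rpoly (%x. u <.> ?t x)" for u using L comp unfolding log_derivations_def by blast
   fix K x assume K: "K : N" "K <.> x = 0"
   then have "K ~= 0 & {x. K <.> x = 0} = {x. K <.> x = 0}" "{x. K <.> x = 0} : (%a. {x. a <.> x = 0}) ` N" using assms by auto
   then obtain g where "ALL x. apply_lin th K x = (K <.> x) * g x" using L unfolding log_derivations_def by blast
   then show "K <.> ?t x = 0" using K(2) ap by simp
  qed simp
 next
  assume T: "?t : tangent_fields UNIV N"
  have "EX g. poly_fun g & (ALL x. apply_lin th a x = (a <.> x) * g x)"
   if H: "H : (%a. {x. a <.> x = 0}) ` N" "a ~= 0" "H = {x. a <.> x = 0}" for H a
  proof -
   obtain K where K: "K : N" "{x. K <.> x = 0} = {x. a <.> x = 0}" using H by blast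
   have "a : span {K}"
   proof (rule ccontr)
    assume "a ~: span {K}"
    then obtain x where "K <.> x = 0" "a <.> x ~= 0" using separating_vector by blast
    then show False using K(2) by blast
   qed
   then obtain k where k: "a = k *R K" by (auto simp: span_singleton)
   have "a <.> ?t x = 0" if "a <.> x = 0" for x
   proof -
    have "K <.> x = 0" using K(2) that by blast
    then have "K <.> ?t x = 0" by (rule tangent_fieldsD(3)[OF T K(1)])
    then show ?thesis by (simp add: k)
   qed
   then obtain g where "rpoly g" "ALL x. a <.> ?t x = (a <.> x) * g x"
    using rpoly_divide_linear[OF tangent_fieldsD(4)[OF T, of a] subspace_UNIV, of a] by auto
   then show ?thesis by (intro exI[of _ g]) (simp add: poly_fun_iff_rpoly ap)
  qed
  moreover have "ALL i. poly_fun (th i)" using comp tangent_fieldsD(4)[OF T] by blast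
  ultimately show "th : log_derivations ((%a. {x. a <.> x = 0}) ` N)" unfolding log_derivations_def by blast
 qed
qed

lemma free_basis_imp_free:
 fixes N :: "(real^'m::finite) set"
 assumes N: "0 ~: N" and fb: "free_basis UNIV N I e th" and b: "bij_betw b (UNIV :: 'm set) I"
 shows "free_with_exponents ((%a. {x. a <.> x = 0}) ` N) (%j. e (b j))"
proof -
 define B where "B j i x = th (b j) x $ i" for j i x
 have bI: "b j : I" for j using b by (auto simp: bij_betw_def)
 have vB: "(%x. \<chi> i. B j i x) = th (b j)" for j by (simp add: B_def vec_eq_iff fun_eq_iff)
 have T: "th (b j) : tangent_fields UNIV N" for j by (rule free_basisD(2)[OF fb bI])
 have sumb: "(SUM i:I. f i) = (SUM j:UNIV. f (b j))" for f :: "_ => real^'m" using sum.reindex_bij_betw[OF b, of f] by simp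
 have conv: "th' = (%i x. SUM j:UNIV. f j x * B j i x) \<longleftrightarrow> (ALL x. (\<chi> i. th' i x) = (SUM j:UNIV. f j x *R th (b j) x))"
  for th' :: "'m derivation" and f by (auto simp: fun_eq_iff vec_eq_iff B_def)
 have "EX! f. (ALL j. poly_fun (f j)) & th' = (%i x. SUM j:UNIV. f j x * B j i x)"
  if L: "th' : log_derivations ((%a. {x. a <.> x = 0}) ` N)" for th'
 proof -
  obtain f where f: "ALL i:I. rpoly (f i)" "ALL x. (\<chi> i. th' i x) = (SUM i:I. f i x *R th i x)"
   using free_basisD(4)[OF fb] L[unfolded log_derivations_iff[OF N]] by blast
  show ?thesis
  proof (rule ex1I[of _ "%j. f (b j)"])
   show "(ALL j. poly_fun (f (b j))) & th' = (%i x. SUM j:UNIV. f (b j) x * B j i x)"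
    unfolding conv using f bI by (simp add: poly_fun_iff_rpoly sumb)
   fix g assume g: "(ALL j. poly_fun (g j)) & th' = (%i x. SUM j:UNIV. g j x * B j i x)"
   define g' where "g' i = g (inv_into UNIV b i)" for i
   have g'b: "g' (b j) = g j" for j using b by (simp add: g'_def bij_betw_def)
   have eq: "(SUM i:I. (f i x - g' i x) *R th i x) = 0" for x
   proof -
    have "(SUM i:I. g' i x *R th i x) = (\<chi> i. th' i x)" using g unfolding conv sumb g'b by simp
    then show ?thesis using f(2) by (simp add: scaleR_diff_left sum_subtractf)
   qed
   have "rpoly (%x. f i x - g' i x)" if "i : I" for i
    using f(1) that g by (intro real_polynomial_function_diff) (auto simp: g'_def poly_fun_iff_rpoly)
   from free_basisD(5)[OF fb, of "%i x. f i x - g' i x", OF this eq] have "f i x = g' i x" if "i : I" for i x using that by simp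
   then show "g = (%j. f (b j))" using bI g'b by (simp add: fun_eq_iff)
  qed
 qed
 moreover have "B j : log_derivations ((%a. {x. a <.> x = 0}) ` N)" for j unfolding log_derivations_iff[OF N] vB by (rule T)
 moreover have "homog_poly (e (b j)) (B j i)" for i j
 proof -
  have "rpoly (%x. axis i 1 <.> th (b j) x)" by (rule tangent_fieldsD(4)[OF T])
  then have "rpoly (B j i)" by (simp add: inner_axis' inner_real_def B_def[abs_def])
  moreover have "B j i (t *R x) = t ^ e (b j) * B j i x" for t x by (simp add: B_def free_basisD(3)[OF fb bI])
  ultimately show ?thesis unfolding homog_poly_iff by blast
 qed
 ultimately show ?thesis unfolding free_with_exponents_def by (intro exI[of _ B]) blast
qed

text \<open>\<open>psi\<close> is inverse and adjoint to \<open>phi\<close>, so it carries normals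
  to normals and fields to fields at the same time.\<close>

lemma free_basis_transport:
 fixes \<phi> :: "'f::euclidean_space => 'e::euclidean_space"
 assumes fb: "free_basis UNIV A I e th" and lin: "linear \<phi>" "linear \<psi>" and inv: "!!x. \<psi> (\<phi> x) = x" "!!y. \<phi> (\<psi> y) = y"
  and adj: "!!K x. \<psi> K <.> x = K <.> \<phi> x"
 shows "free_basis UNIV (\<psi> ` A) I e (%i x. \<psi> (th i (\<phi> x)))"
proof -
 have bl: "bounded_linear \<phi>" "bounded_linear \<psi>" using lin by (simp_all add: linear_conv_bounded_linear)
 have adj': "u <.> \<psi> y = \<phi> u <.> y" for u y using adj[of y u] by (simp add: inner_commute)
 have T: "(%x. \<psi> (et (\<phi> x))) : tangent_fields UNIV (\<psi> ` A)" if et: "et : tangent_fields UNIV A" for et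
 proof (rule tangent_fieldsI)
  show "rpoly (%x. u <.> \<psi> (et (\<phi> x)))" for u unfolding adj' by (rule rpoly_comp[OF tangent_fieldsD(4)[OF et] bl(1)])
  fix K x assume "K : \<psi> ` A" "K <.> x = 0"
  then obtain L where L: "L : A" "K = \<psi> L" "L <.> \<phi> x = 0" using adj by auto
  then show "K <.> \<psi> (et (\<phi> x)) = 0" using tangent_fieldsD(3)[OF et L(1,3)] by (simp add: adj inv)
 qed simp
 have T': "(%y. \<phi> (et (\<psi> y))) : tangent_fields UNIV A" if et: "et : tangent_fields UNIV (\<psi> ` A)" for et
 proof (rule tangent_fieldsI)
  show "rpoly (%y. u <.> \<phi> (et (\<psi> y)))" for u unfolding adj[symmetric] by (rule rpoly_comp[OF tangent_fieldsD(4)[OF et] bl(2)])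
  fix K y assume "K : A" "K <.> y = 0"
  then show "K <.> \<phi> (et (\<psi> y)) = 0" using tangent_fieldsD(3)[OF et, of "\<psi> K" "\<psi> y"] by (simp add: adj[symmetric] adj[of K "\<psi> y"] inv)
 qed simp
 show ?thesis
  unfolding free_basis_def
 proof (intro conjI ballI allI impI)
  show "finite I" by (rule free_basisD(1)[OF fb])
  show "(%x. \<psi> (th i (\<phi> x))) : tangent_fields UNIV (\<psi> ` A)" if "i : I" for i by (rule T[OF free_basisD(2)[OF fb that]])
  show "\<psi> (th i (\<phi> (t *R x))) = t ^ e i *R \<psi> (th i (\<phi> x))" if "i : I" for i t x
   by (simp add: linear_scale[OF lin(1)] linear_scale[OF lin(2)] free_basisD(3)[OF fb that])
 next
  fix et assume et: "et : tangent_fields UNIV (\<psi> ` A)"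
  obtain f where f: "ALL i:I. rpoly (f i)" "ALL y. \<phi> (et (\<psi> y)) = (SUM i:I. f i y *R th i y)" using free_basisD(4)[OF fb T'[OF et]] by blast
  have "et x = (SUM i:I. f i (\<phi> x) *R \<psi> (th i (\<phi> x)))" for x
  proof -
   have "et x = \<psi> (\<phi> (et (\<psi> (\<phi> x))))" by (simp add: inv)
   also have "... = \<psi> (SUM i:I. f i (\<phi> x) *R th i (\<phi> x))" using f(2) by simp
   finally show ?thesis by (simp add: linear_sum[OF lin(2)] linear_scale[OF lin(2)])
  qed
  moreover have "ALL i:I. rpoly (%x. f i (\<phi> x))" using rpoly_comp[OF _ bl(1)] f(1) by blast
  ultimately show "EX f. (ALL i:I. rpoly (f i)) & (ALL x. et x = (SUM i:I. f i x *R \<psi> (th i (\<phi> x))))"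
   by (intro exI[of _ "%i x. f i (\<phi> x)"]) simp
 next
  fix f i x assume f: "ALL i:I. rpoly (f i)" "ALL x. (SUM i:I. f i x *R \<psi> (th i (\<phi> x))) = 0" and i: "i : I"
  have "(SUM i:I. f i (\<psi> y) *R th i y) = 0" for y
  proof -
   have "(SUM i:I. f i (\<psi> y) *R th i y) = \<phi> (SUM i:I. f i (\<psi> y) *R \<psi> (th i (\<phi> (\<psi> y))))"
    by (simp add: linear_sum[OF lin(1)] linear_scale[OF lin(1)] inv)
   then show ?thesis using f(2) linear_0[OF lin(1)] by simp
  qed
  from free_basisD(5)[OF fb, of "%i y. f i (\<psi> y)", OF _ this i, of "\<phi> x"] show "f i x = 0"
   using rpoly_comp[OF _ bl(2)] f(1) by (simp add: inv)
 qed
qed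

text \<open>The last component of a field tangent to infinity is divisible by \<open>x0\<close>;
  subtracting that multiple of the Euler field, which is tangent to everything, leaves a field
  without \<open>x0\<close>-component.\<close>

lemma free_basis_add_euler:
 fixes A :: "((real^'n) \<times> real) set"
 assumes fb: "free_basis (range emb) A I e th" and d: "delta : A"
 shows "free_basis UNIV A (insert None (Some ` I)) (case_option 1 e) (case_option (%x. x) th)"
proof -
 have finI: "finite I" by (rule free_basisD(1)[OF fb])
 have sumI: "(SUM q:insert None (Some ` I). f q *R case_option (%x. x) th q x) = f None *R x + (SUM i:I. f (Some i) *R th i x)" for f :: "_ => real" and x
  using finI by (simp add: sum.reindex)
 have E: "(%x. x) : tangent_fields UNIV A" by (rule tangent_fieldsI) (auto intro: rpoly_inner)
 have sub: "tangent_fields (range emb) A \<subseteq> tangent_fields UNIV A" by (rule tangent_fields_mono_range) simp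
 have rs: "rpoly (%x::(real^'n) \<times> real. snd x)" using rpoly_inner[of "delta :: (real^'n) \<times> real"] by (simp add: delta_inner)
 have snd0: "snd (th i x) = 0" if "i : I" for i x using tangent_fieldsD(2)[OF free_basisD(2)[OF fb that], of x] by auto
 show ?thesis
  unfolding free_basis_def
 proof (intro conjI ballI allI impI)
  show "finite (insert None (Some ` I))" using finI by simp
  show "case_option (%x. x) th q : tangent_fields UNIV A" if "q : insert None (Some ` I)" for q
   using that E free_basisD(2)[OF fb] sub by auto
  show "case_option (%x. x) th q (t *R x) = t ^ case_option 1 e q *R case_option (%x. x) th q x" if "q : insert None (Some ` I)" for q t x
  proof (cases q)
   case (Some i)
   then have "i : I" using that by auto
   then show ?thesis using Some free_basisD(3)[OF fb, of i t x] by simp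
  qed simp
 next
  fix et assume et: "et : tangent_fields UNIV A"
  have "rpoly (%x. snd (et x))" using tangent_fieldsD(4)[OF et, of delta] by (simp add: delta_inner)
  moreover have "snd (et x) = 0" if "delta <.> x = 0" for x using tangent_fieldsD(3)[OF et d that] by (simp add: delta_inner)
  ultimately obtain g where g: "rpoly g" "!!x. snd (et x) = snd x * g x"
   using rpoly_divide_linear[OF _ subspace_UNIV, of "%x. snd (et x)" delta] by (auto simp: delta_inner)
  have "(%x. et x - g x *R x) : tangent_fields (range emb) A"
  proof (rule tangent_fieldsI)
   show "rpoly (%x. u <.> (et x - g x *R x))" for u
    unfolding inner_diff_right inner_scaleR_right by (intro real_polynomial_function_diff tangent_fieldsD(4)[OF et] rpoly_mult g rpoly_inner)
   show "et x - g x *R x : range emb" for x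
   proof -
    have "et x - g x *R x = emb (fst (et x - g x *R x))" by (rule prod_eqI) (simp_all add: g(2))
    then show ?thesis by blast
   qed
   show "K <.> (et x - g x *R x) = 0" if "K : A" "K <.> x = 0" for K x
    using tangent_fieldsD(3)[OF et that] that(2) by (simp add: inner_diff_right)
  qed
  from free_basisD(4)[OF fb this] obtain f where f: "ALL i:I. rpoly (f i)" "ALL x. et x - g x *R x = (SUM i:I. f i x *R th i x)" by blast
  have "et x = (SUM q:insert None (Some ` I). case_option g f q x *R case_option (%x. x) th q x)" for x
   unfolding sumI[where f="%q. case_option g f q x"] using f(2)[rule_format, of x] by (simp add: algebra_simps)
  moreover have "ALL q:insert None (Some ` I). rpoly (case_option g f q)" using g f by auto
  ultimately show "EX f. (ALL q:insert None (Some ` I). rpoly (f q)) & (ALL x. et x = (SUM q:insert None (Some ` I). f q x *R case_option (%x. x) th q x))"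
   by (intro exI[of _ "case_option g f"]) blast
 next
  fix f q x assume f: "ALL q:insert None (Some ` I). rpoly (f q)" "ALL x. (SUM q:insert None (Some ` I). f q x *R case_option (%x. x) th q x) = 0"
   and q: "q : insert None (Some ` I)"
  have eq: "f None x *R x + (SUM i:I. f (Some i) x *R th i x) = 0" for x
   using f(2)[rule_format, of x] unfolding sumI[where f="%q. f q x"] .
  have N0: "f None y = 0" for y
  proof (rule rpoly_domain[OF rs _ subspace_UNIV])
   show "rpoly (f None)" using f(1) by blast
   show "snd x * f None x = 0" for x
   proof -
    have "snd (f None x *R x + (SUM i:I. f (Some i) x *R th i x)) = 0" unfolding eq by simp
    then show ?thesis using snd0 by (simp add: snd_sum mult.commute)
   qed
   show "snd (delta :: (real^'n) \<times> real) ~= 0" by (simp add: delta_def)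
  qed simp_all
  have "(SUM i:I. f (Some i) y *R th i y) = 0" for y using eq[of y] N0 by simp
  from free_basisD(5)[OF fb, of "%i. f (Some i)", OF _ this] have "f (Some i) x = 0" if "i : I" for i using f(1) that by blast
  then show "f q x = 0" using q N0[of x] by auto
 qed
qed

lemma bij_of_fibers:
 assumes "finite A" "finite B" "!!k. card {a:A. f a = k} = card {b:B. g b = k}"
 shows "EX h. bij_betw h A B & (ALL a:A. g (h a) = f a)"
proof -
 have "ALL k. EX h. bij_betw h {a:A. f a = k} {b:B. g b = k}"
  using assms by (intro allI finite_same_card_bij) auto
 then obtain H where H: "!!k. bij_betw (H k) {a:A. f a = k} {b:B. g b = k}" by metis
 let ?h = "%a. H (f a) a"
 have m: "?h a : B" "g (?h a) = f a" if "a : A" for a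
  using bij_betwE[OF H[of "f a"]] that by auto
 have "inj_on ?h A"
 proof (rule inj_onI)
  fix a a' assume a: "a : A" "a' : A" "?h a = ?h a'"
  then have "f a = f a'" using m by metis
  then show "a = a'" using bij_betw_imp_inj_on[OF H[of "f a"]] a by (auto simp: inj_on_def)
 qed
 moreover have "B \<subseteq> ?h ` A"
 proof
  fix b assume b: "b : B"
  then have "b : H (g b) ` {a:A. f a = g b}" using bij_betw_imp_surj_on[OF H[of "g b"]] by blast
  then obtain a where "a : A" "f a = g b" "b = H (g b) a" by blast
  then show "b : ?h ` A" by (intro image_eqI[of _ _ a]) simp_all
 qed
 ultimately have "bij_betw ?h A B" using m unfolding bij_betw_def by blast
 then show ?thesis using m by blast
qed

lemma ex1_eq: "EX! x. P x ==> P a ==> P b ==> a = b"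
 by blast

text \<open>Uniqueness of exponents: modulo the irrelevant ideal the change of basis becomes an invertible
 scalar matrix, and it respects degrees.\<close>

lemma exponents_unique:
 fixes N :: "(real^'n) set" and e :: "'n => nat"
 assumes N: "0 ~: N" and fr: "free_with_exponents ((%a. {x. a <.> x = 0}) ` N) e"
  and I: "finite I" "card I = CARD('n)"
  and th: "!!i. i : I ==> th i : tangent_fields UNIV N" "!!i t x. i : I ==> th i (t *R x) = t ^ d i *R th i x"
  and gen: "!!et. et : tangent_fields UNIV N ==> EX f. (ALL i:I. rpoly (f i)) & (ALL x. et x = (SUM i:I. f i x *R th i x))"
 shows "card {j. e j = k} = card {i:I. d i = k}"
proof -
 let ?L = "log_derivations ((%a. {x. a <.> x = 0}) ` N)"
 from fr[unfolded free_with_exponents_def] obtain B0 :: "'n => 'n derivation" where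
  BB: "(ALL j. B0 j : ?L & (ALL i. homog_poly (e j) (B0 j i))) &
   (ALL et:?L. EX! f. (ALL j. poly_fun (f j)) & et = (%i x. SUM j:UNIV. f j x * B0 j i x))" by (elim exE)
 have B0: "B0 j : ?L" "homog_poly (e j) (B0 j i)" for j i using conjunct1[OF BB] by simp_all
 note B03 = bspec[OF conjunct2[OF BB]]
 define B where "B j x = (\<chi> i. B0 j i x)" for j x
 have BT: "B j : tangent_fields UNIV N" for j using B0(1)[of j] unfolding log_derivations_iff[OF N] B_def[abs_def] .
 have Bh: "B j (t *R x) = t ^ e j *R B j x" for j t x
  using B0(2) unfolding homog_poly_iff by (simp add: B_def vec_eq_iff)
 have rep: "EX! f. (ALL j. rpoly (f j)) & (ALL x. et x = (SUM j:UNIV. f j x *R B j x))" if et: "et : tangent_fields UNIV N" for et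
 proof -
  have L: "(%i x. et x $ i) : log_derivations ((%a. {x. a <.> x = 0}) ` N)" unfolding log_derivations_iff[OF N] using et by simp
  have "(%i x. et x $ i) = (%i x. SUM j:UNIV. f j x * B0 j i x) \<longleftrightarrow> (ALL x. et x = (SUM j:UNIV. f j x *R B j x))" for f
   by (auto simp: fun_eq_iff vec_eq_iff B_def)
  then show ?thesis using B03[OF L] by (simp only: poly_fun_iff_rpoly)
 qed
 have uniq: "f = g" if a: "et : tangent_fields UNIV N" "!!j. rpoly (f j)" "!!x. et x = (SUM j:UNIV. f j x *R B j x)"
  "!!j. rpoly (g j)" "!!x. et x = (SUM j:UNIV. g j x *R B j x)" for et f g
  by (rule ex1_eq[OF rep[OF a(1)]]) (intro conjI allI a)+
 have "ALL i:I. EX f. (ALL j. rpoly (f j)) & (ALL x. th i x = (SUM j:UNIV. f j x *R B j x))"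
  by (intro ballI) (rule ex1_implies_ex[OF rep[OF th(1)]])
 from bchoice[OF this] obtain F where F0: "ALL i:I. (ALL j. rpoly (F i j)) & (ALL x. th i x = (SUM j:UNIV. F i j x *R B j x))" ..
 have F: "rpoly (F i j)" "th i x = (SUM j:UNIV. F i j x *R B j x)" if "i : I" for i j x using bspec[OF F0 that] by blast+
 have "ALL j. EX g. (ALL i:I. rpoly (g i)) & (ALL x. B j x = (SUM i:I. g i x *R th i x))" by (intro allI gen[OF BT])
 from choice[OF this] obtain G where G0: "ALL j. (ALL i:I. rpoly (G j i)) & (ALL x. B j x = (SUM i:I. G j i x *R th i x))" ..
 have G: "i : I ==> rpoly (G j i)" "B j x = (SUM i:I. G j i x *R th i x)" for i j x using G0 by blast+
 have deg: "F i j 0 = 0" if i: "i : I" and ne: "d i ~= e j" for i j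
 proof -
  have r2: "rpoly (%x. F i j (2 *R x))" for j
   using rpoly_comp[OF F(1)[OF i] bounded_linear_scaleR_right[of 2]] .
  \<comment> \<open>Scaling the argument by 2 gives two expansions of the same field; uniqueness
    compares them at 0.\<close>
  have "(%j x. 2 ^ d i * F i j x) = (%j x. 2 ^ e j * F i j (2 *R x))"
  proof (rule uniq)
   show "(%x. 2 ^ d i *R th i x) : tangent_fields UNIV N" by (rule tangent_fields_mult[OF subspace_UNIV th(1)[OF i] rpoly_const])
   show "rpoly (%x. 2 ^ d i * F i j x)" "rpoly (%x. 2 ^ e j * F i j (2 *R x))" for j by (intro rpoly_mult rpoly_const F(1)[OF i] r2)+
   show "2 ^ d i *R th i x = (SUM j:UNIV. (2 ^ d i * F i j x) *R B j x)" for x by (simp add: F(2)[OF i, of x] scaleR_sum_right)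
   show "2 ^ d i *R th i x = (SUM j:UNIV. (2 ^ e j * F i j (2 *R x)) *R B j x)" for x
   proof -
    have "2 ^ d i *R th i x = th i (2 *R x)" by (simp add: th(2)[OF i])
    also have "... = (SUM j:UNIV. F i j (2 *R x) *R (2 ^ e j *R B j x))" unfolding F(2)[OF i, of "2 *R x"] Bh ..
    finally show ?thesis by (simp add: mult.commute)
   qed
  qed
  from fun_cong[OF fun_cong[OF this, of j], of 0] have "(2::real) ^ d i * F i j 0 = 2 ^ e j * F i j 0" by simp
  moreover have "(2::real) ^ d i ~= 2 ^ e j" using ne by simp
  ultimately show ?thesis by simp
 qed
 \<comment> \<open>Substituting one expansion into the other gives a one-sided inverse of the scalar
   matrix at 0.\<close>
 have GF: "(SUM i:I. G j i 0 * F i j' 0) = (if j = j' then 1 else 0)" for j j'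
 proof -
  have "(%j' x. SUM i:I. G j i x * F i j' x) = (%j' x. if j = j' then 1 else 0)"
  proof (rule uniq[OF BT[of j]])
   show "rpoly (%x. SUM i:I. G j i x * F i j' x)" for j' by (intro rpoly_sum rpoly_mult G(1) F(1))
   show "B j x = (SUM j':UNIV. (SUM i:I. G j i x * F i j' x) *R B j' x)" for x
   proof -
    have "B j x = (SUM i:I. G j i x *R (SUM j':UNIV. F i j' x *R B j' x))" by (subst G(2)) (intro sum.cong refl, simp add: F(2)[of _ x, symmetric])
    also have "... = (SUM i:I. SUM j':UNIV. (G j i x * F i j' x) *R B j' x)" by (simp add: scaleR_sum_right)
    also have "... = (SUM j':UNIV. SUM i:I. (G j i x * F i j' x) *R B j' x)" by (rule sum.swap)
    finally show ?thesis by (simp add: scaleR_sum_left)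
   qed
   show "rpoly (%x. if j = j' then 1 else 0)" for j' by (rule rpoly_const)
   show "B j x = (SUM j':UNIV. (if j = j' then 1 else 0) *R B j' x)" for x
   proof -
    have "(SUM j':UNIV. (if j = j' then 1 else 0) *R B j' x) = (SUM j':UNIV. if j = j' then B j' x else 0)" by (intro sum.cong refl) simp
    then show ?thesis by simp
   qed
  qed
  from fun_cong[OF fun_cong[OF this, of j'], of 0] show ?thesis .
 qed
 have le: "card {j. e j = k} <= card {i:I. d i = k}" for k
 proof (rule ccontr)
  assume "~ ?thesis"
  then have lt: "card {i:I. d i = k} < card {j. e j = k}" by simp
  obtain c where c: "EX j:{j. e j = k}. c j ~= 0" "ALL i:{i:I. d i = k}. (SUM j:{j. e j = k}. c j * G j i 0) = 0"
   using nontrivial_left_kernel[of "{i:I. d i = k}" "{j. e j = k}" "%j i. G j i 0"] lt I(1) by auto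
  obtain j' where j': "e j' = k" "c j' ~= 0" using c(1) by blast
  have "c j' = (SUM j:{j. e j = k}. c j * (if j = j' then 1 else 0))" using j' by (simp add: if_distrib[of "%t. _ * t"] sum.delta cong: if_cong)
  also have "... = (SUM j:{j. e j = k}. SUM i:I. c j * G j i 0 * F i j' 0)"
   by (intro sum.cong refl) (simp add: GF[symmetric] sum_distrib_left mult.assoc)
  also have "... = (SUM i:I. (SUM j:{j. e j = k}. c j * G j i 0) * F i j' 0)" by (subst sum.swap) (simp add: sum_distrib_right)
  also have "... = 0"
  proof (rule sum.neutral, rule ballI)
   fix i assume i: "i : I"
   show "(SUM j:{j. e j = k}. c j * G j i 0) * F i j' 0 = 0"
   proof (cases "d i = k")
    case True
    then have "(SUM j:{j. e j = k}. c j * G j i 0) = 0" using c(2) i by blast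
    then show ?thesis by simp
   next
    case False
    then show ?thesis using deg[OF i, of j'] j'(1) by simp
   qed
  qed
  finally show False using j'(2) by simp
 qed
 \<comment> \<open>Both fibre counts sum to the same total over \<open>K\<close>, so the
   inequalities \<open>le\<close> are equalities.\<close>
 define K where "K = range e Un d ` I"
 have finK: "finite K" using I(1) by (simp add: K_def)
 have s1: "(SUM k:K. card {j. e j = k}) = CARD('n)"
  using sum.group[of UNIV K e "%_. 1::nat"] finK by (simp add: K_def)
 have s2: "(SUM k:K. card {i:I. d i = k}) = card I"
  using sum.group[of I K d "%_. 1::nat"] finK I(1) by (simp add: K_def)
 show ?thesis
 proof (cases "k : K")
  case True
  show ?thesis
  proof (rule ccontr)
   assume "card {j. e j = k} ~= card {i:I. d i = k}"
   then have "card {j. e j = k} < card {i:I. d i = k}" using le[of k] by simp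
   then have "(SUM k:K. card {j. e j = k}) < (SUM k:K. card {i:I. d i = k})"
    using finK True le by (intro sum_strict_mono_ex1) auto
   then show False using s1 s2 I(2) by simp
  qed
 next
  case False
  then have "{j. e j = k} = {}" "{i:I. d i = k} = {}" unfolding K_def by auto
  then show ?thesis by (simp only: card.empty)
 qed
qed

section \<open>The cone over the deformed arrangement\<close>

definition split_cone :: "real^('n option) => (real^'n) \<times> real" where
 "split_cone x = (\<chi> i. x $ Some i, x $ None)"

definition join_cone :: "(real^'n) \<times> real => real^('n option)" where
 "join_cone y = (\<chi> o'. case o' of None => snd y | Some i => fst y $ i)"

lemma linear_split_cone: "linear split_cone"
 by (rule linearI) (simp_all add: split_cone_def prod_eq_iff vec_eq_iff)

lemma linear_join_cone: "linear join_cone"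
 by (rule linearI) (simp_all add: join_cone_def vec_eq_iff split: option.split)

lemma join_split_cone: "join_cone (split_cone x) = x" "split_cone (join_cone y) = y"
 by (simp_all add: join_cone_def split_cone_def vec_eq_iff prod_eq_iff split: option.split)

lemma sum_option: "(SUM o':UNIV. f o') = f None + (SUM i:UNIV. f (Some (i::'n::finite)))"
 unfolding UNIV_option_conv by (simp add: sum.reindex)

lemma join_cone_inner: "join_cone K <.> x = K <.> split_cone x"
 unfolding inner_vec_def[of "join_cone K" x] sum_option
 by (simp add: join_cone_def split_cone_def inner_prod_def inner_vec_def add.commute)

lemma fibers_of_tails:
 fixes a b :: "'i => nat"
 assumes "finite I" "finite J" "card I = card J" "!!t. t >= 1 ==> card {i:I. t <= a i} = card {j:J. t <= b j}"
 shows "card {i:I. a i = k} = card {j:J. b j = k}"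
proof -
 have tail: "card {i:I. t <= a i} = card {j:J. t <= b j}" for t using assms(3,4) by (cases "t >= 1") auto
 have eq: "card {i:X. f i = k} = card {i:X. k <= f i} - card {i:X. Suc k <= f i}" if "finite X" for X and f :: "'i => nat"
 proof -
  have eq: "{i:X. f i = k} = {i:X. k <= f i} - {i:X. Suc k <= f i}" by auto
  show ?thesis unfolding eq by (rule card_Diff_subset) (use that in auto)
 qed
 show ?thesis unfolding eq[OF assms(1)] eq[OF assms(2)] tail ..
qed

section \<open>Translation of the given data\<close>

context root_sys
begin

lemma conic_base_coeffs:
 assumes "x : conic_span pos"
 shows "EX k. (ALL s:base. k s >= (0::real)) & x = (SUM s:base. k s *R s)"
 using assms
proof (induction x rule: conic_span.induct)
 case conic_0
 then show ?case by (intro exI[of _ "%_. 0"]) simp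
next
 case (conic_step p t y)
 obtain k where k: "ALL s:base. k s >= 0" "y = (SUM s:base. k s *R s)" using conic_step.IH by blast
 obtain n :: "real^'n => nat" where n: "p = (SUM s:base. real (n s) *R s)" using pos_combination[OF conic_step.hyps(1)] by blast
 have "t *R p + y = (SUM s:base. (t * real (n s) + k s) *R s)"
  unfolding k(2) n by (simp add: scaleR_sum_right scaleR_add_left sum.distrib)
 then show ?case using k(1) conic_step.hyps(2) by (intro exI[of _ "%s. t * real (n s) + k s"]) simp
qed

text \<open>An indecomposable root is a nonnegative combination of \<open>S\<close>, whose members
  are themselves nonnegative combinations of the base; so some member of \<open>S\<close> is
  proportional to it. Comparing cardinalities gives equality.\<close>

lemma simple_system_unique:
 assumes S: "simple_system pos S"
 shows "S = base"
proof -
 have Sp: "S \<subseteq> pos" and ind: "independent S" and gen: "!!a. a : pos ==> EX k. (ALL s:S. k s >= (0::real)) & a = (SUM s:S. k s *R s)"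
  using S unfolding simple_system_def by blast+
 have finS: "finite S" using finite_subset[OF Sp finite_pos] .
 have "base \<subseteq> S"
 proof
  fix b assume b: "b : base"
  obtain k where k: "ALL s:S. k s >= (0::real)" "b = (SUM s:S. k s *R s)" using gen[OF base_pos[OF b]] by blast
  have "ALL t:S. EX n::real^'n => nat. t = (SUM s:base. real (n s) *R s)" using pos_combination Sp by blast
  from bchoice[OF this] obtain n :: "real^'n => real^'n => nat" where n: "ALL t:S. t = (SUM s:base. real (n t s) *R s)" ..
  have b0: "b ~= 0" using b base_pos pos_root root_nz by blast
  obtain t where t: "t : S" "k t ~= 0"
  proof (rule ccontr)
   assume no: "~ thesis"
   have "k s = 0" if "s : S" for s using no that \<open>!!t. t : S ==> k t ~= 0 ==> thesis\<close> by blast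
   then have "b = 0" using k(2) by simp
   then show False using b0 by simp
  qed
  have "b = (SUM u:S. SUM s:base. (k u * real (n u s)) *R s)"
  proof -
   have "(SUM u:S. k u *R u) = (SUM u:S. SUM s:base. (k u * real (n u s)) *R s)"
   proof (rule sum.cong[OF HOL.refl])
    fix u assume "u : S"
    then have "k u *R u = k u *R (SUM s:base. real (n u s) *R s)" using n by metis
    then show "k u *R u = (SUM s:base. (k u * real (n u s)) *R s)" by (simp add: scaleR_sum_right)
   qed
   then show ?thesis using k(2) by simp
  qed
  also have "... = (SUM s:base. SUM u:S. (k u * real (n u s)) *R s)" by (rule sum.swap)
  also have "... = (SUM s:base. (SUM u:S. k u * real (n u s)) *R s)" by (simp add: scaleR_sum_left)
  finally have e1: "b = (SUM s:base. (SUM u:S. k u * real (n u s)) *R s)" .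
  have e2: "b = (SUM s:base. (if s = b then 1 else 0) *R s)"
  proof -
   have "(SUM s:base. (if s = b then 1 else 0) *R s) = (SUM s:base. if s = b then s else 0)" by (intro sum.cong HOL.refl) simp
   then show ?thesis using b finite_base by simp
  qed
  have nt: "n t s = 0" if s: "s : base" "s ~= b" for s
  proof -
   have "(SUM u:S. k u * real (n u s)) = (if s = b then 1 else 0)" by (rule base_coeffs_unique[OF _ s(1)]) (use e1 e2 in simp)
   then have "(SUM u:S. k u * real (n u s)) = 0" using s(2) by simp
   then have "ALL u:S. k u * real (n u s) = 0"
    by (subst (asm) sum_nonneg_eq_0_iff[OF finS]) (use k(1) in auto)
   then show ?thesis using t by auto
  qed
  have "t = (SUM s:base. real (n t s) *R s)" using n t(1) by blast
  also have "... = (SUM s:base. if s = b then real (n t b) *R b else 0)" by (intro sum.cong HOL.refl) (simp add: nt)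
  also have "... = real (n t b) *R b" using b finite_base by simp
  finally have "t = b" using proportional_eq[of t b] Sp t(1) base_pos[OF b] by blast
  then show "b : S" using t by simp
 qed
 moreover have "card S <= card base"
 proof -
  have "S \<subseteq> span base" using Sp pos_in_span_base by blast
  then have "card S <= dim (span base)" by (rule independent_card_le_dim[OF _ ind])
  then show ?thesis using dim_eq_card_independent[OF base_independent] by simp
 qed
 ultimately show ?thesis using card_seteq[OF finS] by blast
qed

end

context affine_sys
begin

text \<open>A hyperplane has two opposite normals; the one that is a positive affine root is chosen,
  which sends the label \<open>(a, k)\<close> with \<open>k >= 1\<close> to the gradient
  \<open>- a\<close>.\<close>

lemma cone_arr_eq:
 assumes I: "I \<subseteq> pos"
 shows "cone_arr (shi_catalan_arr pos I m) = (%a. {x. a <.> x = 0}) ` (join_cone ` aarr m (I Un uminus ` pos))"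
proof -
 define H where "H K = {x. K <.> split_cone x = 0}" for K :: "(real^'n) \<times> real"
 have Hd: "H delta = {x. x $ None = 0}" by (simp add: H_def delta_inner split_cone_def)
 have Hn: "H (- K) = H K" for K by (simp add: H_def)
 have Hk: "{x. (SUM i:UNIV. a $ i * x $ Some i) - real_of_int k * x $ None = 0} = H (a, - real_of_int k)" for a k
  by (simp add: H_def split_cone_def inner_vec_def)
 have img: "(%a. {x. a <.> x = 0}) ` (join_cone ` X) = H ` X" for X by (simp add: image_image join_cone_inner H_def)
 let ?S = "stage (real m) (I Un uminus ` pos)"
 have "(%(a, k). {x. (SUM i:UNIV. a $ i * x $ Some i) - real_of_int k * x $ None = 0}) ` shi_catalan_arr pos I m = H ` ?S"
 proof
  show "(%(a, k). {x. (SUM i:UNIV. a $ i * x $ Some i) - real_of_int k * x $ None = 0}) ` shi_catalan_arr pos I m \<subseteq> H ` ?S"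
  proof
   fix Y assume "Y : (%(a, k). {x. (SUM i:UNIV. a $ i * x $ Some i) - real_of_int k * x $ None = 0}) ` shi_catalan_arr pos I m"
   then obtain a k where ak: "(a, k) : shi_catalan_arr pos I m" and Y: "Y = H (a, - real_of_int k)" unfolding Hk by auto
   have ap: "a : pos" using ak I unfolding shi_catalan_arr_def by auto
   show "Y : H ` ?S"
   proof (cases "k <= 0")
    case True
    define j where "j = nat (- k)"
    have j: "- real_of_int k = real j" using True by (simp add: j_def)
    have "j < m \<or> j = m & a : I" using ak True unfolding shi_catalan_arr_def j_def by auto
    then have "(a, real j) : ?S" using ap by (auto simp: stage_def apos_nat_iff pos_root)
    then show ?thesis using Y j by auto
   next
    case False
    define j where "j = nat k"
    have j: "real_of_int k = real j" "j >= 1" using False by (simp_all add: j_def)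
    have "j <= m" using ak False unfolding shi_catalan_arr_def j_def by auto
    then have "(- a, real j) : ?S" using ap j(2) neg[OF pos_root[OF ap]] by (auto simp: stage_def apos_nat_iff)
    moreover have "Y = H (- a, real j)" using Y j(1) Hn[of "(- a, real j)"] by simp
    ultimately show ?thesis by blast
   qed
  qed
  show "H ` ?S \<subseteq> (%(a, k). {x. (SUM i:UNIV. a $ i * x $ Some i) - real_of_int k * x $ None = 0}) ` shi_catalan_arr pos I m"
  proof
   fix Y assume "Y : H ` ?S"
   then obtain K where K: "K : ?S" "Y = H K" by blast
   then have "K : apos" using stage_apos by blast
   then obtain be j where bj: "K = (be, real j)" "be : Ph" "j >= 1 \<or> (j = 0 & be : pos)" by (rule apos_natE)
   have jm: "j < m \<or> j = m & be : I Un uminus ` pos" using K(1) bj(1) by (simp add: stage_def)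
   have "EX a k. (a, k) : shi_catalan_arr pos I m & Y = H (a, - real_of_int k)"
   proof (cases "be : pos")
    case True
    then have "be ~: uminus ` pos" using not_pos_neg by auto
    then have "j < m \<or> j = m & be : I" using jm by blast
    then have "(be, - int j) : shi_catalan_arr pos I m" using True unfolding shi_catalan_arr_def by auto
    moreover have "Y = H (be, - real_of_int (- int j))" using K(2) bj(1) by simp
    ultimately show ?thesis by blast
   next
    case False
    then have nb: "- be : pos" using pos_or_neg[OF bj(2)] by blast
    have "j >= 1" "j <= m" using bj(3) False jm by auto
    then have "(- be, int j) : shi_catalan_arr pos I m" using nb unfolding shi_catalan_arr_def by auto
    moreover have "Y = H (- be, - real_of_int (int j))" using K(2) bj(1) Hn[of "(be, real j)"] by simp
    ultimately show ?thesis by blast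
   qed
   then obtain a k where ak: "(a, k) : shi_catalan_arr pos I m" "Y = H (a, - real_of_int k)" by blast
   then show "Y : (%(a, k). {x. (SUM i:UNIV. a $ i * x $ Some i) - real_of_int k * x $ None = 0}) ` shi_catalan_arr pos I m"
    unfolding Hk by (intro image_eqI[of _ _ "(a, k)"]) simp_all
  qed
 qed
 then show ?thesis unfolding cone_arr_def aarr_def img Hd[symmetric] by simp
qed

end

text \<open>\<open>fold\<close> puts later reflections on the outside, whereas
  \<open>cox_elt\<close> applies the head of the list last; hence the reversal.\<close>

lemma fold_refl_root: "fold (%s f. refl_root s \<circ> f) ds g x = cox_elt (rev ds) (g x)"
 by (induction ds arbitrary: g) (simp_all add: cox_elt_append)

text \<open>The ordering picked by the definition is arbitrary, so the order is assumed for all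
  orderings of the simple roots.\<close>

lemma coxeter_number_eq:
 assumes fin: "finite S"
  and n: "!!ds. distinct ds ==> set ds = S ==> n > 0 & (ALL x. (cox_elt ds ^^ n) x = x) & (ALL k>0. (ALL x. (cox_elt ds ^^ k) x = x) --> n <= k)"
 shows "coxeter_number S = n"
proof -
 define ds where "ds = (SOME ds. distinct ds & set ds = S)"
 have "EX ds. distinct ds & set ds = S" using finite_distinct_list[OF fin] by blast
 then have ds: "distinct ds & set ds = S" unfolding ds_def by (rule someI_ex)
 have c: "coxeter_element S = cox_elt (rev ds)"
  unfolding coxeter_element_def ds_def[symmetric] by (simp add: fun_eq_iff fold_refl_root)
 have r: "distinct (rev ds)" "set (rev ds) = S" using ds by simp_all
 have i: "(cox_elt (rev ds) ^^ k = id) = (ALL x. (cox_elt (rev ds) ^^ k) x = x)" for k by (simp add: fun_eq_iff)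
 show ?thesis unfolding coxeter_number_def c i
  by (rule Least_equality) (use n[OF r] in blast)+
qed

theorem mainTheorem12:
  fixes R P S I :: "(real^'n) set" and e :: "'n \<Rightarrow> nat" and m :: nat
  assumes "crystallographic_root_system R"
    and "irreducible_root_system R"
    and "positive_system R P"
    and "simple_system P S"
    and "order_ideal S P I"
    and "free_with_exponents (central_arr I) e"
  shows "free_with_exponents (cone_arr (shi_catalan_arr P I m))
           (\<lambda>j. case j of None \<Rightarrow> 1 | Some i \<Rightarrow> e i + m * coxeter_number S)"
proof -
 obtain c0 where c0: "ALL a:R. c0 <.> a ~= 0" "P = {a:R. c0 <.> a > 0}" using assms(3) unfolding positive_system_def by blast
 have sp: "span R = UNIV" using assms(1) unfolding crystallographic_root_system_def by blast
 have rs0: "root_sys R c0"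
  by unfold_locales (use assms(1) c0(1) in \<open>auto simp: crystallographic_root_system_def\<close>)
 obtain c where c: "affine_sys R c" "root_sys.pos R c = root_sys.pos R c0" using root_sys.normalize_exists[OF rs0] by blast
 interpret affine_sys R c by (rule c(1))
 note irr = assms(2)
 have P: "P = pos" using c(2) c0(2) root_sys.pos_def[OF rs0] by simp
 have S: "S = base" using simple_system_unique assms(4) P by simp
 have dimR: "dim R = CARD('n)" using dim_span[of R] sp by (simp add: dim_UNIV)
 have Ip: "I \<subseteq> pos" using assms(5) P unfolding order_ideal_def by blast
 have idl: "order_ideal_in pos I"
  unfolding order_ideal_in_def
 proof (intro conjI ballI impI Ip)
  fix be ga assume b: "be : I" "ga : pos" "be - ga : conic_span pos"
  have "root_le S ga be" unfolding root_le_def S using conic_base_coeffs[OF b(3)] by blast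
  then show "ga : I" using assms(5) b(1,2) P unfolding order_ideal_def by blast
 qed
 \<comment> \<open>Defined by counting roots, so that it is visibly the same for every ordering of
   the simple roots.\<close>
 define n where "n = 2 * card pos div dim R"
 have d0: "dim R > 0" using dimR by simp
 have n: "n > 0 & (ALL x. (cox_elt ds ^^ n) x = x) & (ALL k>0. (ALL x. (cox_elt ds ^^ k) x = x) --> n <= k) & 2 * card pos = n * dim R"
  if ds: "distinct ds" "set ds = base" for ds
 proof -
  obtain n' where n': "n' >= 2" "ALL x. (cox_elt ds ^^ n') x = x" "ALL k>0. (ALL x. (cox_elt ds ^^ k) x = x) --> n' <= k"
   "2 * card pos = n' * dim R" using height_duality[OF irr ds] by blast
  have "n = n'" using n'(4) d0 by (simp add: n_def)
  then show ?thesis using n' by simp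
 qed
 obtain ds where ds: "distinct ds" "set ds = base" using finite_distinct_list[OF finite_base] by blast
 have h: "2 * card pos = n * dim R" using n[OF ds] by blast
 have cox: "coxeter_number S = n" unfolding S by (rule coxeter_number_eq[OF finite_base]) (use n in blast)
 define Th where "Th = I Un uminus ` pos"
 have "affine_exponents n m Th"
  using affine_arrangements_free[OF c(1) irr] h lower_ideal[OF idl] unfolding Th_def by blast
 then obtain I1 :: "nat set" and e1 th1 where fb1: "free_basis (emb ` span R) (aarr m Th) I1 e1 th1" and c1: "card I1 = dim R"
  and cnt1: "!!t. t >= 1 ==> card {i:I1. m * n + t <= e1 i} = card (Th Int level t)" and ge1: "!!i. i : I1 ==> m * n <= e1 i"
  unfolding affine_exponents_def Th_def by blast
 have finI1: "finite I1" using free_basisD(1)[OF fb1] .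
 have lev: "Th Int level t = I Int level t" for t using not_pos_neg by (auto simp: Th_def level_def)
 have "ideal_exponents I" using ideal_arrangements_free[OF root_sys_axioms] idl by blast
 then obtain I0 :: "nat set" and e0 th0 where fb0: "free_basis (emb ` span R) (emb ` I) I0 e0 th0" and c0': "card I0 = dim R"
  and cnt0: "!!t. t >= 1 ==> card {i:I0. e0 i >= t} = card (I Int level t)" unfolding ideal_exponents_def by blast
 have finI0: "finite I0" using free_basisD(1)[OF fb0] .
 obtain th' where th': "ALL i:I0. th' i : tangent_fields UNIV I & (ALL t x. th' i (t *R x) = t ^ e0 i *R th' i x)"
  "ALL et:tangent_fields UNIV I. EX f. (ALL i:I0. rpoly (f i)) & (ALL x. et x = (SUM i:I0. f i x *R th' i x))"
  using free_basis_restrict[OF fb0] unfolding sp by blast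
 have I0z: "0 ~: I" using Ip pos_root nz by blast
 \<comment> \<open>Links the given exponents \<open>e\<close> with the exponents computed from
   heights.\<close>
 have fib0: "card {j. e j = k} = card {i:I0. e0 i = k}" for k
  by (rule exponents_unique[OF I0z, where th=th']) (use assms(6) finI0 c0' dimR th' in \<open>auto simp: central_arr_def\<close>)
 \<comment> \<open>Above \<open>m * n\<close> the exponents of the deformation are dual to the same
   height counts as those of the ideal.\<close>
 have fib1: "card {i:I0. e0 i = k} = card {i:I1. e1 i - m * n = k}" for k
 proof (rule fibers_of_tails[OF finI0 finI1])
  show "card I0 = card I1" using c0' c1 by simp
  fix t :: nat assume t: "t >= 1"
  have "{i:I1. t <= e1 i - m * n} = {i:I1. m * n + t <= e1 i}" using t by auto
  then show "card {i:I0. t <= e0 i} = card {i:I1. t <= e1 i - m * n}" using cnt0[OF t] cnt1[OF t] lev by simp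
 qed
 obtain b where b: "bij_betw b UNIV I1" "ALL j. e1 (b j) - m * n = e j"
  using bij_of_fibers[of "UNIV :: 'n set" I1 e "%i. e1 i - m * n"] finI1 fib0 fib1 by auto
 have eb: "e1 (b j) = e j + m * n" for j
 proof -
  have "b j : I1" using b(1) by (auto simp: bij_betw_def)
  then show ?thesis using b(2) ge1[of "b j"] by (metis le_add_diff_inverse2)
 qed
 have dA: "delta : aarr m Th" by (simp add: aarr_def)
 have fbE: "free_basis UNIV (aarr m Th) (insert None (Some ` I1)) (case_option 1 e1) (case_option (%x. x) th1)"
  by (rule free_basis_add_euler[OF _ dA]) (use fb1 sp in simp)
 note fbC = free_basis_transport[OF fbE linear_split_cone linear_join_cone join_split_cone join_cone_inner]
 have bij: "bij_betw (map_option b) UNIV (insert None (Some ` I1))"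
  unfolding bij_betw_def
 proof
  show "inj (map_option b)" using b(1) by (intro option.inj_map) (auto simp: bij_betw_def)
  have "range (map_option b) = insert None (Some ` range b)" unfolding UNIV_option_conv by (auto simp: image_iff)
  then show "range (map_option b) = insert None (Some ` I1)" using b(1) by (simp add: bij_betw_def)
 qed
 have nz': "0 ~: join_cone ` aarr m Th"
 proof
  assume "0 : join_cone ` aarr m Th"
  then obtain K where K: "K : aarr m Th" "join_cone K = 0" by auto
  have "K = split_cone (join_cone K)" by (simp only: join_split_cone)
  also have "... = 0" unfolding K(2) by (rule linear_0[OF linear_split_cone])
  finally have "K = 0" .
  moreover have "(delta :: (real^'n) \<times> real) ~= 0" by (simp add: delta_def zero_prod_def)
  moreover have "K = delta \<or> K : apos" using K(1) stage_apos[of "real m" Th] unfolding aarr_def by blast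
  then have "K = delta \<or> K ~= 0" using apos_nz(2) by blast
  ultimately show False by metis
 qed
 have "free_with_exponents ((%a. {x. a <.> x = 0}) ` (join_cone ` aarr m Th)) (%j. case_option 1 e1 (map_option b j))"
  by (rule free_basis_imp_free[OF nz' fbC bij])
 moreover have "(%j. case_option 1 e1 (map_option b j)) = (%j. case j of None => 1 | Some i => e i + m * coxeter_number S)"
  by (auto simp: fun_eq_iff eb cox split: option.split)
 ultimately show ?thesis unfolding P cone_arr_eq[OF Ip] Th_def by simp
qed

end
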